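(* Let $p(\rho)=\rho^\gamma$ with $\gamma\ge 1$, and consider Riemann data $(\rho_\pm,v_{b\pm})$ for which the Riemann problem for the compressible Euler system has a two shock solution, with intermediate state $(\rho_m,v_m)$. Let $\epsilon_2>0$ and a left interval $I=[\rho^*,\rho_m]$ of $\rho_m$ be fixed so that for $\rho_1$ contained in this interval ($\rho_1<\rho_m$) a fan sub-solution with parameters $(\rho_1,\epsilon_2)$ is defined. Then: (1) There are infinitely many convex integration weak solutions to the Riemann problem (with parameters $(\rho_1,\epsilon_2)$, $\rho_1\in I$). (2) On the interval $I$, the action of the two shock solution is lower than the action of any of these convex integration solutions. (3) Hence LAAP rules out the admissibility of these convex integration solutions and allows for the possible admissibility of the two shock solution. (4) Furthermore, if there are no other entropic weak solutions other than the convex integration solutions and the two shock solution, then the two shock solution is the unique LAAP-admissible solution.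
   Context: **Equations.** The compressible Euler system on $(t,\mathbf x)\in[0,\infty)\times\mathbb R^2$ is $\partial_t\rho+\mathrm{div}_{\mathbf x}(\rho\mathbf v)=0$, $\partial_t(\rho\mathbf v)+\mathrm{div}_{\mathbf x}(\rho\mathbf v\otimes\mathbf v)+\nabla_{\mathbf x}p(\rho)=0$. Weak solutions are understood in the sense of distributions (including the initial data). The specific internal energy $\epsilon(\rho)$ satisfies $\epsilon'(\rho)=p(\rho)/\rho^2$. A weak solution is *entropic* if $\partial_t(\tfrac12\rho|\mathbf v|^2+\rho\epsilon(\rho))+\mathrm{div}_{\mathbf x}[(\tfrac12\rho|\mathbf v|^2+\rho\epsilon(\rho)+p(\rho))\mathbf v]\le 0$ in the sense of distributions. **Riemann data.** Write $\mathbf v=(v_a,v_b)$. The initial data are $\rho=\rho_-$, $\mathbf v=(0,v_{b-})$ for $x_2<0$ and $\rho=\rho_+$, $\mathbf v=(0,v_{b+})$ for $x_2>0$, with constants $\rho_\pm>0$. A two shock solution exists when $v_{b-}>v_{b+}$ and $S:=\rho_-\rho_+(v_{b-}-v_{b+})^2-(\rho_+-\rho_-)(p(\rho_+)-p(\rho_-))>0$. **Functions of $\rho_1$.** For $\rho_1>\max\{\rho_-,\rho_+\}$ let $\nu_-(\rho_1)<\nu_+(\rho_1)$, $\beta(\rho_1)$, $\epsilon_1(\rho_1)$ be the real numbers determined by $$\nu_\pm(\rho_\pm-\rho_1)=\rho_\pm v_{b\pm}-\rho_1\beta,$$ $$\nu_\pm(\rho_\pm v_{b\pm}-\rho_1\beta)=\rho_\pm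 v_{b\pm}^2+p(\rho_\pm)-\rho_1(\beta^2+\epsilon_1)-p(\rho_1)$$ (two equations for each sign). These are smooth functions of $\rho_1$. **Two shock solution.** $\rho_m>\max\{\rho_-,\rho_+\}$ is the intermediate density and $(0,v_m)$ the intermediate velocity: $\epsilon_1(\rho_m)=0$, $\beta(\rho_m)=v_m$. The two shock solution equals $(\rho_-,(0,v_{b-}))$ for $x_2<\nu_-(\rho_m)t$, $(\rho_m,(0,v_m))$ for $\nu_-(\rho_m)t<x_2<\nu_+(\rho_m)t$, and $(\rho_+,(0,v_{b+}))$ for $x_2>\nu_+(\rho_m)t$. **Fan sub-solutions.** A fan sub-solution with parameters $(\rho_1,\epsilon_2)$, $\max\{\rho_-,\rho_+\}<\rho_1<\rho_m$, $\epsilon_2>0$, is said to be defined if $\epsilon_1(\rho_1)>0$ and, with $C=\beta^2(\rho_1)+\epsilon_1(\rho_1)+\epsilon_2$, $E_1=\tfrac12\rho_1C+\rho_1\epsilon(\rho_1)$, $F_1=(E_1+p(\rho_1))\beta(\rho_1)$, $E_\pm=\tfrac12\rho_\pm v_{b\pm}^2+\rho_\pm\epsilon(\rho_\pm)$, $F_\pm=(E_\pm+p(\rho_\pm))v_{b\pm}$, one has $\nu_-(\rho_1)(E_--E_1)\le F_--F_1$ and $\nu_+(\rho_1)(E_1-E_+)\le F_1-F_+$. It consists of the constant states $(\rho_-,(0,v_{b-}))$, $(\rho_1,\mathbf v_1)$ with $\mathbf v_1=(0,\beta(\rho_1))$, and $(\rho_+,(0,v_{b+}))$ in the regions $P_-=\{x_2<\nu_-(\rho_1)t\}$,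 $P_1=\{\nu_-(\rho_1)t<x_2<\nu_+(\rho_1)t\}$, $P_+=\{x_2>\nu_+(\rho_1)t\}$ ($t>0$), together with the symmetric trace-free matrix $\mathbf u_1=\mathrm{diag}(\epsilon_2-\tfrac C2,\tfrac C2-\epsilon_2)$ in $P_1$; then $\mathbf v_1\otimes\mathbf v_1-\mathbf u_1=\frac C2\mathrm{Id}-\mathrm{diag}(\epsilon_2,\epsilon_1(\rho_1))<\frac C2\mathrm{Id}$. **Convex integration solutions.** A convex integration solution with parameters $(\rho_1,\epsilon_2)$ is an entropic weak solution obtained (by the theorem of Chiodaroli and Kreml) from such a fan sub-solution: it equals $(\rho_\pm,(0,v_{b\pm}))$ in $P_\pm$, and in $P_1$ has density $\rho_1$ and velocity $\mathbf v_1+\mathbf v$, where $(\mathbf v,\mathbf u)$ vanishes outside $P_1$, $\mathbf u$ is symmetric and trace-free, $\mathrm{div}_{\mathbf x}\mathbf v=0$ and $\partial_t\mathbf v+\mathrm{div}_{\mathbf x}\mathbf u=0$ in the sense of distributions, and $(\mathbf v_1+\mathbf v)\otimes(\mathbf v_1+\mathbf v)-(\mathbf u_1+\mathbf u)=\frac C2\mathrm{Id}$ a.e. in $P_1$; in particular $|\mathbf v_1+\mathbf v|^2=C$ a.e. in $P_1$. **Action and LAAP.** The Lagrangian is $\mathcal L=\tfrac12\rho|\mathbf v|^2-\rho\epsilon(\rho)$, and the action, for both kinds of solution, is $\int_{-L_3}^{L_3}\int_0^T\int_{\ell_1}^{\ell_2}\mathcal L\,dx_2\,dt\,dx_1$,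 where $L_3>0$ and $T>0$ are fixed, $\ell_1<T\min_{\rho_1\in I}\nu_-(\rho_1)$ and $\ell_2>T\max_{\rho_1\in I}\nu_+(\rho_1)$. The least action admissibility principle (LAAP) states that an entropic weak solution is admissible if its action is less than or equal to the action of all other entropic weak solutions with the same initial and boundary data.
   Formalization: The action box is also required to satisfy ℓ₁ < 0 < ℓ₂, so the whole fan stays inside it for 0 < t < T (otherwise (2) can fail and boundary data differ); boundary data are compared only on the sides x₂ = ℓ₁ and x₂ = ℓ₂. *)

theory Defs
  imports "HOL-Analysis.Analysis"
begin

section \<open>Test functions and distributional derivatives on space-time\<close>

text \<open>A point of space-time is \<open>z = (t, x)\<close>; the coordinates of \<open>x\<close> are \<open>x $ 1\<close> and \<open>x $ 2\<close>.\<close>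

type_synonym spacetime = "real \<times> (real ^ 2)"

primrec C_k :: "nat \<Rightarrow> ('a::euclidean_space \<Rightarrow> real) \<Rightarrow> bool" where
  "C_k 0 f \<longleftrightarrow> continuous_on UNIV f"
| "C_k (Suc k) f \<longleftrightarrow> f differentiable_on UNIV \<and>
     (\<forall>b\<in>Basis. C_k k (\<lambda>x. frechet_derivative f (at x) b))"

definition test_function :: "(spacetime \<Rightarrow> real) \<Rightarrow> bool" where
  "test_function \<phi> \<longleftrightarrow> (\<forall>k. C_k k \<phi>) \<and> compact (closure {z. \<phi> z \<noteq> 0})"

definition time_deriv :: "(spacetime \<Rightarrow> real) \<Rightarrow> spacetime \<Rightarrow> real" where
  "time_deriv \<phi> z = frechet_derivative \<phi> (at z) (1, 0)"

definition space_grad :: "(spacetime \<Rightarrow> real) \<Rightarrow> spacetime \<Rightarrow> real ^ 2" where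
  "space_grad \<phi> z = (\<chi> i. frechet_derivative \<phi> (at z) (0, axis i 1))"

abbreviation half_space :: "spacetime set" where
  "half_space \<equiv> {z. 0 \<le> fst z}"

definition locally_integrable ::
    "(spacetime \<Rightarrow> 'b::{banach, second_countable_topology}) \<Rightarrow> bool" where
  "locally_integrable f \<longleftrightarrow>
     (\<forall>K. compact K \<longrightarrow> K \<subseteq> half_space \<longrightarrow> set_integrable lebesgue K f)"

text \<open>
  The pairing of \<open>- (\<partial>\<^sub>t w + div F)\<close>, with initial data \<open>w0\<close>, against \<open>\<phi>\<close>. The functions in
  \<open>C\<^sub>c\<^sup>\<infinity>([0,\<infinity>) \<times> \<real>\<^sup>2)\<close> are the restrictions of test functions on the whole space-time; they need not
  vanish at \<open>t = 0\<close>, which gives the initial term.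
\<close>

definition weak_pairing ::
    "(spacetime \<Rightarrow> real) \<Rightarrow> (spacetime \<Rightarrow> real ^ 2) \<Rightarrow> (real ^ 2 \<Rightarrow> real) \<Rightarrow> (spacetime \<Rightarrow> real) \<Rightarrow> real" where
  "weak_pairing w F w0 \<phi> =
     (LINT z:half_space|lebesgue. w z * time_deriv \<phi> z + F z \<bullet> space_grad \<phi> z)
       + (LINT x|lebesgue. w0 x * \<phi> (0, x))"

definition weak_balance_eq ::
    "(spacetime \<Rightarrow> real) \<Rightarrow> (spacetime \<Rightarrow> real ^ 2) \<Rightarrow> (real ^ 2 \<Rightarrow> real) \<Rightarrow> bool" where
  "weak_balance_eq w F w0 \<longleftrightarrow> locally_integrable w \<and> locally_integrable F \<and>
     (\<forall>\<phi>. test_function \<phi> \<longrightarrow> weak_pairing w F w0 \<phi> = 0)"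

text \<open>\<open>\<partial>\<^sub>t w + div F \<le> 0\<close> means a nonnegative pairing with nonnegative test functions, because
  \<^const>\<open>weak_pairing\<close> carries the sign of the integration by parts.\<close>

definition weak_balance_le ::
    "(spacetime \<Rightarrow> real) \<Rightarrow> (spacetime \<Rightarrow> real ^ 2) \<Rightarrow> (real ^ 2 \<Rightarrow> real) \<Rightarrow> bool" where
  "weak_balance_le w F w0 \<longleftrightarrow> locally_integrable w \<and> locally_integrable F \<and>
     (\<forall>\<phi>. test_function \<phi> \<and> (\<forall>z. 0 \<le> \<phi> z) \<longrightarrow> 0 \<le> weak_pairing w F w0 \<phi>)"

definition outer_prod :: "real ^ 2 \<Rightarrow> real ^ 2 \<Rightarrow> real ^ 2 ^ 2" where
  "outer_prod a b = (\<chi> i j. a $ i * b $ j)"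


section \<open>The compressible Euler system with Riemann data\<close>

record euler_riemann =
  pressure :: "real \<Rightarrow> real"
  internal_energy :: "real \<Rightarrow> real"
  rho_minus :: real
  rho_plus :: real
  vb_minus :: real
  vb_plus :: real

text \<open>A flow maps a space-time point to its density and velocity. Only its values for \<open>t > 0\<close>
  matter, and only up to null sets.\<close>

type_synonym flow = "spacetime \<Rightarrow> real \<times> (real ^ 2)"

definition flow_eq :: "flow \<Rightarrow> flow \<Rightarrow> bool" where
  "flow_eq w w' \<longleftrightarrow> (AE z in lebesgue. 0 < fst z \<longrightarrow> w z = w' z)"

definition state_minus :: "euler_riemann \<Rightarrow> real \<times> (real ^ 2)" where
  "state_minus D = (rho_minus D, vector [0, vb_minus D])"

definition state_plus :: "euler_riemann \<Rightarrow> real \<times> (real ^ 2)" where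
  "state_plus D = (rho_plus D, vector [0, vb_plus D])"

definition initial_state :: "euler_riemann \<Rightarrow> real ^ 2 \<Rightarrow> real \<times> (real ^ 2)" where
  "initial_state D x = (if x $ 2 < 0 then state_minus D else state_plus D)"

fun momentum :: "real \<times> (real ^ 2) \<Rightarrow> real ^ 2" where
  "momentum (\<rho>, v) = \<rho> *\<^sub>R v"

fun momentum_flux :: "euler_riemann \<Rightarrow> real \<times> (real ^ 2) \<Rightarrow> real ^ 2 ^ 2" where
  "momentum_flux D (\<rho>, v) = \<rho> *\<^sub>R outer_prod v v + mat (pressure D \<rho>)"

fun energy :: "euler_riemann \<Rightarrow> real \<times> (real ^ 2) \<Rightarrow> real" where
  "energy D (\<rho>, v) = 1 / 2 * \<rho> * (norm v)\<^sup>2 + \<rho> * internal_energy D \<rho>"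

fun energy_flux :: "euler_riemann \<Rightarrow> real \<times> (real ^ 2) \<Rightarrow> real ^ 2" where
  "energy_flux D (\<rho>, v) = (energy D (\<rho>, v) + pressure D \<rho>) *\<^sub>R v"

definition weak_solution :: "euler_riemann \<Rightarrow> flow \<Rightarrow> bool" where
  "weak_solution D w \<longleftrightarrow>
     w \<in> borel_measurable lebesgue \<and>
     (AE z in lebesgue. 0 < fst z \<longrightarrow> 0 < fst (w z)) \<and>
     weak_balance_eq (\<lambda>z. fst (w z)) (\<lambda>z. momentum (w z)) (\<lambda>x. fst (initial_state D x)) \<and>
     (\<forall>i. weak_balance_eq (\<lambda>z. momentum (w z) $ i) (\<lambda>z. momentum_flux D (w z) $ i)
            (\<lambda>x. momentum (initial_state D x) $ i))"

definition entropic_weak_solution :: "euler_riemann \<Rightarrow> flow \<Rightarrow> bool" where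
  "entropic_weak_solution D w \<longleftrightarrow> weak_solution D w \<and>
     weak_balance_le (\<lambda>z. energy D (w z)) (\<lambda>z. energy_flux D (w z)) (\<lambda>x. energy D (initial_state D x))"


section \<open>The two shock solution\<close>

text \<open>The criterion on the data under which the Riemann problem has a two shock solution.\<close>

definition two_shock_data :: "euler_riemann \<Rightarrow> bool" where
  "two_shock_data D \<longleftrightarrow> 0 < rho_minus D \<and> 0 < rho_plus D \<and> vb_plus D < vb_minus D \<and>
     0 < rho_minus D * rho_plus D * (vb_minus D - vb_plus D)\<^sup>2
         - (rho_plus D - rho_minus D) * (pressure D (rho_plus D) - pressure D (rho_minus D))"

definition fan_relations :: "euler_riemann \<Rightarrow> real \<Rightarrow> real \<Rightarrow> real \<Rightarrow> real \<Rightarrow> real \<Rightarrow> bool" where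
  "fan_relations D \<rho>1 nm np b e1 \<longleftrightarrow>
     nm < np \<and>
     nm * (rho_minus D - \<rho>1) = rho_minus D * vb_minus D - \<rho>1 * b \<and>
     np * (rho_plus D - \<rho>1) = rho_plus D * vb_plus D - \<rho>1 * b \<and>
     nm * (rho_minus D * vb_minus D - \<rho>1 * b) =
       rho_minus D * (vb_minus D)\<^sup>2 + pressure D (rho_minus D) - \<rho>1 * (b\<^sup>2 + e1) - pressure D \<rho>1 \<and>
     np * (rho_plus D * vb_plus D - \<rho>1 * b) =
       rho_plus D * (vb_plus D)\<^sup>2 + pressure D (rho_plus D) - \<rho>1 * (b\<^sup>2 + e1) - pressure D \<rho>1"

text \<open>For \<^const>\<open>two_shock_data\<close> and \<open>\<rho>1 > max \<rho>\<^sub>- \<rho>\<^sub>+\<close> the quadruple is unique; elsewhere the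
  description is not meaningful.\<close>

definition fan_values :: "euler_riemann \<Rightarrow> real \<Rightarrow> real \<times> real \<times> real \<times> real" where
  "fan_values D \<rho>1 = (THE (nm, np, b, e1). fan_relations D \<rho>1 nm np b e1)"

definition nu_minus :: "euler_riemann \<Rightarrow> real \<Rightarrow> real" where
  "nu_minus D \<rho>1 = (case fan_values D \<rho>1 of (nm, np, b, e1) \<Rightarrow> nm)"

definition nu_plus :: "euler_riemann \<Rightarrow> real \<Rightarrow> real" where
  "nu_plus D \<rho>1 = (case fan_values D \<rho>1 of (nm, np, b, e1) \<Rightarrow> np)"

definition beta :: "euler_riemann \<Rightarrow> real \<Rightarrow> real" where
  "beta D \<rho>1 = (case fan_values D \<rho>1 of (nm, np, b, e1) \<Rightarrow> b)"

definition eps1 :: "euler_riemann \<Rightarrow> real \<Rightarrow> real" where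
  "eps1 D \<rho>1 = (case fan_values D \<rho>1 of (nm, np, b, e1) \<Rightarrow> e1)"

definition intermediate_state :: "euler_riemann \<Rightarrow> real \<Rightarrow> real \<Rightarrow> bool" where
  "intermediate_state D \<rho>m vm \<longleftrightarrow>
     max (rho_minus D) (rho_plus D) < \<rho>m \<and> eps1 D \<rho>m = 0 \<and> beta D \<rho>m = vm"

definition region_minus :: "euler_riemann \<Rightarrow> real \<Rightarrow> spacetime set" where
  "region_minus D \<rho>1 = {(t, x). 0 < t \<and> x $ 2 < nu_minus D \<rho>1 * t}"

definition region_mid :: "euler_riemann \<Rightarrow> real \<Rightarrow> spacetime set" where
  "region_mid D \<rho>1 = {(t, x). 0 < t \<and> nu_minus D \<rho>1 * t < x $ 2 \<and> x $ 2 < nu_plus D \<rho>1 * t}"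

definition region_plus :: "euler_riemann \<Rightarrow> real \<Rightarrow> spacetime set" where
  "region_plus D \<rho>1 = {(t, x). 0 < t \<and> nu_plus D \<rho>1 * t < x $ 2}"

text \<open>The value on the shock lines and for \<open>t \<le> 0\<close> is irrelevant.\<close>

definition two_shock :: "euler_riemann \<Rightarrow> real \<Rightarrow> real \<Rightarrow> flow" where
  "two_shock D \<rho>m vm z =
     (if z \<in> region_minus D \<rho>m then state_minus D
      else if z \<in> region_mid D \<rho>m then (\<rho>m, vector [0, vm])
      else state_plus D)"


section \<open>Fan sub-solutions and convex integration solutions\<close>

definition fan_C :: "euler_riemann \<Rightarrow> real \<Rightarrow> real \<Rightarrow> real" where
  "fan_C D \<rho>1 \<epsilon>2 = (beta D \<rho>1)\<^sup>2 + eps1 D \<rho>1 + \<epsilon>2"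

definition fan_E1 :: "euler_riemann \<Rightarrow> real \<Rightarrow> real \<Rightarrow> real" where
  "fan_E1 D \<rho>1 \<epsilon>2 = 1 / 2 * \<rho>1 * fan_C D \<rho>1 \<epsilon>2 + \<rho>1 * internal_energy D \<rho>1"

definition fan_F1 :: "euler_riemann \<Rightarrow> real \<Rightarrow> real \<Rightarrow> real" where
  "fan_F1 D \<rho>1 \<epsilon>2 = (fan_E1 D \<rho>1 \<epsilon>2 + pressure D \<rho>1) * beta D \<rho>1"

text \<open>The outer values \<open>E\<^sub>\<plusminus>\<close> and \<open>F\<^sub>\<plusminus>\<close> are the energy and the second component of the energy flux of
  the constant outer states.\<close>

definition fan_subsolution_defined :: "euler_riemann \<Rightarrow> real \<Rightarrow> real \<Rightarrow> real \<Rightarrow> bool" where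
  "fan_subsolution_defined D \<rho>m \<rho>1 \<epsilon>2 \<longleftrightarrow>
     max (rho_minus D) (rho_plus D) < \<rho>1 \<and> \<rho>1 < \<rho>m \<and> 0 < \<epsilon>2 \<and> 0 < eps1 D \<rho>1 \<and>
     nu_minus D \<rho>1 * (energy D (state_minus D) - fan_E1 D \<rho>1 \<epsilon>2)
       \<le> energy_flux D (state_minus D) $ 2 - fan_F1 D \<rho>1 \<epsilon>2 \<and>
     nu_plus D \<rho>1 * (fan_E1 D \<rho>1 \<epsilon>2 - energy D (state_plus D))
       \<le> fan_F1 D \<rho>1 \<epsilon>2 - energy_flux D (state_plus D) $ 2"

definition fan_v1 :: "euler_riemann \<Rightarrow> real \<Rightarrow> real ^ 2" where
  "fan_v1 D \<rho>1 = vector [0, beta D \<rho>1]"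

definition fan_u1 :: "euler_riemann \<Rightarrow> real \<Rightarrow> real \<Rightarrow> real ^ 2 ^ 2" where
  "fan_u1 D \<rho>1 \<epsilon>2 =
     vector [vector [\<epsilon>2 - fan_C D \<rho>1 \<epsilon>2 / 2, 0], vector [0, fan_C D \<rho>1 \<epsilon>2 / 2 - \<epsilon>2]]"

text \<open>
  Here \<open>(v, u)\<close> is the perturbation produced by convex integration. The two distributional
  equations hold on the whole space-time, so they have no initial term. The pointwise constraint
  makes \<open>v\<close> and \<open>u\<close> essentially bounded, hence all integrals converge.
\<close>

definition convex_integration_solution ::
    "euler_riemann \<Rightarrow> real \<Rightarrow> real \<Rightarrow> real \<Rightarrow> flow \<Rightarrow> bool" where
  "convex_integration_solution D \<rho>m \<rho>1 \<epsilon>2 w \<longleftrightarrow>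
     fan_subsolution_defined D \<rho>m \<rho>1 \<epsilon>2 \<and>
     entropic_weak_solution D w \<and>
     (\<exists>(v :: spacetime \<Rightarrow> real ^ 2) (u :: spacetime \<Rightarrow> real ^ 2 ^ 2).
        v \<in> borel_measurable lebesgue \<and> u \<in> borel_measurable lebesgue \<and>
        (AE z in lebesgue. z \<in> region_minus D \<rho>1 \<longrightarrow> w z = state_minus D) \<and>
        (AE z in lebesgue. z \<in> region_plus D \<rho>1 \<longrightarrow> w z = state_plus D) \<and>
        (AE z in lebesgue. z \<in> region_mid D \<rho>1 \<longrightarrow> w z = (\<rho>1, fan_v1 D \<rho>1 + v z)) \<and>
        (AE z in lebesgue. z \<notin> region_mid D \<rho>1 \<longrightarrow> v z = 0 \<and> u z = 0) \<and>
        (AE z in lebesgue. transpose (u z) = u z \<and> trace (u z) = 0) \<and>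
        (\<forall>\<phi>. test_function \<phi> \<longrightarrow> (LINT z|lebesgue. v z \<bullet> space_grad \<phi> z) = 0) \<and>
        (\<forall>\<phi> i. test_function \<phi> \<longrightarrow>
           (LINT z|lebesgue. v z $ i * time_deriv \<phi> z + u z $ i \<bullet> space_grad \<phi> z) = 0) \<and>
        (AE z in lebesgue. z \<in> region_mid D \<rho>1 \<longrightarrow>
           outer_prod (fan_v1 D \<rho>1 + v z) (fan_v1 D \<rho>1 + v z) - (fan_u1 D \<rho>1 \<epsilon>2 + u z)
             = mat (fan_C D \<rho>1 \<epsilon>2 / 2)))"

definition convex_integration_family ::
    "euler_riemann \<Rightarrow> real \<Rightarrow> real \<Rightarrow> real \<Rightarrow> flow set" where
  "convex_integration_family D \<rho>m \<rho>s \<epsilon>2 =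
     {w. \<exists>\<rho>1. \<rho>s \<le> \<rho>1 \<and> \<rho>1 < \<rho>m \<and> convex_integration_solution D \<rho>m \<rho>1 \<epsilon>2 w}"


section \<open>Action and the least action admissibility principle\<close>

fun lagrangian :: "euler_riemann \<Rightarrow> real \<times> (real ^ 2) \<Rightarrow> real" where
  "lagrangian D (\<rho>, v) = 1 / 2 * \<rho> * (norm v)\<^sup>2 - \<rho> * internal_energy D \<rho>"

definition action_box :: "real \<Rightarrow> real \<Rightarrow> real \<Rightarrow> real \<Rightarrow> spacetime set" where
  "action_box L3 T l1 l2 =
     {(t, x). 0 \<le> t \<and> t \<le> T \<and> - L3 \<le> x $ 1 \<and> x $ 1 \<le> L3 \<and> l1 \<le> x $ 2 \<and> x $ 2 \<le> l2}"

definition action :: "euler_riemann \<Rightarrow> real \<Rightarrow> real \<Rightarrow> real \<Rightarrow> real \<Rightarrow> flow \<Rightarrow> real" where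
  "action D L3 T l1 l2 w = (LINT z:action_box L3 T l1 l2|lebesgue. lagrangian D (w z))"

text \<open>
  Boundary data are taken on the sides \<open>x\<^sub>2 = l1\<close> and \<open>x\<^sub>2 = l2\<close> of the box, in the sense of strong
  (one-sided, \<open>L\<^sup>1\<close>) traces: two flows have the same data there if their mean distance over the inner
  layers of thickness \<open>h\<close> tends to \<open>0\<close> with \<open>h\<close>. No data are prescribed on \<open>x\<^sub>1 = \<plusminus> L3\<close>, where the
  flows to be compared have different densities.
\<close>

definition same_boundary_data :: "real \<Rightarrow> real \<Rightarrow> real \<Rightarrow> real \<Rightarrow> flow \<Rightarrow> flow \<Rightarrow> bool" where
  "same_boundary_data L3 T l1 l2 w w' \<longleftrightarrow>
     ((\<lambda>h. (\<integral>\<^sup>+ z \<in> action_box L3 T l1 (l1 + h). ennreal (dist (w z) (w' z)) \<partial>lebesgue) / ennreal h)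
        \<longlongrightarrow> 0) (at_right 0) \<and>
     ((\<lambda>h. (\<integral>\<^sup>+ z \<in> action_box L3 T (l2 - h) l2. ennreal (dist (w z) (w' z)) \<partial>lebesgue) / ennreal h)
        \<longlongrightarrow> 0) (at_right 0)"

definition least_action_among ::
    "flow set \<Rightarrow> euler_riemann \<Rightarrow> real \<Rightarrow> real \<Rightarrow> real \<Rightarrow> real \<Rightarrow> flow \<Rightarrow> bool" where
  "least_action_among \<C> D L3 T l1 l2 w \<longleftrightarrow> w \<in> \<C> \<and>
     (\<forall>w'\<in>\<C>. same_boundary_data L3 T l1 l2 w w' \<longrightarrow> action D L3 T l1 l2 w \<le> action D L3 T l1 l2 w')"

text \<open>All members of the competing class have the same initial data, because those are part of
  \<^const>\<open>entropic_weak_solution\<close>.\<close>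

definition LAAP_admissible :: "euler_riemann \<Rightarrow> real \<Rightarrow> real \<Rightarrow> real \<Rightarrow> real \<Rightarrow> flow \<Rightarrow> bool" where
  "LAAP_admissible D = least_action_among {w. entropic_weak_solution D w} D"

end

theory Submission
  imports Defs
begin

text \<open>
  The middle state of a fan sub-solution lies strictly inside the convex hull of the set
  \<open>v \<otimes> v - u = C/2 Id\<close>. Inside the hull there is always a direction in which one can move by an amount
  comparable to the defect \<open>C - |v|\<^sup>2\<close> without leaving it, and in which the linear system
  \<open>div v = 0\<close>, \<open>\<partial>\<^sub>t v + div u = 0\<close> has localized plane waves, derived from a scalar potential. Adding
  such waves on disjoint balls increases the energy by a multiple of the squared defect and is
  almost orthogonal to any finite number of given fields, so that an iteration converges
  strongly to a perturbation that satisfies the constraint almost everywhere. Since these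
  perturbations may be taken weakly close to but different from \<open>0\<close>, there are infinitely many.

  For the action, pass to the specific volume \<open>x = 1 / \<rho>\<^sub>1\<close> and the mass fluxes through the two interfaces.
  By the trapezoidal inequality for the convex pressure, the action of the fan with \<open>\<epsilon>\<^sub>2 = 0\<close> is strictly
  monotone as long as \<open>\<epsilon>\<^sub>1 \<ge> 0\<close>, and lowest at the two shock solution; the term with \<open>\<epsilon>\<^sub>2\<close> only increases it.
\<close>

section \<open>Calculus with partial derivatives\<close>

text \<open>What shapes the iteration is that each step must gain energy in terms of the defect
  alone. Strict inequality in the relaxed set allows an amplitude proportional to the defect, so the
  gain is quadratic in it; as the energies are bounded, the gains and then the defects tend to 0.
  The middle wedge has infinite measure, so energies carry a fixed positive integrable weight, which
  leaves almost everywhere statements unchanged. Writing velocities and trace-free matrices as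
  complex numbers \<open>z\<close> and \<open>q\<close> makes the largest eigenvalue an explicit
  expression. The energy inequality needs no work inside the wedge: the limit has constant speed, so
  its energy is constant and its energy flux is a multiple of a divergence-free field up to a
  constant. Only conditions at the two interfaces remain. Constant speed also makes the action a
  function of \<rho>1 and \<epsilon>2 alone, although the solutions are highly non-unique. The sign
  of its derivative rests on both mass fluxes into the middle state being positive. The definition
  of a fan does not state this; it follows from \<epsilon>1 \<ge> 0 and the convexity of the
  pressure.\<close>

definition pd :: "'a::real_normed_vector \<Rightarrow> ('a \<Rightarrow> real) \<Rightarrow> 'a \<Rightarrow> real" where
  "pd b f x = frechet_derivative f (at x) b"

lemma pd_eqI: "(f has_derivative f') (at x) \<Longrightarrow> pd b f x = f' b"
  unfolding pd_def using frechet_derivative_at by metis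

lemma C_k_Suc: "C_k (Suc k) f \<longleftrightarrow> f differentiable_on UNIV \<and> (\<forall>b\<in>Basis. C_k k (pd b f))"
  by (simp add: pd_def[abs_def])

declare C_k.simps(2)[simp del]

lemma C_k_SucD: "C_k (Suc k) f \<Longrightarrow> C_k k f"
proof (induction k arbitrary: f)
  case 0
  then show ?case by (simp add: C_k_Suc differentiable_imp_continuous_on)
next
  case (Suc k)
  then show ?case by (metis C_k_Suc)
qed

lemma C_k_antimono: "C_k n f \<Longrightarrow> k \<le> n \<Longrightarrow> C_k k f"
  by (induction n) (use C_k_SucD le_Suc_eq in blast)+

lemma C_k_continuous: "C_k k f \<Longrightarrow> continuous_on UNIV f"
  using C_k_antimono[of k f 0] by simp

lemma C_k_differentiable: "C_k (Suc k) f \<Longrightarrow> f differentiable (at x)"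
  by (simp add: C_k_Suc differentiable_on_def)

lemma C_k_pd: "C_k (Suc k) f \<Longrightarrow> b \<in> Basis \<Longrightarrow> C_k k (pd b f)"
  using C_k_Suc by blast

lemma has_derivative_frechet: "f differentiable (at x) \<Longrightarrow> (f has_derivative (\<lambda>b. pd b f x)) (at x)"
  unfolding pd_def using frechet_derivative_works by auto

lemma linear_pd: "f differentiable (at x) \<Longrightarrow> linear (\<lambda>b. pd b f x)"
  using has_derivative_frechet has_derivative_linear by blast

lemma pd_add: "f differentiable (at x) \<Longrightarrow> g differentiable (at x) \<Longrightarrow> pd b (\<lambda>x. f x + g x) x = pd b f x + pd b g x"
  by (rule pd_eqI[OF has_derivative_add]) (auto intro: has_derivative_frechet)

lemma pd_mult: "f differentiable (at x) \<Longrightarrow> g differentiable (at x) \<Longrightarrow>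
    pd b (\<lambda>x. f x * g x) x = f x * pd b g x + pd b f x * g x"
  by (rule pd_eqI[OF has_derivative_mult]) (auto intro: has_derivative_frechet)

lemma pd_cmult: "f differentiable (at x) \<Longrightarrow> pd b (\<lambda>x. c * f x) x = c * pd b f x"
  by (rule pd_eqI[OF has_derivative_mult_right]) (auto intro: has_derivative_frechet)

lemma pd_const: "pd b (\<lambda>x. c) x = 0"
  by (rule pd_eqI[OF has_derivative_const])

lemma C_k_const: "C_k k (\<lambda>x. c)"
proof (induction k arbitrary: c)
  case (Suc k)
  have "pd b (\<lambda>x::'a. c) = (\<lambda>x. 0)" for b by (auto simp: pd_const)
  then show ?case using Suc by (simp add: C_k_Suc)
qed simp

lemma C_k_add: "C_k k f \<Longrightarrow> C_k k g \<Longrightarrow> C_k k (\<lambda>x. f x + g x)"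
proof (induction k arbitrary: f g)
  case 0 then show ?case by (auto intro: continuous_on_add)
next
  case (Suc k)
  have "pd b (\<lambda>x. f x + g x) = (\<lambda>x. pd b f x + pd b g x)" for b
    using Suc.prems by (auto simp: pd_add C_k_differentiable)
  then show ?case using Suc unfolding C_k_Suc by (auto intro: differentiable_on_add)
qed

lemma C_k_mult: "C_k k f \<Longrightarrow> C_k k g \<Longrightarrow> C_k k (\<lambda>x. f x * g x)"
proof (induction k arbitrary: f g)
  case 0 then show ?case by (auto intro: continuous_on_mult)
next
  case (Suc k)
  have e: "pd b (\<lambda>x. f x * g x) = (\<lambda>x. f x * pd b g x + pd b f x * g x)" for b
    using Suc.prems by (auto simp: pd_mult C_k_differentiable)
  have "C_k k f" "C_k k g" using Suc.prems C_k_SucD by blast+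
  then show ?case using Suc unfolding C_k_Suc e by (auto intro!: differentiable_on_mult C_k_add)
qed

lemma C_k_cmult: "C_k k f \<Longrightarrow> C_k k (\<lambda>x. c * f x)"
  by (intro C_k_mult C_k_const)

lemma C_k_diff: "C_k k f \<Longrightarrow> C_k k g \<Longrightarrow> C_k k (\<lambda>x. f x - g x)"
  using C_k_add[OF _ C_k_cmult[of k g "-1"], of f] by simp

lemma C_k_inner: "C_k k (\<lambda>x. x \<bullet> d)"
proof (cases k)
  case (Suc j)
  have d: "((\<lambda>x. x \<bullet> d) has_derivative (\<lambda>h. h \<bullet> d)) (at x)" for x
    by (auto intro!: derivative_eq_intros)
  have "pd b (\<lambda>x. x \<bullet> d) = (\<lambda>x. b \<bullet> d)" for b using pd_eqI[OF d] by auto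
  then show ?thesis using d unfolding Suc C_k_Suc
    by (auto simp: C_k_const differentiable_on_def differentiable_def)
qed (auto intro: continuous_intros)

lemma has_derivative_sin_inner: "((\<lambda>x. sin (x \<bullet> d)) has_derivative (\<lambda>h. cos (x \<bullet> d) * (h \<bullet> d))) (at x)"
  and has_derivative_cos_inner: "((\<lambda>x. cos (x \<bullet> d)) has_derivative (\<lambda>h. - sin (x \<bullet> d) * (h \<bullet> d))) (at x)"
  by (auto intro!: derivative_eq_intros)

lemma pd_sin_inner: "pd b (\<lambda>x. sin (x \<bullet> d)) = (\<lambda>x. (b \<bullet> d) * cos (x \<bullet> d))"
  using pd_eqI[OF has_derivative_sin_inner] by (auto simp: mult.commute)

lemma pd_cos_inner: "pd b (\<lambda>x. cos (x \<bullet> d)) = (\<lambda>x. - (b \<bullet> d) * sin (x \<bullet> d))"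
  using pd_eqI[OF has_derivative_cos_inner] by (auto simp: mult.commute)

text \<open>Sine and cosine are treated together because each differentiates into a multiple of the
  other, so that neither induction closes alone.\<close>

lemma C_k_sin_cos_inner: "C_k k (\<lambda>x. sin (x \<bullet> d)) \<and> C_k k (\<lambda>x. cos (x \<bullet> d))"
proof (induction k)
  case 0 show ?case by (auto intro!: continuous_intros)
next
  case (Suc k)
  have "(\<lambda>x. sin (x \<bullet> d)) differentiable_on UNIV" "(\<lambda>x. cos (x \<bullet> d)) differentiable_on UNIV"
    unfolding differentiable_on_def differentiable_def
    using has_derivative_sin_inner[of d] has_derivative_cos_inner[of d] by auto
  then show ?case using Suc unfolding C_k_Suc pd_sin_inner pd_cos_inner by (intro conjI ballI C_k_cmult) simp_all
qed

text \<open>Mean value theorem on the second difference quotient along the parallelogram \<open>x, x + s a, x + t b\<close>.\<close>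

lemma second_difference_mvt:
  fixes f :: "'a::real_normed_vector \<Rightarrow> real"
  assumes d: "\<And>x. f differentiable (at x)" "\<And>x. pd a f differentiable (at x)" and s: "0 < s"
  shows "\<exists>u v. 0 < u \<and> u < s \<and> 0 < v \<and> v < s \<and>
     f (x + s *\<^sub>R a + s *\<^sub>R b) - f (x + s *\<^sub>R a) - f (x + s *\<^sub>R b) + f x = s * s * pd b (pd a f) (x + u *\<^sub>R a + v *\<^sub>R b)"
proof -
  have der: "((\<lambda>t. g (y + t *\<^sub>R c)) has_real_derivative pd c g (y + t *\<^sub>R c)) (at t)"
    if "\<And>x. g differentiable (at x)" for g :: "'a \<Rightarrow> real" and y c t
  proof -
    have "((\<lambda>t. g (y + t *\<^sub>R c)) has_derivative (\<lambda>h. pd (h *\<^sub>R c) g (y + t *\<^sub>R c))) (at t)"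
      by (rule has_derivative_compose[where g = g and f = "\<lambda>t. y + t *\<^sub>R c"])
         (auto intro!: derivative_eq_intros has_derivative_frechet that)
    then show ?thesis
      using linear_scale[OF linear_pd[OF that]] by (simp add: has_field_derivative_def mult.commute[of _ "pd _ _ _"])
  qed
  define \<phi> where "\<phi> t = f (x + s *\<^sub>R b + t *\<^sub>R a) - f (x + t *\<^sub>R a)" for t
  have "(\<phi> has_real_derivative (pd a f (x + s *\<^sub>R b + t *\<^sub>R a) - pd a f (x + t *\<^sub>R a))) (at t)" for t
    unfolding \<phi>_def by (intro DERIV_diff der d)
  then obtain u where u: "0 < u" "u < s" "\<phi> s - \<phi> 0 = (s - 0) * (pd a f (x + s *\<^sub>R b + u *\<^sub>R a) - pd a f (x + u *\<^sub>R a))"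
    using MVT2[OF s, of \<phi> "\<lambda>t. pd a f (x + s *\<^sub>R b + t *\<^sub>R a) - pd a f (x + t *\<^sub>R a)"] by blast
  obtain v where v: "0 < v" "v < s" "pd a f (x + u *\<^sub>R a + s *\<^sub>R b) - pd a f (x + u *\<^sub>R a + 0 *\<^sub>R b) = (s - 0) * pd b (pd a f) (x + u *\<^sub>R a + v *\<^sub>R b)"
    using MVT2[OF s, of "\<lambda>t. pd a f (x + u *\<^sub>R a + t *\<^sub>R b)" "\<lambda>t. pd b (pd a f) (x + u *\<^sub>R a + t *\<^sub>R b)"] der[of "pd a f"] d
    by blast
  have "f (x + s *\<^sub>R a + s *\<^sub>R b) - f (x + s *\<^sub>R a) - f (x + s *\<^sub>R b) + f x = \<phi> s - \<phi> 0"
    by (simp add: \<phi>_def algebra_simps)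
  then show ?thesis using u v by (intro exI[of _ u] exI[of _ v]) (simp add: algebra_simps)
qed

text \<open>The second difference is symmetric in \<open>a\<close> and \<open>b\<close>. At every
  scale \<open>s\<close> it therefore yields two points near \<open>x\<close> where the two mixed
  derivatives take the same value, and continuity carries the equality to \<open>x\<close> as the
  scale shrinks.\<close>

lemma pd_commute:
  fixes f :: "'a::real_normed_vector \<Rightarrow> real"
  assumes d: "\<And>x. f differentiable (at x)" "\<And>x. pd a f differentiable (at x)" "\<And>x. pd b f differentiable (at x)"
    and c: "continuous_on UNIV (pd b (pd a f))" "continuous_on UNIV (pd a (pd b f))"
  shows "pd b (pd a f) x = pd a (pd b f) x"
proof -
  have near: "\<exists>y y'. dist y x \<le> s * (norm a + norm b) \<and> dist y' x \<le> s * (norm a + norm b) \<and>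
     pd b (pd a f) y = pd a (pd b f) y'" if s: "0 < s" for s
  proof -
    obtain u v where 1: "0 < u" "u < s" "0 < v" "v < s"
      "f (x + s *\<^sub>R a + s *\<^sub>R b) - f (x + s *\<^sub>R a) - f (x + s *\<^sub>R b) + f x = s * s * pd b (pd a f) (x + u *\<^sub>R a + v *\<^sub>R b)"
      using second_difference_mvt[OF d(1,2) s, where b = b and x = x] by blast
    obtain u' v' where 2: "0 < u'" "u' < s" "0 < v'" "v' < s"
      "f (x + s *\<^sub>R b + s *\<^sub>R a) - f (x + s *\<^sub>R b) - f (x + s *\<^sub>R a) + f x = s * s * pd a (pd b f) (x + u' *\<^sub>R b + v' *\<^sub>R a)"
      using second_difference_mvt[OF d(1,3) s, where b = a and x = x] by blast
    have swap: "x + s *\<^sub>R b + s *\<^sub>R a = x + s *\<^sub>R a + s *\<^sub>R b" by simp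
    have "s * s * pd b (pd a f) (x + u *\<^sub>R a + v *\<^sub>R b) = s * s * pd a (pd b f) (x + u' *\<^sub>R b + v' *\<^sub>R a)"
      using 1(5) 2(5) unfolding swap by linarith
    then have e: "pd b (pd a f) (x + u *\<^sub>R a + v *\<^sub>R b) = pd a (pd b f) (x + u' *\<^sub>R b + v' *\<^sub>R a)"
      using s by simp
    have close: "dist (x + p *\<^sub>R c + q *\<^sub>R e) x \<le> s * (norm c + norm e)"
      if "0 < p" "p < s" "0 < q" "q < s" for p q c e
    proof -
      have "dist (x + p *\<^sub>R c + q *\<^sub>R e) x = norm (p *\<^sub>R c + q *\<^sub>R e)" by (simp add: dist_norm)
      also have "\<dots> \<le> norm (p *\<^sub>R c) + norm (q *\<^sub>R e)" by (rule norm_triangle_ineq)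
      also have "\<dots> \<le> s * norm c + s * norm e" using that by (auto intro!: add_mono mult_right_mono)
      finally show ?thesis by (simp add: distrib_left)
    qed
    show ?thesis using close[OF 1(1-4), of a b] close[OF 2(1-4), of b a] e
      by (intro exI[of _ "x + u *\<^sub>R a + v *\<^sub>R b"] exI[of _ "x + u' *\<^sub>R b + v' *\<^sub>R a"]) (simp add: add.commute)
  qed
  define s where "s n = inverse (real (Suc n))" for n
  have s: "0 < s n" for n by (simp add: s_def)
  have s0: "s \<longlonglongrightarrow> 0" unfolding s_def by (rule LIMSEQ_inverse_real_of_nat)
  define Y where "Y n = (SOME y. \<exists>y'. dist y x \<le> s n * (norm a + norm b) \<and> dist y' x \<le> s n * (norm a + norm b) \<and>
     pd b (pd a f) y = pd a (pd b f) y')" for n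
  have "\<exists>y'. dist (Y n) x \<le> s n * (norm a + norm b) \<and> dist y' x \<le> s n * (norm a + norm b) \<and>
     pd b (pd a f) (Y n) = pd a (pd b f) y'" for n
    unfolding Y_def by (rule someI_ex[OF near[OF s]])
  then obtain Y' where Y: "\<And>n. dist (Y n) x \<le> s n * (norm a + norm b)" "\<And>n. dist (Y' n) x \<le> s n * (norm a + norm b)"
     "\<And>n. pd b (pd a f) (Y n) = pd a (pd b f) (Y' n)" by metis
  have lim: "w \<longlonglongrightarrow> x" if "\<And>n. dist (w n) x \<le> s n * (norm a + norm b)" for w
  proof (rule metric_tendsto_imp_tendsto)
    show "(\<lambda>n. s n * (norm a + norm b)) \<longlonglongrightarrow> 0" using tendsto_mult_left_zero[OF s0] .
    show "\<forall>\<^sub>F n in sequentially. dist (w n) x \<le> dist (s n * (norm a + norm b)) 0"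
      using that by (intro always_eventually) (smt (verit) real_norm_def dist_0_norm dist_commute)
  qed
  have A: "(\<lambda>n. pd b (pd a f) (Y n)) \<longlonglongrightarrow> pd b (pd a f) x"
    using continuous_on_tendsto_compose[OF c(1) lim[OF Y(1)]] by simp
  have B: "(\<lambda>n. pd a (pd b f) (Y' n)) \<longlonglongrightarrow> pd a (pd b f) x"
    using continuous_on_tendsto_compose[OF c(2) lim[OF Y(2)]] by simp
  show ?thesis using A B unfolding Y(3) by (rule LIMSEQ_unique)
qed

lemma C_k_pd_commute:
  assumes "C_k (Suc (Suc k)) f" "a \<in> Basis" "b \<in> Basis"
  shows "pd b (pd a f) = pd a (pd b f)"
  using assms C_k_differentiable[OF assms(1)] C_k_differentiable[OF C_k_pd[OF assms(1)]]
    C_k_continuous[OF C_k_pd[OF C_k_pd[OF assms(1)]]]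
  by (intro ext pd_commute) auto

subsection \<open>Compactly supported functions\<close>

definition bsupp :: "('a::real_normed_vector \<Rightarrow> 'b::zero) \<Rightarrow> bool" where
  "bsupp f \<longleftrightarrow> (\<exists>R. \<forall>z. R < norm z \<longrightarrow> f z = 0)"

lemma pd_eq_0_open:
  assumes "open S" "x \<in> S" "\<And>y. y \<in> S \<Longrightarrow> f y = (0::real)"
  shows "pd b f x = 0"
proof (rule pd_eqI)
  show "(f has_derivative (\<lambda>_. 0)) (at x)"
    by (rule has_derivative_transform_within_open[OF has_derivative_const[of 0] assms(1,2)]) (simp add: assms(3))
qed

lemma bsupp_pd: "bsupp f \<Longrightarrow> bsupp (pd b f)"
proof -
  assume "bsupp f"
  then obtain R where R: "\<And>z. R < norm z \<Longrightarrow> f z = 0" by (auto simp: bsupp_def)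
  have "open {z. R < norm z}" by (intro open_Collect_less continuous_intros)
  then show ?thesis unfolding bsupp_def using pd_eq_0_open[of "{z. R < norm z}" _ f] R by auto
qed

lemma bsupp_mult_left: "bsupp f \<Longrightarrow> bsupp (\<lambda>x. f x * (g x :: 'b::mult_zero))"
  and bsupp_mult_right: "bsupp g \<Longrightarrow> bsupp (\<lambda>x. f x * (g x :: 'b::mult_zero))"
  unfolding bsupp_def by force+

lemma bsupp_bounded:
  fixes f :: "'a::euclidean_space \<Rightarrow> 'b::real_normed_vector"
  assumes "bsupp f" "continuous_on UNIV f"
  obtains M where "0 < M" "\<And>z. norm (f z) \<le> M"
proof -
  obtain R where R: "\<And>z. R < norm z \<Longrightarrow> f z = 0" using assms by (auto simp: bsupp_def)
  have "compact (f ` cball 0 R)"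
    by (intro compact_continuous_image continuous_on_subset[OF assms(2)]) auto
  then obtain M where M: "0 < M" "\<And>y. y \<in> f ` cball 0 R \<Longrightarrow> norm y \<le> M"
    using bounded_pos compact_imp_bounded by metis
  have "norm (f z) \<le> M" for z
    using M R[of z] by (cases "norm z \<le> R") (auto simp: dist_norm)
  then show ?thesis using M that by blast
qed

lemma integrable_bounded_supported:
  fixes f :: "'a::euclidean_space \<Rightarrow> 'b::{banach, second_countable_topology}"
  assumes [measurable]: "f \<in> borel_measurable borel" and "\<And>z. norm (f z) \<le> M" "\<And>z. R < norm z \<Longrightarrow> f z = 0"
  shows "integrable lborel f"
proof (rule integrableI_bounded_set[where A = "cball 0 R" and B = M])
  show "emeasure lborel (cball 0 R :: 'a set) < \<infinity>"
    by (intro emeasure_lborel_cball_finite)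
qed (use assms in auto)

lemma bsupp_integrable:
  fixes f :: "'a::euclidean_space \<Rightarrow> 'b::{banach, second_countable_topology}"
  assumes "bsupp f" "continuous_on UNIV f"
  shows "integrable lborel f"
proof -
  obtain R where R: "\<And>z. R < norm z \<Longrightarrow> f z = 0" using assms by (auto simp: bsupp_def)
  obtain M where "\<And>z. norm (f z) \<le> M" using bsupp_bounded[OF assms] by metis
  then show ?thesis using R by (intro integrable_bounded_supported borel_measurable_continuous_onI assms(2)) auto
qed

lemma integrable_indicator_scaleR:
  fixes f :: "'a::euclidean_space \<Rightarrow> 'b::{banach, second_countable_topology}"
  assumes "integrable lborel f" "A \<in> sets borel"
  shows "integrable lborel (\<lambda>z. indicator A z *\<^sub>R f z)"
  using integrable_mult_indicator[of A lborel f] assms by auto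

section \<open>Integrals of directional derivatives via translation invariance\<close>

lemma lborel_integral_translate:
  fixes f :: "'a::euclidean_space \<Rightarrow> 'b::{banach, second_countable_topology}"
  assumes [measurable]: "f \<in> borel_measurable borel"
  shows "(\<integral>z. f (c + z) \<partial>lborel) = (\<integral>z. f z \<partial>lborel)"
  using integral_distr[of "(+) c" lborel borel f] lborel_distr_plus[of c] by simp

lemma lborel_integrable_translate:
  fixes f :: "'a::euclidean_space \<Rightarrow> 'b::{banach, second_countable_topology}"
  assumes "integrable lborel f"
  shows "integrable lborel (\<lambda>z. f (c + z))"
proof -
  have [measurable]: "f \<in> borel_measurable borel" using assms by auto
  show ?thesis
  using integrable_distr_eq[of "(+) c" lborel borel f] lborel_distr_plus[of c] assms by simp
qed

text \<open>Integrating a directional derivative amounts to differentiating translations of the domain.\<close>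

lemma integral_pd_limit:
  fixes h :: "'a::euclidean_space \<Rightarrow> real"
  assumes diff: "\<And>x. h differentiable (at x)" and cd: "continuous_on UNIV (pd d h)" and bs: "bsupp h" and A[measurable]: "A \<in> sets borel"
  shows "(\<lambda>n. (\<integral>z. indicator A z * (real (Suc n) * (h (inverse (real (Suc n)) *\<^sub>R d + z) - h z)) \<partial>lborel))
     \<longlonglongrightarrow> (\<integral>z. indicator A z * pd d h z \<partial>lborel)"
proof -
  have ch: "continuous_on UNIV h"
    using diff by (simp add: continuous_at_imp_continuous_on differentiable_imp_continuous_within)
  have [measurable]: "h \<in> borel_measurable borel" "pd d h \<in> borel_measurable borel"
    using ch cd by (auto intro: borel_measurable_continuous_onI)
  obtain R where R: "\<And>z. R < norm z \<Longrightarrow> h z = 0" using bs by (auto simp: bsupp_def)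
  obtain M where M: "0 < M" "\<And>z. norm (pd d h z) \<le> M" using bsupp_bounded[OF bsupp_pd[OF bs] cd] by metis
  have der: "((\<lambda>t. h (t *\<^sub>R d + z)) has_real_derivative pd d h (t *\<^sub>R d + z)) (at t)" for t z
  proof -
    have "((\<lambda>t. h (t *\<^sub>R d + z)) has_derivative (\<lambda>k. pd (k *\<^sub>R d) h (t *\<^sub>R d + z))) (at t)"
      by (rule has_derivative_compose[where g = h and f = "\<lambda>t. t *\<^sub>R d + z"])
         (auto intro!: derivative_eq_intros has_derivative_frechet diff)
    then show ?thesis
      using linear_scale[OF linear_pd[OF diff]] by (simp add: has_field_derivative_def mult.commute[of _ "pd _ _ _"])
  qed
  let ?q = "\<lambda>n z. real (Suc n) * (h (inverse (real (Suc n)) *\<^sub>R d + z) - h z)"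
  \<comment> \<open>The mean value theorem bounds all quotients by the supremum of the derivative.
    Since the shifts have length at most \<open>norm d\<close>, the quotients also vanish outside
    one common ball; the two facts give the dominating function.\<close>
  have bound: "\<bar>?q n z\<bar> \<le> M" for n z
  proof -
    obtain u where "h (inverse (real (Suc n)) *\<^sub>R d + z) - h (0 *\<^sub>R d + z) = (inverse (real (Suc n)) - 0) * pd d h (u *\<^sub>R d + z)"
      using MVT2[of 0 "inverse (real (Suc n))" "\<lambda>t. h (t *\<^sub>R d + z)" "\<lambda>t. pd d h (t *\<^sub>R d + z)"] der by auto
    then have "?q n z = pd d h (u *\<^sub>R d + z)" by (simp add: field_simps)
    then show ?thesis using M(2)[of "u *\<^sub>R d + z"] by simp
  qed
  have zero: "?q n z = 0" if "R + norm d < norm z" for n z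
  proof -
    have "norm z \<le> norm (inverse (real (Suc n)) *\<^sub>R d + z) + norm (inverse (real (Suc n)) *\<^sub>R d)"
      by (metis add_diff_cancel_left' norm_minus_commute norm_triangle_sub add.commute)
    moreover have "norm (inverse (real (Suc n)) *\<^sub>R d) \<le> norm d"
      by (simp add: divide_inverse[symmetric] field_simps mult_left_le)
    ultimately have "R < norm (inverse (real (Suc n)) *\<^sub>R d + z)" "R < norm z" using that norm_ge_zero[of d] by linarith+
    then show ?thesis using R by simp
  qed
  show ?thesis
  proof (rule integral_dominated_convergence[where w = "\<lambda>z. M * indicator (cball 0 (R + norm d)) z"])
    show "integrable lborel (\<lambda>z::'a. M * indicator (cball 0 (R + norm d)) z :: real)"
      using emeasure_lborel_cball_finite[of "0::'a" "R + norm d"]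
      by (intro integrable_mult_right integrable_real_indicator) (auto simp: less_top)
    show "AE z in lborel. (\<lambda>n. indicator A z * ?q n z) \<longlonglongrightarrow> indicator A z * pd d h z"
    proof (intro AE_I2 tendsto_mult tendsto_const)
      fix z
      have "((\<lambda>t. (h (t *\<^sub>R d + z) - h (0 *\<^sub>R d + z)) / (t - 0)) \<longlongrightarrow> pd d h (0 *\<^sub>R d + z)) (at 0)"
        using der[of z 0] unfolding has_field_derivative_iff by simp
      then have "((\<lambda>n. (h (inverse (real (Suc n)) *\<^sub>R d + z) - h (0 *\<^sub>R d + z)) / (inverse (real (Suc n)) - 0)) \<longlongrightarrow> pd d h (0 *\<^sub>R d + z)) sequentially"
        by (rule filterlim_compose) (intro filterlim_atI LIMSEQ_inverse_real_of_nat always_eventually, simp)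
      then show "(\<lambda>n. ?q n z) \<longlonglongrightarrow> pd d h z" by (simp add: field_simps)
    qed
    show "AE z in lborel. norm (indicator A z * ?q n z) \<le> M * indicator (cball 0 (R + norm d)) z" for n
      using bound[of n] zero[of _ n] M(1) by (intro AE_I2) (auto split: split_indicator simp: abs_mult)
  qed measurable
qed

text \<open>If \<open>A\<close> is unchanged by translations along \<open>d\<close>, the integral of
  every difference quotient over \<open>A\<close> vanishes by translation invariance.
  \<open>A = UNIV\<close> gives integration by parts; half space and wedges give the tangential
  derivatives along the interfaces.\<close>

lemma integral_pd_invariant:
  fixes h :: "'a::euclidean_space \<Rightarrow> real"
  assumes h: "\<And>x. h differentiable (at x)" "continuous_on UNIV (pd d h)" "bsupp h" and A[measurable]: "A \<in> sets borel"
    and inv: "\<And>t z. 0 \<le> t \<Longrightarrow> t *\<^sub>R d + z \<in> A \<longleftrightarrow> z \<in> A"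
  shows "(\<integral>z. indicator A z * pd d h z \<partial>lborel) = 0"
proof -
  have ch: "continuous_on UNIV h"
    using h(1) by (simp add: continuous_at_imp_continuous_on differentiable_imp_continuous_within)
  have [measurable]: "h \<in> borel_measurable borel" using ch by (auto intro: borel_measurable_continuous_onI)
  have ih: "integrable lborel (\<lambda>z. indicator A z * h z)"
    using integrable_indicator_scaleR[OF bsupp_integrable[OF h(3) ch] A] by simp
  have "(\<integral>z. indicator A z * (real (Suc n) * (h (inverse (real (Suc n)) *\<^sub>R d + z) - h z)) \<partial>lborel) = 0" for n
  proof -
    let ?t = "inverse (real (Suc n)) *\<^sub>R d"
    have e: "indicator A z = (indicator A (?t + z) :: real)" for z
      using inv[of "inverse (real (Suc n))" z] by (auto simp: indicator_def)
    have "(\<integral>z. indicator A z * (real (Suc n) * (h (?t + z) - h z)) \<partial>lborel)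
      = (\<integral>z. real (Suc n) * (indicator A (?t + z) * h (?t + z) - indicator A z * h z) \<partial>lborel)"
      by (intro Bochner_Integration.integral_cong refl) (subst e[symmetric], simp add: algebra_simps)
    also have "\<dots> = real (Suc n) * ((\<integral>z. indicator A (?t + z) * h (?t + z) \<partial>lborel) - (\<integral>z. indicator A z * h z \<partial>lborel))"
      using lborel_integrable_translate[OF ih, of ?t] ih by (simp add: Bochner_Integration.integral_diff)
    also have "\<dots> = 0" using lborel_integral_translate[of "\<lambda>z. indicator A z * h z" ?t] by simp
    finally show ?thesis .
  qed
  then have "(\<lambda>n::nat. 0) \<longlonglongrightarrow> (\<integral>z. indicator A z * pd d h z \<partial>lborel)"
    using integral_pd_limit[OF h A] by presburger
  then show ?thesis using LIMSEQ_const_iff by metis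
qed

lemma integral_by_parts_pd:
  fixes f g :: "'a::euclidean_space \<Rightarrow> real"
  assumes f: "C_k (Suc 0) f" "bsupp f" and g: "C_k (Suc 0) g" and b: "b \<in> Basis"
  shows "(\<integral>z. pd b f z * g z \<partial>lborel) = - (\<integral>z. f z * pd b g z \<partial>lborel)"
proof -
  have fg: "C_k (Suc 0) (\<lambda>z. f z * g z)" using f g by (intro C_k_mult)
  have cont: "continuous_on UNIV f" "continuous_on UNIV g" "continuous_on UNIV (pd b f)" "continuous_on UNIV (pd b g)"
    "continuous_on UNIV (pd b (\<lambda>z. f z * g z))"
    using f g b fg C_k_continuous C_k_pd by blast+
  have e: "pd b (\<lambda>z. f z * g z) = (\<lambda>z. f z * pd b g z + pd b f z * g z)"
    by (intro ext pd_mult C_k_differentiable[OF f(1)] C_k_differentiable[OF g])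
  have "(\<integral>z. indicator UNIV z * pd b (\<lambda>z. f z * g z) z \<partial>lborel) = 0"
    by (rule integral_pd_invariant[OF C_k_differentiable[OF fg] cont(5) bsupp_mult_left[OF f(2)]]) auto
  moreover have "integrable lborel (\<lambda>z. f z * pd b g z)" "integrable lborel (\<lambda>z. pd b f z * g z)"
    by (intro bsupp_integrable bsupp_mult_left bsupp_pd continuous_on_mult cont f(2))+
  ultimately show ?thesis by (simp add: e)
qed

section \<open>Oscillating perturbations\<close>

abbreviation et :: spacetime where "et \<equiv> (1, 0)"
abbreviation e1 :: spacetime where "e1 \<equiv> (0, axis 1 1)"
abbreviation e2 :: spacetime where "e2 \<equiv> (0, axis 2 1)"

lemma spacetime_Basis: "(1, 0) \<in> (Basis :: spacetime set)" "(0, axis i 1) \<in> (Basis :: spacetime set)"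
  by (auto simp: Basis_prod_def axis_in_Basis_iff)

definition smooth :: "(spacetime \<Rightarrow> real) \<Rightarrow> bool" where
  "smooth \<phi> \<longleftrightarrow> (\<forall>k. C_k k \<phi>)"

lemma smooth_pd: "smooth \<phi> \<Longrightarrow> b \<in> Basis \<Longrightarrow> smooth (pd b \<phi>)"
  unfolding smooth_def using C_k_pd by blast

lemma smooth_commute:
  assumes "smooth \<phi>"
  shows "pd e2 (pd e1 \<phi>) = pd e1 (pd e2 \<phi>)" "pd e1 (pd et \<phi>) = pd et (pd e1 \<phi>)" "pd e2 (pd et \<phi>) = pd et (pd e2 \<phi>)"
  using assms unfolding smooth_def by (auto intro!: C_k_pd_commute[of 0] spacetime_Basis)

lemma test_function_smooth: "test_function \<phi> \<Longrightarrow> smooth \<phi>"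
  by (simp add: test_function_def smooth_def)

lemma test_function_bsupp: "test_function \<phi> \<Longrightarrow> bsupp \<phi>"
proof -
  assume "test_function \<phi>"
  then have "bounded (closure {z. \<phi> z \<noteq> 0})" by (simp add: test_function_def compact_imp_bounded)
  then obtain B where B: "\<And>z. z \<in> closure {z. \<phi> z \<noteq> 0} \<Longrightarrow> norm z \<le> B" by (auto simp: bounded_iff)
  have "\<phi> z = 0" if "B < norm z" for z
    using B[of z] that closure_subset[of "{z. \<phi> z \<noteq> 0}"] by force
  then show ?thesis by (auto simp: bsupp_def)
qed

text \<open>A pair \<open>(z, q)\<close> stands for the velocity \<open>z\<close> and the symmetric trace-free matrix with first row \<open>q\<close>.
  The three fields below test the equations \<open>div v = 0\<close> and \<open>\<partial>\<^sub>t v + div u = 0\<close>.\<close>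

type_synonym state = "complex \<times> complex"

definition test_field :: "nat \<Rightarrow> (spacetime \<Rightarrow> real) \<Rightarrow> spacetime \<Rightarrow> state" where
  "test_field i \<phi> z =
    (if i = 0 then (Complex (pd e1 \<phi> z) (pd e2 \<phi> z), 0)
     else if i = 1 then (Complex (pd et \<phi> z) 0, Complex (pd e1 \<phi> z) (pd e2 \<phi> z))
     else (Complex 0 (pd et \<phi> z), Complex (- pd e2 \<phi> z) (pd e1 \<phi> z)))"

definition weak_pair :: "(spacetime \<Rightarrow> state) \<Rightarrow> bool" where
  "weak_pair T \<longleftrightarrow> (\<forall>\<phi> i. test_function \<phi> \<longrightarrow> (\<integral>z. T z \<bullet> test_field i \<phi> z \<partial>lborel) = 0)"

lemma test_field_continuous: "smooth \<phi> \<Longrightarrow> continuous_on UNIV (test_field i \<phi>)"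
proof -
  assume "smooth \<phi>"
  then have "continuous_on UNIV (pd e1 \<phi>)" "continuous_on UNIV (pd e2 \<phi>)" "continuous_on UNIV (pd et \<phi>)"
    using smooth_pd[of \<phi>] spacetime_Basis C_k_continuous unfolding smooth_def by blast+
  then show ?thesis
    unfolding test_field_def complex_eq_iff Complex_eq
    by (cases "i = 0"; cases "i = 1") (auto intro!: continuous_intros)
qed

lemma test_field_bsupp: "bsupp \<phi> \<Longrightarrow> bsupp (test_field i \<phi>)"
proof -
  assume "bsupp \<phi>"
  then have "bsupp (pd e1 \<phi>)" "bsupp (pd e2 \<phi>)" "bsupp (pd et \<phi>)" by (auto intro: bsupp_pd)
  then obtain R1 R2 R3 where R: "\<And>z. R1 < norm z \<Longrightarrow> pd e1 \<phi> z = 0" "\<And>z. R2 < norm z \<Longrightarrow> pd e2 \<phi> z = 0"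
    "\<And>z. R3 < norm z \<Longrightarrow> pd et \<phi> z = 0"
    unfolding bsupp_def by blast
  show ?thesis unfolding bsupp_def
    by (rule exI[of _ "max R1 (max R2 R3)"]) (auto simp: test_field_def R zero_prod_def complex_eq_iff)
qed

text \<open>The equations are solved by \<open>v = \<nabla>\<^sup>\<bottom>\<Delta>\<psi>\<close> and \<open>u = \<partial>\<^sub>t (2\<partial>\<^sub>1\<partial>\<^sub>2\<psi>, (\<partial>\<^sub>2\<^sup>2 - \<partial>\<^sub>1\<^sup>2)\<psi>)\<close> for every potential \<open>\<psi>\<close>.\<close>

definition of_potential :: "(spacetime \<Rightarrow> real) \<Rightarrow> spacetime \<Rightarrow> state" where
  "of_potential \<psi> z =
    (Complex (- (pd e2 (pd e1 (pd e1 \<psi>)) z + pd e2 (pd e2 (pd e2 \<psi>)) z))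
             (pd e1 (pd e1 (pd e1 \<psi>)) z + pd e1 (pd e2 (pd e2 \<psi>)) z),
     Complex (2 * pd et (pd e1 (pd e2 \<psi>)) z) (pd et (pd e2 (pd e2 \<psi>)) z - pd et (pd e1 (pd e1 \<psi>)) z))"

lemma C_k_3D:
  assumes "C_k 3 f" "a \<in> Basis" "b \<in> Basis" "c \<in> Basis"
  shows "C_k 2 (pd c f)" "C_k 1 (pd b (pd c f))" "C_k 0 (pd a (pd b (pd c f)))"
proof -
  show 1: "C_k 2 (pd c f)" using assms C_k_pd[of 2 f c] by (simp add: eval_nat_numeral)
  show 2: "C_k 1 (pd b (pd c f))" using assms C_k_pd[of 1 _ b] 1 by (simp add: eval_nat_numeral)
  show "C_k 0 (pd a (pd b (pd c f)))" using assms C_k_pd[of 0 _ a] 2 by simp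
qed

lemma integral_by_parts_pd3:
  assumes f: "C_k 3 f" "bsupp f" and g: "C_k 3 g" and b: "a \<in> Basis" "b \<in> Basis" "c \<in> Basis"
  shows "(\<integral>z. pd a (pd b (pd c f)) z * g z \<partial>lborel) = - (\<integral>z. f z * pd c (pd b (pd a g)) z \<partial>lborel)"
proof -
  have c1: "C_k (Suc 0) h" if "C_k 2 h \<or> C_k 3 h \<or> C_k 1 h" for h :: "'a \<Rightarrow> real"
    using that C_k_antimono[of _ h "Suc 0"] by auto
  note c = C_k_3D[OF f(1) b] C_k_3D[OF g b(3,2,1)]
  have "(\<integral>z. pd a (pd b (pd c f)) z * g z \<partial>lborel) = - (\<integral>z. pd b (pd c f) z * pd a g z \<partial>lborel)"
    by (intro integral_by_parts_pd c1 bsupp_pd b) (use c f g in auto)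
  also have "(\<integral>z. pd b (pd c f) z * pd a g z \<partial>lborel) = - (\<integral>z. pd c f z * pd b (pd a g) z \<partial>lborel)"
    by (intro integral_by_parts_pd c1 bsupp_pd b) (use c f g in auto)
  also have "(\<integral>z. pd c f z * pd b (pd a g) z \<partial>lborel) = - (\<integral>z. f z * pd c (pd b (pd a g)) z \<partial>lborel)"
    by (intro integral_by_parts_pd c1 bsupp_pd b) (use c f g in auto)
  finally show ?thesis by simp
qed

lemma of_potential_continuous: "C_k 3 \<psi> \<Longrightarrow> continuous_on UNIV (of_potential \<psi>)"
proof -
  assume \<psi>: "C_k 3 \<psi>"
  note c = C_k_3D(3)[OF \<psi> _ _ _, unfolded C_k.simps]
  show ?thesis unfolding of_potential_def complex_eq_iff Complex_eq
    by (intro continuous_intros c spacetime_Basis)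
qed

lemma of_potential_supp: "of_potential \<psi> z = 0" if "open S" "z \<in> S" "\<And>y. y \<in> S \<Longrightarrow> \<psi> y = 0"
proof -
  have "pd a (pd b (pd c \<psi>)) z = 0" for a b c
    using that by (intro pd_eq_0_open[OF that(1)])
  then show ?thesis by (simp add: of_potential_def zero_prod_def complex_eq_iff)
qed

text \<open>The potential is only of class \<open>C_k 3\<close>, so the equations cannot be checked
  by differentiating the field once more. All three derivatives are moved to the test function
  instead, where the resulting fourth derivatives commute and cancel.\<close>

lemma weak_pair_of_potential:
  assumes \<psi>: "C_k 3 \<psi>" "bsupp \<psi>"
  shows "weak_pair (of_potential \<psi>)"
  unfolding weak_pair_def
proof (intro allI impI)
  fix \<phi> and i :: nat assume "test_function \<phi>"
  then have \<phi>: "smooth \<phi>" "bsupp \<phi>" by (simp_all add: test_function_smooth test_function_bsupp)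
  have sm: "smooth (pd et \<phi>)" "smooth (pd e1 \<phi>)" "smooth (pd e2 \<phi>)"
    using \<phi> by (auto intro: smooth_pd spacetime_Basis)
  define I where "I f = (\<integral>z. \<psi> z * f z \<partial>lborel)" for f
  have int: "integrable lborel (\<lambda>z. pd a (pd b (pd c \<psi>)) z * g z)" if "a \<in> Basis" "b \<in> Basis" "c \<in> Basis" "smooth g" for a b c g
    using that C_k_3D(3)[OF \<psi>(1) that(1-3)] C_k_continuous[of 0 g]
    by (auto intro!: bsupp_integrable bsupp_mult_left bsupp_pd \<psi>(2) continuous_on_mult simp: smooth_def)
  have ibp: "(\<integral>z. pd a (pd b (pd c \<psi>)) z * g z \<partial>lborel) = - I (pd c (pd b (pd a g)))"
    if "a \<in> Basis" "b \<in> Basis" "c \<in> Basis" "smooth g" for a b c g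
    unfolding I_def using that by (intro integral_by_parts_pd3 \<psi>) (auto simp: smooth_def)
  note B = spacetime_Basis
  note S = sm \<phi>(1) smooth_pd B smooth_commute
  consider "i = 0" | "i = 1" | "i \<noteq> 0 \<and> i \<noteq> 1" by blast
  then show "(\<integral>z. of_potential \<psi> z \<bullet> test_field i \<phi> z \<partial>lborel) = 0"
  proof cases
    case 1
    have "(\<lambda>z. of_potential \<psi> z \<bullet> test_field i \<phi> z) =
      (\<lambda>z. - (pd e2 (pd e1 (pd e1 \<psi>)) z * pd e1 \<phi> z) - pd e2 (pd e2 (pd e2 \<psi>)) z * pd e1 \<phi> z
        + pd e1 (pd e1 (pd e1 \<psi>)) z * pd e2 \<phi> z + pd e1 (pd e2 (pd e2 \<psi>)) z * pd e2 \<phi> z)"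
      using 1 by (auto simp: of_potential_def test_field_def inner_complex_def algebra_simps)
    then show ?thesis using \<phi>(1) by (simp add: int ibp S)
  next
    case 2
    have "(\<lambda>z. of_potential \<psi> z \<bullet> test_field i \<phi> z) =
      (\<lambda>z. - (pd e2 (pd e1 (pd e1 \<psi>)) z * pd et \<phi> z) - pd e2 (pd e2 (pd e2 \<psi>)) z * pd et \<phi> z
        + 2 * (pd et (pd e1 (pd e2 \<psi>)) z * pd e1 \<phi> z) + pd et (pd e2 (pd e2 \<psi>)) z * pd e2 \<phi> z
        - pd et (pd e1 (pd e1 \<psi>)) z * pd e2 \<phi> z)"
      using 2 by (auto simp: of_potential_def test_field_def inner_complex_def algebra_simps)
    then show ?thesis using \<phi>(1) by (simp add: int ibp S)
  next
    case 3
    have "(\<lambda>z. of_potential \<psi> z \<bullet> test_field i \<phi> z) =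
      (\<lambda>z. pd e1 (pd e1 (pd e1 \<psi>)) z * pd et \<phi> z + pd e1 (pd e2 (pd e2 \<psi>)) z * pd et \<phi> z
        - 2 * (pd et (pd e1 (pd e2 \<psi>)) z * pd e2 \<phi> z) + pd et (pd e2 (pd e2 \<psi>)) z * pd e1 \<phi> z
        - pd et (pd e1 (pd e1 \<psi>)) z * pd e1 \<phi> z)"
      using 3 by (auto simp: of_potential_def test_field_def inner_complex_def algebra_simps)
    then show ?thesis using \<phi>(1) by (simp add: int ibp S)
  qed
qed

subsection \<open>A bump function of class \<open>C\<^sup>3\<close>\<close>

lemma DERIV_max_0_power:
  "((\<lambda>y::real. max 0 y ^ Suc (Suc n)) has_real_derivative real (Suc (Suc n)) * max 0 y ^ Suc n) (at y)"
proof -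
  consider "0 < y" | "y < 0" | "y = 0" by linarith
  then show ?thesis
  proof cases
    case 1
    have "((\<lambda>y::real. y ^ Suc (Suc n)) has_real_derivative real (Suc (Suc n)) * y ^ Suc n) (at y)"
      using DERIV_pow[of "Suc (Suc n)" y] by simp
    then have "((\<lambda>y::real. max 0 y ^ Suc (Suc n)) has_real_derivative real (Suc (Suc n)) * y ^ Suc n) (at y)"
      by (rule has_field_derivative_transform_within_open[of _ _ _ "{0<..}"]) (use 1 in auto)
    then show ?thesis using 1 by simp
  next
    case 2
    have "((\<lambda>y::real. max 0 y ^ Suc (Suc n)) has_real_derivative 0) (at y)"
      by (rule has_field_derivative_transform_within_open[of "\<lambda>_. 0" _ _ "{..<0}"]) (use 2 in auto)
    then show ?thesis using 2 by simp
  next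
    case 3
    have c: "((\<lambda>h::real. max 0 h ^ Suc n) \<longlongrightarrow> 0) (at 0)"
    proof -
      have "((\<lambda>h::real. max 0 h ^ Suc n) \<longlongrightarrow> max 0 0 ^ Suc n) (at 0)" by (intro tendsto_intros)
      then show ?thesis by simp
    qed
    have "((\<lambda>h::real. (max 0 h ^ Suc (Suc n) - max 0 0 ^ Suc (Suc n)) / (h - 0)) \<longlongrightarrow> 0) (at 0)"
    proof (rule Lim_null_comparison[OF _ c], rule always_eventually, rule allI)
      fix h :: real
      show "norm ((max 0 h ^ Suc (Suc n) - max 0 0 ^ Suc (Suc n)) / (h - 0)) \<le> max 0 h ^ Suc n"
        by (cases "h \<le> 0") (auto simp: max_def abs_mult power_abs)
    qed
    then show ?thesis using 3 by (simp add: has_field_derivative_iff)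
  qed
qed

text \<open>A truncated polynomial suffices, because \<open>of_potential\<close> takes three
  derivatives. Each derivative lowers the exponent by one, so exponent 4 leaves a continuous third
  derivative.\<close>

definition bump :: "nat \<Rightarrow> 'a::euclidean_space \<Rightarrow> real \<Rightarrow> 'a \<Rightarrow> real" where
  "bump n c R z = max 0 (R\<^sup>2 - (z - c) \<bullet> (z - c)) ^ n"

lemma has_derivative_bump:
  "(bump (Suc (Suc n)) c R has_derivative (\<lambda>h. - 2 * real (Suc (Suc n)) * (h \<bullet> (z - c)) * bump (Suc n) c R z)) (at z)"
proof -
  have d: "((\<lambda>z. R\<^sup>2 - (z - c) \<bullet> (z - c)) has_derivative (\<lambda>h. - (2 * (h \<bullet> (z - c))))) (at z)"
    by (auto intro!: derivative_eq_intros simp: inner_commute algebra_simps)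
  show ?thesis
    unfolding bump_def[abs_def]
    by (rule has_derivative_eq_rhs[OF has_derivative_compose[OF d DERIV_max_0_power[of n, unfolded has_field_derivative_def]]])
      (simp add: fun_eq_iff algebra_simps)
qed

lemma C_k_bump: "C_k k (bump (k + Suc n) c R)"
proof (induction k arbitrary: n)
  case 0 show ?case unfolding bump_def[abs_def] by (auto intro!: continuous_intros)
next
  case (Suc k)
  have e: "pd b (bump (Suc k + Suc n) c R) =
      (\<lambda>z. (- 2 * real (Suc (Suc (k + n)))) * ((z \<bullet> b - c \<bullet> b) * bump (k + Suc n) c R z))" for b
  proof
    fix z show "pd b (bump (Suc k + Suc n) c R) z =
      (- 2 * real (Suc (Suc (k + n)))) * ((z \<bullet> b - c \<bullet> b) * bump (k + Suc n) c R z)"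
      using pd_eqI[OF has_derivative_bump[of "k + n" c R z], of b]
      by (simp add: inner_diff_right inner_diff_left inner_commute[of b] algebra_simps)
  qed
  have "bump (Suc k + Suc n) c R differentiable_on UNIV"
    using has_derivative_bump[of "k + n" c R] unfolding differentiable_on_def differentiable_def by auto
  then show ?case unfolding C_k_Suc e using Suc.IH[of n]
    by (intro conjI ballI C_k_cmult C_k_mult C_k_diff C_k_inner C_k_const) auto
qed

subsection \<open>Wave packets\<close>

lemma pd_mult_fun:
  assumes "C_k (Suc k) f" "C_k (Suc k) g"
  shows "pd b (\<lambda>x. f x * g x) = (\<lambda>x. f x * pd b g x + pd b f x * g x)"
  using assms by (auto simp: pd_mult C_k_differentiable)

lemma pd_add_fun:
  assumes "C_k (Suc k) f" "C_k (Suc k) g"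
  shows "pd b (\<lambda>x. f x + g x) = (\<lambda>x. pd b f x + pd b g x)"
  using assms by (auto simp: pd_add C_k_differentiable)

lemma pd3_mult:
  assumes f: "C_k 3 f" and g: "C_k 3 g" and b: "a \<in> Basis" "b \<in> Basis" "c \<in> Basis"
  shows "pd a (pd b (pd c (\<lambda>x. f x * g x))) z =
     pd a (pd b (pd c f)) z * g z + pd b (pd c f) z * pd a g z + pd a (pd c f) z * pd b g z + pd a (pd b f) z * pd c g z
     + pd a f z * pd b (pd c g) z + pd b f z * pd a (pd c g) z + pd c f z * pd a (pd b g) z + f z * pd a (pd b (pd c g)) z"
proof -
  have s: "C_k (Suc 2) f" "C_k (Suc 2) g" "C_k (Suc 1) f" "C_k (Suc 1) g" "C_k (Suc 0) f" "C_k (Suc 0) g"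
    using f g by (auto intro: C_k_antimono)
  have p2: "C_k (Suc 1) (pd d f)" "C_k (Suc 1) (pd d g)" "C_k (Suc 0) (pd d f)" "C_k (Suc 0) (pd d g)" if "d \<in> Basis" for d
    using C_k_3D(1)[OF f that that that] C_k_3D(1)[OF g that that that] by (auto intro: C_k_antimono)
  have p3: "C_k (Suc 0) (pd d (pd d' f))" "C_k (Suc 0) (pd d (pd d' g))" if "d \<in> Basis" "d' \<in> Basis" for d d'
    using C_k_3D(2)[OF f that(1) that] C_k_3D(2)[OF g that(1) that] by auto
  have "pd c (\<lambda>x. f x * g x) = (\<lambda>x. f x * pd c g x + pd c f x * g x)" by (rule pd_mult_fun[OF s(1,2)])
  moreover have "pd b (\<lambda>x. f x * pd c g x + pd c f x * g x) =
      (\<lambda>x. (f x * pd b (pd c g) x + pd b f x * pd c g x) + (pd c f x * pd b g x + pd b (pd c f) x * g x))"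
    by (simp add: pd_add_fun[of 0] pd_mult_fun[of 0] C_k_mult s p2 p3 b)
  moreover have "pd a (\<lambda>x. (f x * pd b (pd c g) x + pd b f x * pd c g x) + (pd c f x * pd b g x + pd b (pd c f) x * g x)) =
      (\<lambda>x. ((f x * pd a (pd b (pd c g)) x + pd a f x * pd b (pd c g) x) + (pd b f x * pd a (pd c g) x + pd a (pd b f) x * pd c g x))
       + ((pd c f x * pd a (pd b g) x + pd a (pd c f) x * pd b g x) + (pd b (pd c f) x * pd a g x + pd a (pd b (pd c f)) x * g x)))"
    by (simp add: pd_add_fun[of 0] pd_mult_fun[of 0] C_k_mult C_k_add s p2 p3 b)
  ultimately show ?thesis by simp
qed

text \<open>In the Leibniz expansion only the term with all three derivatives on the cosine has
  order \<open>N ^ 3\<close>; the prefactor \<open>r / N ^ 3\<close> normalises it to the sine term.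
  Every other term has order at most \<open>N ^ 2\<close> and ends up in the error
  \<open>K / N\<close>.\<close>

lemma third_derivative_wave:
  assumes \<eta>: "C_k 3 \<eta>" "bsupp \<eta>" and b: "a \<in> Basis" "b \<in> Basis" "c \<in> Basis"
  shows "\<exists>K. \<forall>N\<ge>1. \<forall>z. \<bar>pd a (pd b (pd c (\<lambda>z. (r / N ^ 3) * (cos (z \<bullet> (N *\<^sub>R \<xi>)) * \<eta> z)))) z
      - (a \<bullet> \<xi>) * (b \<bullet> \<xi>) * (c \<bullet> \<xi>) * (r * sin (z \<bullet> (N *\<^sub>R \<xi>)) * \<eta> z)\<bar> \<le> K / N"
proof -
  have bd: "\<exists>M. \<forall>z. \<bar>h z\<bar> \<le> M" if "bsupp h" "continuous_on UNIV h" for h :: "'a \<Rightarrow> real"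
    using bsupp_bounded[OF that] by (metis real_norm_def)
  have c1: "continuous_on UNIV (pd d \<eta>)" if "d \<in> Basis" for d
    using C_k_continuous[OF C_k_3D(1)[OF \<eta>(1) that that that]] .
  have c2: "continuous_on UNIV (pd d (pd d' \<eta>))" if "d \<in> Basis" "d' \<in> Basis" for d d'
    using C_k_continuous[OF C_k_3D(2)[OF \<eta>(1) that(1) that]] .
  have c3: "continuous_on UNIV (pd a (pd b (pd c \<eta>)))"
    using C_k_continuous[OF C_k_3D(3)[OF \<eta>(1) b]] .
  obtain M1 M2 M3 M4 M5 M6 M7 where M: "\<And>z. \<bar>pd a \<eta> z\<bar> \<le> M1" "\<And>z. \<bar>pd b \<eta> z\<bar> \<le> M2" "\<And>z. \<bar>pd c \<eta> z\<bar> \<le> M3"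
    "\<And>z. \<bar>pd b (pd c \<eta>) z\<bar> \<le> M4" "\<And>z. \<bar>pd a (pd c \<eta>) z\<bar> \<le> M5" "\<And>z. \<bar>pd a (pd b \<eta>) z\<bar> \<le> M6"
    "\<And>z. \<bar>pd a (pd b (pd c \<eta>)) z\<bar> \<le> M7"
    using bd[OF bsupp_pd[OF \<eta>(2)] c1] bd[OF bsupp_pd[OF bsupp_pd[OF \<eta>(2)]] c2]
      bd[OF bsupp_pd[OF bsupp_pd[OF bsupp_pd[OF \<eta>(2)]]] c3] b by metis
  define A B C where "A = \<bar>a \<bullet> \<xi>\<bar>" and "B = \<bar>b \<bullet> \<xi>\<bar>" and "C = \<bar>c \<bullet> \<xi>\<bar>"
  define K where "K = \<bar>r\<bar> * (B * C * M1 + A * C * M2 + A * B * M3 + A * M4 + B * M5 + C * M6 + M7)"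
  show ?thesis
  proof (intro exI[of _ K] allI impI)
    fix N :: real and z :: 'a assume N: "1 \<le> N"
    let ?w = "N *\<^sub>R \<xi>"
    define f where "f z = cos (z \<bullet> ?w)" for z
    have f3: "C_k 3 f" "C_k (Suc k) (\<lambda>z. k' * sin (z \<bullet> ?w))" "C_k (Suc k) (\<lambda>z. cos (z \<bullet> ?w))" "C_k (Suc k) (\<lambda>z. sin (z \<bullet> ?w))" for k k'
      using C_k_sin_cos_inner C_k_cmult unfolding f_def[abs_def] by blast+
    have pc: "pd d f = (\<lambda>z. (- (N * (d \<bullet> \<xi>))) * sin (z \<bullet> ?w))" for d
      unfolding f_def[abs_def] pd_cos_inner by simp
    have pcc: "pd d' (pd d f) = (\<lambda>z. (- (N ^ 2 * (d \<bullet> \<xi>) * (d' \<bullet> \<xi>))) * cos (z \<bullet> ?w))" for d d'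
      unfolding pc
      by (rule ext, subst pd_cmult[OF C_k_differentiable[OF f3(4)]], unfold pd_sin_inner) (simp add: power2_eq_square)
    have pccc: "pd d'' (pd d' (pd d f)) z = N ^ 3 * (d \<bullet> \<xi>) * (d' \<bullet> \<xi>) * (d'' \<bullet> \<xi>) * sin (z \<bullet> ?w)" for d d' d''
      unfolding pcc
      by (subst pd_cmult[OF C_k_differentiable[OF f3(3)]], unfold pd_cos_inner) (simp add: power2_eq_square power3_eq_cube)
    have fe: "C_k 3 (\<lambda>z. f z * \<eta> z)" using f3 \<eta> by (intro C_k_mult)
    have q: "pd a (pd b (pd c (\<lambda>z. (r / N ^ 3) * (f z * \<eta> z)))) z = (r / N ^ 3) * pd a (pd b (pd c (\<lambda>z. f z * \<eta> z))) z"
    proof -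
      have s: "C_k (Suc 2) (\<lambda>z. f z * \<eta> z)" using fe by simp
      have "pd c (\<lambda>z. (r / N ^ 3) * (f z * \<eta> z)) = (\<lambda>z. (r / N ^ 3) * pd c (\<lambda>z. f z * \<eta> z) z)"
        by (intro ext pd_cmult C_k_differentiable[OF s])
      moreover have "pd b (\<lambda>z. (r / N ^ 3) * pd c (\<lambda>z. f z * \<eta> z) z) = (\<lambda>z. (r / N ^ 3) * pd b (pd c (\<lambda>z. f z * \<eta> z)) z)"
        using C_k_3D(1)[OF fe b] C_k_antimono[of 2 _ "Suc 0"]
        by (intro ext pd_cmult C_k_differentiable[of 0]) auto
      moreover have "pd a (\<lambda>z. (r / N ^ 3) * pd b (pd c (\<lambda>z. f z * \<eta> z)) z) z = (r / N ^ 3) * pd a (pd b (pd c (\<lambda>z. f z * \<eta> z))) z"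
        using C_k_3D(2)[OF fe b] by (intro pd_cmult C_k_differentiable[of 0]) auto
      ultimately show ?thesis by simp
    qed
    have N0: "N > 0" using N by simp
    define sn cs where "sn = sin (z \<bullet> ?w)" and "cs = cos (z \<bullet> ?w)"
    have sc: "\<bar>sn\<bar> \<le> 1" "\<bar>cs\<bar> \<le> 1" by (simp_all add: sn_def cs_def)
    \<comment> \<open>The seven remainders share one shape: a power of \<open>N\<close>, direction
      factors, an oscillation, a derivative of \<eta>. This is why \<open>x7\<close> carries the
      factors 1; the single estimate \<open>t\<close> then covers all of them.\<close>
    define x1 x2 x3 x4 x5 x6 x7 where "x1 = N ^ 2 * ((c \<bullet> \<xi>) * (b \<bullet> \<xi>)) * cs * pd a \<eta> z"
      and "x2 = N ^ 2 * ((c \<bullet> \<xi>) * (a \<bullet> \<xi>)) * cs * pd b \<eta> z"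
      and "x3 = N ^ 2 * ((b \<bullet> \<xi>) * (a \<bullet> \<xi>)) * cs * pd c \<eta> z"
      and "x4 = N * (a \<bullet> \<xi>) * sn * pd b (pd c \<eta>) z" and "x5 = N * (b \<bullet> \<xi>) * sn * pd a (pd c \<eta>) z"
      and "x6 = N * (c \<bullet> \<xi>) * sn * pd a (pd b \<eta>) z" and "x7 = 1 * 1 * cs * pd a (pd b (pd c \<eta>)) z"
    have eq: "pd a (pd b (pd c (\<lambda>z. (r / N ^ 3) * (f z * \<eta> z)))) z
      - (a \<bullet> \<xi>) * (b \<bullet> \<xi>) * (c \<bullet> \<xi>) * (r * sn * \<eta> z) =
       (r / N ^ 3) * (- x1 - x2 - x3 - x4 - x5 - x6 + x7)"
      unfolding q pd3_mult[OF f3(1) \<eta>(1) b] pccc unfolding pcc unfolding pc f_def sn_def[symmetric] cs_def[symmetric]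
        x1_def x2_def x3_def x4_def x5_def x6_def x7_def
      using N0 by (simp add: field_simps)
    have t: "\<bar>x * y * s * m\<bar> \<le> N ^ 2 * (\<bar>y\<bar> * M)" if "\<bar>s\<bar> \<le> 1" "\<bar>m\<bar> \<le> M" "0 \<le> x" "x \<le> N ^ 2" for x y s m M
    proof -
      have "\<bar>x * y * s * m\<bar> = x * (\<bar>y\<bar> * (\<bar>s\<bar> * \<bar>m\<bar>))" using that by (simp add: abs_mult)
      also have "\<dots> \<le> N ^ 2 * (\<bar>y\<bar> * (1 * M))" using that by (intro mult_mono mult_nonneg_nonneg) auto
      finally show ?thesis by simp
    qed
    have n2: "N \<le> N ^ 2" "1 \<le> N ^ 2" using N self_le_power[of N 2] one_le_power[of N 2] by simp_all
    have x: "\<bar>x1\<bar> \<le> N ^ 2 * (C * B * M1)" "\<bar>x2\<bar> \<le> N ^ 2 * (C * A * M2)" "\<bar>x3\<bar> \<le> N ^ 2 * (B * A * M3)"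
      "\<bar>x4\<bar> \<le> N ^ 2 * (A * M4)" "\<bar>x5\<bar> \<le> N ^ 2 * (B * M5)" "\<bar>x6\<bar> \<le> N ^ 2 * (C * M6)" "\<bar>x7\<bar> \<le> N ^ 2 * (\<bar>1\<bar> * M7)"
      unfolding A_def B_def C_def abs_mult[symmetric] x1_def x2_def x3_def x4_def x5_def x6_def x7_def
      by ((rule t; use sc M n2 N0 in \<open>simp; fail\<close>))+
    have "\<bar>- x1 - x2 - x3 - x4 - x5 - x6 + x7\<bar> \<le> \<bar>x1\<bar> + \<bar>x2\<bar> + \<bar>x3\<bar> + \<bar>x4\<bar> + \<bar>x5\<bar> + \<bar>x6\<bar> + \<bar>x7\<bar>" by linarith
    also have "\<dots> \<le> N ^ 2 * (C * B * M1) + N ^ 2 * (C * A * M2) + N ^ 2 * (B * A * M3) + N ^ 2 * (A * M4)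
       + N ^ 2 * (B * M5) + N ^ 2 * (C * M6) + N ^ 2 * (\<bar>1\<bar> * M7)"
      by (intro add_mono x)
    also have "\<dots> = N ^ 2 * (B * C * M1 + A * C * M2 + A * B * M3 + A * M4 + B * M5 + C * M6 + M7)"
      by (simp add: algebra_simps)
    finally have fin: "\<bar>- x1 - x2 - x3 - x4 - x5 - x6 + x7\<bar> \<le> N ^ 2 * (B * C * M1 + A * C * M2 + A * B * M3 + A * M4 + B * M5 + C * M6 + M7)" .
    have "\<bar>pd a (pd b (pd c (\<lambda>z. (r / N ^ 3) * (f z * \<eta> z)))) z
      - (a \<bullet> \<xi>) * (b \<bullet> \<xi>) * (c \<bullet> \<xi>) * (r * sn * \<eta> z)\<bar> \<le> (\<bar>r\<bar> / N ^ 3) * (N ^ 2 * (B * C * M1 + A * C * M2 + A * B * M3 + A * M4 + B * M5 + C * M6 + M7))"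
      unfolding eq abs_mult using N0 by (intro mult_mono order_refl fin) auto
    also have "\<dots> = K / N" using N0 by (simp add: K_def field_simps power2_eq_square power3_eq_cube)
    finally show "\<bar>pd a (pd b (pd c (\<lambda>z. (r / N ^ 3) * (cos (z \<bullet> ?w) * \<eta> z)))) z
      - (a \<bullet> \<xi>) * (b \<bullet> \<xi>) * (c \<bullet> \<xi>) * (r * sin (z \<bullet> ?w) * \<eta> z)\<bar> \<le> K / N"
      unfolding f_def sn_def .
  qed
qed

definition wave_vector :: "complex \<Rightarrow> real \<Rightarrow> spacetime" where
  "wave_vector e a = (- a, vector [Re e, Im e])"

text \<open>The symbol of \<open>of_potential\<close> at \<open>wave_vector e a\<close> for a unit
  \<open>e\<close>: what remains of it when each partial derivative is replaced by the matching
  component of the wave vector. The velocity oscillates perpendicularly to \<open>e\<close>, as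
  \<open>div v = 0\<close> demands, and the time frequency \<open>- a\<close> tunes the matrix
  part.\<close>

definition wave_direction :: "complex \<Rightarrow> real \<Rightarrow> state" where
  "wave_direction e a = (\<i> * e, \<i> * of_real a * e\<^sup>2)"

definition wave_packet :: "complex \<Rightarrow> real \<Rightarrow> real \<Rightarrow> (spacetime \<Rightarrow> real) \<Rightarrow> real \<Rightarrow> spacetime \<Rightarrow> state" where
  "wave_packet e a r \<eta> N = of_potential (\<lambda>z. (r / N ^ 3) * (cos (z \<bullet> (N *\<^sub>R wave_vector e a)) * \<eta> z))"

lemma inner_wave_vector:
  "et \<bullet> wave_vector e a = - a" "e1 \<bullet> wave_vector e a = Re e" "e2 \<bullet> wave_vector e a = Im e"
  by (simp_all add: wave_vector_def inner_axis' cart_eq_inner_axis[symmetric])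

lemma norm_state_le: "norm (w :: state) \<le> \<bar>Re (fst w)\<bar> + \<bar>Im (fst w)\<bar> + (\<bar>Re (snd w)\<bar> + \<bar>Im (snd w)\<bar>)"
proof -
  have "norm w \<le> norm (fst w) + norm (snd w)" by (metis norm_Pair_le prod.collapse)
  then show ?thesis using cmod_le[of "fst w"] cmod_le[of "snd w"] by linarith
qed

lemma wave_packet_approx:
  assumes e: "cmod e = 1" and \<eta>: "C_k 3 \<eta>" "bsupp \<eta>"
  shows "\<exists>K. \<forall>N\<ge>1. \<forall>z. norm (wave_packet e a r \<eta> N z
      - (r * sin (z \<bullet> (N *\<^sub>R wave_vector e a)) * \<eta> z) *\<^sub>R wave_direction e a) \<le> K / N"
proof -
  let ?\<xi> = "wave_vector e a"
  define \<psi> where "\<psi> N z = (r / N ^ 3) * (cos (z \<bullet> (N *\<^sub>R ?\<xi>)) * \<eta> z)" for N z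
  define s where "s N z = r * sin (z \<bullet> (N *\<^sub>R ?\<xi>)) * \<eta> z" for N z
  have W: "\<exists>K. \<forall>N\<ge>1. \<forall>z. \<bar>pd a' (pd b' (pd c' (\<psi> N))) z - (a' \<bullet> ?\<xi>) * (b' \<bullet> ?\<xi>) * (c' \<bullet> ?\<xi>) * s N z\<bar> \<le> K / N"
    if "a' \<in> Basis" "b' \<in> Basis" "c' \<in> Basis" for a' b' c'
    unfolding \<psi>_def[abs_def] s_def by (rule third_derivative_wave[OF \<eta> that])
  note B = spacetime_Basis
  obtain K1 where K1: "\<And>N z. 1 \<le> N \<Longrightarrow> \<bar>pd e2 (pd e1 (pd e1 (\<psi> N))) z - Im e * Re e * Re e * s N z\<bar> \<le> K1 / N"
    using W[of e2 e1 e1, unfolded inner_wave_vector, OF B(2) B(2) B(2)] by blast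
  obtain K2 where K2: "\<And>N z. 1 \<le> N \<Longrightarrow> \<bar>pd e2 (pd e2 (pd e2 (\<psi> N))) z - Im e * Im e * Im e * s N z\<bar> \<le> K2 / N"
    using W[of e2 e2 e2, unfolded inner_wave_vector, OF B(2) B(2) B(2)] by blast
  obtain K3 where K3: "\<And>N z. 1 \<le> N \<Longrightarrow> \<bar>pd e1 (pd e1 (pd e1 (\<psi> N))) z - Re e * Re e * Re e * s N z\<bar> \<le> K3 / N"
    using W[of e1 e1 e1, unfolded inner_wave_vector, OF B(2) B(2) B(2)] by blast
  obtain K4 where K4: "\<And>N z. 1 \<le> N \<Longrightarrow> \<bar>pd e1 (pd e2 (pd e2 (\<psi> N))) z - Re e * Im e * Im e * s N z\<bar> \<le> K4 / N"
    using W[of e1 e2 e2, unfolded inner_wave_vector, OF B(2) B(2) B(2)] by blast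
  obtain K5 where K5: "\<And>N z. 1 \<le> N \<Longrightarrow> \<bar>pd et (pd e1 (pd e2 (\<psi> N))) z - (- a) * Re e * Im e * s N z\<bar> \<le> K5 / N"
    using W[of et e1 e2, unfolded inner_wave_vector, OF B(1) B(2) B(2)] by blast
  obtain K6 where K6: "\<And>N z. 1 \<le> N \<Longrightarrow> \<bar>pd et (pd e2 (pd e2 (\<psi> N))) z - (- a) * Im e * Im e * s N z\<bar> \<le> K6 / N"
    using W[of et e2 e2, unfolded inner_wave_vector, OF B(1) B(2) B(2)] by blast
  obtain K7 where K7: "\<And>N z. 1 \<le> N \<Longrightarrow> \<bar>pd et (pd e1 (pd e1 (\<psi> N))) z - (- a) * Re e * Re e * s N z\<bar> \<le> K7 / N"
    using W[of et e1 e1, unfolded inner_wave_vector, OF B(1) B(2) B(2)] by blast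
  \<comment> \<open>The Laplacian in the velocity part of the potential contributes the factor
    |e|^2, which the normalisation removes.\<close>
  have ee: "Re e * Re e + Im e * Im e = 1" using e by (simp add: cmod_def power2_eq_square)
  then have c1: "Im e * Re e * Re e + Im e * Im e * Im e = Im e" "Re e * Re e * Re e + Re e * Im e * Im e = Re e"
    by (metis distrib_left mult.assoc mult.right_neutral)+
  show ?thesis
  proof (intro exI[of _ "K1 + K2 + (K3 + K4) + (2 * K5 + (K6 + K7))"] allI impI)
    fix N z assume N: "(1::real) \<le> N"
    let ?d = "wave_packet e a r \<eta> N z - s N z *\<^sub>R wave_direction e a"
    have r1: "Re (fst ?d) = - ((pd e2 (pd e1 (pd e1 (\<psi> N))) z - Im e * Re e * Re e * s N z)
        + (pd e2 (pd e2 (pd e2 (\<psi> N))) z - Im e * Im e * Im e * s N z))"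
      unfolding wave_packet_def \<psi>_def[symmetric] of_potential_def wave_direction_def
      using arg_cong[OF c1(1), of "\<lambda>x. x * s N z"] by (simp add: algebra_simps)
    have r2: "Im (fst ?d) = (pd e1 (pd e1 (pd e1 (\<psi> N))) z - Re e * Re e * Re e * s N z)
        + (pd e1 (pd e2 (pd e2 (\<psi> N))) z - Re e * Im e * Im e * s N z)"
      unfolding wave_packet_def \<psi>_def[symmetric] of_potential_def wave_direction_def
      using arg_cong[OF c1(2), of "\<lambda>x. x * s N z"] by (simp add: algebra_simps)
    have r3: "Re (snd ?d) = 2 * (pd et (pd e1 (pd e2 (\<psi> N))) z - (- a) * Re e * Im e * s N z)"
      unfolding wave_packet_def \<psi>_def[symmetric] of_potential_def wave_direction_def
      by (simp add: algebra_simps power2_eq_square)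
    have r4: "Im (snd ?d) = (pd et (pd e2 (pd e2 (\<psi> N))) z - (- a) * Im e * Im e * s N z)
        - (pd et (pd e1 (pd e1 (\<psi> N))) z - (- a) * Re e * Re e * s N z)"
      unfolding wave_packet_def \<psi>_def[symmetric] of_potential_def wave_direction_def
      by (simp add: algebra_simps power2_eq_square)
    have aux: "m \<le> y1 + y2 + (y3 + y4) + (2 * y5 + (y6 + y7))"
      if "m \<le> \<bar>- (x1 + x2)\<bar> + \<bar>x3 + x4\<bar> + (\<bar>2 * x5\<bar> + \<bar>x6 - x7\<bar>)" "\<bar>x1\<bar> \<le> y1" "\<bar>x2\<bar> \<le> y2" "\<bar>x3\<bar> \<le> y3"
        "\<bar>x4\<bar> \<le> y4" "\<bar>x5\<bar> \<le> y5" "\<bar>x6\<bar> \<le> y6" "\<bar>x7\<bar> \<le> y7" for m x1 x2 x3 x4 x5 x6 x7 y1 y2 y3 y4 y5 y6 y7 :: real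
      using that by linarith
    have "norm ?d \<le> K1 / N + K2 / N + (K3 / N + K4 / N) + (2 * (K5 / N) + (K6 / N + K7 / N))"
      by (rule aux[OF norm_state_le[of ?d, unfolded r1 r2 r3 r4] K1[OF N] K2[OF N] K3[OF N] K4[OF N] K5[OF N] K6[OF N] K7[OF N]])
    also have "\<dots> = (K1 + K2 + (K3 + K4) + (2 * K5 + (K6 + K7))) / N" by (simp add: add_divide_distrib)
    finally show "norm (wave_packet e a r \<eta> N z - (r * sin (z \<bullet> (N *\<^sub>R ?\<xi>)) * \<eta> z) *\<^sub>R wave_direction e a)
        \<le> (K1 + K2 + (K3 + K4) + (2 * K5 + (K6 + K7))) / N" unfolding s_def .
  qed
qed

lemma C_k_wave_potential: "C_k k \<eta> \<Longrightarrow> C_k k (\<lambda>z. (r / N ^ 3) * (cos (z \<bullet> \<xi>) * \<eta> z))"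
  using C_k_sin_cos_inner by (intro C_k_cmult C_k_mult) auto

lemma wave_packet_continuous: "C_k 3 \<eta> \<Longrightarrow> continuous_on UNIV (wave_packet e a r \<eta> N)"
  unfolding wave_packet_def by (intro of_potential_continuous C_k_wave_potential)

lemma weak_pair_wave_packet: "C_k 3 \<eta> \<Longrightarrow> bsupp \<eta> \<Longrightarrow> weak_pair (wave_packet e a r \<eta> N)"
  unfolding wave_packet_def by (intro weak_pair_of_potential C_k_wave_potential bsupp_mult_right)

lemma wave_packet_supp:
  assumes "closed S" "\<And>z. z \<notin> S \<Longrightarrow> \<eta> z = 0" "z \<notin> S"
  shows "wave_packet e a r \<eta> N z = 0"
  unfolding wave_packet_def by (rule of_potential_supp[of "- S"]) (use assms in auto)

text \<open>Translating by half a period changes the sign of the oscillating factor.\<close>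

lemma Riemann_Lebesgue:
  fixes f :: "'a::euclidean_space \<Rightarrow> real"
  assumes f: "continuous_on UNIV f" "bsupp f" and \<xi>: "\<xi> \<noteq> 0"
  shows "(\<lambda>n. \<integral>z. f z * sin (z \<bullet> (real (Suc n) *\<^sub>R \<xi>) + \<theta>) \<partial>lborel) \<longlonglongrightarrow> 0"
proof -
  define h where "h n = (pi / (real (Suc n) * (\<xi> \<bullet> \<xi>))) *\<^sub>R \<xi>" for n
  define s where "s n z = sin (z \<bullet> (real (Suc n) *\<^sub>R \<xi>) + \<theta>)" for n and z :: 'a
  have [measurable]: "f \<in> borel_measurable borel" using f by (auto intro: borel_measurable_continuous_onI)
  have sm[measurable]: "s n \<in> borel_measurable borel" for n
    unfolding s_def by (intro borel_measurable_continuous_onI continuous_intros)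
  have shift: "s n (h n + z) = - s n z" for n z
  proof -
    have "(h n + z) \<bullet> (real (Suc n) *\<^sub>R \<xi>) + \<theta> = (z \<bullet> (real (Suc n) *\<^sub>R \<xi>) + \<theta>) + pi"
      using \<xi> by (simp add: h_def inner_add_left distrib_left del: of_nat_Suc)
    then show ?thesis by (simp only: s_def sin_periodic_pi)
  qed
  have int: "integrable lborel f" using f bsupp_integrable by blast
  have int2: "integrable lborel (\<lambda>z. f (h n + z))" for n by (rule lborel_integrable_translate[OF int])
  have ints: "integrable lborel (\<lambda>z. F z * s n z)" if "integrable lborel F" for F n
    by (rule Bochner_Integration.integrable_bound[OF that])
       (use that in \<open>auto simp: abs_mult s_def mult_left_le\<close>)
  \<comment> \<open>Averaging the integral with its translate by half a period replaces
    \<open>f\<close> by half its difference with the translate, so that the integral is controlled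
    by the continuity of translations in the mean.\<close>
  have est: "\<bar>\<integral>z. f z * s n z \<partial>lborel\<bar> \<le> (\<integral>z. \<bar>f (h n + z) - f z\<bar> \<partial>lborel)" for n
  proof -
    have "(\<integral>z. f z * s n z \<partial>lborel) = (\<integral>z. f (h n + z) * s n (h n + z) \<partial>lborel)"
      using lborel_integral_translate[of "\<lambda>z. f z * s n z" "h n"] by simp
    then have "2 * (\<integral>z. f z * s n z \<partial>lborel) = (\<integral>z. f z * s n z \<partial>lborel) - (\<integral>z. f (h n + z) * s n z \<partial>lborel)"
      by (simp add: shift)
    also have "\<dots> = (\<integral>z. f z * s n z - f (h n + z) * s n z \<partial>lborel)"
      using ints[OF int] ints[OF int2] by (simp add: Bochner_Integration.integral_diff)
    also have "\<bar>\<dots>\<bar> \<le> (\<integral>z. \<bar>f z * s n z - f (h n + z) * s n z\<bar> \<partial>lborel)" by (rule integral_abs_bound)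
    also have "\<dots> \<le> (\<integral>z. \<bar>f (h n + z) - f z\<bar> \<partial>lborel)"
    proof (rule integral_mono)
      fix z
      have "\<bar>f z * s n z - f (h n + z) * s n z\<bar> = \<bar>f (h n + z) - f z\<bar> * \<bar>s n z\<bar>"
        by (simp add: abs_mult[symmetric] left_diff_distrib abs_minus_commute)
      then show "\<bar>f z * s n z - f (h n + z) * s n z\<bar> \<le> \<bar>f (h n + z) - f z\<bar>"
        by (simp add: s_def mult_left_le)
    qed (use ints[OF int] ints[OF int2] int int2 in auto)
    finally show ?thesis by linarith
  qed
  have h0: "h \<longlonglongrightarrow> 0"
  proof -
    have "(\<lambda>n. (pi / (\<xi> \<bullet> \<xi>) * inverse (real (Suc n))) *\<^sub>R \<xi>) \<longlonglongrightarrow> (pi / (\<xi> \<bullet> \<xi>) * 0) *\<^sub>R \<xi>"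
      by (intro tendsto_intros LIMSEQ_inverse_real_of_nat)
    then show ?thesis by (simp add: h_def[abs_def] field_simps)
  qed
  obtain R where R: "\<And>z. R < norm z \<Longrightarrow> f z = 0" using f by (auto simp: bsupp_def)
  obtain M where M: "0 < M" "\<And>z. norm (f z) \<le> M" using bsupp_bounded[OF f(2,1)] by metis
  have "(\<lambda>n. \<integral>z. \<bar>f (h n + z) - f z\<bar> \<partial>lborel) \<longlonglongrightarrow> (\<integral>z. 0 \<partial>(lborel :: 'a measure))"
  proof (rule integral_dominated_convergence[where w = "\<lambda>z. 2 * M * indicator (cball 0 (R + pi / norm \<xi>)) z"])
    show "integrable lborel (\<lambda>z::'a. 2 * M * indicator (cball 0 (R + pi / norm \<xi>)) z :: real)"
      using emeasure_lborel_cball_finite[of "0::'a" "R + pi / norm \<xi>"]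
      by (intro integrable_mult_right integrable_real_indicator) (auto simp: less_top)
    show "AE z in lborel. (\<lambda>n. \<bar>f (h n + z) - f z\<bar>) \<longlonglongrightarrow> 0"
    proof (intro AE_I2)
      fix z
      have "(\<lambda>n. h n + z) \<longlonglongrightarrow> 0 + z" by (intro tendsto_intros h0)
      then have "(\<lambda>n. f (h n + z)) \<longlonglongrightarrow> f z" using continuous_on_tendsto_compose[OF f(1)] by simp
      then have "(\<lambda>n. \<bar>f (h n + z) - f z\<bar>) \<longlonglongrightarrow> \<bar>f z - f z\<bar>" by (intro tendsto_intros)
      then show "(\<lambda>n. \<bar>f (h n + z) - f z\<bar>) \<longlonglongrightarrow> 0" by simp
    qed
    show "AE z in lborel. norm \<bar>f (h n + z) - f z\<bar> \<le> 2 * M * indicator (cball 0 (R + pi / norm \<xi>)) z" for n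
    proof (intro AE_I2)
      fix z
      have "\<bar>f (h n + z) - f z\<bar> \<le> 2 * M" using M(2)[of "h n + z"] M(2)[of z] by (simp add: abs_le_iff)
      moreover have "f (h n + z) = 0 \<and> f z = 0" if "R + pi / norm \<xi> < norm z"
      proof -
        have p: "0 \<le> pi / norm \<xi>" by simp
        have "norm (h n) = pi / (real (Suc n) * norm \<xi>)"
          using \<xi> by (simp add: h_def dot_square_norm power2_eq_square field_simps del: of_nat_Suc)
        also have "\<dots> \<le> pi / norm \<xi>" using \<xi> by (intro divide_left_mono) (auto simp: mult_le_cancel_right1)
        finally have "norm (h n) \<le> pi / norm \<xi>" .
        moreover have "norm z \<le> norm (h n + z) + norm (h n)"
          using norm_triangle_ineq4[of "h n + z" "h n"] by simp
        ultimately show ?thesis using that R[of "h n + z"] R[of z] p by linarith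
      qed
      ultimately show "norm \<bar>f (h n + z) - f z\<bar> \<le> 2 * M * indicator (cball 0 (R + pi / norm \<xi>)) z"
        by (auto split: split_indicator simp: not_le)
    qed
  qed measurable
  then have "(\<lambda>n. \<integral>z. \<bar>f (h n + z) - f z\<bar> \<partial>lborel) \<longlonglongrightarrow> 0" by simp
  then show ?thesis
    by (rule Lim_null_comparison[OF always_eventually, rotated]) (use est in \<open>auto simp: s_def\<close>)
qed

section \<open>The relaxed constraint\<close>

text \<open>Twice the largest eigenvalue of \<open>z \<otimes> z - u\<close>; the constraint of the theorem is \<open>hull_fun = |z|\<^sup>2 = C\<close>.\<close>

definition hull_fun :: "state \<Rightarrow> real" where
  "hull_fun w = (cmod (fst w))\<^sup>2 + cmod ((fst w)\<^sup>2 - 2 * snd w)"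

lemma continuous_hull_fun: "continuous_on UNIV hull_fun"
  unfolding hull_fun_def by (intro continuous_intros)

lemma open_hull: "open {w. hull_fun w < C}"
  by (intro open_Collect_less continuous_hull_fun continuous_intros)

text \<open>With \<open>e\<^sup>2\<close> the direction of \<open>\<zeta> = z\<^sup>2 - 2q\<close> and \<open>z = e (a + i b)\<close>, along the line one has
  \<open>\<zeta>\<^sub>s = e\<^sup>2 (|\<zeta>| - 2 b s - s\<^sup>2)\<close> and \<open>|z\<^sub>s|\<^sup>2 = |z|\<^sup>2 + 2 b s + s\<^sup>2\<close>, so that \<^term>\<open>hull_fun\<close> stays constant near \<open>s = 0\<close>
  unless \<open>\<zeta> = 0\<close>.\<close>

lemma hull_direction:
  assumes F: "hull_fun w < C"
  shows "\<exists>e a. cmod e = 1 \<and>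
    (\<forall>s. \<bar>s\<bar> \<le> (C - (cmod (fst w))\<^sup>2) / (8 * sqrt C) \<longrightarrow> hull_fun (w + s *\<^sub>R wave_direction e a) < C)"
proof -
  obtain z q where w: "w = (z, q)" by fastforce
  define \<zeta> where "\<zeta> = z\<^sup>2 - 2 * q"
  define e where "e = (if \<zeta> = 0 then 1 else csqrt (sgn \<zeta>))"
  have e2: "\<zeta> = of_real (cmod \<zeta>) * e\<^sup>2"
    by (auto simp: e_def sgn_eq)
  have e1: "cmod e = 1"
  proof (cases "\<zeta> = 0")
    case False
    then have "(cmod e)\<^sup>2 = 1" by (simp add: e_def norm_power[symmetric] norm_sgn)
    then show ?thesis using norm_ge_zero[of e] by (simp add: power2_eq_1_iff)
  qed (simp add: e_def)
  define a b where "a = Re (z * cnj e)" and "b = Im (z * cnj e)"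
  have ee: "e * cnj e = 1" using complex_norm_square[of e] e1 by simp
  have "Complex a b = z * cnj e" unfolding a_def b_def by (rule complex_surj)
  then have z: "z = e * Complex a b"
    using ee by (metis mult.commute mult.left_commute mult.right_neutral)
  have zz: "(cmod z)\<^sup>2 = a\<^sup>2 + b\<^sup>2" unfolding z by (simp only: norm_mult e1 mult_1_left cmod_power2 complex.sel)
  define D where "D = C - (cmod z)\<^sup>2"
  have F': "(cmod z)\<^sup>2 + cmod \<zeta> < C" using F by (simp add: hull_fun_def w \<zeta>_def)
  then have D: "0 < D" by (simp add: D_def) (smt (verit) norm_ge_zero)
  have C: "D \<le> C" "0 < C" using D by (auto simp: D_def)  (smt (verit) zero_le_power2)
  have sC: "0 < sqrt C" "sqrt C * sqrt C = C" using C by auto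
  have "hull_fun (w + s *\<^sub>R wave_direction e a) < C" if s: "\<bar>s\<bar> \<le> D / (8 * sqrt C)" for s
  proof -
    have m: "fst (w + s *\<^sub>R wave_direction e a) = e * Complex a (b + s)"
      by (simp add: w wave_direction_def z complex_eq_iff algebra_simps)
    have A: "(cmod (fst (w + s *\<^sub>R wave_direction e a)))\<^sup>2 = a\<^sup>2 + (b + s)\<^sup>2"
      unfolding m by (simp only: norm_mult e1 mult_1_left cmod_power2 complex.sel)
    have "(fst (w + s *\<^sub>R wave_direction e a))\<^sup>2 - 2 * snd (w + s *\<^sub>R wave_direction e a)
        = (z + of_real s * (\<i> * e))\<^sup>2 - 2 * (q + of_real s * (\<i> * of_real a * e\<^sup>2))"
      by (simp add: w wave_direction_def scaleR_conv_of_real)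
    also have "\<dots> = \<zeta> + e\<^sup>2 * (2 * of_real s * \<i> * (Complex a b - of_real a) - (of_real s)\<^sup>2)"
      unfolding \<zeta>_def z by (simp add: power2_eq_square algebra_simps)
    also have "\<dots> = e\<^sup>2 * of_real (cmod \<zeta> - 2 * b * s - s\<^sup>2)"
      by (subst e2) (simp add: complex_eq_iff algebra_simps power2_eq_square)
    finally have B: "cmod ((fst (w + s *\<^sub>R wave_direction e a))\<^sup>2 - 2 * snd (w + s *\<^sub>R wave_direction e a))
        = \<bar>cmod \<zeta> - 2 * b * s - s\<^sup>2\<bar>"
      by (simp only: norm_mult norm_power e1 norm_of_real) simp
    have bC: "\<bar>b\<bar> \<le> sqrt C"
    proof -
      have "b\<^sup>2 \<le> C" using F' zz by (smt (verit) norm_ge_zero zero_le_power2)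
      then show ?thesis by (metis real_sqrt_abs real_sqrt_le_iff)
    qed
    have s1: "sqrt C * \<bar>s\<bar> \<le> D / 8" using s sC by (simp add: field_simps)
    have s2: "\<bar>s\<bar> \<le> sqrt C / 8" 
    proof -
      have "sqrt C * \<bar>s\<bar> \<le> (sqrt C * sqrt C) / 8" unfolding sC(2) using s1 C by simp
      then have "sqrt C * \<bar>s\<bar> \<le> sqrt C * (sqrt C / 8)" by simp
      then show ?thesis by (rule mult_left_le_imp_le[OF _ sC(1)])
    qed
    have "b * s \<le> \<bar>b\<bar> * \<bar>s\<bar>" by (metis abs_ge_self abs_mult)
    also have "\<dots> \<le> sqrt C * \<bar>s\<bar>" using bC by (intro mult_right_mono) auto
    finally have bs: "b * s \<le> D / 8" using s1 by simp
    have "s\<^sup>2 = \<bar>s\<bar> * \<bar>s\<bar>" by (simp add: power2_eq_square)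
    also have "\<dots> \<le> (sqrt C / 8) * \<bar>s\<bar>" using s2 by (intro mult_right_mono) auto
    finally have ss: "s\<^sup>2 \<le> D / 64" using s1 by simp
    have "a\<^sup>2 + (b + s)\<^sup>2 + \<bar>cmod \<zeta> - 2 * b * s - s\<^sup>2\<bar> < C"
    proof (cases "2 * b * s + s\<^sup>2 \<le> cmod \<zeta>")
      case True
      then show ?thesis using F' zz by (simp add: power2_sum algebra_simps)
    next
      \<comment> \<open>The value of \<open>hull_fun\<close> is now C - D + 4bs + 2s^2 - |\<zeta>|.
        With bs \<le> D/8 and s^2 \<le> D/64 the added terms stay below D; the factor 8 in the
        admissible radius was chosen for this.\<close>
      case False
      have "a\<^sup>2 + b\<^sup>2 = C - D" using zz by (simp add: D_def)
      moreover have "(b + s)\<^sup>2 = b\<^sup>2 + 2 * b * s + s\<^sup>2" by (simp add: power2_sum)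
      moreover have "\<bar>cmod \<zeta> - 2 * b * s - s\<^sup>2\<bar> = 2 * (b * s) + s\<^sup>2 - cmod \<zeta>" using False by simp
      ultimately show ?thesis using bs ss D norm_ge_zero[of \<zeta>] by linarith
    qed
    then show ?thesis unfolding hull_fun_def A B .
  qed
  then show ?thesis using e1 by (auto simp: D_def w)
qed

section \<open>Perturbation of a state on a small ball, with a quantified gain\<close>

definition gain_const :: "real \<Rightarrow> real" where
  "gain_const C = (3 / 4) ^ 8 / (262144 * C)"

lemma wave_vector_nonzero: "cmod e = 1 \<Longrightarrow> wave_vector e a \<noteq> 0"
proof
  assume e: "cmod e = 1" and "wave_vector e a = 0"
  then have "Re e = 0" "Im e = 0" using inner_wave_vector[of e a] by simp_all
  then show False using e by (simp add: complex_eq_iff cmod_def)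
qed

lemma DIM_spacetime: "DIM(spacetime) = 3"
  by simp

text \<open>The maximum of \<open>bump 4\<close> is \<open>R ^ 8\<close>, whence the normalisation.
  At half the radius 1 - 1/4 = 3/4 of the quadratic factor survives; this lower bound on a fixed
  share of the volume is what the energy gain is computed from.\<close>

lemma bump_props:
  fixes c :: "'a::euclidean_space"
  assumes "0 < R"
  defines "\<eta> \<equiv> \<lambda>z. (1 / R ^ 8) * bump 4 c R z"
  shows "C_k 3 \<eta>" "\<And>z. 0 \<le> \<eta> z" "\<And>z. \<eta> z \<le> 1" "\<And>z. z \<notin> cball c R \<Longrightarrow> \<eta> z = 0"
    "\<And>z. z \<in> ball c (R / 2) \<Longrightarrow> (3 / 4) ^ 4 \<le> \<eta> z"
proof -
  have R8: "R ^ 8 = (R\<^sup>2) ^ 4" by (simp add: power_mult[symmetric])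
  have sq: "(z - c) \<bullet> (z - c) = (dist c z)\<^sup>2" for z
    by (metis dist_commute dist_norm power2_norm_eq_inner)
  have eta: "\<eta> z = (max 0 (R\<^sup>2 - (dist c z)\<^sup>2) / R\<^sup>2) ^ 4" for z
    unfolding \<eta>_def bump_def sq R8 power_divide by simp
  show "C_k 3 \<eta>" unfolding \<eta>_def using C_k_bump[of 3 0 c R] by (intro C_k_cmult) simp
  show "0 \<le> \<eta> z" for z unfolding eta by simp
  show "\<eta> z \<le> 1" for z unfolding eta using assms(1) by (intro power_le_one) (auto simp: divide_le_eq)
  show "\<eta> z = 0" if "z \<notin> cball c R" for z
  proof -
    have "R\<^sup>2 \<le> (dist c z)\<^sup>2" using that assms(1) by (intro power_mono) (auto simp: less_imp_le)
    then show ?thesis unfolding eta by simp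
  qed
  show "(3 / 4) ^ 4 \<le> \<eta> z" if "z \<in> ball c (R / 2)" for z
  proof -
    have "(dist c z)\<^sup>2 \<le> (R / 2)\<^sup>2" using that by (intro power_mono) auto
    then have "3 / 4 * R\<^sup>2 \<le> R\<^sup>2 - (dist c z)\<^sup>2" by (simp add: power_divide)
    then have "3 / 4 * R\<^sup>2 \<le> max 0 (R\<^sup>2 - (dist c z)\<^sup>2)" by (simp only: le_max_iff_disj simp_thms)
    then have "3 / 4 \<le> max 0 (R\<^sup>2 - (dist c z)\<^sup>2) / R\<^sup>2"
      using assms(1) by (subst pos_le_divide_eq) auto
    then show ?thesis unfolding eta by (rule power_mono) simp
  qed
qed

text \<open>On a small ball the state is nearly constant, so a wave packet in the direction found for the
  centre stays in the relaxed set; its energy is at least a multiple of the squared defect.\<close>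

lemma ball_perturbation:
  fixes S :: "spacetime \<Rightarrow> state" and g :: "spacetime \<Rightarrow> real"
  assumes S: "continuous_on UNIV S" "\<And>z. hull_fun (S z) < C"
    and g: "continuous_on UNIV g" "\<And>z. 0 < g z"
  shows "\<exists>\<delta>>0. \<forall>c R \<Psi> \<epsilon>. 0 < R \<and> cball c R \<subseteq> ball x \<delta> \<and> finite \<Psi> \<and> (\<forall>\<psi>\<in>\<Psi>. continuous_on UNIV \<psi>) \<and> 0 < \<epsilon> \<longrightarrow>
    (\<exists>p. continuous_on UNIV p \<and> weak_pair p \<and> (\<forall>z. z \<notin> cball c (R / 2) \<longrightarrow> p z = 0) \<and> (\<forall>z. hull_fun (S z + p z) < C) \<and>
      gain_const C * (\<integral>z. indicator (ball c R) z * (g z * (C - (cmod (fst (S z)))\<^sup>2)\<^sup>2) \<partial>lborel)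
        \<le> (\<integral>z. g z * (cmod (fst (p z)))\<^sup>2 \<partial>lborel) \<and>
      (\<forall>\<psi>\<in>\<Psi>. \<bar>\<integral>z. g z * (fst (p z) \<bullet> \<psi> z) \<partial>lborel\<bar> \<le> \<epsilon>))"
proof -
  define D where "D z = C - (cmod (fst (S z)))\<^sup>2" for z
  have D0: "0 < D z" for z using S(2)[of z] norm_ge_zero[of "(fst (S z))\<^sup>2 - 2 * snd (S z)"] unfolding D_def hull_fun_def by linarith
  have cD: "continuous_on UNIV D" unfolding D_def by (intro continuous_intros S)
  have C0: "0 < C" using D0[of x] by (simp add: D_def) (smt (verit) zero_le_power2)
  define r where "r = D x / (8 * sqrt C)"
  have r0: "0 < r" using D0 C0 by (simp add: r_def)
  obtain e a where e: "cmod e = 1" and ea: "\<And>s. \<bar>s\<bar> \<le> r \<Longrightarrow> hull_fun (S x + s *\<^sub>R wave_direction e a) < C"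
    using hull_direction[OF S(2)[of x]] unfolding r_def D_def by blast
  \<comment> \<open>The whole segment of admissible amplitudes is compact inside the open relaxed
    set and so has a tube of some radius \<epsilon>0 in it. Half of \<epsilon>0 is spent on the
    variation of \<open>S\<close> over the ball, half on the error between the packet and its
    leading term.\<close>
  define seg where "seg = (\<lambda>s. S x + s *\<^sub>R wave_direction e a) ` {- r..r}"
  have "compact seg" unfolding seg_def by (intro compact_continuous_image continuous_intros) auto
  moreover have "seg \<subseteq> {w. hull_fun w < C}" using ea by (auto simp: seg_def abs_le_iff)
  ultimately obtain \<epsilon>0 where e0: "0 < \<epsilon>0" "(\<Union>w\<in>seg. ball w \<epsilon>0) \<subseteq> {w. hull_fun w < C}"
    using compact_subset_open_imp_ball_epsilon_subset[OF _ open_hull] by blast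
  have near: "\<exists>d>0. \<forall>y. dist y x < d \<longrightarrow> dist (f y) (f x) < k" if "continuous_on UNIV f" "0 < k"
    for f :: "spacetime \<Rightarrow> 'z::metric_space" and k
    using that unfolding continuous_on_iff by (metis UNIV_I)
  obtain d1 where d1: "0 < d1" "\<And>y. dist y x < d1 \<Longrightarrow> dist (S y) (S x) < \<epsilon>0 / 2"
    using near[OF S(1), of "\<epsilon>0 / 2"] e0 by auto
  obtain d2 where d2: "0 < d2" "\<And>y. dist y x < d2 \<Longrightarrow> dist (D y) (D x) < D x"
    using near[OF cD D0[of x]] by auto
  obtain d3 where d3: "0 < d3" "\<And>y. dist y x < d3 \<Longrightarrow> dist (g y) (g x) < g x / 2"
    using near[OF g(1), of "g x / 2"] g(2)[of x] by auto
  define \<delta> where "\<delta> = min d1 (min d2 d3)"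
  have \<delta>: "0 < \<delta>" using d1 d2 d3 by (simp add: \<delta>_def)
  have nS: "dist (S y) (S x) < \<epsilon>0 / 2" and nD: "D y \<le> 2 * D x" and ng: "g x / 2 \<le> g y" "g y \<le> 2 * g x"
    if "y \<in> ball x \<delta>" for y
  proof -
    have y: "dist y x < d1" "dist y x < d2" "dist y x < d3" using that by (auto simp: \<delta>_def dist_commute)
    show "dist (S y) (S x) < \<epsilon>0 / 2" using d1(2)[OF y(1)] .
    show "D y \<le> 2 * D x" using d2(2)[OF y(2)] by (simp add: dist_real_def abs_less_iff)
    show "g x / 2 \<le> g y" "g y \<le> 2 * g x" using d3(2)[OF y(3)] g(2)[of x] unfolding dist_real_def abs_less_iff by linarith+
  qed
  show ?thesis
  proof (intro exI[of _ \<delta>] conjI \<delta> allI impI, elim conjE)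
    fix c R and \<Psi> :: "(spacetime \<Rightarrow> complex) set" and \<epsilon> :: real
    assume R: "0 < R" and sub: "cball c R \<subseteq> ball x \<delta>" and \<Psi>: "finite \<Psi>" "\<forall>\<psi>\<in>\<Psi>. continuous_on UNIV \<psi>" and \<epsilon>: "0 < \<epsilon>"
    \<comment> \<open>The bump lives on the concentric ball of half the radius, so the packet is
      supported in a closed ball inside the open ball of radius \<open>R\<close>. Packets placed on
      disjoint open balls then never meet.\<close>
    define \<eta> where "\<eta> z = (1 / (R / 2) ^ 8) * bump 4 c (R / 2) z" for z
    have R2: "0 < R / 2" using R by simp
    note eta = bump_props[OF R2, where c = c, folded \<eta>_def]
    have cB: "cball c (R / 2) \<subseteq> ball x \<delta>" using sub R subset_cball[of "R / 2" R c] by simp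
    have bs: "bsupp f" if "\<And>z. z \<notin> cball c (R / 2) \<Longrightarrow> f z = 0" for f :: "spacetime \<Rightarrow> 'z::zero"
      unfolding bsupp_def
    proof (intro exI[of _ "norm c + R / 2"] allI impI that)
      fix z :: spacetime assume "norm c + R / 2 < norm z"
      then show "z \<notin> cball c (R / 2)" using norm_triangle_sub[of z c] by (auto simp: dist_norm norm_minus_commute)
    qed
    have b\<eta>: "bsupp \<eta>" using eta(4) by (rule bs)
    have c\<eta>: "continuous_on UNIV \<eta>" using C_k_continuous[OF eta(1)] .
    let ?\<xi> = "wave_vector e a"
    define s where "s n z = r * sin (z \<bullet> (real (Suc n) *\<^sub>R ?\<xi>)) * \<eta> z" for n z
    define p where "p n = wave_packet e a r \<eta> (real (Suc n))" for n
    obtain K where K: "\<And>N z. 1 \<le> N \<Longrightarrow> norm (wave_packet e a r \<eta> N z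
      - (r * sin (z \<bullet> (N *\<^sub>R wave_vector e a)) * \<eta> z) *\<^sub>R wave_direction e a) \<le> K / N"
      using wave_packet_approx[OF e eta(1) b\<eta>, of a r] by blast
    have K0: "0 \<le> K" using order_trans[OF norm_ge_zero K[of 1 0]] by simp
    have pK: "norm (p n z - s n z *\<^sub>R wave_direction e a) \<le> K / real (Suc n)" for n z
      unfolding p_def s_def by (rule K) simp
    have Klim: "(\<lambda>n. K / real (Suc n)) \<longlonglongrightarrow> 0"
      using tendsto_mult[OF tendsto_const[of K] LIMSEQ_inverse_real_of_nat] by (simp add: divide_inverse)
    have pcont: "continuous_on UNIV (p n)" for n unfolding p_def by (rule wave_packet_continuous[OF eta(1)])
    have psupp: "p n z = 0" if "z \<notin> cball c (R / 2)" for n z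
      unfolding p_def by (rule wave_packet_supp[of "cball c (R / 2)"]) (use eta(4) that in auto)
    have scont: "continuous_on UNIV (s n)" for n unfolding s_def by (intro continuous_intros c\<eta>)
    have ssupp: "s n z = 0" if "z \<notin> cball c (R / 2)" for n z using eta(4)[OF that] by (simp add: s_def)
    have sr: "\<bar>s n z\<bar> \<le> r" for n z
    proof -
      have "\<bar>s n z\<bar> = r * (\<bar>sin (z \<bullet> (real (Suc n) *\<^sub>R ?\<xi>))\<bar> * \<bar>\<eta> z\<bar>)" using r0 by (simp add: s_def abs_mult)
      also have "\<dots> \<le> r * (1 * 1)" using r0 eta(2)[of z] eta(3)[of z] by (intro mult_left_mono mult_mono) auto
      finally show ?thesis by simp
    qed
    have fd: "fst (wave_direction e a) = \<i> * e" "cmod (\<i> * e) = 1" by (simp_all add: wave_direction_def norm_mult e)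
    have fpK: "cmod (fst (p n z) - s n z *\<^sub>R (\<i> * e)) \<le> K / real (Suc n)" for n z
    proof -
      have "norm (fst w) \<le> norm w" for w :: state by (metis norm_fst_le prod.collapse)
      from order_trans[OF this pK[of n z]] show ?thesis by (simp only: fst_diff fst_scaleR fd(1))
    qed
    have hull: "\<forall>\<^sub>F n in sequentially. \<forall>z. hull_fun (S z + p n z) < C"
    proof -
      have "\<forall>\<^sub>F n in sequentially. K / real (Suc n) < \<epsilon>0 / 2"
        using order_tendstoD(2)[OF Klim, of "\<epsilon>0 / 2"] e0 by simp
      then show ?thesis
      proof eventually_elim
        case (elim n)
        show ?case
        proof
          fix z
          show "hull_fun (S z + p n z) < C"
          proof (cases "z \<in> cball c (R / 2)")
            case False then show ?thesis using psupp S(2) by simp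
          next
            case True
            then have z: "dist (S z) (S x) < \<epsilon>0 / 2" using cB nS by blast
            let ?w = "S x + s n z *\<^sub>R wave_direction e a"
            have "?w \<in> seg" using sr[of n z] by (auto simp: seg_def abs_le_iff)
            moreover have "dist ?w (S z + p n z) < \<epsilon>0"
            proof -
              have "dist ?w (S z + p n z) = norm ((S x - S z) - (p n z - s n z *\<^sub>R wave_direction e a))"
                by (simp add: dist_norm algebra_simps)
              also have "\<dots> \<le> norm (S x - S z) + norm (p n z - s n z *\<^sub>R wave_direction e a)" by (rule norm_triangle_ineq4)
              also have "\<dots> < \<epsilon>0" using z pK[of n z] elim unfolding dist_norm norm_minus_commute[of "S x"] by linarith
              finally show ?thesis .
            qed
            ultimately have "S z + p n z \<in> (\<Union>w\<in>seg. ball w \<epsilon>0)" unfolding UN_iff mem_ball by blast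
            then show ?thesis using e0(2) by blast
          qed
        qed
      qed
    qed
    define Mg where "Mg = (\<integral>z. indicator (cball c (R / 2)) z * g z \<partial>lborel)"
    have iB: "integrable lborel (\<lambda>z. indicator (cball c (R / 2)) z * f z)" if "continuous_on UNIV f" for f :: "spacetime \<Rightarrow> real"
    proof -
      have "set_integrable lborel (cball c (R / 2)) f"
        unfolding set_integrable_def by (intro borel_integrable_compact continuous_on_subset[OF that]) auto
      then show ?thesis by (simp add: set_integrable_def)
    qed
    have ig: "integrable lborel f" if "continuous_on UNIV f" "\<And>z. z \<notin> cball c (R / 2) \<Longrightarrow> f z = 0" for f :: "spacetime \<Rightarrow> real"
      using that bs[of f] bsupp_integrable by blast
    have cfp: "continuous_on UNIV (\<lambda>z. fst (p n z))" for n by (intro continuous_intros pcont)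
    define G where "G = (\<integral>z. g z * (r * \<eta> z)\<^sup>2 \<partial>lborel)"
    \<comment> \<open>Here sin^2 is (1 - cos)/2 at doubled frequency, and the cosine is a sine with
      phase pi/2; hence the phase parameter in \<open>Riemann_Lebesgue\<close>. In the limit half of
      the amplitude energy \<open>G\<close> survives.\<close>
    have lim_s: "(\<lambda>n. \<integral>z. g z * (s n z)\<^sup>2 \<partial>lborel) \<longlonglongrightarrow> G / 2"
    proof -
      define f where "f z = g z * (r * \<eta> z)\<^sup>2" for z
      have f: "continuous_on UNIV f" "bsupp f"
        unfolding f_def by (intro continuous_intros g c\<eta>) (rule bs, use eta(4) in auto)
      have RL: "(\<lambda>n. \<integral>z. f z * sin (z \<bullet> (real (Suc n) *\<^sub>R (2 *\<^sub>R ?\<xi>)) + pi / 2) \<partial>lborel) \<longlonglongrightarrow> 0"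
        by (rule Riemann_Lebesgue[OF f]) (use wave_vector_nonzero[OF e] in simp)
      have e: "(\<integral>z. g z * (s n z)\<^sup>2 \<partial>lborel) = (G - (\<integral>z. f z * sin (z \<bullet> (real (Suc n) *\<^sub>R (2 *\<^sub>R ?\<xi>)) + pi / 2) \<partial>lborel)) / 2" for n
      proof -
        have eq: "g z * (s n z)\<^sup>2 = (f z - f z * sin (z \<bullet> (real (Suc n) *\<^sub>R (2 *\<^sub>R ?\<xi>)) + pi / 2)) / 2" for z
        proof -
          have "z \<bullet> (real (Suc n) *\<^sub>R (2 *\<^sub>R ?\<xi>)) = 2 * (z \<bullet> (real (Suc n) *\<^sub>R ?\<xi>))" by simp
          then have e: "F * sin (z \<bullet> (real (Suc n) *\<^sub>R (2 *\<^sub>R ?\<xi>)) + pi / 2) = F - 2 * F * (sin (z \<bullet> (real (Suc n) *\<^sub>R ?\<xi>)))\<^sup>2" for F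
            by (simp only: sin_add sin_pi_half cos_pi_half cos_double_sin) (simp add: right_diff_distrib)
          show ?thesis unfolding e unfolding f_def s_def power_mult_distrib by simp
        qed
        have i1: "integrable lborel (\<lambda>z. f z * sin (z \<bullet> (real (Suc n) *\<^sub>R (2 *\<^sub>R ?\<xi>)) + pi / 2))"
          by (intro bsupp_integrable bsupp_mult_left f continuous_intros)
        have "G = (\<integral>z. f z \<partial>lborel)" by (simp add: G_def f_def)
        then show ?thesis unfolding eq
          by (simp only: integral_divide_zero Bochner_Integration.integral_diff[OF bsupp_integrable[OF f(2,1)] i1])
      qed
      have "(\<lambda>n. (G - (\<integral>z. f z * sin (z \<bullet> (real (Suc n) *\<^sub>R (2 *\<^sub>R ?\<xi>)) + pi / 2) \<partial>lborel)) / 2) \<longlonglongrightarrow> (G - 0) / 2"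
        by (intro tendsto_intros RL) simp
      then show ?thesis unfolding e by (simp only: diff_0_right)
    qed
    have low: "(\<integral>z. g z * (s n z)\<^sup>2 \<partial>lborel) - 2 * r * (K / real (Suc n)) * Mg \<le> (\<integral>z. g z * (cmod (fst (p n z)))\<^sup>2 \<partial>lborel)" for n
    proof -
      have i: "integrable lborel (\<lambda>z. g z * (s n z)\<^sup>2)" "integrable lborel (\<lambda>z. g z * (cmod (fst (p n z)))\<^sup>2)"
        by (intro ig continuous_intros g scont cfp; simp add: ssupp psupp)+
      have "(\<integral>z. g z * (s n z)\<^sup>2 \<partial>lborel) - 2 * r * (K / real (Suc n)) * Mg
        = (\<integral>z. g z * (s n z)\<^sup>2 - 2 * r * (K / real (Suc n)) * (indicator (cball c (R / 2)) z * g z) \<partial>lborel)"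
        using i iB[OF g(1)] by (simp add: Mg_def Bochner_Integration.integral_diff)
      also have "\<dots> \<le> (\<integral>z. g z * (cmod (fst (p n z)))\<^sup>2 \<partial>lborel)"
      proof (rule integral_mono)
        fix z
        show "g z * (s n z)\<^sup>2 - 2 * r * (K / real (Suc n)) * (indicator (cball c (R / 2)) z * g z) \<le> g z * (cmod (fst (p n z)))\<^sup>2"
        proof (cases "z \<in> cball c (R / 2)")
          case False then show ?thesis by (simp add: ssupp psupp)
        next
          case True
          define k where "k = K / real (Suc n)"
          have k: "0 \<le> k" using K0 by (simp add: k_def)
          have "cmod (s n z *\<^sub>R (\<i> * e)) = \<bar>s n z\<bar>" by (simp only: norm_scaleR fd mult_1_right)
          then have m: "\<bar>s n z\<bar> - k \<le> cmod (fst (p n z))"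
            using norm_triangle_ineq2[of "s n z *\<^sub>R (\<i> * e)" "fst (p n z)"] fpK[of n z]
              norm_minus_commute[of "s n z *\<^sub>R (\<i> * e)" "fst (p n z)"] unfolding k_def by linarith
          \<comment> \<open>This squares |s| - k \<le> |p|. When |s| \<le> k the left side of that
            bound may be negative and cannot be squared, but then the claimed lower bound is itself
            at most 0.\<close>
          have "(s n z)\<^sup>2 - 2 * r * k \<le> (cmod (fst (p n z)))\<^sup>2"
          proof (cases "\<bar>s n z\<bar> \<le> k")
            case True
            have "(s n z)\<^sup>2 = \<bar>s n z\<bar> * \<bar>s n z\<bar>" by (simp add: power2_eq_square)
            also have "\<dots> \<le> r * k" using True sr[of n z] r0 by (intro mult_mono) auto
            also have "\<dots> \<le> 2 * r * k" using r0 k by simp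
            finally show ?thesis by (smt (verit) zero_le_power2)
          next
            case False
            have "(\<bar>s n z\<bar> - k)\<^sup>2 \<le> (cmod (fst (p n z)))\<^sup>2" using m False by (intro power_mono) auto
            moreover have "(\<bar>s n z\<bar> - k)\<^sup>2 = (s n z)\<^sup>2 - 2 * (\<bar>s n z\<bar> * k) + k\<^sup>2" by (simp add: power2_diff)
            moreover have "\<bar>s n z\<bar> * k \<le> r * k" using sr[of n z] k by (rule mult_right_mono)
            moreover have "0 \<le> k\<^sup>2" by simp
            ultimately show ?thesis by linarith
          qed
          then have "g z * ((s n z)\<^sup>2 - 2 * r * k) \<le> g z * (cmod (fst (p n z)))\<^sup>2"
            using g(2)[of z] by (intro mult_left_mono) auto
          then show ?thesis using True by (simp add: k_def algebra_simps)
        qed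
      qed (use i iB[OF g(1)] in auto)
      finally show ?thesis .
    qed
    define vol where "vol = measure lborel (ball c R)"
    have vol0: "0 < vol" unfolding vol_def using R by (simp add: content_ball_pos)
    have v4: "measure lborel (ball c (R / 2 / 2)) = vol / 64"
      unfolding vol_def using R by (simp add: content_ball DIM_spacetime power_divide)
    have G_low: "r\<^sup>2 * (g x / 2) * (3 / 4) ^ 8 * (vol / 64) \<le> G"
    proof -
      have "r\<^sup>2 * (g x / 2) * (3 / 4) ^ 8 * (vol / 64) = (\<integral>z. indicator (ball c (R / 2 / 2)) z * (r\<^sup>2 * (g x / 2) * (3 / 4) ^ 8) \<partial>lborel)"
        using v4 by simp
      also have "\<dots> \<le> G" unfolding G_def
      proof (rule integral_mono)
        show "integrable lborel (\<lambda>z. indicator (ball c (R / 2 / 2)) z * (r\<^sup>2 * (g x / 2) * (3 / 4) ^ 8))"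
          using emeasure_lborel_ball_finite[of c "R / 2 / 2"]
          by (intro integrable_mult_left integrable_real_indicator) auto
        show "integrable lborel (\<lambda>z. g z * (r * \<eta> z)\<^sup>2)"
          by (intro ig continuous_intros g c\<eta>) (use eta(4) in auto)
        fix z
        show "indicator (ball c (R / 2 / 2)) z * (r\<^sup>2 * (g x / 2) * (3 / 4) ^ 8) \<le> g z * (r * \<eta> z)\<^sup>2"
        proof (cases "z \<in> ball c (R / 2 / 2)")
          case False then show ?thesis using g(2)[of z] by (simp add: less_imp_le)
        next
          case True
          have "z \<in> cball c (R / 2)" using True R by auto
          then have gz: "g x / 2 \<le> g z" using cB ng by blast
          have "((3 / 4 :: real) ^ 4)\<^sup>2 \<le> (\<eta> z)\<^sup>2" using eta(5)[OF True] by (intro power_mono) auto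
          then have "(3 / 4 :: real) ^ 8 \<le> (\<eta> z)\<^sup>2" by (simp add: power_mult[symmetric])
          then have "(g x / 2) * (r\<^sup>2 * (3 / 4) ^ 8) \<le> g z * (r\<^sup>2 * (\<eta> z)\<^sup>2)"
            using gz g(2)[of x] g(2)[of z] by (intro mult_mono mult_left_mono) auto
          then show ?thesis using True by (simp add: power_mult_distrib mult_ac)
        qed
      qed
      finally show ?thesis .
    qed
    have "0 < r\<^sup>2 * (g x / 2) * (3 / 4) ^ 8 * (vol / 64)" using r0 g(2)[of x] vol0 by simp
    then have G0: "0 < G" using G_low by linarith
    have D_up: "(\<integral>z. indicator (ball c R) z * (g z * (D z)\<^sup>2) \<partial>lborel) \<le> vol * (2 * g x * (4 * (D x)\<^sup>2))"
    proof -
      have "(\<integral>z. indicator (ball c R) z * (g z * (D z)\<^sup>2) \<partial>lborel) \<le> (\<integral>z. indicator (ball c R) z * (2 * g x * (4 * (D x)\<^sup>2)) \<partial>lborel)"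
      proof (rule integral_mono)
        have "continuous_on UNIV (\<lambda>z. g z * (D z)\<^sup>2)" by (intro continuous_intros g cD)
        then have "set_integrable lborel (cball c R) (\<lambda>z. g z * (D z)\<^sup>2)"
          unfolding set_integrable_def by (intro borel_integrable_compact[OF compact_cball continuous_on_subset[OF _ subset_UNIV]])
        then have "set_integrable lborel (ball c R) (\<lambda>z. g z * (D z)\<^sup>2)"
          by (rule set_integrable_subset) auto
        then show "integrable lborel (\<lambda>z. indicator (ball c R) z * (g z * (D z)\<^sup>2))" by (simp add: set_integrable_def)
        show "integrable lborel (\<lambda>z. indicator (ball c R) z * (2 * g x * (4 * (D x)\<^sup>2)))"
          using emeasure_lborel_ball_finite[of c R]
          by (intro integrable_mult_left integrable_real_indicator) auto
        fix z
        show "indicator (ball c R) z * (g z * (D z)\<^sup>2) \<le> indicator (ball c R) z * (2 * g x * (4 * (D x)\<^sup>2))"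
        proof (cases "z \<in> ball c R")
          case True
          then have z: "z \<in> ball x \<delta>" using sub ball_subset_cball by blast
          have "(D z)\<^sup>2 \<le> (2 * D x)\<^sup>2" using nD[OF z] D0[of z] by (intro power_mono) auto
          then have "g z * (D z)\<^sup>2 \<le> 2 * g x * (2 * D x)\<^sup>2" using ng(2)[OF z] g(2)[of z] by (intro mult_mono) auto
          then show ?thesis using True by (simp add: power_mult_distrib)
        qed simp
      qed
      then show ?thesis by (simp add: vol_def)
    qed
    \<comment> \<open>Origin of 262144 = 64 * 64 * 2 * 4 * 8 in \<open>gain_const\<close>. One 64 is
      the square of the 8 in the amplitude \<open>D x / (8 * sqrt C)\<close>, the other the volume
      ratio of a ball of a quarter of the radius in dimension 3. The 2 comes from g \<ge> g(x)/2,
      the 4 from keeping \<open>G / 4\<close> of the limit \<open>G / 2\<close>, the 8 from the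
      upper bounds 2 g(x) and 4 D(x)^2. The power of 3/4 is the lower bound for the squared
      bump.\<close>
    have gain0: "gain_const C * (\<integral>z. indicator (ball c R) z * (g z * (D z)\<^sup>2) \<partial>lborel) \<le> G / 4"
    proof -
      have gc: "0 \<le> gain_const C" using C0 by (simp add: gain_const_def)
      have "gain_const C * (\<integral>z. indicator (ball c R) z * (g z * (D z)\<^sup>2) \<partial>lborel) \<le> gain_const C * (vol * (2 * g x * (4 * (D x)\<^sup>2)))"
        by (rule mult_left_mono[OF D_up gc])
      also have "\<dots> = (r\<^sup>2 * (g x / 2) * (3 / 4) ^ 8 * (vol / 64)) / 4"
        using C0 by (simp add: gain_const_def r_def power_divide power_mult_distrib field_simps)
      also have "\<dots> \<le> G / 4" using G_low by (simp only: divide_right_mono zero_le_numeral)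
      finally show ?thesis .
    qed
    have gain: "\<forall>\<^sub>F n in sequentially. gain_const C * (\<integral>z. indicator (ball c R) z * (g z * (D z)\<^sup>2) \<partial>lborel)
        \<le> (\<integral>z. g z * (cmod (fst (p n z)))\<^sup>2 \<partial>lborel)"
    proof -
      have "(\<lambda>n. (\<integral>z. g z * (s n z)\<^sup>2 \<partial>lborel) - 2 * r * (K / real (Suc n)) * Mg) \<longlonglongrightarrow> G / 2 - 2 * r * 0 * Mg"
        by (intro tendsto_intros lim_s Klim)
      then have "\<forall>\<^sub>F n in sequentially. G / 4 < (\<integral>z. g z * (s n z)\<^sup>2 \<partial>lborel) - 2 * r * (K / real (Suc n)) * Mg"
        by (rule order_tendstoD(1)) (use G0 in simp)
      then show ?thesis 
      proof eventually_elim
        case (elim n)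
        show ?case using elim gain0 low[of n] by linarith
      qed
    qed
    \<comment> \<open>Up to an error of order 1/n the packet is a fixed field times a fast sine, so
      its correlation with any fixed continuous field dies out by the Riemann-Lebesgue
      lemma.\<close>
    have orth1: "\<forall>\<^sub>F n in sequentially. \<bar>\<integral>z. g z * (fst (p n z) \<bullet> \<psi> z) \<partial>lborel\<bar> \<le> \<epsilon>" if "\<psi> \<in> \<Psi>" for \<psi>
    proof -
      have c\<psi>: "continuous_on UNIV \<psi>" using \<Psi> that by blast
      define f where "f z = g z * (r * \<eta> z) * ((\<i> * e) \<bullet> \<psi> z)" for z
      have f: "continuous_on UNIV f" "bsupp f"
        unfolding f_def by (intro continuous_intros g c\<eta> c\<psi>) (rule bs, use eta(4) in auto)
      have RL: "(\<lambda>n. \<integral>z. f z * sin (z \<bullet> (real (Suc n) *\<^sub>R ?\<xi>) + 0) \<partial>lborel) \<longlonglongrightarrow> 0"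
        by (rule Riemann_Lebesgue[OF f wave_vector_nonzero[OF e]])
      define M where "M = (\<integral>z. indicator (cball c (R / 2)) z * (g z * cmod (\<psi> z)) \<partial>lborel)"
      have est: "\<bar>(\<integral>z. g z * (fst (p n z) \<bullet> \<psi> z) \<partial>lborel) - (\<integral>z. f z * sin (z \<bullet> (real (Suc n) *\<^sub>R ?\<xi>) + 0) \<partial>lborel)\<bar>
         \<le> (K / real (Suc n)) * M" for n
      proof -
        have i: "integrable lborel (\<lambda>z. g z * (fst (p n z) \<bullet> \<psi> z))" "integrable lborel (\<lambda>z. f z * sin (z \<bullet> (real (Suc n) *\<^sub>R ?\<xi>) + 0))"
          by (intro ig continuous_intros g cfp c\<psi> f(1); simp add: psupp f_def eta(4))+
        have eq: "g z * (fst (p n z) \<bullet> \<psi> z) - f z * sin (z \<bullet> (real (Suc n) *\<^sub>R ?\<xi>) + 0) = g z * ((fst (p n z) - s n z *\<^sub>R (\<i> * e)) \<bullet> \<psi> z)" for z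
          unfolding f_def s_def inner_diff_left inner_scaleR_left by (simp add: algebra_simps)
        have "(\<integral>z. g z * (fst (p n z) \<bullet> \<psi> z) \<partial>lborel) - (\<integral>z. f z * sin (z \<bullet> (real (Suc n) *\<^sub>R ?\<xi>) + 0) \<partial>lborel)
          = (\<integral>z. g z * ((fst (p n z) - s n z *\<^sub>R (\<i> * e)) \<bullet> \<psi> z) \<partial>lborel)"
          unfolding eq[symmetric] by (rule Bochner_Integration.integral_diff[OF i, symmetric])
        also have "\<bar>\<dots>\<bar> \<le> (\<integral>z. \<bar>g z * ((fst (p n z) - s n z *\<^sub>R (\<i> * e)) \<bullet> \<psi> z)\<bar> \<partial>lborel)" by (rule integral_abs_bound)
        also have "\<dots> \<le> (\<integral>z. (K / real (Suc n)) * (indicator (cball c (R / 2)) z * (g z * cmod (\<psi> z))) \<partial>lborel)"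
        proof (rule integral_mono)
          show "integrable lborel (\<lambda>z. \<bar>g z * ((fst (p n z) - s n z *\<^sub>R (\<i> * e)) \<bullet> \<psi> z)\<bar>)"
            unfolding eq[symmetric] using i by simp
          show "integrable lborel (\<lambda>z. (K / real (Suc n)) * (indicator (cball c (R / 2)) z * (g z * cmod (\<psi> z))))"
            by (intro integrable_mult_right iB continuous_intros g c\<psi>)
          fix z
          show "\<bar>g z * ((fst (p n z) - s n z *\<^sub>R (\<i> * e)) \<bullet> \<psi> z)\<bar> \<le> (K / real (Suc n)) * (indicator (cball c (R / 2)) z * (g z * cmod (\<psi> z)))"
          proof (cases "z \<in> cball c (R / 2)")
            case False then show ?thesis by (simp add: ssupp psupp)
          next
            case True
            have "\<bar>(fst (p n z) - s n z *\<^sub>R (\<i> * e)) \<bullet> \<psi> z\<bar> \<le> cmod (fst (p n z) - s n z *\<^sub>R (\<i> * e)) * cmod (\<psi> z)"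
              by (rule Cauchy_Schwarz_ineq2)
            also have "\<dots> \<le> (K / real (Suc n)) * cmod (\<psi> z)" by (intro mult_right_mono fpK) auto
            finally have "g z * \<bar>(fst (p n z) - s n z *\<^sub>R (\<i> * e)) \<bullet> \<psi> z\<bar> \<le> g z * ((K / real (Suc n)) * cmod (\<psi> z))"
              using g(2)[of z] by (intro mult_left_mono) auto
            then show ?thesis using True g(2)[of z] by (simp add: abs_mult mult_ac)
          qed
        qed
        also have "\<dots> = (K / real (Suc n)) * M" by (simp add: M_def)
        finally show ?thesis .
      qed
      have "(\<lambda>n. (\<integral>z. g z * (fst (p n z) \<bullet> \<psi> z) \<partial>lborel) - (\<integral>z. f z * sin (z \<bullet> (real (Suc n) *\<^sub>R ?\<xi>) + 0) \<partial>lborel)) \<longlonglongrightarrow> 0"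
        by (rule Lim_null_comparison[OF _ tendsto_mult_left_zero[OF Klim, of M]]) (use est in auto)
      from tendsto_add[OF this RL] have "(\<lambda>n. \<integral>z. g z * (fst (p n z) \<bullet> \<psi> z) \<partial>lborel) \<longlonglongrightarrow> 0" by simp
      then have "(\<lambda>n. \<bar>\<integral>z. g z * (fst (p n z) \<bullet> \<psi> z) \<partial>lborel\<bar>) \<longlonglongrightarrow> 0" by (rule tendsto_rabs_zero)
      then have "\<forall>\<^sub>F n in sequentially. \<bar>\<integral>z. g z * (fst (p n z) \<bullet> \<psi> z) \<partial>lborel\<bar> < \<epsilon>" by (rule order_tendstoD(2)) (rule \<epsilon>)
      then show ?thesis by eventually_elim simp
    qed
    have orth: "\<forall>\<^sub>F n in sequentially. \<forall>\<psi>\<in>\<Psi>. \<bar>\<integral>z. g z * (fst (p n z) \<bullet> \<psi> z) \<partial>lborel\<bar> \<le> \<epsilon>"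
      using orth1 \<Psi>(1) by (intro eventually_ball_finite) auto
    obtain n where "\<forall>z. hull_fun (S z + p n z) < C"
      "gain_const C * (\<integral>z. indicator (ball c R) z * (g z * (D z)\<^sup>2) \<partial>lborel) \<le> (\<integral>z. g z * (cmod (fst (p n z)))\<^sup>2 \<partial>lborel)"
      "\<forall>\<psi>\<in>\<Psi>. \<bar>\<integral>z. g z * (fst (p n z) \<bullet> \<psi> z) \<partial>lborel\<bar> \<le> \<epsilon>"
      using eventually_happens[OF eventually_conj[OF hull eventually_conj[OF gain orth]]] by auto
    then show "\<exists>p. continuous_on UNIV p \<and> weak_pair p \<and> (\<forall>z. z \<notin> cball c (R / 2) \<longrightarrow> p z = 0) \<and> (\<forall>z. hull_fun (S z + p z) < C) \<and>
      gain_const C * (\<integral>z. indicator (ball c R) z * (g z * (C - (cmod (fst (S z)))\<^sup>2)\<^sup>2) \<partial>lborel)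
        \<le> (\<integral>z. g z * (cmod (fst (p z)))\<^sup>2 \<partial>lborel) \<and>
      (\<forall>\<psi>\<in>\<Psi>. \<bar>\<integral>z. g z * (fst (p z) \<bullet> \<psi> z) \<partial>lborel\<bar> \<le> \<epsilon>)"
      using pcont psupp weak_pair_wave_packet[OF eta(1) b\<eta>] unfolding D_def
      by (intro exI[of _ "p n"]) (auto simp: p_def)
  qed
qed

section \<open>From one ball to an open set\<close>

lemma bsupp_comp: "bsupp f \<Longrightarrow> (\<And>z. f z = 0 \<Longrightarrow> h z = 0) \<Longrightarrow> bsupp h"
  unfolding bsupp_def by metis

lemma weak_pair_sum:
  assumes "finite F" "\<And>i. i \<in> F \<Longrightarrow> continuous_on UNIV (p i)" "\<And>i. i \<in> F \<Longrightarrow> weak_pair (p i)"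
  shows "weak_pair (\<lambda>z. \<Sum>i\<in>F. p i z)"
  unfolding weak_pair_def
proof (intro allI impI)
  fix \<phi> j assume \<phi>: "test_function \<phi>"
  have i: "integrable lborel (\<lambda>z. p i z \<bullet> test_field j \<phi> z)" if "i \<in> F" for i
  proof (rule bsupp_integrable)
    show "bsupp (\<lambda>z. p i z \<bullet> test_field j \<phi> z)"
      using test_field_bsupp[OF test_function_bsupp[OF \<phi>], of j] unfolding bsupp_def by force
    show "continuous_on UNIV (\<lambda>z. p i z \<bullet> test_field j \<phi> z)"
      by (intro continuous_intros assms(2) that test_field_continuous test_function_smooth \<phi>)
  qed
  have "(\<integral>z. (\<Sum>i\<in>F. p i z) \<bullet> test_field j \<phi> z \<partial>lborel) = (\<Sum>i\<in>F. \<integral>z. p i z \<bullet> test_field j \<phi> z \<partial>lborel)"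
    unfolding inner_sum_left by (rule Bochner_Integration.integral_sum) (rule i)
  also have "\<dots> = 0" using assms(3) \<phi> by (simp add: weak_pair_def)
  finally show "(\<integral>z. (\<Sum>i\<in>F. p i z) \<bullet> test_field j \<phi> z \<partial>lborel) = 0" .
qed

text \<open>Vitali's theorem fills \<open>\<Omega>\<close> up to a null set with countably many
  disjoint balls. By dominated convergence their finite unions exhaust the integral, so finitely
  many balls already carry half of it. Finiteness keeps the summed perturbation continuous and its
  support compact.\<close>

lemma finite_ball_cover:
  fixes f :: "spacetime \<Rightarrow> real"
  assumes f: "integrable lborel (\<lambda>z. indicator \<Omega> z * f z)" "\<And>z. 0 \<le> f z" and m: "0 < (\<integral>z. indicator \<Omega> z * f z \<partial>lborel)"
    and K: "\<And>x d. \<lbrakk>x \<in> \<Omega>; 0 < d\<rbrakk> \<Longrightarrow> \<exists>i. i \<in> K \<and> x \<in> ball (fst i) (snd i) \<and> snd i < d"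
    and KO: "\<And>i. i \<in> K \<Longrightarrow> ball (fst i) (snd i) \<subseteq> \<Omega>" and [measurable]: "\<Omega> \<in> sets borel"
  shows "\<exists>F. finite F \<and> F \<subseteq> K \<and> disjoint_family_on (\<lambda>i. ball (fst i) (snd i)) F \<and>
     (\<integral>z. indicator \<Omega> z * f z \<partial>lborel) / 2 \<le> (\<Sum>i\<in>F. \<integral>z. indicator (ball (fst i) (snd i)) z * f z \<partial>lborel)"
proof -
  let ?B = "\<lambda>i. ball (fst i) (snd i) :: spacetime set"
  let ?I = "\<integral>z. indicator \<Omega> z * f z \<partial>lborel"
  obtain \<C> where \<C>: "countable \<C>" "\<C> \<subseteq> K" "pairwise (\<lambda>i j. disjnt (?B i) (?B j)) \<C>" "negligible (\<Omega> - (\<Union>i\<in>\<C>. ?B i))"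
    using Vitali_covering_theorem_balls[of \<Omega> K fst snd] K by blast
  define U where "U = (\<Union>i\<in>\<C>. ?B i)"
  have [measurable]: "U \<in> sets borel" unfolding U_def by (intro borel_open open_UN) auto
  have "\<Omega> - U \<in> null_sets lebesgue" using \<C>(4) by (simp add: U_def negligible_iff_null_sets)
  then have "\<Omega> - U \<in> null_sets lborel" by (simp add: null_sets_completion_iff)
  then have ae: "AE z in lborel. z \<in> \<Omega> \<longrightarrow> z \<in> U" by (intro AE_I'[of "\<Omega> - U"]) auto
  have ne: "\<C> \<noteq> {}"
  proof
    assume "\<C> = {}"
    then have "AE z in lborel. indicator \<Omega> z * f z = 0" using ae by (auto simp: U_def)
    then have "?I = 0" by (rule integral_eq_zero_AE)
    then show False using m by simp
  qed
  define en where "en = from_nat_into \<C>"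
  have rng: "range en = \<C>" unfolding en_def using ne \<C>(1) by (rule range_from_nat_into)
  define Us where "Us n = (\<Union>i\<in>en ` {..<n}. ?B i)" for n
  have [measurable]: "Us n \<in> sets borel" for n unfolding Us_def by (intro borel_open open_UN) auto
  have UsO: "Us n \<subseteq> \<Omega>" for n unfolding Us_def using KO \<C>(2) rng by blast
  have fm: "(\<lambda>z. indicator \<Omega> z * f z) \<in> borel_measurable borel" using f by auto
  have eqn: "indicator (Us n) z * f z = indicator (Us n) z * (indicator \<Omega> z * f z)" for n z
    using UsO[of n] by (auto split: split_indicator)
  have "(\<lambda>n. \<integral>z. indicator (Us n) z * f z \<partial>lborel) \<longlonglongrightarrow> ?I"
  proof (rule integral_dominated_convergence[OF _ _ f(1)])
    show "(\<lambda>z. indicator \<Omega> z * f z) \<in> borel_measurable lborel" using fm by simp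
    show "(\<lambda>z. indicator (Us n) z * f z) \<in> borel_measurable lborel" for n
      unfolding eqn using fm by measurable
    show "AE z in lborel. (\<lambda>n. indicator (Us n) z * f z) \<longlonglongrightarrow> indicator \<Omega> z * f z"
      using ae
    proof eventually_elim
      case (elim z)
      show ?case
      proof (cases "z \<in> \<Omega>")
        case True
        then have "z \<in> U" using elim by blast
        then obtain k where k: "z \<in> ?B (en k)" using rng unfolding U_def by blast
        have "z \<in> Us n" if "k < n" for n using k that by (auto simp: Us_def)
        then have "\<forall>\<^sub>F n in sequentially. indicator (Us n) z * f z = indicator \<Omega> z * f z"
          using True by (intro eventually_sequentiallyI[of "Suc k"]) auto
        then show ?thesis by (rule tendsto_eventually)
      next
        case False
        then have "z \<notin> Us n" for n using UsO by blast
        then show ?thesis using False by simp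
      qed
    qed
    show "AE z in lborel. norm (indicator (Us n) z * f z) \<le> indicator \<Omega> z * f z" for n
      using f(2) UsO[of n] by (intro AE_I2) (auto split: split_indicator)
  qed
  then have "\<forall>\<^sub>F n in sequentially. ?I / 2 < (\<integral>z. indicator (Us n) z * f z \<partial>lborel)"
    by (rule order_tendstoD(1)) (use m in simp)
  then obtain n where n: "?I / 2 < (\<integral>z. indicator (Us n) z * f z \<partial>lborel)"
    using eventually_happens by fastforce
  define F where "F = en ` {..<n}"
  have F: "finite F" "F \<subseteq> \<C>" using rng by (auto simp: F_def)
  have dj: "disjoint_family_on ?B F"
    using \<C>(3) F(2) unfolding disjoint_family_on_def pairwise_def disjnt_def by blast
  have "(\<integral>z. indicator (Us n) z * f z \<partial>lborel) = (\<integral>z. (\<Sum>i\<in>F. indicator (?B i) z * f z) \<partial>lborel)"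
  proof (rule Bochner_Integration.integral_cong[OF refl])
    fix z
    show "indicator (Us n) z * f z = (\<Sum>i\<in>F. indicator (?B i) z * f z)"
      unfolding Us_def F_def[symmetric] sum_distrib_right[symmetric]
      by (subst indicator_UN_disjoint[OF F(1) dj]) simp
  qed
  also have "\<dots> = (\<Sum>i\<in>F. \<integral>z. indicator (?B i) z * f z \<partial>lborel)"
  proof (rule Bochner_Integration.integral_sum)
    fix i assume "i \<in> F"
    then have "?B i \<subseteq> \<Omega>" using F \<C>(2) KO by blast
    then have e: "indicator (?B i) z * f z = indicator (?B i) z *\<^sub>R (indicator \<Omega> z * f z)" for z
      by (auto split: split_indicator)
    show "integrable lborel (\<lambda>z. indicator (?B i) z * f z)" unfolding e by (rule integrable_indicator_scaleR[OF f(1)]) simp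
  qed
  finally show ?thesis using n F \<C>(2) dj by (intro exI[of _ F]) auto
qed

text \<open>Packets on disjoint balls do not interact: at each point at most one of them is nonzero.
  Hence the strict constraint survives, energies add without cross terms, and correlation errors add
  up. The factor 1/2 against the single ball is lost in \<open>finite_ball_cover\<close>.\<close>

lemma perturbation_step:
  fixes S :: "spacetime \<Rightarrow> state" and g :: "spacetime \<Rightarrow> real"
  assumes \<Omega>: "open \<Omega>" and S: "continuous_on UNIV S" "\<And>z. hull_fun (S z) < C"
    and g: "continuous_on UNIV g" "\<And>z. 0 < g z" "integrable lborel g"
    and \<Psi>: "finite \<Psi>" "\<And>\<psi>. \<psi> \<in> \<Psi> \<Longrightarrow> continuous_on UNIV \<psi>" and \<epsilon>: "0 < \<epsilon>"
  shows "\<exists>p. continuous_on UNIV p \<and> weak_pair p \<and> (\<exists>K. compact K \<and> K \<subseteq> \<Omega> \<and> (\<forall>z. z \<notin> K \<longrightarrow> p z = 0)) \<and>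
      (\<forall>z. hull_fun (S z + p z) < C) \<and>
      gain_const C / 2 * (\<integral>z. indicator \<Omega> z * (g z * (C - (cmod (fst (S z)))\<^sup>2)\<^sup>2) \<partial>lborel)
        \<le> (\<integral>z. g z * (cmod (fst (p z)))\<^sup>2 \<partial>lborel) \<and>
      (\<forall>\<psi>\<in>\<Psi>. \<bar>\<integral>z. g z * (fst (p z) \<bullet> \<psi> z) \<partial>lborel\<bar> \<le> \<epsilon>)"
proof -
  define f where "f z = g z * (C - (cmod (fst (S z)))\<^sup>2)\<^sup>2" for z
  have cf: "continuous_on UNIV f" unfolding f_def by (intro continuous_intros g S)
  have f0: "0 \<le> f z" for z using g(2)[of z] by (simp add: f_def less_imp_le)
  have S2: "(cmod (fst (S z)))\<^sup>2 < C" for z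
    using S(2)[of z] norm_ge_zero[of "(fst (S z))\<^sup>2 - 2 * snd (S z)"] unfolding hull_fun_def by linarith
  have C0: "0 < C" using S2[of 0] zero_le_power2[of "cmod (fst (S 0))"] by linarith
  have fb: "f z \<le> C\<^sup>2 * g z" for z
  proof -
    have "(C - (cmod (fst (S z)))\<^sup>2)\<^sup>2 \<le> C\<^sup>2" using S2[of z] by (intro power_mono) auto
    then show ?thesis using g(2)[of z] by (simp add: f_def mult_right_mono mult.commute)
  qed
  have fi: "integrable lborel f"
    by (rule Bochner_Integration.integrable_bound[OF integrable_mult_right[OF g(3), of "C\<^sup>2"]])
       (use cf f0 fb g(2) in \<open>auto intro!: borel_measurable_continuous_onI simp: less_imp_le\<close>)
  have \<Omega>b[measurable]: "\<Omega> \<in> sets borel" using \<Omega> by simp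
  have fo: "integrable lborel (\<lambda>z. indicator \<Omega> z * f z)" using integrable_indicator_scaleR[OF fi \<Omega>b] by simp
  show ?thesis
  proof (cases "0 < (\<integral>z. indicator \<Omega> z * f z \<partial>lborel)")
    \<comment> \<open>Without a defect to reduce, the zero perturbation meets the bound.\<close>
    case False
    have "gain_const C / 2 * (\<integral>z. indicator \<Omega> z * f z \<partial>lborel) \<le> 0"
      using False C0 by (intro mult_nonneg_nonpos) (auto simp: gain_const_def)
    then show ?thesis using S(2) \<epsilon>
      by (intro exI[of _ "\<lambda>_. 0"]) (auto simp: f_def weak_pair_def intro!: exI[of _ "{}"])
  next
    case True
    define Q where "Q x \<delta> \<longleftrightarrow> (\<forall>c R \<Psi>' \<epsilon>'. 0 < R \<and> cball c R \<subseteq> ball x \<delta> \<and> finite \<Psi>' \<and> (\<forall>\<psi>\<in>\<Psi>'. continuous_on UNIV \<psi>) \<and> 0 < \<epsilon>' \<longrightarrow>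
      (\<exists>p. continuous_on UNIV p \<and> weak_pair p \<and> (\<forall>z. z \<notin> cball c (R / 2) \<longrightarrow> p z = 0) \<and> (\<forall>z. hull_fun (S z + p z) < C) \<and>
      gain_const C * (\<integral>z. indicator (ball c R) z * f z \<partial>lborel)
        \<le> (\<integral>z. g z * (cmod (fst (p z)))\<^sup>2 \<partial>lborel) \<and>
      (\<forall>\<psi>\<in>\<Psi>'. \<bar>\<integral>z. g z * (fst (p z) \<bullet> \<psi> z) \<partial>lborel\<bar> \<le> \<epsilon>')))" for x \<delta>
    have "\<exists>\<delta>>0. Q x \<delta>" for x
      unfolding Q_def f_def by (rule ball_perturbation[OF S g(1,2)])
    then obtain \<delta> where \<delta>: "\<And>x. 0 < \<delta> x" "\<And>x. Q x (\<delta> x)" by metis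
    define K where "K = {i. 0 < snd i \<and> cball (fst i) (snd i) \<subseteq> \<Omega> \<and> (\<exists>x. cball (fst i) (snd i) \<subseteq> ball x (\<delta> x))}"
    have KI: "(c, R) \<in> K" if "0 < R" "cball c R \<subseteq> \<Omega>" "cball c R \<subseteq> ball x (\<delta> x)" for c R x
      using that unfolding K_def mem_Collect_eq fst_conv snd_conv by blast
    have KD: "0 < snd i" "cball (fst i) (snd i) \<subseteq> \<Omega>" "\<exists>x. cball (fst i) (snd i) \<subseteq> ball x (\<delta> x)" if "i \<in> K" for i
      using that unfolding K_def mem_Collect_eq by blast+
    obtain F where F: "finite F" "F \<subseteq> K" "disjoint_family_on (\<lambda>i. ball (fst i) (snd i)) F"
      "(\<integral>z. indicator \<Omega> z * f z \<partial>lborel) / 2 \<le> (\<Sum>i\<in>F. \<integral>z. indicator (ball (fst i) (snd i)) z * f z \<partial>lborel)"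
    proof -
      have "\<exists>i. i \<in> K \<and> x \<in> ball (fst i) (snd i) \<and> snd i < d" if x: "x \<in> \<Omega>" and d: "0 < d" for x d
      proof -
        obtain k where k: "0 < k" "cball x k \<subseteq> \<Omega>" using \<Omega> x open_contains_cball by blast
        define R where "R = min k (min (d / 2) (\<delta> x / 2))"
        have R: "0 < R" "R \<le> k" "R < d" "R < \<delta> x" using k d \<delta>(1)[of x] by (auto simp: R_def min_def)
        have "cball x R \<subseteq> \<Omega>" using subset_cball[OF R(2), of x] k(2) by blast
        moreover have "cball x R \<subseteq> ball x (\<delta> x)" using R(4) by auto
        ultimately have "(x, R) \<in> K" using R(1) by (intro KI)
        then show ?thesis using R by (intro exI[of _ "(x, R)"]) simp
      qed
      moreover have "ball (fst i) (snd i) \<subseteq> \<Omega>" if "i \<in> K" for i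
        using KD(2)[OF that] ball_subset_cball by blast
      ultimately show ?thesis
        using finite_ball_cover[OF fo f0 True, of K] that by auto
    qed
    \<comment> \<open>The added 1 keeps the quotient meaningful for an empty family of
      balls.\<close>
    define \<epsilon>' where "\<epsilon>' = \<epsilon> / (real (card F) + 1)"
    have e': "0 < \<epsilon>'" using \<epsilon> by (simp add: \<epsilon>'_def add_nonneg_pos)
    define QP where "QP i p \<longleftrightarrow> continuous_on UNIV p \<and> weak_pair p \<and> (\<forall>z. z \<notin> cball (fst i) (snd i / 2) \<longrightarrow> p z = 0) \<and> (\<forall>z. hull_fun (S z + p z) < C) \<and>
      gain_const C * (\<integral>z. indicator (ball (fst i) (snd i)) z * f z \<partial>lborel)
        \<le> (\<integral>z. g z * (cmod (fst (p z)))\<^sup>2 \<partial>lborel) \<and>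
      (\<forall>\<psi>\<in>\<Psi>. \<bar>\<integral>z. g z * (fst (p z) \<bullet> \<psi> z) \<partial>lborel\<bar> \<le> \<epsilon>')" for i p
    have "\<exists>p. QP i p" if iF: "i \<in> F" for i
    proof -
      obtain x where x: "0 < snd i" "cball (fst i) (snd i) \<subseteq> ball x (\<delta> x)" using F(2) iF KD by blast
      show ?thesis using \<delta>(2)[of x] x \<Psi> e' unfolding Q_def QP_def by blast
    qed
    then obtain P where "\<And>i. i \<in> F \<Longrightarrow> QP i (P i)" by metis
    then have P: "\<And>i. i \<in> F \<Longrightarrow> continuous_on UNIV (P i)" "\<And>i. i \<in> F \<Longrightarrow> weak_pair (P i)"
      "\<And>i z. i \<in> F \<Longrightarrow> z \<notin> cball (fst i) (snd i / 2) \<Longrightarrow> P i z = 0" "\<And>i z. i \<in> F \<Longrightarrow> hull_fun (S z + P i z) < C"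
      "\<And>i. i \<in> F \<Longrightarrow> gain_const C * (\<integral>z. indicator (ball (fst i) (snd i)) z * f z \<partial>lborel)
        \<le> (\<integral>z. g z * (cmod (fst (P i z)))\<^sup>2 \<partial>lborel)"
      "\<And>i \<psi>. i \<in> F \<Longrightarrow> \<psi> \<in> \<Psi> \<Longrightarrow> \<bar>\<integral>z. g z * (fst (P i z) \<bullet> \<psi> z) \<partial>lborel\<bar> \<le> \<epsilon>'"
      unfolding QP_def by blast+
    have in_ball: "z \<in> ball (fst i) (snd i)" if "i \<in> F" "P i z \<noteq> 0" for i z
    proof -
      have "z \<in> cball (fst i) (snd i / 2)" using P(3) that by blast
      moreover have "0 < snd i" using that F(2) KD(1) by blast
      ultimately show ?thesis by auto
    qed
    have one: "(\<forall>i\<in>F. P i z = 0) \<or> (\<exists>i\<in>F. \<forall>j\<in>F - {i}. P j z = 0)" for z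
    proof (rule ccontr)
      assume "\<not> ?thesis"
      then obtain i j where "i \<in> F" "P i z \<noteq> 0" "j \<in> F" "j \<noteq> i" "P j z \<noteq> 0" by blast
      then show False using F(3) in_ball unfolding disjoint_family_on_def by blast
    qed
    define p where "p z = (\<Sum>i\<in>F. P i z)" for z
    have p1: "(\<forall>i\<in>F. P i z = 0) \<and> p z = 0 \<or> (\<exists>i\<in>F. p z = P i z \<and> (\<forall>j\<in>F - {i}. P j z = 0))" for z
      using one[of z]
    proof
      assume "\<exists>i\<in>F. \<forall>j\<in>F - {i}. P j z = 0"
      then obtain i where i: "i \<in> F" "\<forall>j\<in>F - {i}. P j z = 0" by blast
      then have "p z = P i z" unfolding p_def using sum.remove[OF F(1) i(1), of "\<lambda>i. P i z"] by simp
      then show ?thesis using i by blast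
    qed (simp add: p_def)
    have sq: "(cmod (fst (p z)))\<^sup>2 = (\<Sum>i\<in>F. (cmod (fst (P i z)))\<^sup>2)" for z
      using p1[of z]
    proof
      assume "\<exists>i\<in>F. p z = P i z \<and> (\<forall>j\<in>F - {i}. P j z = 0)"
      then obtain i where i: "i \<in> F" "p z = P i z" "\<forall>j\<in>F - {i}. P j z = 0" by blast
      then show ?thesis using sum.remove[OF F(1) i(1), of "\<lambda>i. (cmod (fst (P i z)))\<^sup>2"] by simp
    qed simp
    have bP: "bsupp (P i)" if "i \<in> F" for i
      unfolding bsupp_def
    proof (intro exI[of _ "norm (fst i) + snd i / 2"] allI impI P(3)[OF that])
      fix z :: spacetime assume "norm (fst i) + snd i / 2 < norm z"
      then show "z \<notin> cball (fst i) (snd i / 2)" using norm_triangle_sub[of z "fst i"] by (auto simp: dist_norm norm_minus_commute)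
    qed
    have cp: "continuous_on UNIV p" unfolding p_def by (intro continuous_on_sum P(1))
    have wp: "weak_pair p" unfolding p_def[abs_def] by (rule weak_pair_sum[OF F(1) P(1,2)])
    have supp: "\<exists>K. compact K \<and> K \<subseteq> \<Omega> \<and> (\<forall>z. z \<notin> K \<longrightarrow> p z = 0)"
    proof (intro exI[of _ "\<Union>i\<in>F. cball (fst i) (snd i)"] conjI allI impI)
      show "compact (\<Union>i\<in>F. cball (fst i) (snd i))" by (intro compact_UN F) auto
      show "(\<Union>i\<in>F. cball (fst i) (snd i)) \<subseteq> \<Omega>" using F(2) KD(2) by blast
      fix z assume z: "z \<notin> (\<Union>i\<in>F. cball (fst i) (snd i))"
      have "P i z = 0" if "i \<in> F" for i using in_ball[OF that, of z] z that ball_subset_cball by blast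
      then show "p z = 0" by (simp add: p_def)
    qed
    have hull: "hull_fun (S z + p z) < C" for z
      using p1[of z]
    proof
      assume "\<exists>i\<in>F. p z = P i z \<and> (\<forall>j\<in>F - {i}. P j z = 0)"
      then show ?thesis using P(4) by metis
    qed (simp add: S(2))
    have gain: "gain_const C / 2 * (\<integral>z. indicator \<Omega> z * f z \<partial>lborel) \<le> (\<integral>z. g z * (cmod (fst (p z)))\<^sup>2 \<partial>lborel)"
    proof -
      have "gain_const C / 2 * (\<integral>z. indicator \<Omega> z * f z \<partial>lborel) = gain_const C * ((\<integral>z. indicator \<Omega> z * f z \<partial>lborel) / 2)" by simp
      also have "\<dots> \<le> gain_const C * (\<Sum>i\<in>F. \<integral>z. indicator (ball (fst i) (snd i)) z * f z \<partial>lborel)"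
        using C0 by (intro mult_left_mono F(4)) (simp add: gain_const_def)
      also have "\<dots> \<le> (\<Sum>i\<in>F. \<integral>z. g z * (cmod (fst (P i z)))\<^sup>2 \<partial>lborel)"
        unfolding sum_distrib_left by (intro sum_mono P(5))
      also have "\<dots> = (\<integral>z. (\<Sum>i\<in>F. g z * (cmod (fst (P i z)))\<^sup>2) \<partial>lborel)"
      proof (rule Bochner_Integration.integral_sum[symmetric])
        fix i assume i: "i \<in> F"
        show "integrable lborel (\<lambda>z. g z * (cmod (fst (P i z)))\<^sup>2)"
          by (intro bsupp_integrable bsupp_comp[OF bP[OF i]] continuous_intros g P(1)[OF i]) simp
      qed
      also have "\<dots> = (\<integral>z. g z * (cmod (fst (p z)))\<^sup>2 \<partial>lborel)" unfolding sq sum_distrib_left ..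
      finally show ?thesis .
    qed
    have orth: "\<bar>\<integral>z. g z * (fst (p z) \<bullet> \<psi> z) \<partial>lborel\<bar> \<le> \<epsilon>" if \<psi>: "\<psi> \<in> \<Psi>" for \<psi>
    proof -
      have "g z * (fst (p z) \<bullet> \<psi> z) = (\<Sum>i\<in>F. g z * (fst (P i z) \<bullet> \<psi> z))" for z
        by (simp add: p_def fst_sum inner_sum_left sum_distrib_left)
      then have "(\<integral>z. g z * (fst (p z) \<bullet> \<psi> z) \<partial>lborel) = (\<integral>z. (\<Sum>i\<in>F. g z * (fst (P i z) \<bullet> \<psi> z)) \<partial>lborel)" by simp
      also have "\<dots> = (\<Sum>i\<in>F. \<integral>z. g z * (fst (P i z) \<bullet> \<psi> z) \<partial>lborel)"
      proof (rule Bochner_Integration.integral_sum)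
        fix i assume i: "i \<in> F"
        show "integrable lborel (\<lambda>z. g z * (fst (P i z) \<bullet> \<psi> z))"
          by (intro bsupp_integrable bsupp_comp[OF bP[OF i]] continuous_intros g P(1)[OF i] \<Psi>(2)[OF \<psi>]) simp
      qed
      also have "\<bar>\<dots>\<bar> \<le> (\<Sum>i\<in>F. \<bar>\<integral>z. g z * (fst (P i z) \<bullet> \<psi> z) \<partial>lborel\<bar>)" by (rule sum_abs)
      also have "\<dots> \<le> (\<Sum>i\<in>F. \<epsilon>')" using P(6) \<psi> by (intro sum_mono) auto
      also have "\<dots> \<le> \<epsilon>" using \<epsilon> by (simp add: \<epsilon>'_def field_simps)
      finally show ?thesis .
    qed
    show ?thesis using cp wp supp hull gain orth unfolding f_def by blast
  qed
qed

section \<open>Convergence of the iteration\<close>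

declare split_paired_All[simp del] split_paired_Ex[simp del]

section \<open>Almost everywhere convergence from summable integrals\<close>

lemma subseq_fast:
  fixes c :: "nat \<Rightarrow> real"
  assumes "c \<longlonglongrightarrow> 0"
  obtains r where "strict_mono r" "\<And>n. c (r n) < (1 / 4) ^ n"
proof -
  have ev: "\<forall>\<^sub>F k in sequentially. c k < (1 / 4) ^ n" for n
    by (rule order_tendstoD(2)[OF assms]) simp
  have "\<exists>r. \<forall>n. c (r n) < (1 / 4) ^ n \<and> r n < r (Suc n)"
  proof (rule dependent_nat_choice)
    show "\<exists>k. c k < (1 / 4) ^ 0" using eventually_happens[OF ev[of 0]] by simp
    fix k n
    show "\<exists>y. c y < (1 / 4) ^ Suc n \<and> k < y"
      using eventually_happens[OF eventually_conj[OF ev[of "Suc n"] eventually_gt_at_top[of k]]] by simp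
  qed
  then show ?thesis using that strict_mono_Suc_iff by blast
qed

text \<open>By monotone convergence the integral of the series is at most the sum of the bounds, so
  the series is finite almost everywhere. Applied to increments and defects at once, it delivers
  pointwise limits directly, with no appeal to completeness of a function space.\<close>

lemma AE_summable_of_integral_bound:
  fixes f :: "nat \<Rightarrow> 'a \<Rightarrow> real"
  assumes f: "\<And>n. integrable M (f n)" "\<And>n x. 0 \<le> f n x" and b: "\<And>n. (\<integral>x. f n x \<partial>M) \<le> b n" "summable b"
  shows "AE x in M. summable (\<lambda>n. f n x)"
proof -
  have [measurable]: "f n \<in> borel_measurable M" for n using f by auto
  have "0 \<le> (\<integral>x. f n x \<partial>M)" for n by (intro integral_nonneg_AE AE_I2 f(2))
  then have b0: "0 \<le> b n" for n using b(1)[of n] by (rule order_trans)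
  have "(\<integral>\<^sup>+ x. (\<Sum>n. ennreal (f n x)) \<partial>M) = (\<Sum>n. \<integral>\<^sup>+ x. ennreal (f n x) \<partial>M)"
    by (rule nn_integral_suminf) measurable
  also have "\<dots> = (\<Sum>n. ennreal (\<integral>x. f n x \<partial>M))"
    using f by (intro suminf_cong nn_integral_eq_integral) auto
  also have "\<dots> \<le> (\<Sum>n. ennreal (b n))" by (intro suminf_le ennreal_leI b) auto
  also have "\<dots> < \<infinity>" using b(2) b0 by (simp add: suminf_ennreal2)
  finally have "(\<integral>\<^sup>+ x. (\<Sum>n. ennreal (f n x)) \<partial>M) \<noteq> \<infinity>" by simp
  then have "AE x in M. (\<Sum>n. ennreal (f n x)) \<noteq> \<infinity>" by (intro nn_integral_PInf_AE) auto
  then show ?thesis by eventually_elim (use f(2) in \<open>auto intro: summable_suminf_not_top\<close>)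
qed

lemma AE_lborel_open_nonempty:
  assumes "open \<Omega>" "\<Omega> \<noteq> {}" "AE z in lborel. z \<in> \<Omega> \<longrightarrow> P z"
  shows "\<exists>z\<in>\<Omega>. P (z :: 'a::euclidean_space)"
proof (rule ccontr)
  assume "\<not> ?thesis"
  then have "AE z in lborel. z \<notin> \<Omega>" using assms(3) by (auto elim: eventually_mono)
  then have "\<Omega> \<in> null_sets lborel" using assms(1) by (subst AE_iff_null_sets) auto
  then have "negligible \<Omega>" using null_sets_completionI[of \<Omega> lborel] by (simp add: negligible_iff_null_sets)
  then show False using assms(1,2) open_not_negligible by blast
qed

section \<open>Approximants, exact perturbations and the iteration between them\<close>

definition approximant :: "spacetime set \<Rightarrow> real \<Rightarrow> state \<Rightarrow> (spacetime \<Rightarrow> state) \<Rightarrow> bool" where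
  "approximant \<Omega> C s0 T \<longleftrightarrow> continuous_on UNIV T \<and> weak_pair T \<and> (\<forall>z. z \<notin> \<Omega> \<longrightarrow> T z = 0) \<and> (\<forall>z. hull_fun (s0 + T z) < C)"

text \<open>For a velocity \<open>z\<close> and first row \<open>q\<close> of the matrix, the two
  equations are the trace and the trace-free part of v \<otimes> v - u = C/2 Id. They say that the
  state has reached the value \<open>C\<close> of the relaxed constraint in both parts at
  once.\<close>

definition exact_perturbation :: "spacetime set \<Rightarrow> real \<Rightarrow> state \<Rightarrow> (spacetime \<Rightarrow> state) \<Rightarrow> bool" where
  "exact_perturbation \<Omega> C s0 T \<longleftrightarrow> T \<in> borel_measurable borel \<and> weak_pair T \<and> (\<forall>z. z \<notin> \<Omega> \<longrightarrow> T z = 0) \<and>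
     (AE z in lborel. z \<in> \<Omega> \<longrightarrow> (cmod (fst (s0 + T z)))\<^sup>2 = C \<and> (fst (s0 + T z))\<^sup>2 = 2 * snd (s0 + T z))"

text \<open>Confines all approximants to one bounded set of states, which supplies the dominating
  functions of the limit passages.\<close>

lemma hull_fun_bounds:
  assumes "hull_fun w < C"
  shows "(cmod (fst w))\<^sup>2 < C" "cmod (fst w) \<le> sqrt C" "cmod (snd w) \<le> C"
proof -
  have 1: "(cmod (fst w))\<^sup>2 + cmod ((fst w)\<^sup>2 - 2 * snd w) < C" using assms by (simp add: hull_fun_def)
  then show 2: "(cmod (fst w))\<^sup>2 < C" using norm_ge_zero[of "(fst w)\<^sup>2 - 2 * snd w"] by linarith
  then show "cmod (fst w) \<le> sqrt C" by (simp add: real_le_rsqrt)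
  have "2 * cmod (snd w) = cmod ((fst w)\<^sup>2 - ((fst w)\<^sup>2 - 2 * snd w))" by (simp add: norm_mult)
  also have "\<dots> \<le> cmod ((fst w)\<^sup>2) + cmod ((fst w)\<^sup>2 - 2 * snd w)" by (rule norm_triangle_ineq4)
  also have "\<dots> < C" using 1 by (simp add: norm_power)
  finally show "cmod (snd w) \<le> C" using norm_ge_zero[of "snd w"] by linarith
qed

context
  fixes \<Omega> :: "spacetime set" and C :: real and s0 :: state and g :: "spacetime \<Rightarrow> real"
  assumes \<Omega>: "open \<Omega>" "\<Omega> \<noteq> {}" and s0: "hull_fun s0 < C"
    and g: "continuous_on UNIV g" "\<And>z. 0 < g z" "integrable lborel g"
begin

lemma weighted_integrable:
  fixes h :: "spacetime \<Rightarrow> real"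
  assumes [measurable]: "h \<in> borel_measurable borel" and "\<And>z. \<bar>h z\<bar> \<le> M"
  shows "integrable lborel (\<lambda>z. g z * h z)"
proof (rule Bochner_Integration.integrable_bound[OF integrable_mult_left[OF g(3), of M]])
  have [measurable]: "g \<in> borel_measurable borel" using g(1) by (rule borel_measurable_continuous_onI)
  show "(\<lambda>z. g z * h z) \<in> borel_measurable lborel" by measurable
  show "AE z in lborel. norm (g z * h z) \<le> norm (g z * M)"
  proof (intro AE_I2)
    fix z
    have "\<bar>h z\<bar> \<le> \<bar>M\<bar>" using assms(2)[of z] by linarith
    then show "norm (g z * h z) \<le> norm (g z * M)" using g(2)[of z] by (simp add: abs_mult)
  qed
qed

lemma approximant_bounds:
  assumes "approximant \<Omega> C s0 T"
  shows "cmod (fst (s0 + T z)) \<le> sqrt C" "cmod (fst (T z)) \<le> 2 * sqrt C" "norm (T z) \<le> 2 * sqrt C + 2 * C"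
proof -
  have h: "hull_fun (s0 + T z) < C" using assms by (simp add: approximant_def)
  show 1: "cmod (fst (s0 + T z)) \<le> sqrt C" using hull_fun_bounds(2)[OF h] .
  have "cmod (fst (T z)) = cmod (fst (s0 + T z) - fst s0)" by simp
  also have "\<dots> \<le> cmod (fst (s0 + T z)) + cmod (fst s0)" by (rule norm_triangle_ineq4)
  also have "\<dots> \<le> 2 * sqrt C" using 1 hull_fun_bounds(2)[OF s0] by simp
  finally show 2: "cmod (fst (T z)) \<le> 2 * sqrt C" .
  have "cmod (snd (T z)) = cmod (snd (s0 + T z) - snd s0)" by simp
  also have "\<dots> \<le> cmod (snd (s0 + T z)) + cmod (snd s0)" by (rule norm_triangle_ineq4)
  also have "\<dots> \<le> 2 * C" using hull_fun_bounds(3)[OF h] hull_fun_bounds(3)[OF s0] by simp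
  finally have "norm (fst (T z)) + norm (snd (T z)) \<le> 2 * sqrt C + 2 * C" using 2 by simp
  then show "norm (T z) \<le> 2 * sqrt C + 2 * C" by (metis norm_Pair_le prod.collapse order_trans)
qed

lemma approximant_measurable: "approximant \<Omega> C s0 T \<Longrightarrow> T \<in> borel_measurable borel"
  unfolding approximant_def by (auto intro: borel_measurable_continuous_onI)

lemma approximant_step:
  assumes T: "approximant \<Omega> C s0 T" and A: "finite A" "\<And>\<psi>. \<psi> \<in> A \<Longrightarrow> continuous_on UNIV \<psi>" and \<epsilon>: "0 < \<epsilon>"
  shows "\<exists>T'. approximant \<Omega> C s0 T' \<and>
      gain_const C / 2 * (\<integral>z. indicator \<Omega> z * (g z * (C - (cmod (fst (s0 + T z)))\<^sup>2)\<^sup>2) \<partial>lborel)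
        \<le> (\<integral>z. g z * (cmod (fst (T' z) - fst (T z)))\<^sup>2 \<partial>lborel) \<and>
      (\<forall>\<psi>\<in>A. \<bar>\<integral>z. g z * ((fst (T' z) - fst (T z)) \<bullet> \<psi> z) \<partial>lborel\<bar> \<le> \<epsilon>)"
proof -
  have cT: "continuous_on UNIV T" "weak_pair T" using T by (auto simp: approximant_def)
  have cS: "continuous_on UNIV (\<lambda>z. s0 + T z)" by (intro continuous_intros cT)
  have hS: "hull_fun (s0 + T z) < C" for z using T by (simp add: approximant_def)
  obtain p where p: "continuous_on UNIV p" "weak_pair p" "\<exists>K. compact K \<and> K \<subseteq> \<Omega> \<and> (\<forall>z. z \<notin> K \<longrightarrow> p z = 0)"
      "\<forall>z. hull_fun (s0 + T z + p z) < C"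
      "gain_const C / 2 * (\<integral>z. indicator \<Omega> z * (g z * (C - (cmod (fst (s0 + T z)))\<^sup>2)\<^sup>2) \<partial>lborel)
        \<le> (\<integral>z. g z * (cmod (fst (p z)))\<^sup>2 \<partial>lborel)"
      "\<forall>\<psi>\<in>A. \<bar>\<integral>z. g z * (fst (p z) \<bullet> \<psi> z) \<partial>lborel\<bar> \<le> \<epsilon>"
    using perturbation_step[OF \<Omega>(1) cS hS g A \<epsilon>] by blast
  have "weak_pair (\<lambda>z. \<Sum>b\<in>{True, False}. if b then T z else p z)"
  proof (rule weak_pair_sum)
    show "continuous_on UNIV (\<lambda>z. if b then T z else p z)" "weak_pair (\<lambda>z. if b then T z else p z)" for b
      using cT p(1,2) by (cases b; simp)+
  qed simp
  then have "weak_pair (\<lambda>z. T z + p z)" by simp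
  moreover have "p z = 0" if "z \<notin> \<Omega>" for z using p(3) that by blast
  ultimately have "approximant \<Omega> C s0 (\<lambda>z. T z + p z)"
    using T p unfolding approximant_def by (auto intro: continuous_on_add simp: add.assoc)
  then show ?thesis using p(5,6) by (intro exI[of _ "\<lambda>z. T z + p z"]) simp
qed

text \<open>The choice carries, besides the current field, a finite set of probes that grows by each
  newly built velocity. The next increment is thus nearly orthogonal to every earlier velocity and
  not just to the last one, which is what estimates the distance between non-consecutive
  terms.\<close>

lemma iteration_sequence:
  assumes \<Psi>: "finite \<Psi>" "\<And>\<psi>. \<psi> \<in> \<Psi> \<Longrightarrow> continuous_on UNIV \<psi>" and \<epsilon>: "\<And>k::nat. 0 < \<epsilon> k"
  obtains T :: "nat \<Rightarrow> spacetime \<Rightarrow> state" where "\<And>k. approximant \<Omega> C s0 (T k)" "T 0 = (\<lambda>_. 0)"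
    "\<And>k. gain_const C / 2 * (\<integral>z. indicator \<Omega> z * (g z * (C - (cmod (fst (s0 + T k z)))\<^sup>2)\<^sup>2) \<partial>lborel)
        \<le> (\<integral>z. g z * (cmod (fst (T (Suc k) z) - fst (T k z)))\<^sup>2 \<partial>lborel)"
    "\<And>k \<psi>. \<psi> \<in> \<Psi> \<Longrightarrow> \<bar>\<integral>z. g z * ((fst (T (Suc k) z) - fst (T k z)) \<bullet> \<psi> z) \<partial>lborel\<bar> \<le> \<epsilon> k"
    "\<And>k j. j \<le> k \<Longrightarrow> \<bar>\<integral>z. g z * ((fst (T (Suc k) z) - fst (T k z)) \<bullet> fst (s0 + T j z)) \<partial>lborel\<bar> \<le> \<epsilon> k"
proof -
  define P where "P k X \<longleftrightarrow> approximant \<Omega> C s0 (fst X) \<and> finite (snd X) \<and> (\<forall>\<psi>\<in>snd X. continuous_on UNIV \<psi>) \<and>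
     \<Psi> \<subseteq> snd X \<and> (\<lambda>z. fst (s0 + fst X z)) \<in> snd X \<and> (k = 0 \<longrightarrow> fst X = (\<lambda>_. 0))" for k :: nat and X
  define Q where "Q k X Y \<longleftrightarrow> snd X \<subseteq> snd Y \<and>
      gain_const C / 2 * (\<integral>z. indicator \<Omega> z * (g z * (C - (cmod (fst (s0 + fst X z)))\<^sup>2)\<^sup>2) \<partial>lborel)
        \<le> (\<integral>z. g z * (cmod (fst (fst Y z) - fst (fst X z)))\<^sup>2 \<partial>lborel) \<and>
      (\<forall>\<psi>\<in>snd X. \<bar>\<integral>z. g z * ((fst (fst Y z) - fst (fst X z)) \<bullet> \<psi> z) \<partial>lborel\<bar> \<le> \<epsilon> k)"
    for k and X Y :: "(spacetime \<Rightarrow> state) \<times> (spacetime \<Rightarrow> complex) set"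
  have "\<exists>f. \<forall>n. P n (f n) \<and> Q n (f n) (f (Suc n))"
  proof (rule dependent_nat_choice)
    have "approximant \<Omega> C s0 (\<lambda>_. 0)" using s0 by (simp add: approximant_def weak_pair_def)
    then show "\<exists>X. P 0 X"
      using \<Psi> by (intro exI[of _ "(\<lambda>_. 0, insert (\<lambda>_. fst s0) \<Psi>)"]) (auto simp: P_def)
    fix X n assume "P n X"
    then have X: "approximant \<Omega> C s0 (fst X)" "finite (snd X)" "\<And>\<psi>. \<psi> \<in> snd X \<Longrightarrow> continuous_on UNIV \<psi>" "\<Psi> \<subseteq> snd X"
      by (auto simp: P_def)
    obtain T' where T': "approximant \<Omega> C s0 T'"
      "gain_const C / 2 * (\<integral>z. indicator \<Omega> z * (g z * (C - (cmod (fst (s0 + fst X z)))\<^sup>2)\<^sup>2) \<partial>lborel)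
        \<le> (\<integral>z. g z * (cmod (fst (T' z) - fst (fst X z)))\<^sup>2 \<partial>lborel)"
      "\<forall>\<psi>\<in>snd X. \<bar>\<integral>z. g z * ((fst (T' z) - fst (fst X z)) \<bullet> \<psi> z) \<partial>lborel\<bar> \<le> \<epsilon> n"
      using approximant_step[OF X(1-3) \<epsilon>] by blast
    have "continuous_on UNIV (\<lambda>z. fst (s0 + T' z))"
      using T'(1) unfolding approximant_def by (intro continuous_intros) auto
    then have "P (Suc n) (T', insert (\<lambda>z. fst (s0 + T' z)) (snd X))"
      using T' X by (auto simp: P_def)
    moreover have "Q n X (T', insert (\<lambda>z. fst (s0 + T' z)) (snd X))"
      using T' unfolding Q_def by auto
    ultimately show "\<exists>Y. P (Suc n) Y \<and> Q n X Y" by blast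
  qed
  then obtain f where f: "\<And>n. P n (f n)" "\<And>n. Q n (f n) (f (Suc n))" by blast
  have mono: "snd (f j) \<subseteq> snd (f k)" if "j \<le> k" for j k
    using that by (induction rule: dec_induct) (use f(2) in \<open>auto simp: Q_def\<close>)
  show ?thesis
  proof (rule that[of "\<lambda>k. fst (f k)"])
    show "approximant \<Omega> C s0 (fst (f k))" for k using f(1)[of k] by (simp add: P_def)
    show "fst (f 0) = (\<lambda>_. 0)" using f(1)[of 0] by (simp add: P_def)
    show "gain_const C / 2 * (\<integral>z. indicator \<Omega> z * (g z * (C - (cmod (fst (s0 + fst (f k) z)))\<^sup>2)\<^sup>2) \<partial>lborel)
        \<le> (\<integral>z. g z * (cmod (fst (fst (f (Suc k)) z) - fst (fst (f k) z)))\<^sup>2 \<partial>lborel)" for k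
      using f(2)[of k] unfolding Q_def by blast
    show "\<bar>\<integral>z. g z * ((fst (fst (f (Suc k)) z) - fst (fst (f k) z)) \<bullet> \<psi> z) \<partial>lborel\<bar> \<le> \<epsilon> k" if "\<psi> \<in> \<Psi>" for k \<psi>
      using f(2)[of k] f(1)[of k] that unfolding Q_def P_def by blast
    show "\<bar>\<integral>z. g z * ((fst (fst (f (Suc k)) z) - fst (fst (f k) z)) \<bullet> fst (s0 + fst (f j) z)) \<partial>lborel\<bar> \<le> \<epsilon> k" if "j \<le> k" for k j
    proof -
      have "(\<lambda>z. fst (s0 + fst (f j) z)) \<in> snd (f k)" using mono[OF that] f(1)[of j] unfolding P_def by blast
      moreover have "\<forall>\<psi>\<in>snd (f k). \<bar>\<integral>z. g z * ((fst (fst (f (Suc k)) z) - fst (fst (f k) z)) \<bullet> \<psi> z) \<partial>lborel\<bar> \<le> \<epsilon> k"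
        using f(2)[of k] unfolding Q_def by blast
      ultimately show ?thesis by (rule bspec[rotated])
    qed
  qed
qed

text \<open>The increments are nearly orthogonal to the earlier terms, so the weighted energies are
  increasing up to \<open>\<epsilon> k\<close> and bounded. Hence the gains, and with them the defects, tend to \<open>0\<close> and the
  velocities form a Cauchy sequence in the weighted \<open>L\<^sup>2\<close> space.\<close>

lemma exists_exact_perturbation:
  assumes \<Psi>: "finite \<Psi>" "\<And>\<psi>. \<psi> \<in> \<Psi> \<Longrightarrow> continuous_on UNIV \<psi>" "\<And>\<psi>. \<psi> \<in> \<Psi> \<Longrightarrow> \<exists>M. \<forall>z. cmod (\<psi> z) \<le> M" and \<delta>: "0 < \<delta>"
  shows "\<exists>T. exact_perturbation \<Omega> C s0 T \<and> (\<forall>\<psi>\<in>\<Psi>. \<bar>\<integral>z. g z * (fst (T z) \<bullet> \<psi> z) \<partial>lborel\<bar> \<le> \<delta>) \<and>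
     (\<exists>\<psi> M. continuous_on UNIV \<psi> \<and> (\<forall>z. cmod (\<psi> z) \<le> M) \<and> (\<integral>z. g z * (fst (T z) \<bullet> \<psi> z) \<partial>lborel) \<noteq> 0)"
proof -
  \<comment> \<open>Geometric, so that the errors from step \<open>j\<close> to step
    \<open>k\<close> sum to 2 \<epsilon> j - 2 \<epsilon> k. With first term \<delta>/2 the total
    correlation with a member of \<Psi> stays within \<delta>.\<close>
  define \<epsilon> where "\<epsilon> k = \<delta> / 2 * (1 / 2) ^ k" for k :: nat
  have \<epsilon>: "0 < \<epsilon> k" and \<epsilon>S: "\<epsilon> (Suc k) = \<epsilon> k / 2" for k using \<delta> by (simp_all add: \<epsilon>_def)
  have \<epsilon>lim: "\<epsilon> \<longlonglongrightarrow> 0" unfolding \<epsilon>_def using tendsto_mult_right_zero[OF LIMSEQ_power_zero[of "1/2::real"]] by simp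
  obtain T :: "nat \<Rightarrow> spacetime \<Rightarrow> state" where T: "\<And>k. approximant \<Omega> C s0 (T k)" "T 0 = (\<lambda>_. 0)"
    "\<And>k. gain_const C / 2 * (\<integral>z. indicator \<Omega> z * (g z * (C - (cmod (fst (s0 + T k z)))\<^sup>2)\<^sup>2) \<partial>lborel)
        \<le> (\<integral>z. g z * (cmod (fst (T (Suc k) z) - fst (T k z)))\<^sup>2 \<partial>lborel)"
    "\<And>k \<psi>. \<psi> \<in> \<Psi> \<Longrightarrow> \<bar>\<integral>z. g z * ((fst (T (Suc k) z) - fst (T k z)) \<bullet> \<psi> z) \<partial>lborel\<bar> \<le> \<epsilon> k"
    "\<And>k j. j \<le> k \<Longrightarrow> \<bar>\<integral>z. g z * ((fst (T (Suc k) z) - fst (T k z)) \<bullet> fst (s0 + T j z)) \<partial>lborel\<bar> \<le> \<epsilon> k"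
    by (rule iteration_sequence[where \<Psi> = \<Psi> and \<epsilon> = \<epsilon>, OF \<Psi>(1) \<Psi>(2) \<epsilon>]) (assumption | rule that)+
  have C0: "0 < C" using hull_fun_bounds(1)[OF s0] zero_le_power2[of "cmod (fst s0)"] by linarith
  define B where "B = 2 * sqrt C + 2 * C"
  define V where "V k z = fst (T k z)" for k z
  define W where "W k z = fst (s0 + T k z)" for k z
  have WV: "W k z = fst s0 + V k z" for k z by (simp add: W_def V_def)
  have T4: "\<bar>\<integral>z. g z * ((V (Suc k) z - V k z) \<bullet> \<psi> z) \<partial>lborel\<bar> \<le> \<epsilon> k" if "\<psi> \<in> \<Psi>" for k \<psi>
    using T(4)[OF that] unfolding V_def .
  have T5: "\<bar>\<integral>z. g z * ((V (Suc k) z - V k z) \<bullet> W j z) \<partial>lborel\<bar> \<le> \<epsilon> k" if "j \<le> k" for k j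
    using T(5)[OF that] unfolding V_def W_def .
  note Tb = approximant_bounds[OF T(1)]
  have [measurable]: "T k \<in> borel_measurable borel" for k by (rule approximant_measurable[OF T(1)])
  have [measurable]: "V k \<in> borel_measurable borel" for k
    using T(1)[of k] unfolding V_def approximant_def by (intro borel_measurable_continuous_onI continuous_intros) auto
  have [measurable]: "W k \<in> borel_measurable borel" for k unfolding WV[abs_def] by measurable
  have [measurable]: "\<Omega> \<in> sets borel" "g \<in> borel_measurable borel"
    using \<Omega>(1) g(1) by (auto intro: borel_measurable_continuous_onI)
  have Wb: "cmod (W k z) \<le> sqrt C" and Vb: "cmod (V k z) \<le> 2 * sqrt C" for k z using Tb by (simp_all add: W_def V_def)
  have W2: "(cmod (W k z))\<^sup>2 < C" for k z
    using T(1)[of k] hull_fun_bounds(1)[of "s0 + T k z" C] unfolding approximant_def W_def by blast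
  have wi: "integrable lborel (\<lambda>z. g z * (f z \<bullet> h z))" if [measurable]: "f \<in> borel_measurable borel" "h \<in> borel_measurable borel"
    and b: "\<And>z. cmod (f z) \<le> M" "\<And>z. cmod (h z) \<le> N" for f h :: "spacetime \<Rightarrow> complex" and M N
  proof (rule weighted_integrable[of _ "M * N"])
    show "(\<lambda>z. f z \<bullet> h z) \<in> borel_measurable borel" by measurable
    show "\<bar>f z \<bullet> h z\<bar> \<le> M * N" for z
      using Cauchy_Schwarz_ineq2[of "f z" "h z"] mult_mono[OF b(1)[of z] b(2)[of z]] b(1)[of z] norm_ge_zero[of "f z"] norm_ge_zero[of "h z"]
      by linarith
  qed
  define D where "D k z = indicator \<Omega> z * (C - (cmod (W k z))\<^sup>2)" for k z
  have D0: "0 \<le> D k z" and DC: "D k z \<le> C" for k z using W2[of k z] C0 by (auto simp: D_def split: split_indicator)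
  have [measurable]: "D k \<in> borel_measurable borel" for k unfolding D_def by measurable
  define m where "m k = (\<integral>z. g z * (D k z)\<^sup>2 \<partial>lborel)" for k
  have m0: "0 \<le> m k" for k unfolding m_def using g(2) by (intro integral_nonneg_AE AE_I2) (simp add: less_imp_le)
  define \<kappa> where "\<kappa> = gain_const C / 2"
  have \<kappa>: "0 < \<kappa>" using C0 by (simp add: \<kappa>_def gain_const_def)
  have gain: "\<kappa> * m k \<le> (\<integral>z. g z * (cmod (V (Suc k) z - V k z))\<^sup>2 \<partial>lborel)" for k
  proof -
    have "m k = (\<integral>z. indicator \<Omega> z * (g z * (C - (cmod (fst (s0 + T k z)))\<^sup>2)\<^sup>2) \<partial>lborel)"
      unfolding m_def D_def W_def by (rule Bochner_Integration.integral_cong) (auto split: split_indicator)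
    then show ?thesis using T(3)[of k] by (simp add: \<kappa>_def V_def)
  qed
  define E where "E k = (\<integral>z. g z * (W k z \<bullet> W k z) \<partial>lborel)" for k
  \<comment> \<open>A step can lose up to 2 \<epsilon> k of energy through correlation. Since
    \<epsilon> halves each time, the correction 4 \<epsilon> k decreases by exactly this amount, and
    the corrected energy increases by at least the gain.\<close>
  define a where "a k = E k - 4 * \<epsilon> k" for k
  have iWW: "integrable lborel (\<lambda>z. g z * (W k z \<bullet> W j z))" for k j by (rule wi) (use Wb in auto)
  have iVW: "integrable lborel (\<lambda>z. g z * ((V k z - V i z) \<bullet> W j z))" for k i j
  proof (rule wi)
    show "cmod (V k z - V i z) \<le> 4 * sqrt C" for z using norm_triangle_ineq4[of "V k z" "V i z"] Vb[of k z] Vb[of i z] by linarith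
  qed (use Wb in auto)
  have iVV: "integrable lborel (\<lambda>z. g z * (cmod (V k z - V i z))\<^sup>2)" for k i
    unfolding power2_norm_eq_inner
  proof (rule wi)
    show "cmod (V k z - V i z) \<le> 4 * sqrt C" "cmod (V k z - V i z) \<le> 4 * sqrt C" for z
      using norm_triangle_ineq4[of "V k z" "V i z"] Vb[of k z] Vb[of i z] by linarith+
  qed auto
  have Eid: "E k = E j + 2 * (\<integral>z. g z * ((V k z - V j z) \<bullet> W j z) \<partial>lborel) + (\<integral>z. g z * (cmod (V k z - V j z))\<^sup>2 \<partial>lborel)" for j k
  proof -
    have "g z * (W k z \<bullet> W k z) = (g z * (W j z \<bullet> W j z) + 2 * (g z * ((V k z - V j z) \<bullet> W j z))) + g z * (cmod (V k z - V j z))\<^sup>2" for z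
      unfolding power2_norm_eq_inner WV by (simp add: inner_diff inner_add inner_commute algebra_simps)
    then show ?thesis using iWW[of j j] iVW[of k j j] iVV[of k j] by (simp add: E_def)
  qed
  have step: "a k + \<kappa> * m k \<le> a (Suc k)" for k
    using Eid[of "Suc k" k] gain[of k] T(5)[of k k] unfolding a_def \<epsilon>S V_def[symmetric] W_def[symmetric] by linarith
  have inc: "incseq a"
  proof (rule incseq_SucI)
    fix k have "0 \<le> \<kappa> * m k" using \<kappa> m0 by simp
    then show "a k \<le> a (Suc k)" using step[of k] by linarith
  qed
  have aub: "a k \<le> C * (\<integral>z. g z \<partial>lborel)" for k
  proof -
    have "E k \<le> (\<integral>z. g z * C \<partial>lborel)" unfolding E_def
    proof (rule integral_mono[OF iWW])
      show "integrable lborel (\<lambda>z. g z * C)" using g(3) by simp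
      show "g z * (W k z \<bullet> W k z) \<le> g z * C" for z
        using W2[of k z] g(2)[of z] unfolding power2_norm_eq_inner by (intro mult_left_mono) auto
    qed
    then show ?thesis using \<epsilon>[of k] by (simp add: a_def mult.commute)
  qed
  obtain L where L: "a \<longlonglongrightarrow> L" "\<And>k. a k \<le> L" using incseq_convergent[OF inc, of "C * (\<integral>z. g z \<partial>lborel)"] aub by auto
  have mlim: "m \<longlonglongrightarrow> 0"
  proof -
    have "(\<lambda>k. (a (Suc k) - a k) / \<kappa>) \<longlonglongrightarrow> (L - L) / \<kappa>"
      by (intro tendsto_intros LIMSEQ_Suc L(1)) (use \<kappa> in auto)
    then have lim: "(\<lambda>k. (a (Suc k) - a k) / \<kappa>) \<longlonglongrightarrow> 0" by simp
    show ?thesis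
    proof (rule tendsto_sandwich[OF _ _ tendsto_const lim])
      show "\<forall>\<^sub>F k in sequentially. m k \<le> (a (Suc k) - a k) / \<kappa>"
      proof (intro always_eventually allI)
        fix k show "m k \<le> (a (Suc k) - a k) / \<kappa>"
          unfolding pos_le_divide_eq[OF \<kappa>] using step[of k] by (simp add: mult.commute)
      qed
    qed (use m0 in auto)
  qed
  have orth: "\<bar>\<integral>z. g z * ((V k z - V j z) \<bullet> \<psi> z) \<partial>lborel\<bar> \<le> 2 * \<epsilon> j - 2 * \<epsilon> k"
    if jk: "j \<le> k" and \<psi>: "\<And>i. j \<le> i \<Longrightarrow> \<bar>\<integral>z. g z * ((V (Suc i) z - V i z) \<bullet> \<psi> z) \<partial>lborel\<bar> \<le> \<epsilon> i"
      and [measurable]: "\<psi> \<in> borel_measurable borel" and \<psi>b: "\<And>z. cmod (\<psi> z) \<le> M" for j k \<psi> M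
    using jk
  proof (induction k rule: dec_induct)
    case base show ?case by simp
  next
    case (step i)
    have int: "integrable lborel (\<lambda>z. g z * ((V k z - V j z) \<bullet> \<psi> z))" for k j
    proof (rule wi)
      show "cmod (V k z - V j z) \<le> 4 * sqrt C" for z using norm_triangle_ineq4[of "V k z" "V j z"] Vb[of k z] Vb[of j z] by linarith
    qed (use \<psi>b in auto)
    have "g z * ((V (Suc i) z - V j z) \<bullet> \<psi> z) = g z * ((V (Suc i) z - V i z) \<bullet> \<psi> z) + g z * ((V i z - V j z) \<bullet> \<psi> z)" for z
      by (simp add: inner_diff_left algebra_simps)
    then have "(\<integral>z. g z * ((V (Suc i) z - V j z) \<bullet> \<psi> z) \<partial>lborel) =
       (\<integral>z. g z * ((V (Suc i) z - V i z) \<bullet> \<psi> z) \<partial>lborel) + (\<integral>z. g z * ((V i z - V j z) \<bullet> \<psi> z) \<partial>lborel)"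
      using int[of "Suc i" i] int[of i j] by simp
    then show ?case using step.IH \<psi>[OF step.hyps(1)] \<epsilon>S[of i] by linarith
  qed
  \<comment> \<open>\<open>L - a j\<close> is the corrected energy still to be gained after step
    \<open>j\<close>; the multiple of \<epsilon> dominates the correlation errors. Together they
    bound the squared distance of all later velocities from the \<open>j\<close>-th.\<close>
  define b where "b j = (L - a j) + 8 * \<epsilon> j" for j
  have blim: "b \<longlonglongrightarrow> 0"
  proof -
    have "b \<longlonglongrightarrow> (L - L) + 8 * 0" unfolding b_def by (intro tendsto_intros L(1) \<epsilon>lim)
    then show ?thesis by simp
  qed
  have cauchy: "(\<integral>z. g z * (cmod (V k z - V j z))\<^sup>2 \<partial>lborel) \<le> b j" if "j \<le> k" for j k
  proof -
    have "\<bar>\<integral>z. g z * ((V k z - V j z) \<bullet> W j z) \<partial>lborel\<bar> \<le> 2 * \<epsilon> j - 2 * \<epsilon> k"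
      by (rule orth[OF that T5 _ Wb]) measurable
    then show ?thesis using Eid[of k j] L(2)[of k] \<epsilon>[of j] \<epsilon>[of k] unfolding b_def a_def by linarith
  qed
  have "(\<lambda>j. b j + m j) \<longlonglongrightarrow> 0" using tendsto_add[OF blim mlim] by simp
  then obtain r where r: "strict_mono r" "\<And>n. b (r n) + m (r n) < (1 / 4) ^ n" using subseq_fast by blast
  define X where "X n z = g z * (cmod (V (r (Suc n)) z - V (r n) z) + D (r n) z)" for n z
  have X1: "integrable lborel (\<lambda>z. g z * cmod (V k z - V j z))" for k j
  proof (rule weighted_integrable)
    show "\<bar>cmod (V k z - V j z)\<bar> \<le> 4 * sqrt C" for z using norm_triangle_ineq4[of "V k z" "V j z"] Vb[of k z] Vb[of j z] by simp
  qed measurable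
  have X2: "integrable lborel (\<lambda>z. g z * D k z)" "integrable lborel (\<lambda>z. g z * (D k z)\<^sup>2)" for k
  proof -
    show "integrable lborel (\<lambda>z. g z * D k z)"
      by (rule weighted_integrable[of _ C]) (use D0 DC in auto)
    show "integrable lborel (\<lambda>z. g z * (D k z)\<^sup>2)"
      by (rule weighted_integrable[of _ "C\<^sup>2"]) (use D0 DC in \<open>auto intro!: power_mono\<close>)
  qed
  \<comment> \<open>Replaces the Cauchy-Schwarz inequality: squared bounds of size 4^-n become
    integral bounds of size 2^-n, which are summable. This fixes the rate 1/4 in the choice of the
    subsequence.\<close>
  have amgm: "x \<le> 2 ^ n * x\<^sup>2 + (1 / 2) ^ n" for x :: real and n :: nat
  proof -
    have "0 \<le> (2 ^ n * x - 1)\<^sup>2" by simp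
    then have "2 * (2 ^ n * x) \<le> (2 ^ n * x)\<^sup>2 + 1" by (simp add: power2_diff)
    then have "2 ^ n * (2 * x) \<le> 2 ^ n * (2 ^ n * x\<^sup>2 + (1 / 2) ^ n)"
      by (simp add: algebra_simps power2_eq_square power_one_over)
    then have "2 * x \<le> 2 ^ n * x\<^sup>2 + (1 / 2) ^ n" by (rule mult_left_le_imp_le) simp
    moreover have "0 \<le> 2 ^ n * x\<^sup>2 + (1 / 2) ^ n" by simp
    ultimately show ?thesis by linarith
  qed
  define Gt where "Gt = (\<integral>z. g z \<partial>lborel)"
  have small: "(\<integral>z. g z * f z \<partial>lborel) \<le> (1 / 2) ^ n * (1 + Gt)"
    if f: "integrable lborel (\<lambda>z. g z * f z)" "integrable lborel (\<lambda>z. g z * (f z)\<^sup>2)" "(\<integral>z. g z * (f z)\<^sup>2 \<partial>lborel) \<le> (1 / 4) ^ n" for f n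
  proof -
    have i: "integrable lborel (\<lambda>z. 2 ^ n * (g z * (f z)\<^sup>2) + (1 / 2) ^ n * g z)" using f(2) g(3) by simp
    have "(\<integral>z. g z * f z \<partial>lborel) \<le> (\<integral>z. 2 ^ n * (g z * (f z)\<^sup>2) + (1 / 2) ^ n * g z \<partial>lborel)"
    proof (rule integral_mono[OF f(1) i])
      fix z
      have "g z * f z \<le> g z * (2 ^ n * (f z)\<^sup>2 + (1 / 2) ^ n)" using amgm[of "f z" n] g(2)[of z] by (intro mult_left_mono) auto
      then show "g z * f z \<le> 2 ^ n * (g z * (f z)\<^sup>2) + (1 / 2) ^ n * g z" by (simp add: algebra_simps)
    qed
    also have "\<dots> = 2 ^ n * (\<integral>z. g z * (f z)\<^sup>2 \<partial>lborel) + (1 / 2) ^ n * Gt" using f(2) g(3) by (simp add: Gt_def)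
    also have "\<dots> \<le> 2 ^ n * (1 / 4) ^ n + (1 / 2) ^ n * Gt" using f(3) by simp
    also have "2 ^ n * (1 / 4) ^ n = ((1 / 2) ^ n :: real)" by (simp add: power_mult_distrib[symmetric])
    finally show ?thesis by (simp add: algebra_simps)
  qed
  have b0: "0 \<le> b j" for j using L(2)[of j] \<epsilon>[of j] by (simp add: b_def)
  have Xint: "(\<integral>z. X n z \<partial>lborel) \<le> (1 / 2) ^ n * (2 * (1 + Gt))" for n
  proof -
    have rl: "r n \<le> r (Suc n)" using r(1) by (simp add: strict_mono_less_eq)
    have "(\<integral>z. g z * cmod (V (r (Suc n)) z - V (r n) z) \<partial>lborel) \<le> (1 / 2) ^ n * (1 + Gt)"
      by (rule small[OF X1 iVV]) (use cauchy[OF rl] r(2)[of n] m0[of "r n"] in linarith)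
    moreover have "(\<integral>z. g z * D (r n) z \<partial>lborel) \<le> (1 / 2) ^ n * (1 + Gt)"
      by (rule small[OF X2]) (use b0[of "r n"] r(2)[of n] in \<open>simp add: m_def[symmetric]\<close>)
    ultimately show ?thesis using X1 X2 by (simp add: X_def distrib_left)
  qed
  have "AE z in lborel. summable (\<lambda>n. X n z)"
  proof (rule AE_summable_of_integral_bound[OF _ _ Xint])
    show "integrable lborel (X n)" for n using X1 X2 unfolding X_def distrib_left by simp
    show "0 \<le> X n z" for n z using g(2)[of z] D0 by (simp add: X_def less_imp_le)
    show "summable (\<lambda>n. (1 / 2) ^ n * (2 * (1 + Gt)))" by (intro summable_mult2 summable_geometric) simp
  qed
  \<comment> \<open>At a given point the weight is a fixed positive number and can be divided out of
    the summable series.\<close>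
  then have AEs: "AE z in lborel. convergent (\<lambda>n. W (r n) z) \<and> (\<lambda>n. D (r n) z) \<longlonglongrightarrow> 0"
  proof eventually_elim
    case (elim z)
    then have "summable (\<lambda>n. inverse (g z) * X n z)" by (rule summable_mult)
    moreover have "inverse (g z) * X n z = cmod (V (r (Suc n)) z - V (r n) z) + D (r n) z" for n
      using g(2)[of z] by (simp add: X_def)
    ultimately have s: "summable (\<lambda>n. cmod (V (r (Suc n)) z - V (r n) z) + D (r n) z)" by simp
    have s1: "summable (\<lambda>n. cmod (V (r (Suc n)) z - V (r n) z))"
      by (rule summable_comparison_test'[OF s, of 0]) (use D0 in simp)
    have s2: "summable (\<lambda>n. D (r n) z)"
      by (rule summable_comparison_test'[OF s, of 0]) (use D0 in simp)
    have "summable (\<lambda>n. V (r (Suc n)) z - V (r n) z)" using s1 by (rule summable_norm_cancel)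
    then have "convergent (\<lambda>N. \<Sum>n<N. V (r (Suc n)) z - V (r n) z)" by (simp add: summable_iff_convergent)
    then have "convergent (\<lambda>N. V (r N) z - V (r 0) z)" by (simp add: sum_lessThan_telescope[of "\<lambda>n. V (r n) z"])
    then have "convergent (\<lambda>N. (fst s0 + V (r 0) z) + (V (r N) z - V (r 0) z))" by (intro convergent_add convergent_const)
    then have "convergent (\<lambda>N. W (r N) z)" by (simp add: WV)
    then show ?case using summable_LIMSEQ_zero[OF s2] by simp
  qed
  define Wl where "Wl z = lim (\<lambda>n. W (r n) z)" for z
  have [measurable]: "Wl \<in> borel_measurable borel" unfolding Wl_def by (rule borel_measurable_lim_metric) measurable
  \<comment> \<open>Only the velocities are shown to converge by the energy argument. The matrix
    part of the limit is prescribed by the constraint, and the convergence of the actual matrix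
    parts to it is recovered below.\<close>
  define Tl where "Tl z = (if z \<in> \<Omega> then (Wl z - fst s0, (Wl z)\<^sup>2 / 2 - snd s0) else 0)" for z
  have Tlm[measurable]: "Tl \<in> borel_measurable borel" unfolding Tl_def by measurable
  have AEl: "AE z in lborel. (\<lambda>n. T (r n) z) \<longlonglongrightarrow> Tl z \<and> (z \<in> \<Omega> \<longrightarrow> (cmod (fst (s0 + Tl z)))\<^sup>2 = C \<and> (fst (s0 + Tl z))\<^sup>2 = 2 * snd (s0 + Tl z))"
    using AEs
  proof eventually_elim
    case (elim z)
    show ?case
    proof (cases "z \<in> \<Omega>")
      case False
      then have "T (r n) z = 0" for n using T(1)[of "r n"] by (simp add: approximant_def)
      then show ?thesis using False by (simp add: Tl_def)
    next
      case True
      have Wc: "(\<lambda>n. W (r n) z) \<longlonglongrightarrow> Wl z" using elim unfolding Wl_def by (simp add: convergent_LIMSEQ_iff)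
      have Dc: "(\<lambda>n. C - (cmod (W (r n) z))\<^sup>2) \<longlonglongrightarrow> 0" using elim True by (simp add: D_def)
      have "(\<lambda>n. C - (C - (cmod (W (r n) z))\<^sup>2)) \<longlonglongrightarrow> C - 0" by (intro tendsto_diff tendsto_const Dc)
      then have "(\<lambda>n. (cmod (W (r n) z))\<^sup>2) \<longlonglongrightarrow> C" by simp
      moreover have "(\<lambda>n. (cmod (W (r n) z))\<^sup>2) \<longlonglongrightarrow> (cmod (Wl z))\<^sup>2" by (intro tendsto_intros Wc)
      ultimately have cC: "(cmod (Wl z))\<^sup>2 = C" by (rule LIMSEQ_unique[symmetric])
      \<comment> \<open>\<open>hull_fun < C\<close> bounds the deviation of the matrix part by the
        scalar defect C - |W|^2, so a vanishing defect forces the matrix part to converge as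
        well.\<close>
      have "(\<lambda>n. (W (r n) z)\<^sup>2 - 2 * snd (s0 + T (r n) z)) \<longlonglongrightarrow> 0"
      proof (rule Lim_null_comparison[OF always_eventually Dc], rule allI)
        fix n
        have "hull_fun (s0 + T (r n) z) < C" using T(1)[of "r n"] by (simp add: approximant_def)
        then show "norm ((W (r n) z)\<^sup>2 - 2 * snd (s0 + T (r n) z)) \<le> C - (cmod (W (r n) z))\<^sup>2"
          unfolding hull_fun_def W_def by linarith
      qed
      from tendsto_diff[OF tendsto_power[OF Wc, of 2] this]
      have "(\<lambda>n. 2 * snd (s0 + T (r n) z)) \<longlonglongrightarrow> (Wl z)\<^sup>2" by simp
      then have "(\<lambda>n. 2 * snd (s0 + T (r n) z) / 2 - snd s0) \<longlonglongrightarrow> (Wl z)\<^sup>2 / 2 - snd s0" by (intro tendsto_intros) auto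
      then have "(\<lambda>n. snd (T (r n) z)) \<longlonglongrightarrow> (Wl z)\<^sup>2 / 2 - snd s0" by (simp add: add_divide_distrib)
      moreover have "(\<lambda>n. W (r n) z - fst s0) \<longlonglongrightarrow> Wl z - fst s0" by (intro tendsto_intros Wc)
      then have "(\<lambda>n. fst (T (r n) z)) \<longlonglongrightarrow> Wl z - fst s0" by (simp add: W_def)
      ultimately have "(\<lambda>n. (fst (T (r n) z), snd (T (r n) z))) \<longlonglongrightarrow> (Wl z - fst s0, (Wl z)\<^sup>2 / 2 - snd s0)"
        by (intro tendsto_Pair)
      then show ?thesis using True cC by (simp add: Tl_def)
    qed
  qed
  have conv: "(\<lambda>n. \<integral>z. T (r n) z \<bullet> F z \<partial>lborel) \<longlonglongrightarrow> (\<integral>z. Tl z \<bullet> F z \<partial>lborel)"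
    if F: "integrable lborel F" for F
  proof (rule integral_dominated_convergence[where w = "\<lambda>z. B * norm (F z)"])
    have [measurable]: "F \<in> borel_measurable borel" using F by auto
    show "(\<lambda>z. Tl z \<bullet> F z) \<in> borel_measurable lborel" by measurable
    show "(\<lambda>z. T (r n) z \<bullet> F z) \<in> borel_measurable lborel" for n by measurable
    show "integrable lborel (\<lambda>z. B * norm (F z))" using F by simp
    show "AE z in lborel. (\<lambda>n. T (r n) z \<bullet> F z) \<longlonglongrightarrow> Tl z \<bullet> F z"
      using AEl by eventually_elim (intro tendsto_inner tendsto_const, simp)
    show "AE z in lborel. norm (T (r n) z \<bullet> F z) \<le> B * norm (F z)" for n
    proof (intro AE_I2)
      fix z
      have "\<bar>T (r n) z \<bullet> F z\<bar> \<le> norm (T (r n) z) * norm (F z)" by (rule Cauchy_Schwarz_ineq2)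
      also have "\<dots> \<le> B * norm (F z)" using Tb(3) by (intro mult_right_mono) (auto simp: B_def)
      finally show "norm (T (r n) z \<bullet> F z) \<le> B * norm (F z)" by simp
    qed
  qed
  have gF: "integrable lborel (\<lambda>z. (g z *\<^sub>R \<psi> z, 0 :: complex))" if "continuous_on UNIV \<psi>" "\<And>z. cmod (\<psi> z) \<le> M" for \<psi> M
  proof (rule Bochner_Integration.integrable_bound[OF integrable_mult_left[OF g(3), of M]])
    have "continuous_on UNIV (\<lambda>z. (g z *\<^sub>R \<psi> z, 0 :: complex))" by (intro continuous_intros g that)
    then show "(\<lambda>z. (g z *\<^sub>R \<psi> z, 0 :: complex)) \<in> borel_measurable lborel" by (simp add: borel_measurable_continuous_onI)
    show "AE z in lborel. norm (g z *\<^sub>R \<psi> z, 0 :: complex) \<le> norm (g z * M)"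
    proof (intro AE_I2)
      fix z have "cmod (\<psi> z) \<le> \<bar>M\<bar>" using that(2)[of z] by linarith
      then show "norm (g z *\<^sub>R \<psi> z, 0 :: complex) \<le> norm (g z * M)" using g(2)[of z] by (simp add: norm_Pair abs_mult)
    qed
  qed
  have convg: "(\<lambda>n. \<integral>z. g z * (V (r n) z \<bullet> \<psi> z) \<partial>lborel) \<longlonglongrightarrow> (\<integral>z. g z * (fst (Tl z) \<bullet> \<psi> z) \<partial>lborel)"
    if "continuous_on UNIV \<psi>" "\<And>z. cmod (\<psi> z) \<le> M" for \<psi> M
    using conv[OF gF[OF that]] by (simp add: inner_prod_def V_def)
  have "weak_pair Tl" unfolding weak_pair_def
  proof (intro allI impI)
    fix \<phi> and i :: nat assume \<phi>: "test_function \<phi>"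
    have "integrable lborel (test_field i \<phi>)"
      using \<phi> by (intro bsupp_integrable test_field_bsupp test_field_continuous test_function_bsupp test_function_smooth)
    from conv[OF this] have "(\<lambda>n. 0) \<longlonglongrightarrow> (\<integral>z. Tl z \<bullet> test_field i \<phi> z \<partial>lborel)"
      using T(1) \<phi> by (simp add: approximant_def weak_pair_def)
    then show "(\<integral>z. Tl z \<bullet> test_field i \<phi> z \<partial>lborel) = 0" by (simp add: LIMSEQ_const_iff)
  qed
  then have ex: "exact_perturbation \<Omega> C s0 Tl"
    using AEl unfolding exact_perturbation_def by (auto simp: Tl_def[abs_def] intro!: Tlm[unfolded Tl_def[abs_def]] elim: eventually_mono)
  have small: "\<bar>\<integral>z. g z * (fst (Tl z) \<bullet> \<psi> z) \<partial>lborel\<bar> \<le> \<delta>" if \<psi>: "\<psi> \<in> \<Psi>" for \<psi>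
  proof -
    obtain M where M: "\<And>z. cmod (\<psi> z) \<le> M" using \<Psi>(3)[OF \<psi>] by blast
    have c: "continuous_on UNIV \<psi>" using \<Psi>(2)[OF \<psi>] .
    have [measurable]: "\<psi> \<in> borel_measurable borel" using c by (rule borel_measurable_continuous_onI)
    have "\<bar>\<integral>z. g z * ((V (r n) z - V 0 z) \<bullet> \<psi> z) \<partial>lborel\<bar> \<le> 2 * \<epsilon> 0 - 2 * \<epsilon> (r n)" for n
      by (rule orth[OF _ T4[OF \<psi>] _ M]) auto
    then have est: "\<bar>\<integral>z. g z * ((V (r n) z - V 0 z) \<bullet> \<psi> z) \<partial>lborel\<bar> \<le> 2 * \<epsilon> 0 - 2 * \<epsilon> (r n)" for n .
    have V0: "V 0 z = 0" for z by (simp add: V_def T(2))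
    have e0: "2 * \<epsilon> 0 = \<delta>" by (simp add: \<epsilon>_def)
    have "\<bar>\<integral>z. g z * (V (r n) z \<bullet> \<psi> z) \<partial>lborel\<bar> \<le> \<delta>" for n
      using est[of n] \<epsilon>[of "r n"] unfolding V0 e0 diff_0_right by linarith
    then show ?thesis by (intro tendsto_upperbound[OF tendsto_rabs[OF convg[OF c M]]]) auto
  qed
  \<comment> \<open>The limit is detected by one of its own approximants. If all these pairings
    vanished, so would the weighted norm of the limit; but a zero perturbation leaves |fst s0|^2 < C
    and misses the constraint on the nonempty open set.\<close>
  have "\<exists>n. (\<integral>z. g z * (fst (Tl z) \<bullet> V (r n) z) \<partial>lborel) \<noteq> 0"
  proof (rule ccontr)
    assume "\<not> ?thesis"
    then have z0: "(\<integral>z. g z * (fst (Tl z) \<bullet> V (r n) z) \<partial>lborel) = 0" for n by blast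
    have Tlb: "AE z in lborel. cmod (fst (Tl z)) \<le> 2 * sqrt C"
      using AEl
    proof eventually_elim
      case (elim z)
      show ?case
      proof (cases "z \<in> \<Omega>")
        case True
        then have "(cmod (fst (s0 + Tl z)))\<^sup>2 = C" using elim by blast
        then have "cmod (fst (s0 + Tl z)) = sqrt C" by (metis norm_ge_zero real_sqrt_unique)
        then show ?thesis using norm_triangle_ineq4[of "fst (s0 + Tl z)" "fst s0"] hull_fun_bounds(2)[OF s0] by simp
      qed (use C0 in \<open>simp add: Tl_def\<close>)
    qed
    have "(\<lambda>n. \<integral>z. g z * (fst (Tl z) \<bullet> V (r n) z) \<partial>lborel) \<longlonglongrightarrow> (\<integral>z. g z * (fst (Tl z) \<bullet> fst (Tl z)) \<partial>lborel)"
    proof (rule integral_dominated_convergence[where w = "\<lambda>z. g z * ((2 * sqrt C) * (2 * sqrt C))"])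
      show "integrable lborel (\<lambda>z. g z * ((2 * sqrt C) * (2 * sqrt C)))" using g(3) by simp
      have [measurable]: "(\<lambda>z. fst (Tl z)) \<in> borel_measurable borel"
        using Tlm by (intro borel_measurable_continuous_on[OF continuous_on_fst[OF continuous_on_id]])
      show "(\<lambda>z. g z * (fst (Tl z) \<bullet> fst (Tl z))) \<in> borel_measurable lborel" by measurable
      show "(\<lambda>z. g z * (fst (Tl z) \<bullet> V (r n) z)) \<in> borel_measurable lborel" for n by measurable
      show "AE z in lborel. (\<lambda>n. g z * (fst (Tl z) \<bullet> V (r n) z)) \<longlonglongrightarrow> g z * (fst (Tl z) \<bullet> fst (Tl z))"
        using AEl unfolding V_def by eventually_elim (intro tendsto_mult tendsto_inner tendsto_const tendsto_fst, simp)
      show "AE z in lborel. norm (g z * (fst (Tl z) \<bullet> V (r n) z)) \<le> g z * ((2 * sqrt C) * (2 * sqrt C))" for n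
        using Tlb
      proof eventually_elim
        case (elim z)
        have "\<bar>fst (Tl z) \<bullet> V (r n) z\<bar> \<le> cmod (fst (Tl z)) * cmod (V (r n) z)" by (rule Cauchy_Schwarz_ineq2)
        also have "\<dots> \<le> (2 * sqrt C) * (2 * sqrt C)" using elim Vb C0 by (intro mult_mono) auto
        finally have "g z * \<bar>fst (Tl z) \<bullet> V (r n) z\<bar> \<le> g z * ((2 * sqrt C) * (2 * sqrt C))"
          using g(2)[of z] by (intro mult_left_mono) auto
        then show ?case using g(2)[of z] by (simp add: abs_mult)
      qed
    qed
    then have zero: "(\<integral>z. g z * (fst (Tl z) \<bullet> fst (Tl z)) \<partial>lborel) = 0" unfolding z0 by (simp add: LIMSEQ_const_iff)
    have fm[measurable]: "(\<lambda>z. fst (Tl z)) \<in> borel_measurable borel"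
      using Tlm by (intro borel_measurable_continuous_on[OF continuous_on_fst[OF continuous_on_id]])
    have int: "integrable lborel (\<lambda>z. g z * (fst (Tl z) \<bullet> fst (Tl z)))"
    proof (rule Bochner_Integration.integrable_bound[OF integrable_mult_left[OF g(3), of "(2 * sqrt C)\<^sup>2"]])
      show "AE z in lborel. norm (g z * (fst (Tl z) \<bullet> fst (Tl z))) \<le> norm (g z * (2 * sqrt C)\<^sup>2)"
        using Tlb
      proof eventually_elim
        case (elim z)
        have "fst (Tl z) \<bullet> fst (Tl z) \<le> (2 * sqrt C)\<^sup>2"
          using elim by (simp only: power2_norm_eq_inner[symmetric]) (intro power_mono, auto)
        then show ?case using g(2)[of z] by (simp add: abs_mult)
      qed
    qed measurable
    have "AE z in lborel. g z * (fst (Tl z) \<bullet> fst (Tl z)) = 0"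
      using integral_nonneg_eq_0_iff_AE[OF int] zero g(2) by (simp add: less_imp_le)
    then have "AE z in lborel. z \<in> \<Omega> \<longrightarrow> False"
      using AEl
    proof eventually_elim
      case (elim z)
      have "fst (Tl z) = 0" using elim(1) g(2)[of z] by simp
      then show ?case using elim(2) hull_fun_bounds(1)[OF s0] by auto
    qed
    then show False using AE_lborel_open_nonempty[OF \<Omega>, of "\<lambda>_. False"] by simp
  qed
  then obtain n where n: "(\<integral>z. g z * (fst (Tl z) \<bullet> V (r n) z) \<partial>lborel) \<noteq> 0" by blast
  have "continuous_on UNIV (V (r n))" using T(1)[of "r n"] unfolding V_def approximant_def by (intro continuous_intros) auto
  then show ?thesis using ex small n Vb by blast
qed

text \<open>Each perturbation is stored with a probe against which its pairing is nonzero. The next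
  one is built so nearly orthogonal to all earlier probes that its pairings are strictly smaller
  there, so it differs from every predecessor. The distinction is made in the velocity, the only
  part that a flow shows.\<close>

lemma infinitely_many_exact_perturbations:
  obtains \<T> :: "nat \<Rightarrow> spacetime \<Rightarrow> state" where "\<And>n. exact_perturbation \<Omega> C s0 (\<T> n)"
    "\<And>m n. m \<noteq> n \<Longrightarrow> \<not> (AE z in lborel. fst (\<T> m z) = fst (\<T> n z))"
proof -
  define I where "I T \<psi> = (\<integral>z. g z * (fst (T z) \<bullet> \<psi> z) \<partial>lborel)" for T :: "spacetime \<Rightarrow> state" and \<psi>
  define R where "R X \<longleftrightarrow> exact_perturbation \<Omega> C s0 (fst X) \<and> continuous_on UNIV (snd X) \<and> (\<exists>M. \<forall>z. cmod (snd X z) \<le> M) \<and> I (fst X) (snd X) \<noteq> 0"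
    for X :: "(spacetime \<Rightarrow> state) \<times> (spacetime \<Rightarrow> complex)"
  have step: "\<exists>Y. R Y \<and> (\<forall>X\<in>F. \<bar>I (fst Y) (snd X)\<bar> < \<bar>I (fst X) (snd X)\<bar>)" if F: "finite F" "\<And>X. X \<in> F \<Longrightarrow> R X" for F
  proof -
    \<comment> \<open>The inserted 1 makes the minimum meaningful when there is no predecessor;
      halving leaves room for the strict inequality.\<close>
    define \<delta> where "\<delta> = Min (insert 1 ((\<lambda>X. \<bar>I (fst X) (snd X)\<bar>) ` F)) / 2"
    have "0 < Min (insert 1 ((\<lambda>X. \<bar>I (fst X) (snd X)\<bar>) ` F))" using F by (auto simp: R_def)
    then have \<delta>: "0 < \<delta>" by (simp add: \<delta>_def)
    have \<delta>l: "\<delta> < \<bar>I (fst X) (snd X)\<bar>" if "X \<in> F" for X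
    proof -
      have "2 * \<delta> \<le> \<bar>I (fst X) (snd X)\<bar>" unfolding \<delta>_def using that F(1) by (simp add: Min_le)
      then show ?thesis using \<delta> by linarith
    qed
    have "\<exists>T. exact_perturbation \<Omega> C s0 T \<and> (\<forall>\<psi>\<in>snd ` F. \<bar>\<integral>z. g z * (fst (T z) \<bullet> \<psi> z) \<partial>lborel\<bar> \<le> \<delta>) \<and>
     (\<exists>\<psi> M. continuous_on UNIV \<psi> \<and> (\<forall>z. cmod (\<psi> z) \<le> M) \<and> (\<integral>z. g z * (fst (T z) \<bullet> \<psi> z) \<partial>lborel) \<noteq> 0)"
      by (rule exists_exact_perturbation[OF _ _ _ \<delta>]) (use F in \<open>auto simp: R_def\<close>)
    then obtain T \<psi> M where T: "exact_perturbation \<Omega> C s0 T" "\<forall>\<psi>\<in>snd ` F. \<bar>I T \<psi>\<bar> \<le> \<delta>"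
      "continuous_on UNIV \<psi>" "\<forall>z. cmod (\<psi> z) \<le> M" "I T \<psi> \<noteq> 0" unfolding I_def by blast
    then have "R (T, \<psi>)" by (auto simp: R_def)
    moreover have "\<bar>I T (snd X)\<bar> < \<bar>I (fst X) (snd X)\<bar>" if "X \<in> F" for X using T(2) \<delta>l[OF that] that by fastforce
    ultimately show ?thesis by (intro exI[of _ "(T, \<psi>)"]) auto
  qed
  have "\<exists>f. \<forall>n::nat. R (f n) \<and> (\<forall>m<n. \<bar>I (fst (f n)) (snd (f m))\<bar> < \<bar>I (fst (f m)) (snd (f m))\<bar>)"
  proof (rule dependent_wellorder_choice[where P = "\<lambda>f n r. R r \<and> (\<forall>m<n. \<bar>I (fst r) (snd (f m))\<bar> < \<bar>I (fst (f m)) (snd (f m))\<bar>)"])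
    fix n :: nat and f :: "nat \<Rightarrow> (spacetime \<Rightarrow> state) \<times> (spacetime \<Rightarrow> complex)"
    assume IH: "\<And>y. y < n \<Longrightarrow> R (f y) \<and> (\<forall>m<y. \<bar>I (fst (f y)) (snd (f m))\<bar> < \<bar>I (fst (f m)) (snd (f m))\<bar>)"
    have "\<exists>Y. R Y \<and> (\<forall>X\<in>f ` {..<n}. \<bar>I (fst Y) (snd X)\<bar> < \<bar>I (fst X) (snd X)\<bar>)"
    proof (rule step)
      show "R X" if "X \<in> f ` {..<n}" for X using that IH by blast
    qed simp
    then show "\<exists>r. R r \<and> (\<forall>m<n. \<bar>I (fst r) (snd (f m))\<bar> < \<bar>I (fst (f m)) (snd (f m))\<bar>)"
      by blast
  qed auto
  then obtain f :: "nat \<Rightarrow> (spacetime \<Rightarrow> state) \<times> (spacetime \<Rightarrow> complex)" where f: "\<And>n. R (f n)" "\<And>m n. m < n \<Longrightarrow> \<bar>I (fst (f n)) (snd (f m))\<bar> < \<bar>I (fst (f m)) (snd (f m))\<bar>" by blast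
  have ne: "\<not> (AE z in lborel. fst (fst (f m) z) = fst (fst (f n) z))" if "m < n" for m n
  proof
    assume "AE z in lborel. fst (fst (f m) z) = fst (fst (f n) z)"
    then have ae: "AE z in lborel. g z * (fst (fst (f m) z) \<bullet> snd (f m) z) = g z * (fst (fst (f n) z) \<bullet> snd (f m) z)"
      by (auto elim: eventually_mono)
    have [measurable]: "(\<lambda>z. fst (fst (f k) z)) \<in> borel_measurable borel" "snd (f k) \<in> borel_measurable borel" "g \<in> borel_measurable borel" for k
      using f(1)[of k] g(1) unfolding R_def exact_perturbation_def
      by (auto intro: borel_measurable_continuous_onI borel_measurable_continuous_on[OF continuous_on_fst[OF continuous_on_id]])
    have "I (fst (f m)) (snd (f m)) = I (fst (f n)) (snd (f m))"
      unfolding I_def by (rule integral_cong_AE[OF _ _ ae]) measurable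
    then show False using f(2)[OF that] by simp
  qed
  show ?thesis
  proof (rule that[of "\<lambda>n. fst (f n)"])
    show "exact_perturbation \<Omega> C s0 (fst (f n))" for n using f(1) by (simp add: R_def)
    fix m n :: nat assume "m \<noteq> n"
    then consider "m < n" | "n < m" by linarith
    then show "\<not> (AE z in lborel. fst (fst (f m) z) = fst (fst (f n) z))"
      by cases (use ne[of m n] ne[of n m] in \<open>auto simp: eq_commute\<close>)
  qed
qed

end

section \<open>Weak formulation for fans\<close>

text \<open>A fan is a combination of the indicators of the half space and of two wedges, so a
  single kind of moving interface has to be integrated. The initial slice is the set where
  \<open>x $ 2 < 0\<close>.\<close>

definition wedge :: "real \<Rightarrow> spacetime set" where
  "wedge \<nu> = {z. 0 \<le> fst z \<and> snd z $ 2 < \<nu> * fst z}"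

lemma wedge_borel [measurable]: "wedge \<nu> \<in> sets borel"
proof -
  have "wedge \<nu> = {z. 0 \<le> fst z} \<inter> {z. snd z $ 2 < \<nu> * fst z}" by (auto simp: wedge_def)
  moreover have "closed {z :: spacetime. 0 \<le> fst z}" by (intro closed_Collect_le continuous_intros)
  moreover have "open {z :: spacetime. snd z $ 2 < \<nu> * fst z}" by (intro open_Collect_less continuous_intros)
  ultimately show ?thesis by auto
qed

lemma half_space_borel [measurable]: "half_space \<in> sets borel"
proof -
  have "closed half_space" by (intro closed_Collect_le continuous_intros)
  then show ?thesis by auto
qed

lemma AE_lborel_fst_ne_0: "AE z in (lborel :: spacetime measure). fst z \<noteq> 0"
  and AE_lborel_line: "AE z in (lborel :: spacetime measure). snd z $ 2 \<noteq> \<nu> * fst z"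
proof -
  have *: "AE z in (lborel :: spacetime measure). a \<bullet> z \<noteq> b" if "a \<noteq> 0" for a b
  proof -
    have "negligible {z :: spacetime. a \<bullet> z = b}" using that by (intro negligible_hyperplane) auto
    moreover have "closed {z :: spacetime. a \<bullet> z = b}" by (rule closed_hyperplane)
    ultimately have "{z :: spacetime. a \<bullet> z = b} \<in> null_sets lborel"
      by (simp add: negligible_iff_null_sets null_sets_completion_iff)
    then show ?thesis by (intro AE_I'[of "{z. a \<bullet> z = b}"]) auto
  qed
  show "AE z in (lborel :: spacetime measure). fst z \<noteq> 0"
    using *[of "(1, 0)" 0] by (simp add: inner_prod_def zero_prod_def)
  have "AE z in (lborel :: spacetime measure). (- \<nu>, axis 2 1) \<bullet> z \<noteq> 0"
    by (rule *) (simp add: zero_prod_def axis_eq_0_iff)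
  then show "AE z in (lborel :: spacetime measure). snd z $ 2 \<noteq> \<nu> * fst z"
    by (simp add: inner_prod_def inner_axis' mult.commute[of _ "1::real"])
qed

text \<open>Since \<open>A\<close> is stable under moving backwards along \<open>d\<close>, it is
  contained in its forward translates, and translating a nonnegative function can only increase its
  integral over \<open>A\<close>. This gives the sign of a flux through the boundary without a
  surface measure.\<close>

lemma integral_pd_nonneg:
  fixes h :: "'a::euclidean_space \<Rightarrow> real"
  assumes h: "\<And>x. h differentiable (at x)" "continuous_on UNIV (pd d h)" "bsupp h" and A[measurable]: "A \<in> sets borel"
    and h0: "\<And>z. 0 \<le> h z" and inv: "\<And>t z. 0 \<le> t \<Longrightarrow> t *\<^sub>R d + z \<in> A \<Longrightarrow> z \<in> A"
    and inv2: "\<And>t z. 0 \<le> t \<Longrightarrow> z \<in> A \<Longrightarrow> - (t *\<^sub>R d) + z \<in> A"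
  shows "0 \<le> (\<integral>z. indicator A z * pd d h z \<partial>lborel)"
proof (rule LIMSEQ_le_const[OF integral_pd_limit[OF h A]], intro exI[of _ 0] allI impI)
  fix n :: nat
  have ch: "continuous_on UNIV h"
    using h(1) by (simp add: continuous_at_imp_continuous_on differentiable_imp_continuous_within)
  have [measurable]: "h \<in> borel_measurable borel" using ch by (auto intro: borel_measurable_continuous_onI)
  define c where "c = inverse (real (Suc n)) *\<^sub>R d"
  have ih: "integrable lborel (\<lambda>z. indicator A z * h z)"
    using integrable_indicator_scaleR[OF bsupp_integrable[OF h(3) ch] A] by simp
  have ih2: "integrable lborel (\<lambda>z. indicator A z * h (c + z))"
    using integrable_indicator_scaleR[OF lborel_integrable_translate[OF bsupp_integrable[OF h(3) ch]] A, of c] by simp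
  have ih3: "integrable lborel (\<lambda>z. indicator A (- c + z) * h z)"
    using lborel_integrable_translate[OF ih2, of "- c"] by simp
  have "(\<integral>z. indicator A z * h z \<partial>lborel) \<le> (\<integral>z. indicator A (- c + z) * h z \<partial>lborel)"
  proof (rule integral_mono[OF ih ih3])
    fix z show "indicator A z * h z \<le> indicator A (- c + z) * h z"
      using inv2[of "inverse (real (Suc n))" z] h0[of z] by (auto simp: c_def split: split_indicator)
  qed
  also have "\<dots> = (\<integral>z. indicator A z * h (c + z) \<partial>lborel)"
    using lborel_integral_translate[of "\<lambda>z. indicator A z * h (c + z)" "- c"] by simp
  finally have "0 \<le> real (Suc n) * ((\<integral>z. indicator A z * h (c + z) \<partial>lborel) - (\<integral>z. indicator A z * h z \<partial>lborel))"
    by simp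
  also have "\<dots> = (\<integral>z. indicator A z * (real (Suc n) * (h (c + z) - h z)) \<partial>lborel)"
  proof -
    have e: "indicator A z * (real (Suc n) * (h (c + z) - h z)) = real (Suc n) * (indicator A z * h (c + z) - indicator A z * h z)" for z
      by (simp add: right_diff_distrib mult.left_commute del: of_nat_Suc)
    show ?thesis unfolding e using ih ih2 by (simp del: of_nat_Suc)
  qed
  finally show "0 \<le> (\<integral>z. indicator A z * (real (Suc n) * (h (inverse (real (Suc n)) *\<^sub>R d + z) - h z)) \<partial>lborel)"
    unfolding c_def .
qed

section \<open>Test functions integrated over the half space and over wedges\<close>

context
  fixes \<phi> :: "spacetime \<Rightarrow> real"
  assumes \<phi>: "smooth \<phi>" "bsupp \<phi>"
begin

lemma test_differentiable: "\<phi> differentiable (at z)"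
  using \<phi>(1) C_k_differentiable[of 0 \<phi>] by (simp add: smooth_def)

lemma test_pd_continuous: "b \<in> Basis \<Longrightarrow> continuous_on UNIV (pd b \<phi>)"
  using smooth_pd[OF \<phi>(1), of b] unfolding smooth_def by (intro C_k_continuous[of 0]) blast

lemma test_pd_integrable: "b \<in> Basis \<Longrightarrow> integrable lborel (pd b \<phi>)"
  by (intro bsupp_integrable bsupp_pd \<phi> test_pd_continuous)

lemma pd_drift: "pd (1, \<nu> *\<^sub>R axis 2 1) \<phi> z = pd et \<phi> z + \<nu> * pd e2 \<phi> z"
proof -
  have e: "(1, \<nu> *\<^sub>R axis 2 1) = et + \<nu> *\<^sub>R e2" by simp
  show ?thesis unfolding e
    using linear_add[OF linear_pd[OF test_differentiable[of z]], of et "\<nu> *\<^sub>R e2"]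
      linear_scale[OF linear_pd[OF test_differentiable[of z]], of \<nu> e2] unfolding real_scaleR_def by linarith
qed

lemma integral_half_space_pd: "(\<integral>z. indicator half_space z * pd (0, axis i 1) \<phi> z \<partial>lborel) = 0"
  by (rule integral_pd_invariant[OF test_differentiable test_pd_continuous[OF spacetime_Basis(2)] \<phi>(2) half_space_borel]) auto

lemma integral_wedge_pd1: "(\<integral>z. indicator (wedge \<nu>) z * pd e1 \<phi> z \<partial>lborel) = 0"
  by (rule integral_pd_invariant[OF test_differentiable test_pd_continuous[OF spacetime_Basis(2)] \<phi>(2) wedge_borel])
     (auto simp: wedge_def axis_def)

text \<open>By the divergence theorem the right-hand integral is a multiple of the integral of
  \<phi> over the interface. For the entropy inequality only its sign matters, and for the
  conservation laws its coefficient is zero.\<close>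

lemma integral_wedge_pd2: "(\<And>z. 0 \<le> \<phi> z) \<Longrightarrow> 0 \<le> (\<integral>z. indicator (wedge \<nu>) z * pd e2 \<phi> z \<partial>lborel)"
  by (rule integral_pd_nonneg[OF test_differentiable test_pd_continuous[OF spacetime_Basis(2)] \<phi>(2) wedge_borel])
     (auto simp: wedge_def axis_def)

lemma slice_integrable: "integrable lborel (\<lambda>x. \<phi> (0, x))"
proof (rule bsupp_integrable)
  obtain R where R: "\<And>z. R < norm z \<Longrightarrow> \<phi> z = 0" using \<phi>(2) by (auto simp: bsupp_def)
  show "bsupp (\<lambda>x. \<phi> (0, x))" unfolding bsupp_def by (intro exI[of _ R]) (auto intro!: R simp: norm_Pair)
  show "continuous_on UNIV (\<lambda>x. \<phi> (0, x))"
  proof (rule continuous_on_compose2[of UNIV \<phi>])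
    show "continuous_on UNIV \<phi>" using \<phi>(1) C_k_continuous[of 0 \<phi>] unfolding smooth_def by blast
    show "continuous_on UNIV (\<lambda>x. (0 :: real, x :: real ^ 2))" by (intro continuous_intros)
  qed simp
qed

text \<open>Along the drift \<open>x = y + \<nu> t e\<^sub>2\<close> the derivative is the total \<open>t\<close>-derivative.\<close>

lemma integral_drift:
  assumes A[measurable]: "A \<in> sets borel"
  shows "(\<integral>z. indicator half_space z * indicator A (snd z - (\<nu> * fst z) *\<^sub>R axis 2 1) * (pd et \<phi> z + \<nu> * pd e2 \<phi> z) \<partial>lborel)
    = - (\<integral>x. indicator A x * \<phi> (0, x) \<partial>lborel)"
proof -
  let ?e = "axis 2 1 :: real ^ 2"
  define f where "f z = pd et \<phi> z + \<nu> * pd e2 \<phi> z" for z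
  have cf: "continuous_on UNIV f" unfolding f_def by (intro continuous_intros test_pd_continuous spacetime_Basis)
  obtain R where R: "\<And>z. R < norm z \<Longrightarrow> \<phi> z = 0" using \<phi>(2) by (auto simp: bsupp_def)
  obtain R' where R': "\<And>z. R' < norm z \<Longrightarrow> f z = 0"
  proof -
    obtain R1 R2 where "\<And>z. R1 < norm z \<Longrightarrow> pd et \<phi> z = 0" "\<And>z. R2 < norm z \<Longrightarrow> pd e2 \<phi> z = 0"
      using bsupp_pd[OF \<phi>(2)] unfolding bsupp_def by metis
    then show ?thesis using that[of "max R1 R2"] by (simp add: f_def)
  qed
  have [measurable]: "f \<in> borel_measurable borel" using cf by (rule borel_measurable_continuous_onI)
  \<comment> \<open>The shear that follows the drift. At fixed time it is a translation in space, so
    Fubini and translation invariance suffice to change variables.\<close>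
  define s where "s z = (fst z, snd z + (\<nu> * fst z) *\<^sub>R ?e)" for z :: spacetime
  have cs: "continuous_on UNIV s" unfolding s_def by (intro continuous_intros)
  have cfs: "continuous_on UNIV (\<lambda>z. f (s z))" by (rule continuous_on_compose2[OF cf cs]) auto
  have bfs: "bsupp (\<lambda>z. f (s z))"
    unfolding bsupp_def
  proof (intro exI[of _ "R' + R' + \<bar>\<nu>\<bar> * R'"] allI impI R')
    fix z :: spacetime assume z: "R' + R' + \<bar>\<nu>\<bar> * R' < norm z"
    show "R' < norm (s z)"
    proof (rule ccontr)
      assume "\<not> ?thesis"
      then have n: "norm (s z) \<le> R'" by simp
      have 1: "\<bar>fst z\<bar> \<le> R'" using norm_fst_le[of "fst (s z)" "snd (s z)"] n by (simp add: s_def)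
      have 2: "norm (snd z + (\<nu> * fst z) *\<^sub>R ?e) \<le> R'" using norm_snd_le[of "snd (s z)" "fst (s z)"] n by (simp add: s_def)
      have "norm (snd z) \<le> norm (snd z + (\<nu> * fst z) *\<^sub>R ?e) + norm ((\<nu> * fst z) *\<^sub>R ?e)"
        using norm_triangle_ineq4[of "snd z + (\<nu> * fst z) *\<^sub>R ?e" "(\<nu> * fst z) *\<^sub>R ?e"] by simp
      also have "norm ((\<nu> * fst z) *\<^sub>R ?e) = \<bar>\<nu>\<bar> * \<bar>fst z\<bar>" by (simp add: abs_mult)
      also have "\<bar>\<nu>\<bar> * \<bar>fst z\<bar> \<le> \<bar>\<nu>\<bar> * R'" using 1 by (intro mult_left_mono) auto
      finally have "norm (snd z) \<le> R' + \<bar>\<nu>\<bar> * R'" using 2 by simp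
      moreover have "norm z \<le> norm (fst z) + norm (snd z)" by (metis norm_Pair_le prod.collapse)
      ultimately show False using z 1 by simp
    qed
  qed
  have [measurable]: "(\<lambda>z. f (s z)) \<in> borel_measurable borel" using cfs by (rule borel_measurable_continuous_onI)
  have pb: "(borel :: spacetime measure) = borel \<Otimes>\<^sub>M borel" by (simp add: borel_prod)
  have m1: "(\<lambda>z :: spacetime. indicator {0..} (fst z) * indicator A (snd z) :: real) \<in> borel_measurable borel"
    unfolding pb by measurable
  have m2: "(\<lambda>z :: spacetime. indicator {0..} (fst z) * indicator A (snd z - (\<nu> * fst z) *\<^sub>R ?e) :: real) \<in> borel_measurable borel"
    unfolding pb by measurable
  have b1: "integrable lborel (\<lambda>z. indicator {0..} (fst z) * indicator A (snd z) * f (s z))"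
    by (rule Bochner_Integration.integrable_bound[OF bsupp_integrable[OF bfs cfs]])
       (use m1 in \<open>auto simp: abs_mult split: split_indicator\<close>)
  have b2: "integrable lborel (\<lambda>z. indicator {0..} (fst z) * indicator A (snd z - (\<nu> * fst z) *\<^sub>R ?e) * f z)"
  proof (rule Bochner_Integration.integrable_bound)
    have "bsupp f" using R' unfolding bsupp_def by blast
    then show "integrable lborel f" using cf by (rule bsupp_integrable)
  qed (use m2 in \<open>auto simp: abs_mult split: split_indicator\<close>)
  have b1': "integrable (lborel \<Otimes>\<^sub>M lborel) (\<lambda>(t, x). indicator {0..} t * indicator A x * f (s (t, x)))"
    using b1 unfolding lborel_prod by (simp add: case_prod_beta')
  have b2': "integrable (lborel \<Otimes>\<^sub>M lborel) (\<lambda>(t, x). indicator {0..} t * indicator A (x - (\<nu> * t) *\<^sub>R ?e) * f (t, x))"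
    using b2 unfolding lborel_prod by (simp add: case_prod_beta')
  have "(\<integral>z. indicator half_space z * indicator A (snd z - (\<nu> * fst z) *\<^sub>R ?e) * f z \<partial>lborel)
     = (\<integral>z. (case z of (t, x) \<Rightarrow> indicator {0..} t * indicator A (x - (\<nu> * t) *\<^sub>R ?e) * f (t, x)) \<partial>(lborel \<Otimes>\<^sub>M lborel))"
    unfolding lborel_prod by (rule Bochner_Integration.integral_cong) (auto simp: indicator_def)
  also have "\<dots> = (\<integral>t. (\<integral>x. indicator {0..} t * indicator A (x - (\<nu> * t) *\<^sub>R ?e) * f (t, x) \<partial>lborel) \<partial>lborel)"
    by (rule lborel_pair.integral_fst[OF b2', symmetric])
  also have "\<dots> = (\<integral>t. (\<integral>x. indicator {0..} t * indicator A x * f (s (t, x)) \<partial>lborel) \<partial>lborel)"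
  proof (rule Bochner_Integration.integral_cong[OF refl])
    fix t :: real
    have [measurable]: "(\<lambda>x. f (t, x)) \<in> borel_measurable borel"
      by (rule borel_measurable_continuous_onI, rule continuous_on_compose2[OF cf, of UNIV "\<lambda>x. (t, x)"])
        (auto intro!: continuous_on_Pair)
    show "(\<integral>x. indicator {0..} t * indicator A (x - (\<nu> * t) *\<^sub>R ?e) * f (t, x) \<partial>lborel)
        = (\<integral>x. indicator {0..} t * indicator A x * f (s (t, x)) \<partial>lborel)"
      using lborel_integral_translate[of "\<lambda>x. indicator {0..} t * indicator A (x - (\<nu> * t) *\<^sub>R ?e) * f (t, x)" "(\<nu> * t) *\<^sub>R ?e"]
      by (simp add: s_def add.commute)
  qed
  also have "\<dots> = (\<integral>x. (\<integral>t. indicator {0..} t * indicator A x * f (s (t, x)) \<partial>lborel) \<partial>lborel)"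
    by (rule lborel_pair.Fubini_integral[OF b1', symmetric])
  also have "\<dots> = (\<integral>x. - (indicator A x * \<phi> (0, x)) \<partial>lborel)"
  proof (rule Bochner_Integration.integral_cong[OF refl])
    fix x :: "real ^ 2"
    define u where "u t = \<phi> (t, x + (\<nu> * t) *\<^sub>R ?e)" for t
    \<comment> \<open>From time \<open>S\<close> on, both \<phi> and its drift derivative vanish
      along the line; the added 1 makes the comparison with both radii strict. The half-line
      integral is then one over a compact interval.\<close>
    define S where "S = max 0 (max R R') + 1"
    have S: "0 \<le> S" "R < S" "R' < S" by (auto simp: S_def)
    have du: "(u has_real_derivative f (s (t, x))) (at t)" for t
    proof -
      have "((\<lambda>t. \<phi> (t, x + (\<nu> * t) *\<^sub>R ?e)) has_derivative (\<lambda>h. pd (h, (\<nu> * h) *\<^sub>R ?e) \<phi> (t, x + (\<nu> * t) *\<^sub>R ?e))) (at t)"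
        by (rule has_derivative_compose[where g = \<phi> and f = "\<lambda>t. (t, x + (\<nu> * t) *\<^sub>R ?e)"])
           (auto intro!: derivative_eq_intros has_derivative_frechet test_differentiable)
      moreover have "pd (h, (\<nu> * h) *\<^sub>R ?e) \<phi> (t, x + (\<nu> * t) *\<^sub>R ?e) = f (s (t, x)) * h" for h
      proof -
        have e: "(h, (\<nu> * h) *\<^sub>R ?e) = h *\<^sub>R (1, \<nu> *\<^sub>R ?e)" by (simp add: mult.commute)
        show ?thesis
          unfolding e linear_scale[OF linear_pd[OF test_differentiable]] pd_drift real_scaleR_def by (simp add: f_def s_def mult.commute)
      qed
      ultimately show ?thesis by (simp add: has_field_derivative_def u_def[abs_def])
    qed
    have "(\<integral>t. f (s (t, x)) * indicator {0..S} t \<partial>lborel) = u S - u 0"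
    proof (rule integral_FTC_Icc_real[OF S(1) du])
      have "continuous_on UNIV (\<lambda>t. f (s (t, x)))"
        by (rule continuous_on_compose2[OF cfs, of UNIV "\<lambda>t. (t, x)"]) (auto intro: continuous_intros)
      then show "isCont (\<lambda>t. f (s (t, x))) t" for t by (simp add: continuous_on_eq_continuous_at)
    qed
    moreover have "norm t \<le> norm (s (t, x))" for t
      using norm_fst_le[of "fst (s (t, x))" "snd (s (t, x))"] by (simp add: s_def)
    then have big: "S \<le> \<bar>norm t\<bar> \<Longrightarrow> S \<le> norm (s (t, x))" for t by (metis abs_norm_cancel order_trans)
    have "u S = 0" unfolding u_def using big[of S] S R[of "s (S, x)"] by (simp add: s_def)
    moreover have "f (s (t, x)) * indicator {0..S} t = indicator {0..} t * f (s (t, x))" for t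
      using big[of t] S R'[of "s (t, x)"] by (auto split: split_indicator)
    ultimately have "(\<integral>t. indicator {0..} t * f (s (t, x)) \<partial>lborel) = - \<phi> (0, x)" by (simp add: u_def)
    moreover have "(\<integral>t. indicator {0..} t * indicator A x * f (s (t, x)) \<partial>lborel) = indicator A x * (\<integral>t. indicator {0..} t * f (s (t, x)) \<partial>lborel)"
      by (subst integral_mult_right_zero[symmetric]) (simp add: mult.left_commute mult.commute)
    ultimately show "(\<integral>t. indicator {0..} t * indicator A x * f (s (t, x)) \<partial>lborel) = - (indicator A x * \<phi> (0, x))" by simp
  qed
  finally show ?thesis unfolding f_def by simp
qed

lemma integral_half_space_time: "(\<integral>z. indicator half_space z * pd et \<phi> z \<partial>lborel) = - (\<integral>x. \<phi> (0, x) \<partial>lborel)"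
  using integral_drift[of UNIV 0] by simp

text \<open>The wedge is the set \<open>x $ 2 < 0\<close> carried along by the drift of speed \<nu>,
  so the combination of time derivative and \<nu> times the normal derivative integrates to the
  initial term. Solving for the time derivative makes the speed appear in the jump
  conditions.\<close>

lemma integral_wedge_time:
  "(\<integral>z. indicator (wedge \<nu>) z * pd et \<phi> z \<partial>lborel) =
    - (\<integral>x. indicator {x. x $ 2 < 0} x * \<phi> (0, x) \<partial>lborel) - \<nu> * (\<integral>z. indicator (wedge \<nu>) z * pd e2 \<phi> z \<partial>lborel)"
proof -
  have o: "open {x :: real ^ 2. x $ 2 < 0}" by (intro open_Collect_less continuous_intros)
  have i: "integrable lborel (\<lambda>z. indicator (wedge \<nu>) z * pd b \<phi> z)" if "b \<in> Basis" for b
    using integrable_indicator_scaleR[OF test_pd_integrable[OF that] wedge_borel] by simp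
  have "indicator (wedge \<nu>) z * pd et \<phi> z + \<nu> * (indicator (wedge \<nu>) z * pd e2 \<phi> z) =
      indicator half_space z * indicator {x. x $ 2 < 0} (snd z - (\<nu> * fst z) *\<^sub>R axis 2 1) * (pd et \<phi> z + \<nu> * pd e2 \<phi> z)" for z
    by (auto simp: wedge_def indicator_def axis_def)
  then have "(\<integral>z. indicator (wedge \<nu>) z * pd et \<phi> z + \<nu> * (indicator (wedge \<nu>) z * pd e2 \<phi> z) \<partial>lborel)
     = - (\<integral>x. indicator {x. x $ 2 < 0} x * \<phi> (0, x) \<partial>lborel)"
    using integral_drift[of "{x. x $ 2 < 0}" \<nu>] o by simp
  then show ?thesis using i[of et] i[of e2] spacetime_Basis by simp
qed

text \<open>The three constant states telescope into the right state on the half space plus one jump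
  on each wedge. Initial terms cancel, and each interface is left with its Rankine-Hugoniot defect
  as a coefficient. \<open>r\<close> and \<open>G\<close> hold the deviation from the constants in
  the middle region and contribute the last integral.\<close>

lemma weak_pairing_fan:
  fixes w :: "spacetime \<Rightarrow> real" and F :: "spacetime \<Rightarrow> real ^ 2"
  assumes \<nu>: "\<nu>1 < \<nu>2"
    and m[measurable]: "w \<in> borel_measurable borel" "F \<in> borel_measurable borel"
      "r \<in> borel_measurable borel" "G \<in> borel_measurable borel"
    and left: "\<And>z. 0 < fst z \<Longrightarrow> snd z $ 2 < \<nu>1 * fst z \<Longrightarrow> w z = a1 \<and> F z = f1"
    and mid: "\<And>z. 0 < fst z \<Longrightarrow> \<nu>1 * fst z < snd z $ 2 \<Longrightarrow> snd z $ 2 < \<nu>2 * fst z \<Longrightarrow> w z = a2 + r z \<and> F z = f2 + G z"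
    and right: "\<And>z. 0 < fst z \<Longrightarrow> \<nu>2 * fst z < snd z $ 2 \<Longrightarrow> w z = a3 \<and> F z = f3"
    and zero: "\<And>z. \<not> (0 < fst z \<and> \<nu>1 * fst z < snd z $ 2 \<and> snd z $ 2 < \<nu>2 * fst z) \<Longrightarrow> r z = 0 \<and> G z = 0"
    and bd: "AE z in lborel. \<bar>r z\<bar> \<le> M \<and> norm (G z) \<le> M"
  shows "weak_pairing w F (\<lambda>x. if x $ 2 < 0 then a1 else a3) \<phi> =
    (f2 $ 2 - f3 $ 2 - \<nu>2 * (a2 - a3)) * (\<integral>z. indicator (wedge \<nu>2) z * pd e2 \<phi> z \<partial>lborel)
    + (f1 $ 2 - f2 $ 2 - \<nu>1 * (a1 - a2)) * (\<integral>z. indicator (wedge \<nu>1) z * pd e2 \<phi> z \<partial>lborel)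
    + (\<integral>z. r z * pd et \<phi> z + (G z $ 1 * pd e1 \<phi> z + G z $ 2 * pd e2 \<phi> z) \<partial>lborel)"
proof -
  have td: "time_deriv \<phi> = pd et \<phi>" by (simp add: fun_eq_iff time_deriv_def pd_def)
  have sg: "v \<bullet> space_grad \<phi> z = v $ 1 * pd e1 \<phi> z + v $ 2 * pd e2 \<phi> z" for v z
    by (simp add: space_grad_def inner_vec_def sum_2 pd_def)
  note B = spacetime_Basis
  have [measurable]: "pd et \<phi> \<in> borel_measurable borel" "pd e1 \<phi> \<in> borel_measurable borel" "pd e2 \<phi> \<in> borel_measurable borel"
    using test_pd_continuous B by (auto intro: borel_measurable_continuous_onI)
  have nthm[measurable]: "(\<lambda>z. H z $ i) \<in> borel_measurable borel" if "H \<in> borel_measurable borel" for H :: "spacetime \<Rightarrow> real ^ 2" and i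
    using that by (rule borel_measurable_continuous_on[OF bounded_linear.continuous_on[OF bounded_linear_vec_nth continuous_on_id]])
  have i: "integrable lborel (\<lambda>z. indicator A z * pd b \<phi> z)" if "b \<in> Basis" "A \<in> sets borel" for b A
    using integrable_indicator_scaleR[OF test_pd_integrable[OF that(1)] that(2)] by simp
  define q where "q z = r z * pd et \<phi> z + (G z $ 1 * pd e1 \<phi> z + G z $ 2 * pd e2 \<phi> z)" for z
  have bi: "integrable lborel (\<lambda>z. k z * pd b \<phi> z)" if "b \<in> Basis" "AE z in lborel. \<bar>k z\<bar> \<le> M" and [measurable]: "k \<in> borel_measurable borel" for k b
  proof (rule Bochner_Integration.integrable_bound[OF integrable_mult_right[OF test_pd_integrable[OF that(1)], of M]])
    have [measurable]: "pd b \<phi> \<in> borel_measurable borel" using test_pd_continuous[OF that(1)] by (rule borel_measurable_continuous_onI)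
    show "(\<lambda>z. k z * pd b \<phi> z) \<in> borel_measurable lborel" by measurable
    show "AE z in lborel. norm (k z * pd b \<phi> z) \<le> norm (M * pd b \<phi> z)"
      using that(2) by eventually_elim (simp add: abs_mult mult_right_mono)
  qed
  have br: "AE z in lborel. \<bar>r z\<bar> \<le> M" using bd by eventually_elim simp
  have bG: "AE z in lborel. \<bar>G z $ i\<bar> \<le> M" for i
    using bd by eventually_elim (rule order_trans[OF component_le_norm_cart], simp)
  have qi: "integrable lborel q"
    unfolding q_def
    by (intro Bochner_Integration.integrable_add bi B br bG) measurable
  define c0 c1 c2 c3 where "c0 b = (\<integral>z. indicator half_space z * pd b \<phi> z \<partial>lborel)"
    and "c1 b = (\<integral>z. indicator (wedge \<nu>1) z * pd b \<phi> z \<partial>lborel)"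
    and "c2 b = (\<integral>z. indicator (wedge \<nu>2) z * pd b \<phi> z \<partial>lborel)"
    and "c3 = (\<integral>x. indicator {x. x $ 2 < 0} x * \<phi> (0, x) \<partial>lborel)" for b
  have "(LINT z:half_space|lebesgue. w z * time_deriv \<phi> z + F z \<bullet> space_grad \<phi> z)
      = (\<integral>z. indicator half_space z * (w z * pd et \<phi> z + (F z $ 1 * pd e1 \<phi> z + F z $ 2 * pd e2 \<phi> z)) \<partial>lborel)"
    unfolding set_lebesgue_integral_def td sg real_scaleR_def by (rule integral_completion) measurable
  also have "\<dots> = (\<integral>z. (a3 * (indicator half_space z * pd et \<phi> z) + f3 $ 1 * (indicator half_space z * pd e1 \<phi> z) + f3 $ 2 * (indicator half_space z * pd e2 \<phi> z))
     + ((a2 - a3) * (indicator (wedge \<nu>2) z * pd et \<phi> z) + (f2 $ 1 - f3 $ 1) * (indicator (wedge \<nu>2) z * pd e1 \<phi> z) + (f2 $ 2 - f3 $ 2) * (indicator (wedge \<nu>2) z * pd e2 \<phi> z))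
     + ((a1 - a2) * (indicator (wedge \<nu>1) z * pd et \<phi> z) + (f1 $ 1 - f2 $ 1) * (indicator (wedge \<nu>1) z * pd e1 \<phi> z) + (f1 $ 2 - f2 $ 2) * (indicator (wedge \<nu>1) z * pd e2 \<phi> z))
     + q z \<partial>lborel)" (is "_ = (\<integral>z. ?rhs z \<partial>lborel)")
  proof (rule integral_cong_AE)
    show "(\<lambda>z. indicator half_space z * (w z * pd et \<phi> z + (F z $ 1 * pd e1 \<phi> z + F z $ 2 * pd e2 \<phi> z))) \<in> borel_measurable lborel" by measurable
    show "?rhs \<in> borel_measurable lborel" unfolding q_def by measurable
    show "AE z in lborel. indicator half_space z * (w z * pd et \<phi> z + (F z $ 1 * pd e1 \<phi> z + F z $ 2 * pd e2 \<phi> z)) = ?rhs z"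
      using AE_lborel_fst_ne_0 AE_lborel_line[of \<nu>1] AE_lborel_line[of \<nu>2]
    proof eventually_elim
      case (elim z)
      consider "fst z < 0" | "0 < fst z" "snd z $ 2 < \<nu>1 * fst z" | "0 < fst z" "\<nu>1 * fst z < snd z $ 2" "snd z $ 2 < \<nu>2 * fst z"
        | "0 < fst z" "\<nu>2 * fst z < snd z $ 2"
        using elim by linarith
      then show ?case
      proof cases
        case 1
        then have "r z = 0 \<and> G z = 0" by (intro zero) auto
        then show ?thesis using 1 by (simp add: wedge_def q_def indicator_def)
      next
        case 2
        have "\<nu>1 * fst z < \<nu>2 * fst z" using 2 \<nu> by simp
        then have "snd z $ 2 < \<nu>2 * fst z" using 2 by linarith
        moreover have "r z = 0 \<and> G z = 0" using 2 by (intro zero) auto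
        ultimately show ?thesis using 2 left[OF 2] by (simp add: wedge_def q_def indicator_def algebra_simps)
      next
        case 3
        then show ?thesis using mid[OF 3] by (simp add: wedge_def q_def indicator_def algebra_simps)
      next
        case 4
        have "\<nu>1 * fst z < \<nu>2 * fst z" using 4 \<nu> by simp
        then have "\<not> snd z $ 2 < \<nu>1 * fst z" using 4 by linarith
        moreover have "r z = 0 \<and> G z = 0" using 4 by (intro zero) auto
        ultimately show ?thesis using 4 right[OF 4] by (simp add: wedge_def q_def indicator_def)
      qed
    qed
  qed
  also have "\<dots> = (a3 * c0 et + f3 $ 1 * c0 e1 + f3 $ 2 * c0 e2) + ((a2 - a3) * c2 et + (f2 $ 1 - f3 $ 1) * c2 e1 + (f2 $ 2 - f3 $ 2) * c2 e2)
     + ((a1 - a2) * c1 et + (f1 $ 1 - f2 $ 1) * c1 e1 + (f1 $ 2 - f2 $ 2) * c1 e2) + (\<integral>z. q z \<partial>lborel)"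
    using i[OF B(1) half_space_borel] i[OF B(2) half_space_borel] i[OF B(1) wedge_borel] i[OF B(2) wedge_borel] qi
    by (simp add: c0_def c1_def c2_def)
  finally have 1: "(LINT z:half_space|lebesgue. w z * time_deriv \<phi> z + F z \<bullet> space_grad \<phi> z) = \<dots>" .
  have o: "open {x :: real ^ 2. x $ 2 < 0}" by (intro open_Collect_less continuous_intros)
  have ob[measurable]: "{x :: real ^ 2. x $ 2 < 0} \<in> sets borel" using o by simp
  have i0: "integrable lborel (\<lambda>x. indicator {x. x $ 2 < 0} x * \<phi> (0, x))"
    using integrable_indicator_scaleR[OF slice_integrable ob] by simp
  have [measurable]: "(\<lambda>x. \<phi> (0, x)) \<in> borel_measurable borel" using slice_integrable by auto
  have e: "(if x $ 2 < 0 then a1 else a3) * \<phi> (0, x) = a3 * \<phi> (0, x) + (a1 - a3) * (indicator {x. x $ 2 < 0} x * \<phi> (0, x))" for x :: "real ^ 2"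
    by (simp add: indicator_def algebra_simps)
  have "(LINT x|lebesgue. (if x $ 2 < 0 then a1 else a3) * \<phi> (0, x)) = (\<integral>x. a3 * \<phi> (0, x) + (a1 - a3) * (indicator {x. x $ 2 < 0} x * \<phi> (0, x)) \<partial>lborel)"
    unfolding e by (rule integral_completion) measurable
  also have "\<dots> = a3 * (\<integral>x. \<phi> (0, x) \<partial>lborel) + (a1 - a3) * c3"
    using slice_integrable i0 by (simp add: c3_def)
  finally have 2: "(LINT x|lebesgue. (if x $ 2 < 0 then a1 else a3) * \<phi> (0, x)) = \<dots>" .
  have c: "c0 et = - (\<integral>x. \<phi> (0, x) \<partial>lborel)" "c0 e1 = 0" "c0 e2 = 0" "c1 e1 = 0" "c2 e1 = 0"
    "c1 et = - c3 - \<nu>1 * c1 e2" "c2 et = - c3 - \<nu>2 * c2 e2"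
    unfolding c0_def c1_def c2_def c3_def
    by (rule integral_half_space_time integral_half_space_pd integral_wedge_pd1 integral_wedge_time)+
  show ?thesis unfolding weak_pairing_def 1 2 c by (simp add: c1_def[symmetric] c2_def[symmetric] q_def[symmetric] algebra_simps)
qed

end

lemma locally_integrable_bounded:
  fixes f :: "spacetime \<Rightarrow> 'b::{banach, second_countable_topology}"
  assumes [measurable]: "f \<in> borel_measurable borel" and b: "AE z in lborel. 0 < fst z \<longrightarrow> norm (f z) \<le> M"
  shows "locally_integrable f"
  unfolding locally_integrable_def
proof (intro allI impI)
  fix K :: "spacetime set" assume K: "compact K" "K \<subseteq> half_space"
  have [measurable]: "K \<in> sets borel" using K by (simp add: borel_compact)
  have "integrable lborel (\<lambda>z. indicator K z *\<^sub>R f z)"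
  proof (rule Bochner_Integration.integrable_bound[where f = "\<lambda>z. indicator K z * M"])
    show "integrable lborel (\<lambda>z. indicator K z * M)"
      using emeasure_compact_finite[OF K(1)] by (intro integrable_mult_left integrable_real_indicator) (auto simp: top.not_eq_extremum)
    show "AE z in lborel. norm (indicator K z *\<^sub>R f z) \<le> norm (indicator K z * M)"
      using b AE_lborel_fst_ne_0
    proof eventually_elim
      case (elim z)
      show ?case
      proof (cases "z \<in> K")
        case True
        then have "0 < fst z" using K(2) elim(2) by force
        then show ?thesis using elim(1) True by simp
      qed simp
    qed
  qed measurable
  then show "set_integrable lebesgue K f"
    unfolding set_integrable_def by (subst integrable_completion) auto
qed

section \<open>The algebra of the shock relations\<close>

text \<open>In the specific volume \<open>x = 1 / \<rho>\<close> the pressure law is \<open>x powr (- \<gamma>)\<close>, which is convex, and the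
  internal energy is an antiderivative of minus the pressure.\<close>

lemma powr_minus_tangent:
  fixes x y g :: real
  assumes x: "0 < x" "0 < y" and g: "0 \<le> g"
  shows "x powr (- g) - g * x powr (- g) / x * (y - x) \<le> y powr (- g)"
proof -
  have "1 - g * (y / x - 1) \<le> 1 - g * ln (y / x)"
    using ln_le_minus_one[of "y / x"] x g by (simp add: mult_left_mono)
  also have "\<dots> \<le> exp (- g * ln (y / x))" using exp_ge_add_one_self[of "- g * ln (y / x)"] by simp
  also have "\<dots> = (y / x) powr (- g)" using x by (simp add: powr_def)
  finally have "x powr (- g) * (1 - g * (y / x - 1)) \<le> x powr (- g) * (y / x) powr (- g)"
    by (intro mult_left_mono) auto
  also have "x powr (- g) * (y / x) powr (- g) = y powr (- g)"
    using x by (simp add: powr_mult[symmetric])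
  finally show ?thesis using x by (simp add: field_simps)
qed

text \<open>Here \<tau> is the drop of specific volume from an outer state to the middle one,
  \<open>q0\<close> the pressure in the middle, and \<open>k\<close> the negated slope of the
  pressure at the outer state \<open>a\<close>. If mass left the middle through \<open>a\<close>,
  then more would have to enter through \<open>b\<close>, and with a larger velocity jump.
  Monotonicity of the pressure excludes this for \<tau>b \<le> \<tau>a, convexity otherwise.\<close>

lemma flux_positive:
  fixes ja jb \<tau>a \<tau>b pa pb P q0 k :: real
  assumes \<tau>: "0 < \<tau>a" "0 < \<tau>b" and J: "0 < ja + jb" "0 < ja * \<tau>a + jb * \<tau>b"
    and P: "ja\<^sup>2 * \<tau>a + pa = P" "jb\<^sup>2 * \<tau>b + pb = P" "q0 \<le> P" "pa < q0"
    and k: "k * \<tau>a \<le> q0 - pa" "- k * (\<tau>b - \<tau>a) \<le> pb - pa" and mono: "\<tau>b \<le> \<tau>a \<Longrightarrow> pa \<le> pb"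
  shows "0 < ja"
proof (rule ccontr)
  assume "\<not> 0 < ja"
  moreover have "ja \<noteq> 0" using P by auto
  ultimately have ja: "ja < 0" by simp
  then have jb: "- ja < jb" "- ja * \<tau>a < jb * \<tau>b" using J by auto
  have Pa: "P - pa = ja\<^sup>2 * \<tau>a" and Pb: "P - pb = jb\<^sup>2 * \<tau>b" using P(1,2) by simp_all
  have sq: "ja\<^sup>2 < jb\<^sup>2" using power_strict_mono[OF jb(1), of 2] ja by simp
  show False
  proof (cases "\<tau>b \<le> \<tau>a")
    case True
    \<comment> \<open>The squared velocity jump across an interface is the stress jump P - p times
      \<tau>, and here both factors are at least as large on the side of \<open>a\<close>.\<close>
    have "(- ja * \<tau>a)\<^sup>2 < (jb * \<tau>b)\<^sup>2" using ja \<tau> by (intro power_strict_mono[OF jb(2)]) (auto simp: mult_nonpos_nonneg)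
    then have "(P - pa) * \<tau>a < (P - pb) * \<tau>b"
      unfolding Pa Pb by (simp add: power_mult_distrib power2_eq_square mult_ac)
    moreover have "(P - pb) * \<tau>b \<le> (P - pa) * \<tau>a"
    proof (rule mult_mono)
      show "P - pb \<le> P - pa" using mono True by simp
      show "0 \<le> P - pa" using P by simp
    qed (use True \<tau> in auto)
    ultimately show False by simp
  next
    case False
    have "(P - pa) * \<tau>b = ja\<^sup>2 * (\<tau>a * \<tau>b)" "(P - pb) * \<tau>a = jb\<^sup>2 * (\<tau>a * \<tau>b)" unfolding Pa Pb by simp_all
    moreover have "ja\<^sup>2 * (\<tau>a * \<tau>b) < jb\<^sup>2 * (\<tau>a * \<tau>b)" using sq \<tau> by simp
    ultimately have lt: "(P - pa) * \<tau>b < (P - pb) * \<tau>a" by linarith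
    \<comment> \<open>Two uses of the tangent at \<open>a\<close>: towards the middle volume the
      pressure rises at least at rate \<open>k\<close>, towards the outer volume of \<open>b\<close>
      it falls at most at rate \<open>k\<close>.\<close>
    have "(k * \<tau>a) * (\<tau>b - \<tau>a) \<le> (q0 - pa) * (\<tau>b - \<tau>a)" using k(1) False by (intro mult_right_mono) auto
    moreover have "(- k * (\<tau>b - \<tau>a)) * \<tau>a \<le> (pb - pa) * \<tau>a" using k(2) \<tau> by (intro mult_right_mono) auto
    moreover have "0 \<le> (P - q0) * (\<tau>b - \<tau>a)" using P(3) False by simp
    ultimately show False using lt by (simp add: algebra_simps)
  qed
qed

text \<open>Makes the system for the two fluxes explicitly solvable. On the right stand the total
  velocity jump and, by the momentum balance, the difference of the outer pressures, both known from
  the data; so the square of the flux sum is known. This is the origin of \<open>jj\<close>.\<close>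

lemma flux_sum_identity:
  fixes ja jb \<tau>a \<tau>b :: real
  shows "\<tau>a * \<tau>b * (ja + jb)\<^sup>2 = (ja * \<tau>a + jb * \<tau>b)\<^sup>2 - (\<tau>b - \<tau>a) * (jb\<^sup>2 * \<tau>b - ja\<^sup>2 * \<tau>a)"
  by (simp add: power2_eq_square algebra_simps)

text \<open>The sign of the derivative of the action: the trapezoidal bound on the energy differences makes
  everything cancel except the terms with \<open>s\<close>.\<close>

lemma action_derivative_negative:
  fixes j1 j2 d1 d2 \<tau>1 \<tau>2 p1 p2 X1 X2 P Pd q qd s :: real
  assumes j: "0 < j1" "0 < j2" "0 < s" and d: "d1 * \<tau>1 + d2 * \<tau>2 = j1 + j2" and \<tau>: "0 < \<tau>1" "0 < \<tau>2"
    and Pd: "Pd = 2 * j1 * d1 * \<tau>1 - j1\<^sup>2" "Pd = 2 * j2 * d2 * \<tau>2 - j2\<^sup>2"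
    and P: "j1\<^sup>2 * \<tau>1 + p1 = P" "j2\<^sup>2 * \<tau>2 + p2 = P" "q \<le> P" and qd: "qd \<le> 0"
    and X: "X1 \<le> \<tau>1 * (q + p1) / 2" "X2 \<le> \<tau>2 * (q + p2) / 2"
  shows "d1 * (\<tau>1 * (P + p1) / 2 + X1 - (P - q) * s / 2) + j1 * (- (P + p1) / 2 + \<tau>1 * Pd / 2 - q - (Pd - qd) * s / 2 - (P - q) / 2)
    + (d2 * (\<tau>2 * (P + p2) / 2 + X2 - (P - q) * s / 2) + j2 * (- (P + p2) / 2 + \<tau>2 * Pd / 2 - q - (Pd - qd) * s / 2 - (P - q) / 2)) < 0"
proof -
  \<comment> \<open>The constraint on \<open>d1\<close> and \<open>d2\<close> is rewritten in terms
    of \<open>Pd\<close> alone. It makes \<open>Pd\<close> a positive multiple of the flux sum, and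
    then \<open>d1\<close> and \<open>d2\<close> are positive too, which allows the energy bounds to
    be multiplied by them.\<close>
  have d1: "d1 * \<tau>1 = (Pd + j1\<^sup>2) / (2 * j1)" and d2: "d2 * \<tau>2 = (Pd + j2\<^sup>2) / (2 * j2)"
    using Pd j by (simp_all add: field_simps power2_eq_square)
  have "Pd / (2 * j1) + j1 / 2 + (Pd / (2 * j2) + j2 / 2) = j1 + j2"
    using d j unfolding d1 d2 by (simp add: add_divide_distrib power2_eq_square)
  then have "Pd * (1 / (2 * j1) + 1 / (2 * j2)) = (j1 + j2) / 2" by (simp add: algebra_simps add_divide_distrib)
  moreover have "0 < 1 / (2 * j1) + 1 / (2 * j2)" "0 < (j1 + j2) / 2" using j by (simp_all add: add_pos_pos)
  ultimately have Pd0: "0 < Pd" by (metis zero_less_mult_pos2)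
  have dp: "0 < d1" "0 < d2"
  proof -
    have "0 < d1 * \<tau>1" "0 < d2 * \<tau>2" unfolding d1 d2 using Pd0 j by (simp_all add: add_pos_nonneg)
    then show "0 < d1" "0 < d2" using \<tau> by (simp_all add: zero_less_mult_iff)
  qed
  have "d1 * X1 \<le> d1 * (\<tau>1 * (q + p1) / 2)" "d2 * X2 \<le> d2 * (\<tau>2 * (q + p2) / 2)"
    using X dp by (auto intro!: mult_left_mono)
  moreover have "j1 * (\<tau>1 * Pd / 2) = d1 * \<tau>1 * (P - p1) - j1 * (P - p1) / 2"
  proof -
    have "j1 * (\<tau>1 * Pd / 2) = d1 * \<tau>1 * (j1\<^sup>2 * \<tau>1) - j1 * (j1\<^sup>2 * \<tau>1) / 2"
      unfolding Pd(1) by (simp add: power2_eq_square field_simps)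
    then show ?thesis using P(1) by (simp add: eq_diff_eq[symmetric])
  qed
  moreover have "j2 * (\<tau>2 * Pd / 2) = d2 * \<tau>2 * (P - p2) - j2 * (P - p2) / 2"
  proof -
    have "j2 * (\<tau>2 * Pd / 2) = d2 * \<tau>2 * (j2\<^sup>2 * \<tau>2) - j2 * (j2\<^sup>2 * \<tau>2) / 2"
      unfolding Pd(2) by (simp add: power2_eq_square field_simps)
    then show ?thesis using P(2) by (simp add: eq_diff_eq[symmetric])
  qed
  moreover have "(d1 * \<tau>1 + d2 * \<tau>2) * (P + q / 2) = (j1 + j2) * (P + q / 2)" "(d1 * \<tau>1 + d2 * \<tau>2) * P = (j1 + j2) * P"
     "(d1 * \<tau>1 + d2 * \<tau>2) * q = (j1 + j2) * q" using d by simp_all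
  moreover have "0 \<le> (j1 + j2) * (- qd * s)" by (intro mult_nonneg_nonneg) (use j qd in auto)
  moreover have "0 < (j1 + j2) * (Pd * s)" "0 \<le> (d1 + d2) * ((P - q) * s)"
    using j Pd0 qd P(3) dp by (auto intro!: mult_nonneg_nonneg mult_pos_pos add_pos_pos)
  ultimately show ?thesis
    by (simp only: algebra_simps add_divide_distrib diff_divide_distrib times_divide_eq_right times_divide_eq_left
        minus_divide_left[symmetric] mult_minus_right mult_minus_left minus_add_distrib)
qed

section \<open>The shock relations in specific volume and mass fluxes\<close>

locale shock_data =
  fixes D :: euler_riemann and \<gamma> :: real
  assumes gamma: "1 \<le> \<gamma>"
    and pressure_law: "\<And>\<rho>. 0 < \<rho> \<Longrightarrow> pressure D \<rho> = \<rho> powr \<gamma>"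
    and energy_law: "\<And>\<rho>. 0 < \<rho> \<Longrightarrow> (internal_energy D has_real_derivative pressure D \<rho> / \<rho>\<^sup>2) (at \<rho>)"
    and two_shock: "two_shock_data D"
begin

abbreviation "rm \<equiv> rho_minus D"
abbreviation "rp \<equiv> rho_plus D"
abbreviation "um \<equiv> vb_minus D"
abbreviation "up \<equiv> vb_plus D"
abbreviation "pm \<equiv> pressure D rm"
abbreviation "pp \<equiv> pressure D rp"

definition pr :: "real \<Rightarrow> real" where "pr x = x powr (- \<gamma>)"
definition en :: "real \<Rightarrow> real" where "en x = internal_energy D (1 / x)"
definition tm :: "real \<Rightarrow> real" where "tm x = 1 / rm - x"
definition tp :: "real \<Rightarrow> real" where "tp x = 1 / rp - x"

definition dissip :: real where
  "dissip = rm * rp * (um - up)\<^sup>2 - (rp - rm) * (pp - pm)"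

text \<open>The mass fluxes through the two interfaces and their sum, as functions of the specific volume
  of the middle state.\<close>

definition jj :: "real \<Rightarrow> real" where "jj x = sqrt (dissip / (rm * rp * (tm x * tp x)))"
text \<open>The velocity jump and the known sum of the fluxes form a linear system that degenerates
  for equal outer densities. In that case the momentum balance makes the two fluxes equal.\<close>

definition jp :: "real \<Rightarrow> real" where "jp x = (if rm = rp then jj x / 2 else (um - up - jj x * tm x) / (1 / rp - 1 / rm))"
definition jm :: "real \<Rightarrow> real" where "jm x = jj x - jp x"
text \<open>The effective pressure p(\<rho>1) + \<rho>1 \<epsilon>1 of the middle state. Thus
  \<epsilon>1 \<ge> 0 means \<open>pr x \<le> PP x\<close>, with equality for the two shock
  solution.\<close>

definition PP :: "real \<Rightarrow> real" where "PP x = pm + (jm x)\<^sup>2 * tm x"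

lemma data_pos: "0 < rm" "0 < rp" "up < um" "0 < dissip"
  using two_shock by (auto simp: two_shock_data_def dissip_def)

definition vol :: "real set" where "vol = {x. 0 < x \<and> x < 1 / rm \<and> x < 1 / rp}"

lemma vol_iff: "0 < \<rho> \<Longrightarrow> 1 / \<rho> \<in> vol \<longleftrightarrow> max rm rp < \<rho>"
  using data_pos by (auto simp: vol_def field_simps)

lemma open_vol: "open vol"
proof -
  have "vol = {0<..<1 / rm} \<inter> {..<1 / rp}" by (auto simp: vol_def)
  then show ?thesis by (simp add: open_Int)
qed

lemma vol_pos: "x \<in> vol \<Longrightarrow> 0 < x" "x \<in> vol \<Longrightarrow> 0 < tm x" "x \<in> vol \<Longrightarrow> 0 < tp x"
  by (auto simp: vol_def tm_def tp_def)

lemma pr_eq: "0 < x \<Longrightarrow> pr x = pressure D (1 / x)"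
  by (simp add: pr_def pressure_law powr_minus_divide powr_divide)

lemma pr_tm: "pr (x + tm x) = pm" "pr (x + tp x) = pp"
  using data_pos pr_eq[of "1 / rm"] pr_eq[of "1 / rp"] by (simp_all add: tm_def tp_def)

lemma pr_tangent: "0 < x \<Longrightarrow> 0 < y \<Longrightarrow> pr x - \<gamma> * pr x / x * (y - x) \<le> pr y"
  unfolding pr_def using gamma by (intro powr_minus_tangent) auto

lemma pr_antimono: "0 < x \<Longrightarrow> x < y \<Longrightarrow> pr y < pr x"
  unfolding pr_def using gamma by (intro powr_less_mono2_neg) auto

lemma DERIV_pr: "0 < x \<Longrightarrow> (pr has_real_derivative - (\<gamma> * pr x / x)) (at x)"
proof -
  assume x: "0 < x"
  have "((\<lambda>x. x powr (- \<gamma>)) has_real_derivative (- \<gamma>) * x powr (- \<gamma> - 1)) (at x)"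
    using x by (rule has_real_derivative_powr)
  moreover have "(- \<gamma>) * x powr (- \<gamma> - 1) = - (\<gamma> * pr x / x)" using x by (simp add: pr_def powr_diff)
  ultimately show ?thesis by (simp add: pr_def[abs_def])
qed

lemma DERIV_en: "0 < x \<Longrightarrow> (en has_real_derivative - pr x) (at x)"
proof -
  assume x: "0 < x"
  have "((\<lambda>x. 1 / x) has_real_derivative - (1 / x\<^sup>2)) (at x)"
    using x by (auto intro!: derivative_eq_intros simp: power2_eq_square)
  from DERIV_chain2[OF energy_law[of "1 / x"] this] x
  have "(en has_real_derivative pressure D (1 / x) / (1 / x)\<^sup>2 * - (1 / x\<^sup>2)) (at x)" by (simp add: en_def[abs_def])
  then show ?thesis using x by (simp add: pr_eq power_divide)
qed

text \<open>The left side is the integral of the pressure between two volumes, and for a convex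
  function the trapezoidal rule overestimates it. The proof differentiates in the lower end, where
  the tangent inequality gives the sign.\<close>

lemma trapezoid:
  assumes x: "0 < x" "x \<le> y"
  shows "en x - en y \<le> (y - x) * (pr x + pr y) / 2"
proof -
  define k where "k x = (y - x) * (pr x + pr y) / 2 - en x" for x
  have "k y \<le> k x"
  proof (rule DERIV_nonpos_imp_nonincreasing[OF x(2)])
    fix z assume z: "x \<le> z" "z \<le> y"
    then have z0: "0 < z" using x by simp
    have "(k has_real_derivative ((y - z) * (- (\<gamma> * pr z / z)) + (- 1) * (pr z + pr y)) / 2 - (- pr z)) (at z)"
      unfolding k_def by (auto intro!: derivative_eq_intros DERIV_pr DERIV_en z0)
    moreover have "((y - z) * (- (\<gamma> * pr z / z)) + (- 1) * (pr z + pr y)) / 2 - (- pr z) \<le> 0"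
    proof -
      define W where "W = \<gamma> * pr z / z * (y - z)"
      have e: "(y - z) * (- (\<gamma> * pr z / z)) = - W" by (simp add: W_def)
      have "0 < y" using z x by linarith
      then have "pr z - W \<le> pr y" unfolding W_def by (rule pr_tangent[OF z0])
      then show ?thesis unfolding e by (simp add: divide_simps)
    qed
    ultimately show "\<exists>d. (k has_real_derivative d) (at z) \<and> d \<le> 0" by blast
  qed
  then show ?thesis by (simp add: k_def)
qed

text \<open>The outer states have volumes \<open>x + tm x\<close> and \<open>x + tp x\<close>. These
  two bounds decide both the entropy production across the shocks and the sign of the derivative of
  \<open>Phi\<close>.\<close>

lemma energy_jump:
  assumes "x \<in> vol"
  shows "en x - internal_energy D rm \<le> tm x * (pr x + pm) / 2" "en x - internal_energy D rp \<le> tp x * (pr x + pp) / 2"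
  using trapezoid[of x "x + tm x"] trapezoid[of x "x + tp x"] vol_pos[OF assms] pr_tm[of x]
  by (simp_all add: en_def tm_def tp_def)

lemma jj_pos: "x \<in> vol \<Longrightarrow> 0 < jj x"
  unfolding jj_def using vol_pos data_pos by simp

lemma jj_sq: "x \<in> vol \<Longrightarrow> tm x * tp x * (jj x)\<^sup>2 = (um - up)\<^sup>2 - (tp x - tm x) * (pm - pp)"
proof -
  assume x: "x \<in> vol"
  have "(jj x)\<^sup>2 = dissip / (rm * rp * (tm x * tp x))"
    unfolding jj_def using vol_pos[OF x] data_pos by (intro real_sqrt_pow2) (simp add: less_imp_le)
  then have "tm x * tp x * (jj x)\<^sup>2 = dissip / (rm * rp)" using vol_pos[OF x] data_pos by simp
  also have "\<dots> = (um - up)\<^sup>2 - (tp x - tm x) * (pm - pp)"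
    using data_pos by (simp add: dissip_def tm_def tp_def field_simps)
  finally show ?thesis .
qed

lemma flux_relations:
  assumes x: "x \<in> vol"
  shows "jm x * tm x + jp x * tp x = um - up" "(jm x)\<^sup>2 * tm x + pm = (jp x)\<^sup>2 * tp x + pp" "0 < jm x + jp x"
proof -
  show 3: "0 < jm x + jp x" using jj_pos[OF x] by (simp add: jm_def)
  have d: "tp x - tm x = 1 / rp - 1 / rm" by (simp add: tm_def tp_def)
  have s: "jm x + jp x = jj x" by (simp add: jm_def)
  show 1: "jm x * tm x + jp x * tp x = um - up"
  proof (cases "rm = rp")
    case True
    then have t: "tp x = tm x" by (simp add: tm_def tp_def)
    have "(tm x * jj x)\<^sup>2 = (um - up)\<^sup>2" using jj_sq[OF x] True t by (simp add: power2_eq_square mult_ac)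
    then have "tm x * jj x = um - up"
      using vol_pos[OF x] jj_pos[OF x] data_pos by (simp add: power2_eq_iff_nonneg)
    then show ?thesis using True t by (simp add: jm_def jp_def algebra_simps)
  next
    case False
    then have "1 / rp - 1 / rm \<noteq> 0" using data_pos by (simp add: field_simps)
    then have "jp x * (tp x - tm x) = um - up - jj x * tm x" unfolding d using False by (simp add: jp_def)
    then show ?thesis by (simp add: jm_def algebra_simps)
  qed
  show "(jm x)\<^sup>2 * tm x + pm = (jp x)\<^sup>2 * tp x + pp"
  proof (cases "rm = rp")
    case True
    then show ?thesis by (simp add: jm_def jp_def tm_def tp_def)
  next
    case False
    have "(tp x - tm x) * ((jp x)\<^sup>2 * tp x - (jm x)\<^sup>2 * tm x) = (tp x - tm x) * (pm - pp)"
      using flux_sum_identity[of "tm x" "tp x" "jm x" "jp x"] jj_sq[OF x] unfolding s 1 by linarith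
    moreover have "tp x - tm x \<noteq> 0" unfolding d using False data_pos by (simp add: field_simps)
    ultimately show ?thesis by simp
  qed
qed

text \<open>\<open>flux_sum_identity\<close> fixes the sum of the fluxes up to sign, and the
  ordering of the interfaces selects the positive root. The individual fluxes then follow from the
  velocity jump, or by symmetry if the outer densities agree.\<close>

lemma flux_unique:
  assumes x: "x \<in> vol" and a: "a * tm x + b * tp x = um - up" "a\<^sup>2 * tm x + pm = b\<^sup>2 * tp x + pp" "0 < a + b"
  shows "a = jm x \<and> b = jp x"
proof -
  have "tm x * tp x * (a + b)\<^sup>2 = tm x * tp x * (jj x)\<^sup>2"
  proof -
    have e: "b\<^sup>2 * tp x - a\<^sup>2 * tm x = pm - pp" using a(2) by linarith
    show ?thesis unfolding jj_sq[OF x] flux_sum_identity a(1) e ..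
  qed
  then have "(a + b)\<^sup>2 = (jj x)\<^sup>2" using vol_pos[OF x] by simp
  then have ab: "a + b = jj x" using a(3) jj_pos[OF x] by (simp add: power2_eq_iff_nonneg)
  show ?thesis
  proof (cases "rm = rp")
    case True
    then have "a\<^sup>2 = b\<^sup>2" using a(2) vol_pos[OF x] by (simp add: tm_def tp_def)
    then have "a = b" using a(3) by (auto simp: power2_eq_iff)
    then show ?thesis using ab True by (simp add: jm_def jp_def)
  next
    case False
    then have n: "1 / rp - 1 / rm \<noteq> 0" using data_pos by (simp add: field_simps)
    have "b * (tp x - tm x) = um - up - (a + b) * tm x" using a(1) by (simp add: algebra_simps)
    then have "b * (1 / rp - 1 / rm) = um - up - jj x * tm x" unfolding ab by (simp add: tm_def tp_def)
    then have "b = jp x" using n False by (simp add: jp_def nonzero_eq_divide_eq)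
    then show ?thesis using ab by (simp add: jm_def)
  qed
qed

text \<open>The mass fluxes \<open>a\<close> and \<open>c\<close> relative to the interfaces are the
  right unknowns. The mass balances become velocity jumps proportional to volume drops, and the
  momentum balances become two expressions for the same stress, so \<open>flux_unique\<close>
  applies.\<close>

lemma fan_relations_fluxes:
  assumes \<rho>: "max rm rp < \<rho>" and f: "fan_relations D \<rho> nm np b e"
  shows "nm = um - jm (1 / \<rho>) / rm \<and> np = up + jp (1 / \<rho>) / rp \<and> b = um - jm (1 / \<rho>) * tm (1 / \<rho>)
    \<and> e = (PP (1 / \<rho>) - pr (1 / \<rho>)) / \<rho>"
proof -
  have \<rho>0: "0 < \<rho>" using \<rho> data_pos by simp
  have v: "1 / \<rho> \<in> vol" using \<rho> vol_iff[OF \<rho>0] by simp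
  note f = f[unfolded fan_relations_def]
  define a c where "a = rm * (um - nm)" and "c = rp * (np - up)"
  have m1: "\<rho> * (b - nm) = a" and m2: "\<rho> * (np - b) = c" using f by (simp_all add: a_def c_def algebra_simps)
  have u1: "a * tm (1 / \<rho>) = um - b"
  proof -
    have "a * tm (1 / \<rho>) = a / rm - a / \<rho>" by (simp add: tm_def right_diff_distrib)
    also have "a / rm = um - nm" using data_pos by (simp add: a_def)
    also have "a / \<rho> = b - nm" unfolding m1[symmetric] using \<rho>0 by simp
    finally show ?thesis by simp
  qed
  have u2: "c * tp (1 / \<rho>) = b - up"
  proof -
    have "c * tp (1 / \<rho>) = c / rp - c / \<rho>" by (simp add: tp_def right_diff_distrib)
    also have "c / rp = np - up" using data_pos by (simp add: c_def)
    also have "c / \<rho> = np - b" unfolding m2[symmetric] using \<rho>0 by simp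
    finally show ?thesis by simp
  qed
  have p: "pressure D \<rho> = pr (1 / \<rho>)" using \<rho>0 pr_eq[of "1 / \<rho>"] by simp
  have q1: "\<rho> * e + pr (1 / \<rho>) = pm + a * (um - b)"
  proof -
    have "nm * (rm * um - \<rho> * b) = rm * um\<^sup>2 + pm - \<rho> * (b\<^sup>2 + e) - pressure D \<rho>" using f by blast
    moreover have "rm * um\<^sup>2 - nm * (rm * um) = a * um" by (simp add: a_def power2_eq_square algebra_simps)
    moreover have "\<rho> * b\<^sup>2 - nm * (\<rho> * b) = a * b" unfolding m1[symmetric] by (simp add: power2_eq_square algebra_simps)
    ultimately show ?thesis unfolding p by (simp add: algebra_simps)
  qed
  have q2: "\<rho> * e + pr (1 / \<rho>) = pp + c * (b - up)"
  proof -
    have "np * (rp * up - \<rho> * b) = rp * up\<^sup>2 + pp - \<rho> * (b\<^sup>2 + e) - pressure D \<rho>" using f by blast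
    moreover have "rp * up\<^sup>2 - np * (rp * up) = - c * up" by (simp add: c_def power2_eq_square algebra_simps)
    moreover have "\<rho> * b\<^sup>2 - np * (\<rho> * b) = - c * b" unfolding m2[symmetric] by (simp add: power2_eq_square algebra_simps)
    ultimately show ?thesis unfolding p by (simp add: algebra_simps)
  qed
  have "0 < a + c"
  proof -
    have "a + c = \<rho> * (np - nm)" unfolding m1[symmetric] m2[symmetric] by (simp add: algebra_simps)
    then show ?thesis using f \<rho>0 by simp
  qed
  moreover have "a * tm (1 / \<rho>) + c * tp (1 / \<rho>) = um - up" unfolding u1 u2 by simp
  moreover have "a\<^sup>2 * tm (1 / \<rho>) + pm = c\<^sup>2 * tp (1 / \<rho>) + pp"
    using q1 q2 unfolding u1[symmetric] u2[symmetric] by (simp add: power2_eq_square algebra_simps)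
  ultimately have ac: "a = jm (1 / \<rho>)" "c = jp (1 / \<rho>)" using flux_unique[OF v] by blast+
  have "nm = um - a / rm" "np = up + c / rp" using data_pos by (simp_all add: a_def c_def)
  moreover have "b = um - a * tm (1 / \<rho>)" using u1 by simp
  moreover have "e = (PP (1 / \<rho>) - pr (1 / \<rho>)) / \<rho>"
    using q1 \<rho>0 unfolding u1[symmetric] PP_def ac[symmetric] by (simp add: field_simps power2_eq_square)
  ultimately show ?thesis using ac by simp
qed

lemma fluxes_fan_relations:
  assumes \<rho>: "max rm rp < \<rho>"
  shows "fan_relations D \<rho> (um - jm (1 / \<rho>) / rm) (up + jp (1 / \<rho>) / rp) (um - jm (1 / \<rho>) * tm (1 / \<rho>))
    ((PP (1 / \<rho>) - pr (1 / \<rho>)) / \<rho>)"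
proof -
  have \<rho>0: "0 < \<rho>" using \<rho> data_pos by simp
  have v: "1 / \<rho> \<in> vol" using \<rho> vol_iff[OF \<rho>0] by simp
  define a c where "a = jm (1 / \<rho>)" and "c = jp (1 / \<rho>)"
  define b nm np e where "b = um - a * tm (1 / \<rho>)" and "nm = um - a / rm" and "np = up + c / rp"
    and "e = (PP (1 / \<rho>) - pr (1 / \<rho>)) / \<rho>"
  note r = flux_relations[OF v, folded a_def c_def]
  have b2: "b = up + c * tp (1 / \<rho>)" using r(1) by (simp add: b_def)
  have "b - nm = a / \<rho>" by (simp add: b_def nm_def tm_def right_diff_distrib)
  then have m1: "\<rho> * (b - nm) = a" using \<rho>0 by simp
  have "np - b = c / \<rho>" by (simp add: b2 np_def tp_def right_diff_distrib)
  then have m2: "\<rho> * (np - b) = c" using \<rho>0 by simp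
  have a2: "rm * (um - nm) = a" "rp * (np - up) = c" using data_pos by (simp_all add: nm_def np_def)
  have p: "pressure D \<rho> = pr (1 / \<rho>)" using \<rho>0 pr_eq[of "1 / \<rho>"] by simp
  have q1: "\<rho> * e + pr (1 / \<rho>) = pm + a * (um - b)"
    using \<rho>0 by (simp add: e_def PP_def a_def[symmetric] b_def power2_eq_square)
  have q2: "\<rho> * e + pr (1 / \<rho>) = pp + c * (b - up)"
    using q1 r(2) by (simp add: b_def) (simp add: b_def[symmetric] b2 power2_eq_square algebra_simps)
  have "fan_relations D \<rho> nm np b e"
    unfolding fan_relations_def
  proof (intro conjI)
    have "\<rho> * (np - nm) = a + c" unfolding m1[symmetric] m2[symmetric] by (simp add: algebra_simps)
    then have "0 < \<rho> * (np - nm)" using r(3) by simp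
    then show "nm < np" using \<rho>0 by (simp add: zero_less_mult_iff)
    show "nm * (rm - \<rho>) = rm * um - \<rho> * b" using m1 a2(1) by (simp add: algebra_simps)
    show "np * (rp - \<rho>) = rp * up - \<rho> * b" using m2 a2(2) by (simp add: algebra_simps)
    have "rm * um\<^sup>2 - nm * (rm * um) = a * um" unfolding a2(1)[symmetric] by (simp add: power2_eq_square algebra_simps)
    moreover have "\<rho> * b\<^sup>2 - nm * (\<rho> * b) = a * b" unfolding m1[symmetric] by (simp add: power2_eq_square algebra_simps)
    ultimately show "nm * (rm * um - \<rho> * b) = rm * um\<^sup>2 + pm - \<rho> * (b\<^sup>2 + e) - pressure D \<rho>"
      unfolding p using q1 by (simp add: algebra_simps)
    have "rp * up\<^sup>2 - np * (rp * up) = - c * up" unfolding a2(2)[symmetric] by (simp add: power2_eq_square algebra_simps)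
    moreover have "\<rho> * b\<^sup>2 - np * (\<rho> * b) = - c * b" unfolding m2[symmetric] by (simp add: power2_eq_square algebra_simps)
    ultimately show "np * (rp * up - \<rho> * b) = rp * up\<^sup>2 + pp - \<rho> * (b\<^sup>2 + e) - pressure D \<rho>"
      unfolding p using q2 by (simp add: algebra_simps)
  qed
  then show ?thesis by (simp add: nm_def np_def b_def e_def a_def c_def)
qed

text \<open>Existence and uniqueness give the definite description in \<open>fan_values\<close> its
  value; everything later uses these explicit formulas.\<close>

lemma fan_values_eq:
  assumes "max rm rp < \<rho>"
  shows "nu_minus D \<rho> = um - jm (1 / \<rho>) / rm" "nu_plus D \<rho> = up + jp (1 / \<rho>) / rp"
    "beta D \<rho> = um - jm (1 / \<rho>) * tm (1 / \<rho>)" "eps1 D \<rho> = (PP (1 / \<rho>) - pr (1 / \<rho>)) / \<rho>"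
    "fan_relations D \<rho> (nu_minus D \<rho>) (nu_plus D \<rho>) (beta D \<rho>) (eps1 D \<rho>)"
proof -
  have "fan_values D \<rho> = (um - jm (1 / \<rho>) / rm, up + jp (1 / \<rho>) / rp, um - jm (1 / \<rho>) * tm (1 / \<rho>), (PP (1 / \<rho>) - pr (1 / \<rho>)) / \<rho>)"
    unfolding fan_values_def
  proof (rule the_equality)
    show "case (um - jm (1 / \<rho>) / rm, up + jp (1 / \<rho>) / rp, um - jm (1 / \<rho>) * tm (1 / \<rho>), (PP (1 / \<rho>) - pr (1 / \<rho>)) / \<rho>) of
      (nm, np, b, e) \<Rightarrow> fan_relations D \<rho> nm np b e" using fluxes_fan_relations[OF assms] by simp
    fix x assume "case x of (nm, np, b, e) \<Rightarrow> fan_relations D \<rho> nm np b e"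
    then show "x = (um - jm (1 / \<rho>) / rm, up + jp (1 / \<rho>) / rp, um - jm (1 / \<rho>) * tm (1 / \<rho>), (PP (1 / \<rho>) - pr (1 / \<rho>)) / \<rho>)"
      using fan_relations_fluxes[OF assms] by (auto split: prod.splits)
  qed
  then show "nu_minus D \<rho> = um - jm (1 / \<rho>) / rm" "nu_plus D \<rho> = up + jp (1 / \<rho>) / rp"
    "beta D \<rho> = um - jm (1 / \<rho>) * tm (1 / \<rho>)" "eps1 D \<rho> = (PP (1 / \<rho>) - pr (1 / \<rho>)) / \<rho>"
    by (simp_all add: nu_minus_def nu_plus_def beta_def eps1_def)
  then show "fan_relations D \<rho> (nu_minus D \<rho>) (nu_plus D \<rho>) (beta D \<rho>) (eps1 D \<rho>)"
    using fluxes_fan_relations[OF assms] by simp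
qed

text \<open>Fluid enters the middle region through both interfaces. The hypothesis is \<epsilon>1
  \<ge> 0, and the slopes passed to \<open>flux_positive\<close> are those of the pressure at the
  two outer volumes.\<close>

lemma fluxes_positive:
  assumes x: "x \<in> vol" and P: "pr x \<le> PP x"
  shows "0 < jm x" "0 < jp x"
proof -
  note r = flux_relations[OF x]
  have Pp: "(jp x)\<^sup>2 * tp x + pp = PP x" and Pm: "(jm x)\<^sup>2 * tm x + pm = PP x" using r(2) by (simp_all add: PP_def)
  have x0: "0 < x" "0 < x + tm x" "0 < x + tp x" using vol_pos[OF x] by simp_all
  have lt: "pm < pr x" "pp < pr x"
    using pr_antimono[of x "x + tm x"] pr_antimono[of x "x + tp x"] vol_pos[OF x] pr_tm[of x] by auto
  have mono: "pm \<le> pp" if "tp x \<le> tm x"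
    using that pr_antimono[of "x + tp x" "x + tm x"] x0 pr_tm[of x] by (cases "tp x = tm x") auto
  have mono': "pp \<le> pm" if "tm x \<le> tp x"
    using that pr_antimono[of "x + tm x" "x + tp x"] x0 pr_tm[of x] by (cases "tp x = tm x") auto
  show "0 < jm x"
  proof (rule flux_positive[OF vol_pos(2,3)[OF x] r(3) _ Pm Pp P lt(1) _ _ mono])
    show "0 < jm x * tm x + jp x * tp x" using r(1) data_pos by simp
    show "\<gamma> * pm / (x + tm x) * tm x \<le> pr x - pm"
      using pr_tangent[OF x0(2,1)] pr_tm[of x] by simp
    show "- (\<gamma> * pm / (x + tm x)) * (tp x - tm x) \<le> pp - pm"
      using pr_tangent[OF x0(2,3)] pr_tm[of x] by simp
  qed
  show "0 < jp x"
  proof (rule flux_positive[OF vol_pos(3,2)[OF x] _ _ Pp Pm P lt(2) _ _ mono'])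
    show "0 < jp x + jm x" "0 < jp x * tp x + jm x * tm x" using r(1,3) data_pos by simp_all
    show "\<gamma> * pp / (x + tp x) * tp x \<le> pr x - pp"
      using pr_tangent[OF x0(3,1)] pr_tm[of x] by simp
    show "- (\<gamma> * pp / (x + tp x)) * (tm x - tp x) \<le> pm - pp"
      using pr_tangent[OF x0(3,2)] pr_tm[of x] by simp
  qed
qed

section \<open>Monotonicity of the action in the specific volume\<close>

lemma flux_derivatives:
  assumes x: "x \<in> vol"
  obtains dm dp where "(jm has_real_derivative dm) (at x)" "(jp has_real_derivative dp) (at x)"
    "dm * tm x + dp * tp x = jm x + jp x" "2 * jm x * dm * tm x - (jm x)\<^sup>2 = 2 * jp x * dp * tp x - (jp x)\<^sup>2"
    "(PP has_real_derivative 2 * jm x * dm * tm x - (jm x)\<^sup>2) (at x)"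
proof -
  have t: "(tm has_real_derivative - 1) (at y)" "(tp has_real_derivative - 1) (at y)" for y
    unfolding tm_def[abs_def] tp_def[abs_def] by (auto intro!: derivative_eq_intros)
  \<comment> \<open>The explicit formulas serve only to show differentiability. The values of the
    derivatives enter through the two flux relations, which hold on an open set and may be
    differentiated there.\<close>
  have "\<exists>d. (jj has_real_derivative d) (at x)"
  proof -
    have n: "rm * rp * (tm x * tp x) \<noteq> 0" "0 < dissip / (rm * rp * (tm x * tp x))"
      using vol_pos[OF x] data_pos by simp_all
    show ?thesis unfolding jj_def[abs_def]
      using n by (intro exI) (auto intro!: derivative_eq_intros t)
  qed
  then obtain d where d: "(jj has_real_derivative d) (at x)" by blast
  have "\<exists>d. (jp has_real_derivative d) (at x)"
  proof (cases "rm = rp")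
    case True
    then have "jp = (\<lambda>x. jj x / 2)" by (simp add: fun_eq_iff jp_def)
    then show ?thesis using DERIV_cdivide[OF d, of 2] by auto
  next
    case False
    then have e: "jp = (\<lambda>x. (um - up - jj x * tm x) / (1 / rp - 1 / rm))" by (simp add: fun_eq_iff jp_def)
    have "((\<lambda>x. um - up - jj x * tm x) has_real_derivative (0 - (d * tm x + (- 1) * jj x))) (at x)"
      by (intro DERIV_diff DERIV_const DERIV_mult d t)
    then show ?thesis unfolding e using DERIV_cdivide by blast
  qed
  then obtain dp where dp: "(jp has_real_derivative dp) (at x)" by blast
  have dm: "(jm has_real_derivative (d - dp)) (at x)" unfolding jm_def[abs_def] by (intro DERIV_diff d dp)
  let ?dm = "d - dp"
  have sq: "((\<lambda>x. (jm x)\<^sup>2 * tm x + pm) has_real_derivative 2 * jm x * ?dm * tm x - (jm x)\<^sup>2) (at x)"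
    "((\<lambda>x. (jp x)\<^sup>2 * tp x + pp) has_real_derivative 2 * jp x * dp * tp x - (jp x)\<^sup>2) (at x)"
    by (auto intro!: derivative_eq_intros dm dp t simp: power2_eq_square)
  have "((\<lambda>x. jm x * tm x + jp x * tp x) has_real_derivative (?dm * tm x - jm x + (dp * tp x - jp x))) (at x)"
    by (auto intro!: derivative_eq_intros dm dp t)
  moreover have "((\<lambda>x. jm x * tm x + jp x * tp x) has_real_derivative 0) (at x)"
    by (rule has_field_derivative_transform_within_open[OF DERIV_const open_vol x]) (use flux_relations(1) in simp)
  ultimately have 1: "?dm * tm x + dp * tp x = jm x + jp x" using DERIV_unique by fastforce
  have "((\<lambda>x. (jp x)\<^sup>2 * tp x + pp) has_real_derivative 2 * jm x * ?dm * tm x - (jm x)\<^sup>2) (at x)"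
    by (rule has_field_derivative_transform_within_open[OF sq(1) open_vol x]) (rule flux_relations(2))
  then have 2: "2 * jm x * ?dm * tm x - (jm x)\<^sup>2 = 2 * jp x * dp * tp x - (jp x)\<^sup>2" using DERIV_unique sq(2) by blast
  have "(PP has_real_derivative 2 * jm x * ?dm * tm x - (jm x)\<^sup>2) (at x)"
    using sq(1) by (simp add: PP_def[abs_def] add.commute)
  then show ?thesis using that dm dp 1 2 by blast
qed

text \<open>Minus the action of the fan with \<epsilon>2 = 0, up to a constant and a positive
  factor, as \<open>fan_action_Phi\<close> and \<open>action_fan\<close> show. Each summand is a
  mass flux times a specific energy: the mean stress acting on the volume drop, the change of
  internal energy, and minus half of \<epsilon>1.\<close>

definition Phi :: "real \<Rightarrow> real" where
  "Phi x = jm x * (tm x * (PP x + pm) / 2 + (en x - internal_energy D rm) - (PP x - pr x) * x / 2)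
         + jp x * (tp x * (PP x + pp) / 2 + (en x - internal_energy D rp) - (PP x - pr x) * x / 2)"

lemma Phi_decreasing:
  assumes xy: "x < y" and v: "\<And>z. x \<le> z \<Longrightarrow> z \<le> y \<Longrightarrow> z \<in> vol \<and> pr z \<le> PP z"
  shows "Phi y < Phi x"
proof (rule DERIV_neg_imp_decreasing[OF xy])
  fix z assume "x \<le> z" "z \<le> y"
  then have z: "z \<in> vol" "pr z \<le> PP z" using v by auto
  have z0: "0 < z" using vol_pos[OF z(1)] by simp
  obtain dm dp where d: "(jm has_real_derivative dm) (at z)" "(jp has_real_derivative dp) (at z)"
    "dm * tm z + dp * tp z = jm z + jp z" "2 * jm z * dm * tm z - (jm z)\<^sup>2 = 2 * jp z * dp * tp z - (jp z)\<^sup>2"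
    "(PP has_real_derivative 2 * jm z * dm * tm z - (jm z)\<^sup>2) (at z)"
    using flux_derivatives[OF z(1)] .
  define Pd where "Pd = 2 * jm z * dm * tm z - (jm z)\<^sup>2"
  define qd where "qd = - (\<gamma> * pr z / z)"
  have t: "(tm has_real_derivative - 1) (at z)" "(tp has_real_derivative - 1) (at z)"
    unfolding tm_def[abs_def] tp_def[abs_def] by (auto intro!: derivative_eq_intros)
  note P = d(5)[folded Pd_def] and q = DERIV_pr[OF z0, folded qd_def]
  let ?d = "dm * (tm z * (PP z + pm) / 2 + (en z - internal_energy D rm) - (PP z - pr z) * z / 2)
      + jm z * (- (PP z + pm) / 2 + tm z * Pd / 2 - pr z - (Pd - qd) * z / 2 - (PP z - pr z) / 2)
    + (dp * (tp z * (PP z + pp) / 2 + (en z - internal_energy D rp) - (PP z - pr z) * z / 2)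
      + jp z * (- (PP z + pp) / 2 + tp z * Pd / 2 - pr z - (Pd - qd) * z / 2 - (PP z - pr z) / 2))"
  have "(Phi has_real_derivative ?d) (at z)"
    unfolding Phi_def[abs_def]
    by (auto intro!: derivative_eq_intros d(1,2) t P q DERIV_en[OF z0] simp: field_simps)
  moreover have "?d < 0"
  proof (rule action_derivative_negative[OF fluxes_positive[OF z] z0 d(3) vol_pos(2,3)[OF z(1)] Pd_def])
    show "Pd = 2 * jp z * dp * tp z - (jp z)\<^sup>2" using d(4) by (simp add: Pd_def)
    show "(jm z)\<^sup>2 * tm z + pm = PP z" by (simp add: PP_def)
    show "(jp z)\<^sup>2 * tp z + pp = PP z" using flux_relations(2)[OF z(1)] by (simp add: PP_def)
    show "pr z \<le> PP z" by (rule z(2))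
    show "qd \<le> 0" using gamma z0 by (simp add: qd_def pr_def)
  qed (use energy_jump[OF z(1)] in auto)
  ultimately show "\<exists>d. (Phi has_real_derivative d) (at z) \<and> d < 0" by blast
qed

end

section \<open>Fan solutions\<close>

text \<open>The deviation in the middle region is invisible to test functions by
  \<open>free\<close>, so a balance law reduces to one scalar condition per interface: equality for
  a conservation law, inequality for the entropy, where the interface integrals have a sign.\<close>

lemma weak_balance_fan:
  fixes w :: "spacetime \<Rightarrow> real" and F :: "spacetime \<Rightarrow> real ^ 2"
  assumes \<nu>: "\<nu>1 < \<nu>2"
    and m[measurable]: "w \<in> borel_measurable borel" "F \<in> borel_measurable borel"
      "r \<in> borel_measurable borel" "G \<in> borel_measurable borel"
    and left: "\<And>z. 0 < fst z \<Longrightarrow> snd z $ 2 < \<nu>1 * fst z \<Longrightarrow> w z = a1 \<and> F z = f1"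
    and mid: "\<And>z. 0 < fst z \<Longrightarrow> \<nu>1 * fst z < snd z $ 2 \<Longrightarrow> snd z $ 2 < \<nu>2 * fst z \<Longrightarrow> w z = a2 + r z \<and> F z = f2 + G z"
    and right: "\<And>z. 0 < fst z \<Longrightarrow> \<nu>2 * fst z < snd z $ 2 \<Longrightarrow> w z = a3 \<and> F z = f3"
    and zero: "\<And>z. \<not> (0 < fst z \<and> \<nu>1 * fst z < snd z $ 2 \<and> snd z $ 2 < \<nu>2 * fst z) \<Longrightarrow> r z = 0 \<and> G z = 0"
    and bd: "\<And>z. \<bar>r z\<bar> \<le> M" "\<And>z. norm (G z) \<le> M"
    and free: "\<And>\<phi>. test_function \<phi> \<Longrightarrow> (\<integral>z. r z * pd et \<phi> z + (G z $ 1 * pd e1 \<phi> z + G z $ 2 * pd e2 \<phi> z) \<partial>lborel) = 0"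
  shows "f1 $ 2 - f2 $ 2 = \<nu>1 * (a1 - a2) \<Longrightarrow> f2 $ 2 - f3 $ 2 = \<nu>2 * (a2 - a3) \<Longrightarrow>
      weak_balance_eq w F (\<lambda>x. if x $ 2 < 0 then a1 else a3)"
    and "\<nu>1 * (a1 - a2) \<le> f1 $ 2 - f2 $ 2 \<Longrightarrow> \<nu>2 * (a2 - a3) \<le> f2 $ 2 - f3 $ 2 \<Longrightarrow>
      weak_balance_le w F (\<lambda>x. if x $ 2 < 0 then a1 else a3)"
proof -
  have M0: "0 \<le> M" using bd(1)[of 0] by linarith
  have "AE z in lborel. 0 < fst z \<longrightarrow> norm (w z) \<le> (\<bar>a1\<bar> + \<bar>a2\<bar> + \<bar>a3\<bar>) + M \<and> norm (F z) \<le> (norm f1 + norm f2 + norm f3) + M"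
    using AE_lborel_line[of \<nu>1] AE_lborel_line[of \<nu>2]
  proof eventually_elim
    case (elim z)
    show ?case
    proof
      assume t: "0 < fst z"
      consider "snd z $ 2 < \<nu>1 * fst z" | "\<nu>1 * fst z < snd z $ 2" "snd z $ 2 < \<nu>2 * fst z" | "\<nu>2 * fst z < snd z $ 2"
        using elim by linarith
      then show "norm (w z) \<le> (\<bar>a1\<bar> + \<bar>a2\<bar> + \<bar>a3\<bar>) + M \<and> norm (F z) \<le> (norm f1 + norm f2 + norm f3) + M"
      proof cases
        case 1
        then show ?thesis using left[OF t 1] M0 by simp
      next
        case 2
        have "norm (f2 + G z) \<le> norm f2 + M" using norm_triangle_ineq[of f2 "G z"] bd(2)[of z] by linarith
        moreover have e: "w z = a2 + r z" "F z = f2 + G z" using mid[OF t 2] by simp_all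
        ultimately show ?thesis unfolding e real_norm_def
          using bd(1)[of z] norm_ge_zero[of f1] norm_ge_zero[of f3] by (intro conjI) linarith+
      next
        case 3
        then show ?thesis using right[OF t 3] M0 by simp
      qed
    qed
  qed
  then have b: "AE z in lborel. 0 < fst z \<longrightarrow> norm (w z) \<le> (\<bar>a1\<bar> + \<bar>a2\<bar> + \<bar>a3\<bar>) + M"
    "AE z in lborel. 0 < fst z \<longrightarrow> norm (F z) \<le> (norm f1 + norm f2 + norm f3) + M"
    by (auto elim!: eventually_mono)
  have li: "locally_integrable w" "locally_integrable F"
    using locally_integrable_bounded[OF m(1) b(1)] locally_integrable_bounded[OF m(2) b(2)] by auto
  have pairing: "weak_pairing w F (\<lambda>x. if x $ 2 < 0 then a1 else a3) \<phi> =
    (f2 $ 2 - f3 $ 2 - \<nu>2 * (a2 - a3)) * (\<integral>z. indicator (wedge \<nu>2) z * pd e2 \<phi> z \<partial>lborel)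
    + (f1 $ 2 - f2 $ 2 - \<nu>1 * (a1 - a2)) * (\<integral>z. indicator (wedge \<nu>1) z * pd e2 \<phi> z \<partial>lborel)" if \<phi>: "test_function \<phi>" for \<phi>
    using weak_pairing_fan[OF test_function_smooth[OF \<phi>] test_function_bsupp[OF \<phi>] \<nu> m left mid right zero, of M] bd free[OF \<phi>]
    by simp
  show "weak_balance_eq w F (\<lambda>x. if x $ 2 < 0 then a1 else a3)"
    if "f1 $ 2 - f2 $ 2 = \<nu>1 * (a1 - a2)" "f2 $ 2 - f3 $ 2 = \<nu>2 * (a2 - a3)"
    unfolding weak_balance_eq_def using li pairing that by simp
  show "weak_balance_le w F (\<lambda>x. if x $ 2 < 0 then a1 else a3)"
    if "\<nu>1 * (a1 - a2) \<le> f1 $ 2 - f2 $ 2" "\<nu>2 * (a2 - a3) \<le> f2 $ 2 - f3 $ 2"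
    unfolding weak_balance_le_def
  proof (intro conjI li allI impI, elim conjE)
    fix \<phi> assume \<phi>: "test_function \<phi>" and pos: "\<forall>z. 0 \<le> \<phi> z"
    have "0 \<le> (\<integral>z. indicator (wedge \<nu>) z * pd e2 \<phi> z \<partial>lborel)" for \<nu>
      by (rule integral_wedge_pd2[OF test_function_smooth[OF \<phi>] test_function_bsupp[OF \<phi>]]) (use pos in blast)
    then show "0 \<le> weak_pairing w F (\<lambda>x. if x $ 2 < 0 then a1 else a3) \<phi>"
      unfolding pairing[OF \<phi>] using that by (intro add_nonneg_nonneg mult_nonneg_nonneg) auto
  qed
qed

section \<open>Complex numbers as plane vectors and as symmetric trace-free matrices\<close>

definition vec_of :: "complex \<Rightarrow> real ^ 2" where
  "vec_of c = vector [Re c, Im c]"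

definition mat_of :: "complex \<Rightarrow> real ^ 2 ^ 2" where
  "mat_of c = vector [vector [Re c, Im c], vector [Im c, - Re c]]"

lemma vec_of_nth [simp]: "vec_of c $ 1 = Re c" "vec_of c $ 2 = Im c"
  by (simp_all add: vec_of_def)

lemma mat_of_nth [simp]: "mat_of c $ 1 = vec_of c" "mat_of c $ 2 $ 1 = Im c" "mat_of c $ 2 $ 2 = - Re c"
  by (simp_all add: mat_of_def vec_of_def)

lemma vec_of_0 [simp]: "vec_of 0 = 0" and mat_of_0 [simp]: "mat_of 0 = 0"
  by (simp_all add: vec_eq_iff forall_2)

lemma vec_of_eq_iff: "vec_of c = vec_of d \<longleftrightarrow> c = d"
  by (auto simp: vec_eq_iff forall_2 complex_eq_iff)

lemma norm_vec_of: "norm (vec_of c) = cmod c"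
  by (simp add: norm_vec_def L2_set_def sum_2 cmod_def)

lemma norm_mat_of_row: "norm (mat_of c $ i) = cmod c"
  by (cases i rule: exhaust_2[THEN disjE]) (auto simp: norm_vec_def L2_set_def sum_2 cmod_def add.commute)

lemma linear_vec_of: "bounded_linear vec_of"
proof (rule bounded_linear_intro[where K = 1])
  show "vec_of (x + y) = vec_of x + vec_of y" "vec_of (r *\<^sub>R x) = r *\<^sub>R vec_of x" for x y r
    by (simp_all add: vec_eq_iff forall_2)
qed (simp add: norm_vec_of)

lemma linear_mat_of: "bounded_linear (\<lambda>c. mat_of c $ i)"
proof (rule bounded_linear_intro[where K = 1])
  show "mat_of (x + y) $ i = mat_of x $ i + mat_of y $ i" "mat_of (r *\<^sub>R x) $ i = r *\<^sub>R (mat_of x $ i)" for x y r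
    by (cases i rule: exhaust_2[THEN disjE]; auto simp: vec_eq_iff forall_2)+
qed (simp add: norm_mat_of_row)

lemma region_borel [measurable]:
  "region_minus D \<rho> \<in> sets borel" "region_mid D \<rho> \<in> sets borel" "region_plus D \<rho> \<in> sets borel"
  and open_region_mid: "open (region_mid D \<rho>)"
proof -
  have e: "region_minus D \<rho> = {z. 0 < fst z} \<inter> {z. snd z $ 2 < nu_minus D \<rho> * fst z}"
    "region_mid D \<rho> = {z. 0 < fst z} \<inter> ({z. nu_minus D \<rho> * fst z < snd z $ 2} \<inter> {z. snd z $ 2 < nu_plus D \<rho> * fst z})"
    "region_plus D \<rho> = {z. 0 < fst z} \<inter> {z. nu_plus D \<rho> * fst z < snd z $ 2}"
    by (auto simp: region_minus_def region_mid_def region_plus_def)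
  have o: "open {z :: spacetime. 0 < fst z}" "open {z :: spacetime. snd z $ 2 < a * fst z}" "open {z :: spacetime. a * fst z < snd z $ 2}" for a
    by (intro open_Collect_less continuous_intros)+
  show "open (region_mid D \<rho>)" unfolding e by (intro open_Int o)
  show "region_minus D \<rho> \<in> sets borel" "region_mid D \<rho> \<in> sets borel" "region_plus D \<rho> \<in> sets borel"
    unfolding e by (intro borel_open open_Int o)+
qed

lemma region_iff:
  "z \<in> region_minus D \<rho> \<longleftrightarrow> 0 < fst z \<and> snd z $ 2 < nu_minus D \<rho> * fst z"
  "z \<in> region_mid D \<rho> \<longleftrightarrow> 0 < fst z \<and> nu_minus D \<rho> * fst z < snd z $ 2 \<and> snd z $ 2 < nu_plus D \<rho> * fst z"
  "z \<in> region_plus D \<rho> \<longleftrightarrow> 0 < fst z \<and> nu_plus D \<rho> * fst z < snd z $ 2"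
  by (auto simp: region_minus_def region_mid_def region_plus_def case_prod_beta')

text \<open>The two shock solution is the case \<open>T = 0\<close>.\<close>

definition fan_flow :: "euler_riemann \<Rightarrow> real \<Rightarrow> (spacetime \<Rightarrow> state) \<Rightarrow> flow" where
  "fan_flow D \<rho> T z =
     (if z \<in> region_minus D \<rho> then state_minus D
      else if z \<in> region_mid D \<rho> then (\<rho>, fan_v1 D \<rho> + vec_of (fst (T z)))
      else state_plus D)"

lemma fan_flow_borel:
  assumes [measurable]: "T \<in> borel_measurable borel"
  shows "fan_flow D \<rho> T \<in> borel_measurable borel"
proof -
  have "continuous_on UNIV (\<lambda>s :: state. (\<rho>, fan_v1 D \<rho> + vec_of (fst s)))"
    by (intro continuous_intros bounded_linear.continuous_on[OF linear_vec_of])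
  from borel_measurable_continuous_on[OF this assms]
  have [measurable]: "(\<lambda>z. (\<rho>, fan_v1 D \<rho> + vec_of (fst (T z)))) \<in> borel_measurable borel" .
  show ?thesis unfolding fan_flow_def[abs_def] by measurable
qed

section \<open>Entropic weak solutions with a fan structure\<close>

context shock_data
begin

text \<open>\<open>M0\<close> is the constant part of v \<otimes> v in the middle region: C/2 Id +
  u1 for convex integration, v1 \<otimes> v1 for the two shock solution. Only its normal column
  meets the interfaces, and the entry \<beta>^2 + \<epsilon>1 lets \<epsilon>1 act as an additional
  pressure.\<close>

lemma entropic_fan_flow:
  fixes \<rho> Cc :: real and M0 :: "real ^ 2 ^ 2" and T :: "spacetime \<Rightarrow> state"
  defines "E1 \<equiv> 1 / 2 * \<rho> * Cc + \<rho> * internal_energy D \<rho>"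
  assumes \<rho>: "max rm rp < \<rho>"
    and T[measurable]: "T \<in> borel_measurable borel" and wT: "weak_pair T" and T0: "\<And>z. z \<notin> region_mid D \<rho> \<Longrightarrow> T z = 0"
    and bT: "\<And>z. norm (T z) \<le> B"
    and M0: "M0 $ 1 $ 2 = 0" "M0 $ 2 $ 2 = (beta D \<rho>)\<^sup>2 + eps1 D \<rho>"
    and outer: "\<And>z. z \<in> region_mid D \<rho> \<Longrightarrow>
      outer_prod (fan_v1 D \<rho> + vec_of (fst (T z))) (fan_v1 D \<rho> + vec_of (fst (T z))) = M0 + mat_of (snd (T z))"
    and speed: "\<And>z. z \<in> region_mid D \<rho> \<Longrightarrow> (norm (fan_v1 D \<rho> + vec_of (fst (T z))))\<^sup>2 = Cc"
    and ent: "nu_minus D \<rho> * (energy D (state_minus D) - E1) \<le> energy_flux D (state_minus D) $ 2 - (E1 + pressure D \<rho>) * beta D \<rho>"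
      "nu_plus D \<rho> * (E1 - energy D (state_plus D)) \<le> (E1 + pressure D \<rho>) * beta D \<rho> - energy_flux D (state_plus D) $ 2"
  shows "entropic_weak_solution D (fan_flow D \<rho> T)"
proof -
  let ?w = "fan_flow D \<rho> T"
  note fr = fan_values_eq(5)[OF \<rho>, unfolded fan_relations_def]
  have \<nu>: "nu_minus D \<rho> < nu_plus D \<rho>" using fr by blast
  have \<rho>0: "0 < \<rho>" using \<rho> data_pos by simp
  have left: "?w z = state_minus D" if "0 < fst z" "snd z $ 2 < nu_minus D \<rho> * fst z" for z
    using that by (simp add: fan_flow_def region_iff)
  have mid: "?w z = (\<rho>, fan_v1 D \<rho> + vec_of (fst (T z)))" "z \<in> region_mid D \<rho>"
    if "0 < fst z" "nu_minus D \<rho> * fst z < snd z $ 2" "snd z $ 2 < nu_plus D \<rho> * fst z" for z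
    using that by (auto simp: fan_flow_def region_iff)
  have right: "?w z = state_plus D" if "0 < fst z" "nu_plus D \<rho> * fst z < snd z $ 2" for z
  proof -
    have "nu_minus D \<rho> * fst z < nu_plus D \<rho> * fst z" using that \<nu> by simp
    then have "\<not> snd z $ 2 < nu_minus D \<rho> * fst z" using that by linarith
    then show ?thesis using that by (simp add: fan_flow_def region_iff)
  qed
  have zero: "T z = 0" if "\<not> (0 < fst z \<and> nu_minus D \<rho> * fst z < snd z $ 2 \<and> snd z $ 2 < nu_plus D \<rho> * fst z)" for z
    using that T0 by (simp add: region_iff)
  have wb[measurable]: "?w \<in> borel_measurable borel" by (rule fan_flow_borel[OF T])
  have wif: "h (?w z) = (if z \<in> region_minus D \<rho> then h (state_minus D)
      else if z \<in> region_mid D \<rho> then h (\<rho>, fan_v1 D \<rho> + vec_of (fst (T z))) else h (state_plus D))" for h :: "real \<times> (real ^ 2) \<Rightarrow> 'z" and z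
    by (simp add: fan_flow_def)
  have vm[measurable]: "(\<lambda>z. vec_of (fst (T z))) \<in> borel_measurable borel"
    using borel_measurable_continuous_on[OF _ T, of "\<lambda>s. vec_of (fst s)"] bounded_linear.continuous_on[OF linear_vec_of continuous_on_fst[OF continuous_on_id]]
    by blast
  have mm[measurable]: "(\<lambda>z. mat_of (snd (T z)) $ i) \<in> borel_measurable borel" for i
    using borel_measurable_continuous_on[OF _ T, of "\<lambda>s. mat_of (snd s) $ i"] bounded_linear.continuous_on[OF linear_mat_of continuous_on_snd[OF continuous_on_id]]
    by blast
  have vn[measurable]: "(\<lambda>z. vec_of (fst (T z)) $ i) \<in> borel_measurable borel" for i
    using vm by (rule borel_measurable_continuous_on[OF bounded_linear.continuous_on[OF bounded_linear_vec_nth continuous_on_id]])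
  have bv: "norm (vec_of (fst (T z))) \<le> B" "norm (mat_of (snd (T z)) $ i) \<le> B" for z i
    using bT[of z] norm_fst_le[of "fst (T z)" "snd (T z)"] norm_snd_le[of "snd (T z)" "fst (T z)"] by (simp_all add: norm_vec_of norm_mat_of_row)
  have bvi: "\<bar>vec_of (fst (T z)) $ i\<bar> \<le> B" for z i using bv(1)[of z] component_le_norm_cart[of "vec_of (fst (T z))" i] by linarith
  have B0: "0 \<le> B" using bT[of 0] norm_ge_zero[of "T 0"] by linarith
  have ifm: "(\<lambda>z. if z \<in> region_minus D \<rho> then c1 else if z \<in> region_mid D \<rho> then f z else c3) \<in> borel_measurable borel"
    if [measurable]: "f \<in> borel_measurable borel" for f :: "spacetime \<Rightarrow> 'z::topological_space" and c1 c3
    by measurable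
  have dv: "(\<integral>z. vec_of (fst (T z)) $ 1 * pd e1 \<phi> z + vec_of (fst (T z)) $ 2 * pd e2 \<phi> z \<partial>lborel) = 0" if "test_function \<phi>" for \<phi>
    using wT[unfolded weak_pair_def, rule_format, OF that, of 0] by (simp add: test_field_def inner_prod_def inner_complex_def)
  have mo: "(\<integral>z. vec_of (fst (T z)) $ i * pd et \<phi> z + (mat_of (snd (T z)) $ i $ 1 * pd e1 \<phi> z + mat_of (snd (T z)) $ i $ 2 * pd e2 \<phi> z) \<partial>lborel) = 0"
    if "test_function \<phi>" for \<phi> i
    using exhaust_2[of i] wT[unfolded weak_pair_def, rule_format, OF that, of 1] wT[unfolded weak_pair_def, rule_format, OF that, of 2]
    by (auto simp: test_field_def inner_prod_def inner_complex_def algebra_simps)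
  have fv: "fan_v1 D \<rho> $ 1 = 0" "fan_v1 D \<rho> $ 2 = beta D \<rho>" by (simp_all add: fan_v1_def)
  have sm: "fst (state_minus D) = rm" "snd (state_minus D) $ 1 = 0" "snd (state_minus D) $ 2 = um"
    "fst (state_plus D) = rp" "snd (state_plus D) $ 1 = 0" "snd (state_plus D) $ 2 = up"
    by (simp_all add: state_minus_def state_plus_def)
  have mom: "momentum s = fst s *\<^sub>R snd s" for s by (cases s) simp
  have mfl: "momentum_flux D s $ i $ j = fst s * (snd s $ i * snd s $ j) + (if i = j then pressure D (fst s) else 0)" for s i j
    by (cases s) (simp add: outer_prod_def mat_def)
  have mass: "weak_balance_eq (\<lambda>z. fst (?w z)) (\<lambda>z. momentum (?w z)) (\<lambda>x. fst (initial_state D x))"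
  proof -
    have i: "(\<lambda>x. fst (initial_state D x)) = (\<lambda>x. if x $ 2 < 0 then rm else rp)" by (auto simp: initial_state_def sm)
    show ?thesis unfolding i
    proof (rule weak_balance_fan(1)[where r = "\<lambda>_. 0" and G = "\<lambda>z. \<rho> *\<^sub>R vec_of (fst (T z))" and M = "\<bar>\<rho>\<bar> * B"
          and ?a2.0 = \<rho> and ?f1.0 = "momentum (state_minus D)" and ?f2.0 = "\<rho> *\<^sub>R fan_v1 D \<rho>" and ?f3.0 = "momentum (state_plus D)", OF \<nu>])
      show "(\<lambda>z. fst (?w z)) \<in> borel_measurable borel" unfolding wif by measurable
      show "(\<lambda>z. momentum (?w z)) \<in> borel_measurable borel" unfolding wif
        by (rule ifm) (simp only: momentum.simps, measurable)
      show "(\<integral>z. 0 * pd et \<phi> z + ((\<rho> *\<^sub>R vec_of (fst (T z))) $ 1 * pd e1 \<phi> z + (\<rho> *\<^sub>R vec_of (fst (T z))) $ 2 * pd e2 \<phi> z) \<partial>lborel) = 0"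
        if "test_function \<phi>" for \<phi>
      proof -
        have "0 * pd et \<phi> z + ((\<rho> *\<^sub>R vec_of (fst (T z))) $ 1 * pd e1 \<phi> z + (\<rho> *\<^sub>R vec_of (fst (T z))) $ 2 * pd e2 \<phi> z)
          = \<rho> * (vec_of (fst (T z)) $ 1 * pd e1 \<phi> z + vec_of (fst (T z)) $ 2 * pd e2 \<phi> z)" for z
          by (simp add: algebra_simps)
        then show ?thesis using dv[OF that] by simp
      qed
      show "momentum (state_minus D) $ 2 - (\<rho> *\<^sub>R fan_v1 D \<rho>) $ 2 = nu_minus D \<rho> * (rm - \<rho>)"
        using fr by (simp add: mom sm fv)
      have "nu_plus D \<rho> * (rp - \<rho>) = rp * up - \<rho> * beta D \<rho>" using fr by blast
      then show "(\<rho> *\<^sub>R fan_v1 D \<rho>) $ 2 - momentum (state_plus D) $ 2 = nu_plus D \<rho> * (\<rho> - rp)"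
        by (simp add: mom sm fv algebra_simps)
      show "norm (\<rho> *\<^sub>R vec_of (fst (T z))) \<le> \<bar>\<rho>\<bar> * B" for z using bv(1)[of z] by (simp add: mult_left_mono)
    qed (use left mid right zero B0 in \<open>auto simp: sm scaleR_add_right\<close>)
  qed
  have moment: "weak_balance_eq (\<lambda>z. momentum (?w z) $ i) (\<lambda>z. momentum_flux D (?w z) $ i) (\<lambda>x. momentum (initial_state D x) $ i)" for i
  proof -
    have i: "(\<lambda>x. momentum (initial_state D x) $ i) = (\<lambda>x. if x $ 2 < 0 then momentum (state_minus D) $ i else momentum (state_plus D) $ i)"
      by (auto simp: initial_state_def)
    define f2 where "f2 = \<rho> *\<^sub>R M0 $ i + pressure D \<rho> *\<^sub>R axis i 1"
    have fl: "momentum_flux D (\<rho>, fan_v1 D \<rho> + vec_of (fst (T z))) $ i = f2 + \<rho> *\<^sub>R mat_of (snd (T z)) $ i" if "z \<in> region_mid D \<rho>" for z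
      unfolding f2_def momentum_flux.simps outer[OF that] by (simp add: vec_eq_iff mat_def axis_def algebra_simps)
    have wif2: "momentum_flux D (?w z) $ i = (if z \<in> region_minus D \<rho> then momentum_flux D (state_minus D) $ i
      else if z \<in> region_mid D \<rho> then f2 + \<rho> *\<^sub>R mat_of (snd (T z)) $ i else momentum_flux D (state_plus D) $ i)" for z
      using fl by (simp add: fan_flow_def)
    have q: "nu_minus D \<rho> * (rm * um - \<rho> * beta D \<rho>) = rm * um\<^sup>2 + pm - \<rho> * ((beta D \<rho>)\<^sup>2 + eps1 D \<rho>) - pressure D \<rho>"
      "nu_plus D \<rho> * (rp * up - \<rho> * beta D \<rho>) = rp * up\<^sup>2 + pp - \<rho> * ((beta D \<rho>)\<^sup>2 + eps1 D \<rho>) - pressure D \<rho>"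
      using fr by blast+
    have i2: "i = 1 \<or> i = 2" by (rule exhaust_2)
    show ?thesis unfolding i
    proof (rule weak_balance_fan(1)[where r = "\<lambda>z. \<rho> * vec_of (fst (T z)) $ i" and G = "\<lambda>z. \<rho> *\<^sub>R mat_of (snd (T z)) $ i" and M = "\<bar>\<rho>\<bar> * B"
          and ?a2.0 = "\<rho> * fan_v1 D \<rho> $ i" and ?f1.0 = "momentum_flux D (state_minus D) $ i" and ?f2.0 = f2 and ?f3.0 = "momentum_flux D (state_plus D) $ i", OF \<nu>])
      show "(\<lambda>z. momentum (?w z) $ i) \<in> borel_measurable borel"
        unfolding wif[of "\<lambda>s. momentum s $ i"]
        by (rule ifm) (simp only: momentum.simps vector_scaleR_component vector_add_component, measurable)
      show "(\<lambda>z. momentum_flux D (?w z) $ i) \<in> borel_measurable borel" unfolding wif2 by measurable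
      show "(\<integral>z. \<rho> * vec_of (fst (T z)) $ i * pd et \<phi> z + ((\<rho> *\<^sub>R mat_of (snd (T z)) $ i) $ 1 * pd e1 \<phi> z + (\<rho> *\<^sub>R mat_of (snd (T z)) $ i) $ 2 * pd e2 \<phi> z) \<partial>lborel) = 0"
        if "test_function \<phi>" for \<phi>
      proof -
        have "\<rho> * vec_of (fst (T z)) $ i * pd et \<phi> z + ((\<rho> *\<^sub>R mat_of (snd (T z)) $ i) $ 1 * pd e1 \<phi> z + (\<rho> *\<^sub>R mat_of (snd (T z)) $ i) $ 2 * pd e2 \<phi> z)
          = \<rho> * (vec_of (fst (T z)) $ i * pd et \<phi> z + (mat_of (snd (T z)) $ i $ 1 * pd e1 \<phi> z + mat_of (snd (T z)) $ i $ 2 * pd e2 \<phi> z))" for z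
          by (simp add: algebra_simps)
        then show ?thesis using mo[OF that] by simp
      qed
      show "momentum_flux D (state_minus D) $ i $ 2 - f2 $ 2 = nu_minus D \<rho> * (momentum (state_minus D) $ i - \<rho> * fan_v1 D \<rho> $ i)"
        using i2 q(1) M0 by (auto simp: mfl mom sm fv f2_def axis_def power2_eq_square algebra_simps)
      show "f2 $ 2 - momentum_flux D (state_plus D) $ i $ 2 = nu_plus D \<rho> * (\<rho> * fan_v1 D \<rho> $ i - momentum (state_plus D) $ i)"
        using i2 q(2) M0 by (auto simp: mfl mom sm fv f2_def axis_def power2_eq_square algebra_simps)
      show "norm (\<rho> *\<^sub>R mat_of (snd (T z)) $ i) \<le> \<bar>\<rho>\<bar> * B" for z using bv(2)[of z i] by (simp add: mult_left_mono)
      show "\<bar>\<rho> * vec_of (fst (T z)) $ i\<bar> \<le> \<bar>\<rho>\<bar> * B" for z using bvi[of z i] by (simp add: abs_mult mult_left_mono)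
    qed (use left mid right zero fl in \<open>auto simp: distrib_left\<close>)
  qed
  have energy: "weak_balance_le (\<lambda>z. energy D (?w z)) (\<lambda>z. energy_flux D (?w z)) (\<lambda>x. energy D (initial_state D x))"
  proof -
    have i: "(\<lambda>x. energy D (initial_state D x)) = (\<lambda>x. if x $ 2 < 0 then energy D (state_minus D) else energy D (state_plus D))"
      by (auto simp: initial_state_def)
    \<comment> \<open>Constant speed makes the energy of the middle region a constant, and the
      energy flux below a constant multiple of the velocity. The energy law therefore reduces to
      \<open>div v = 0\<close> and the two interface inequalities.\<close>
    have en: "energy D (\<rho>, fan_v1 D \<rho> + vec_of (fst (T z))) = E1" if "z \<in> region_mid D \<rho>" for z
      using speed[OF that] by (simp add: E1_def)
    have ef: "energy_flux D (\<rho>, fan_v1 D \<rho> + vec_of (fst (T z))) = (E1 + pressure D \<rho>) *\<^sub>R (fan_v1 D \<rho> + vec_of (fst (T z)))" if "z \<in> region_mid D \<rho>" for z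
      unfolding energy_flux.simps en[OF that] ..
    have wif1: "energy D (?w z) = (if z \<in> region_minus D \<rho> then energy D (state_minus D)
      else if z \<in> region_mid D \<rho> then E1 else energy D (state_plus D))" for z
      using en by (simp add: fan_flow_def)
    have wif2: "energy_flux D (?w z) = (if z \<in> region_minus D \<rho> then energy_flux D (state_minus D)
      else if z \<in> region_mid D \<rho> then (E1 + pressure D \<rho>) *\<^sub>R (fan_v1 D \<rho> + vec_of (fst (T z))) else energy_flux D (state_plus D))" for z
      using ef by (simp add: fan_flow_def)
    let ?k = "E1 + pressure D \<rho>"
    show ?thesis unfolding i
    proof (rule weak_balance_fan(2)[where r = "\<lambda>_. 0" and G = "\<lambda>z. ?k *\<^sub>R vec_of (fst (T z))" and M = "\<bar>?k\<bar> * B"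
          and ?a2.0 = E1 and ?f1.0 = "energy_flux D (state_minus D)" and ?f2.0 = "?k *\<^sub>R fan_v1 D \<rho>" and ?f3.0 = "energy_flux D (state_plus D)", OF \<nu>])
      show "(\<lambda>z. energy D (?w z)) \<in> borel_measurable borel" unfolding wif1 by measurable
      show "(\<lambda>z. energy_flux D (?w z)) \<in> borel_measurable borel" unfolding wif2 by measurable
      show "(\<integral>z. 0 * pd et \<phi> z + ((?k *\<^sub>R vec_of (fst (T z))) $ 1 * pd e1 \<phi> z + (?k *\<^sub>R vec_of (fst (T z))) $ 2 * pd e2 \<phi> z) \<partial>lborel) = 0"
        if "test_function \<phi>" for \<phi>
      proof -
        have "0 * pd et \<phi> z + ((?k *\<^sub>R vec_of (fst (T z))) $ 1 * pd e1 \<phi> z + (?k *\<^sub>R vec_of (fst (T z))) $ 2 * pd e2 \<phi> z)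
          = ?k * (vec_of (fst (T z)) $ 1 * pd e1 \<phi> z + vec_of (fst (T z)) $ 2 * pd e2 \<phi> z)" for z
          by (simp add: algebra_simps)
        then show ?thesis using dv[OF that] by simp
      qed
      show "nu_minus D \<rho> * (energy D (state_minus D) - E1) \<le> energy_flux D (state_minus D) $ 2 - (?k *\<^sub>R fan_v1 D \<rho>) $ 2"
        using ent(1) by (simp add: fv)
      show "nu_plus D \<rho> * (E1 - energy D (state_plus D)) \<le> (?k *\<^sub>R fan_v1 D \<rho>) $ 2 - energy_flux D (state_plus D) $ 2"
        using ent(2) by (simp add: fv)
      show "norm (?k *\<^sub>R vec_of (fst (T z))) \<le> \<bar>?k\<bar> * B" for z using bv(1)[of z] by (simp add: mult_left_mono)
    qed (use left mid right zero en ef B0 in \<open>auto simp: scaleR_add_right\<close>)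
  qed
  have "0 < fst (?w z)" for z using data_pos \<rho>0 by (simp add: fan_flow_def sm)
  then have "weak_solution D ?w"
    unfolding weak_solution_def using mass moment wb by (auto intro: borel_measurable_if_I measurable_completion)
  then show ?thesis unfolding entropic_weak_solution_def using energy by blast
qed

end

section \<open>An integrable weight, and constraints made to hold everywhere\<close>

lemma nn_integral_inverse_1_plus_square: "(\<integral>\<^sup>+ x. ennreal (inverse (1 + x\<^sup>2)) \<partial>lborel) < \<infinity>"
proof -
  let ?f = "\<lambda>x :: real. inverse (1 + x\<^sup>2)"
  have m[measurable]: "?f \<in> borel_measurable borel" by measurable
  have half: "(\<integral>\<^sup>+ x. ennreal (?f x) * indicator {0..} x \<partial>lborel) = ennreal (pi / 2 - arctan 0)"
    by (rule nn_integral_FTC_atLeast[OF m _ _ tendsto_arctan_at_top])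
       (auto intro!: DERIV_arctan simp: add_nonneg_nonneg)
  have "(\<integral>\<^sup>+ x. ennreal (?f x) * indicator {..0} x \<partial>lborel) = ennreal \<bar>- 1\<bar> * (\<integral>\<^sup>+ x. ennreal (?f (0 + - 1 * x)) * indicator {..0} (0 + - 1 * x) \<partial>lborel)"
    by (rule nn_integral_real_affine) auto
  also have "(\<integral>\<^sup>+ x. ennreal (?f (0 + - 1 * x)) * indicator {..0} (0 + - 1 * x) \<partial>lborel) = (\<integral>\<^sup>+ x. ennreal (?f x) * indicator {0..} x \<partial>lborel)"
    by (rule nn_integral_cong) (auto split: split_indicator)
  finally have half2: "(\<integral>\<^sup>+ x. ennreal (?f x) * indicator {..0} x \<partial>lborel) = ennreal (pi / 2 - arctan 0)" using half by simp
  have "(\<integral>\<^sup>+ x. ennreal (?f x) \<partial>lborel) \<le> (\<integral>\<^sup>+ x. ennreal (?f x) * indicator {0..} x + ennreal (?f x) * indicator {..0} x \<partial>lborel)"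
    by (rule nn_integral_mono) (auto split: split_indicator)
  also have "\<dots> = ennreal (pi / 2 - arctan 0) + ennreal (pi / 2 - arctan 0)"
    by (subst nn_integral_add) (auto simp: half half2)
  finally show ?thesis by (rule order_le_less_trans) (simp add: less_top[symmetric])
qed

text \<open>A product of Cauchy densities in the coordinates, up to normalisation. The middle wedge
  has infinite measure, so the energies of bounded fields are finite only with respect to such a
  weight.\<close>

lemma weight_exists:
  "\<exists>g :: 'a::euclidean_space \<Rightarrow> real. continuous_on UNIV g \<and> (\<forall>z. 0 < g z) \<and> integrable lborel g"
proof -
  define g where "g z = (\<Prod>b\<in>Basis. inverse (1 + (z \<bullet> b)\<^sup>2))" for z :: 'a
  have p: "0 < 1 + (x :: real)\<^sup>2" for x by (simp add: add_pos_nonneg)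
  have c: "continuous_on UNIV g"
    unfolding g_def using p by (intro continuous_intros) (auto simp: less_imp_neq[symmetric])
  have pos: "0 < g z" for z unfolding g_def using p by (intro prod_pos) auto
  have "(\<integral>\<^sup>+ z. ennreal (g z) \<partial>lborel) = (\<integral>\<^sup>+ z. (\<Prod>b\<in>Basis. ennreal (inverse (1 + (z \<bullet> b)\<^sup>2))) \<partial>(lborel :: 'a measure))"
    unfolding g_def using p by (subst prod_ennreal) (auto simp: less_imp_le)
  also have "\<dots> = (\<Prod>b\<in>(Basis :: 'a set). (\<integral>\<^sup>+ x. ennreal (inverse (1 + x\<^sup>2)) \<partial>lborel))"
    by (rule nn_integral_lborel_prod) auto
  also have "\<dots> = (\<integral>\<^sup>+ x. ennreal (inverse (1 + x\<^sup>2)) \<partial>lborel) ^ card (Basis :: 'a set)" by simp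
  also have "\<dots> < \<infinity>" using nn_integral_inverse_1_plus_square by (simp add: power_less_top_ennreal)
  finally have "integrable lborel g"
    using c pos by (intro integrableI_bounded) (auto simp: less_imp_le intro: borel_measurable_continuous_onI)
  then show ?thesis using c pos by blast
qed

lemma weak_pair_cong_AE:
  assumes "weak_pair T" and [measurable]: "T \<in> borel_measurable borel" "T' \<in> borel_measurable borel"
    and "AE z in lborel. T' z = T z"
  shows "weak_pair T'"
  unfolding weak_pair_def
proof (intro allI impI)
  fix \<phi> and i :: nat assume \<phi>: "test_function \<phi>"
  have [measurable]: "test_field i \<phi> \<in> borel_measurable borel"
    by (intro borel_measurable_continuous_onI test_field_continuous test_function_smooth \<phi>)
  have "(\<integral>z. T' z \<bullet> test_field i \<phi> z \<partial>lborel) = (\<integral>z. T z \<bullet> test_field i \<phi> z \<partial>lborel)"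
    by (rule integral_cong_AE) (use assms(4) in \<open>auto elim!: eventually_mono\<close>)
  then show "(\<integral>z. T' z \<bullet> test_field i \<phi> z \<partial>lborel) = 0" using assms(1) \<phi> by (simp add: weak_pair_def)
qed

text \<open>\<open>entropic_fan_flow\<close> asks for the constraint at every point, while the limit
  of the iteration satisfies it almost everywhere. A change on a null set repairs this and keeps
  Borel measurability and the weak equations.\<close>

lemma exact_perturbation_everywhere:
  assumes T: "exact_perturbation \<Omega> C s0 T" and C: "0 \<le> C" and \<Omega>: "open \<Omega>"
  obtains T' where "T' \<in> borel_measurable borel" "weak_pair T'" "\<And>z. z \<notin> \<Omega> \<Longrightarrow> T' z = 0" "AE z in lborel. T' z = T z"
    "\<And>z. z \<in> \<Omega> \<Longrightarrow> (cmod (fst (s0 + T' z)))\<^sup>2 = C" "\<And>z. z \<in> \<Omega> \<Longrightarrow> (fst (s0 + T' z))\<^sup>2 = 2 * snd (s0 + T' z)"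
    "\<And>z. norm (T' z) \<le> sqrt C + C + norm s0"
proof -
  note T = T[unfolded exact_perturbation_def]
  have Tm[measurable]: "T \<in> borel_measurable borel" using T by blast
  have [measurable]: "\<Omega> \<in> sets borel" using \<Omega> by simp
  define S where "S = {s. (cmod (fst (s0 + s)))\<^sup>2 = C} \<inter> {s. (fst (s0 + s))\<^sup>2 = 2 * snd (s0 + s)}"
  have "closed S" unfolding S_def by (intro closed_Int closed_Collect_eq continuous_intros)
  then have Sm[measurable]: "S \<in> sets borel" by simp
  \<comment> \<open>The default state with velocity sqrt C and matrix part C/2 satisfies both
    constraint equations.\<close>
  define T' where "T' z = (if z \<in> \<Omega> then (if T z \<in> S then T z else (of_real (sqrt C), of_real (C / 2)) - s0) else 0)" for z
  have m: "T' \<in> borel_measurable borel" unfolding T'_def by measurable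
  have ae: "AE z in lborel. T' z = T z"
  proof -
    have "AE z in lborel. z \<in> \<Omega> \<longrightarrow> T z \<in> S" using T by (auto simp: S_def elim!: eventually_mono)
    then show ?thesis by eventually_elim (use T in \<open>auto simp: T'_def\<close>)
  qed
  have S: "T' z \<in> S" if "z \<in> \<Omega>" for z
  proof (cases "T z \<in> S")
    case False
    then show ?thesis using that C by (simp add: T'_def S_def) (simp add: of_real_power[symmetric])
  qed (use that in \<open>simp add: T'_def\<close>)
  have z0: "T' z = 0" if "z \<notin> \<Omega>" for z using that by (simp add: T'_def)
  have b: "norm (T' z) \<le> sqrt C + C + norm s0" for z
  proof (cases "z \<in> \<Omega>")
    case True
    define w where "w = s0 + T' z"
    have w: "(cmod (fst w))\<^sup>2 = C" "(fst w)\<^sup>2 = 2 * snd w" using S[OF True] by (auto simp: S_def w_def)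
    have "cmod (fst w) = sqrt C" using w(1) by (metis norm_ge_zero real_sqrt_unique)
    moreover have "2 * cmod (snd w) = C"
      using arg_cong[OF w(2), of cmod] w(1) by (simp add: norm_power norm_mult)
    ultimately have "norm (fst w) + norm (snd w) \<le> sqrt C + C" using C by simp
    then have "norm w \<le> sqrt C + C" by (metis norm_Pair_le prod.collapse order_trans)
    moreover have "norm (T' z) \<le> norm w + norm s0" unfolding w_def by (metis add_diff_cancel_left' norm_triangle_ineq4)
    ultimately show ?thesis by simp
  qed (use z0 C in simp)
  show ?thesis
    by (rule that[OF m weak_pair_cong_AE[OF _ Tm m ae] z0 ae _ _ b]) (use T S in \<open>auto simp: S_def\<close>)
qed

lemma linear_mat_of_full: "bounded_linear mat_of"
proof -
  have "linear mat_of" by (rule linearI) (simp_all add: vec_eq_iff forall_2)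
  then show ?thesis by (simp add: linear_conv_bounded_linear)
qed

text \<open>The splitting into trace part and trace-free part on which the complex notation rests.
  It translates the two complex equations of an exact perturbation into the matrix constraint of a
  convex integration solution.\<close>

lemma outer_prod_vec_of: "outer_prod (vec_of c) (vec_of c) = mat ((cmod c)\<^sup>2 / 2) + mat_of (c\<^sup>2 / 2)"
  unfolding cmod_power2 by (simp add: vec_eq_iff forall_2 outer_prod_def mat_def power2_eq_square field_simps)

section \<open>Infinitely many convex integration solutions\<close>

context shock_data
begin

lemma region_mid_nonempty:
  assumes "nu_minus D \<rho> < nu_plus D \<rho>"
  shows "region_mid D \<rho> \<noteq> {}"
proof -
  have "(1, vector [0, (nu_minus D \<rho> + nu_plus D \<rho>) / 2]) \<in> region_mid D \<rho>"
    using assms by (simp add: region_iff)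
  then show ?thesis by blast
qed

definition sub_state :: "real \<Rightarrow> real \<Rightarrow> state" where
  "sub_state \<rho> \<epsilon> = (Complex 0 (beta D \<rho>), of_real (\<epsilon> - fan_C D \<rho> \<epsilon> / 2))"

text \<open>For the fan sub-solution the complex number z^2 - 2q is the real number \<epsilon>1 -
  \<epsilon>2, so the claim is |\<epsilon>1 - \<epsilon>2| < \<epsilon>1 + \<epsilon>2. This is
  where the positivity of both parameters enters.\<close>

lemma hull_sub_state:
  assumes "0 < eps1 D \<rho>" "0 < \<epsilon>"
  shows "hull_fun (sub_state \<rho> \<epsilon>) < fan_C D \<rho> \<epsilon>"
proof -
  have "(fst (sub_state \<rho> \<epsilon>))\<^sup>2 - 2 * snd (sub_state \<rho> \<epsilon>) = of_real (eps1 D \<rho> - \<epsilon>)"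
    by (simp add: sub_state_def fan_C_def complex_eq_iff power2_eq_square field_simps)
  then have "hull_fun (sub_state \<rho> \<epsilon>) = (beta D \<rho>)\<^sup>2 + \<bar>eps1 D \<rho> - \<epsilon>\<bar>"
    unfolding hull_fun_def by (simp only: norm_of_real) (simp add: sub_state_def cmod_power2)
  then show ?thesis using assms by (simp add: fan_C_def)
qed

lemma fan_flow_convex_integration:
  assumes sub: "fan_subsolution_defined D \<rho>m \<rho> \<epsilon>"
    and T: "T \<in> borel_measurable borel" "weak_pair T" "\<And>z. z \<notin> region_mid D \<rho> \<Longrightarrow> T z = 0"
    and con: "\<And>z. z \<in> region_mid D \<rho> \<Longrightarrow> (cmod (fst (sub_state \<rho> \<epsilon> + T z)))\<^sup>2 = fan_C D \<rho> \<epsilon>"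
      "\<And>z. z \<in> region_mid D \<rho> \<Longrightarrow> (fst (sub_state \<rho> \<epsilon> + T z))\<^sup>2 = 2 * snd (sub_state \<rho> \<epsilon> + T z)"
    and b: "\<And>z. norm (T z) \<le> B"
  shows "convex_integration_solution D \<rho>m \<rho> \<epsilon> (fan_flow D \<rho> T)"
proof -
  note s = sub[unfolded fan_subsolution_defined_def]
  let ?C = "fan_C D \<rho> \<epsilon>"
  define v u where "v z = vec_of (fst (T z))" and "u z = mat_of (snd (T z))" for z
  have W: "fan_v1 D \<rho> + v z = vec_of (fst (sub_state \<rho> \<epsilon> + T z))" for z
    by (simp add: v_def sub_state_def fan_v1_def vec_eq_iff forall_2)
  have u1: "fan_u1 D \<rho> \<epsilon> + u z = mat_of (snd (sub_state \<rho> \<epsilon> + T z))" for z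
    by (simp add: u_def sub_state_def fan_u1_def vec_eq_iff forall_2)
  have o: "outer_prod (fan_v1 D \<rho> + v z) (fan_v1 D \<rho> + v z) = mat (?C / 2) + (fan_u1 D \<rho> \<epsilon> + u z)" if "z \<in> region_mid D \<rho>" for z
    unfolding W u1 outer_prod_vec_of con[OF that] by (simp add: add_divide_distrib)
  have ent: "entropic_weak_solution D (fan_flow D \<rho> T)"
  proof (rule entropic_fan_flow[where ?M0.0 = "mat (?C / 2) + fan_u1 D \<rho> \<epsilon>" and Cc = ?C, OF _ T b])
    show "max rm rp < \<rho>" using s by blast
    show "(mat (?C / 2) + fan_u1 D \<rho> \<epsilon>) $ 1 $ 2 = 0" by (simp add: mat_def fan_u1_def)
    show "(mat (?C / 2) + fan_u1 D \<rho> \<epsilon>) $ 2 $ 2 = (beta D \<rho>)\<^sup>2 + eps1 D \<rho>"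
      by (simp add: mat_def fan_u1_def) (simp add: fan_C_def)
    show "outer_prod (fan_v1 D \<rho> + vec_of (fst (T z))) (fan_v1 D \<rho> + vec_of (fst (T z))) = mat (?C / 2) + fan_u1 D \<rho> \<epsilon> + mat_of (snd (T z))"
      if "z \<in> region_mid D \<rho>" for z using o[OF that] by (simp add: v_def u_def add.assoc)
    show "(norm (fan_v1 D \<rho> + vec_of (fst (T z))))\<^sup>2 = ?C" if "z \<in> region_mid D \<rho>" for z
      using con(1)[OF that] W[of z] by (simp add: v_def norm_vec_of)
    show "nu_minus D \<rho> * (energy D (state_minus D) - (1 / 2 * \<rho> * ?C + \<rho> * internal_energy D \<rho>))
      \<le> energy_flux D (state_minus D) $ 2 - (1 / 2 * \<rho> * ?C + \<rho> * internal_energy D \<rho> + pressure D \<rho>) * beta D \<rho>"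
      "nu_plus D \<rho> * ((1 / 2 * \<rho> * ?C + \<rho> * internal_energy D \<rho>) - energy D (state_plus D))
      \<le> (1 / 2 * \<rho> * ?C + \<rho> * internal_energy D \<rho> + pressure D \<rho>) * beta D \<rho> - energy_flux D (state_plus D) $ 2"
      using s unfolding fan_E1_def fan_F1_def by blast+
  qed
  have vm: "v \<in> borel_measurable borel" unfolding v_def[abs_def]
    by (rule borel_measurable_continuous_on[OF bounded_linear.continuous_on[OF linear_vec_of continuous_on_fst[OF continuous_on_id]] T(1)])
  have um': "u \<in> borel_measurable borel" unfolding u_def[abs_def]
    by (rule borel_measurable_continuous_on[OF bounded_linear.continuous_on[OF linear_mat_of_full continuous_on_snd[OF continuous_on_id]] T(1)])
  have tst: "(LINT z|lebesgue. T z \<bullet> test_field i \<phi> z) = 0" if \<phi>: "test_function \<phi>" for \<phi> i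
  proof -
    have [measurable]: "test_field i \<phi> \<in> borel_measurable borel" "T \<in> borel_measurable borel"
      using T(1) by (auto intro!: borel_measurable_continuous_onI test_field_continuous test_function_smooth \<phi>)
    have "(LINT z|lebesgue. T z \<bullet> test_field i \<phi> z) = (LINT z|lborel. T z \<bullet> test_field i \<phi> z)"
      by (rule integral_completion) measurable
    then show ?thesis using T(2) \<phi> by (simp add: weak_pair_def)
  qed
  have sg: "x \<bullet> space_grad \<phi> z = x $ 1 * pd e1 \<phi> z + x $ 2 * pd e2 \<phi> z" for x z \<phi>
    by (simp add: space_grad_def inner_vec_def sum_2 pd_def)
  have t0: "v z \<bullet> space_grad \<phi> z = T z \<bullet> test_field 0 \<phi> z" for z \<phi>
    by (simp add: sg v_def test_field_def inner_prod_def inner_complex_def)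
  have t12: "v z $ i * time_deriv \<phi> z + u z $ i \<bullet> space_grad \<phi> z = T z \<bullet> test_field (if i = 1 then 1 else 2) \<phi> z" for z \<phi> i
    using exhaust_2[of i] unfolding sg
    by (auto simp: v_def u_def test_field_def inner_prod_def inner_complex_def time_deriv_def pd_def algebra_simps)
  have mid: "fan_flow D \<rho> T z = (\<rho>, fan_v1 D \<rho> + v z)" if "z \<in> region_mid D \<rho>" for z
    using that by (auto simp: fan_flow_def v_def region_iff)
  have nu: "nu_minus D \<rho> < nu_plus D \<rho>" using fan_values_eq(5)[of \<rho>] s unfolding fan_relations_def by blast
  have right: "fan_flow D \<rho> T z = state_plus D" if "z \<in> region_plus D \<rho>" for z
  proof -
    have "nu_minus D \<rho> * fst z < nu_plus D \<rho> * fst z" using nu that by (simp add: region_iff)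
    then have "z \<notin> region_minus D \<rho>" "z \<notin> region_mid D \<rho>" using that unfolding region_iff by linarith+
    then show ?thesis by (simp add: fan_flow_def)
  qed
  show ?thesis
    unfolding convex_integration_solution_def
  proof (intro conjI sub ent exI[of _ v] exI[of _ u])
    show "v \<in> borel_measurable lebesgue" "u \<in> borel_measurable lebesgue" using vm um' by (auto intro: measurable_completion)
    show "AE z in lebesgue. z \<in> region_minus D \<rho> \<longrightarrow> fan_flow D \<rho> T z = state_minus D" by (simp add: fan_flow_def)
    show "AE z in lebesgue. z \<in> region_plus D \<rho> \<longrightarrow> fan_flow D \<rho> T z = state_plus D" using right by simp
    show "AE z in lebesgue. z \<in> region_mid D \<rho> \<longrightarrow> fan_flow D \<rho> T z = (\<rho>, fan_v1 D \<rho> + v z)" using mid by simp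
    show "AE z in lebesgue. z \<notin> region_mid D \<rho> \<longrightarrow> v z = 0 \<and> u z = 0" using T(3) by (simp add: v_def u_def)
    have "transpose (u z) = u z" "trace (u z) = 0" for z by (simp_all add: u_def vec_eq_iff forall_2 transpose_def trace_def sum_2)
    then show "AE z in lebesgue. transpose (u z) = u z \<and> trace (u z) = 0" by simp
    show "\<forall>\<phi>. test_function \<phi> \<longrightarrow> (LINT z|lebesgue. v z \<bullet> space_grad \<phi> z) = 0" unfolding t0 using tst by blast
    show "\<forall>\<phi> i. test_function \<phi> \<longrightarrow> (LINT z|lebesgue. v z $ i * time_deriv \<phi> z + u z $ i \<bullet> space_grad \<phi> z) = 0"
      unfolding t12 using tst by blast
    show "AE z in lebesgue. z \<in> region_mid D \<rho> \<longrightarrow>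
           outer_prod (fan_v1 D \<rho> + v z) (fan_v1 D \<rho> + v z) - (fan_u1 D \<rho> \<epsilon> + u z) = mat (?C / 2)"
      using o by simp
  qed
qed

text \<open>The density is the same for all of these flows, and the velocity determines the
  perturbation field \<open>fst\<close>. Distinctness of the perturbations on a set of positive
  measure therefore passes to the flows, and it survives the corrections on null sets.\<close>

lemma infinitely_many_convex_integration_solutions:
  assumes sub: "fan_subsolution_defined D \<rho>m \<rho> \<epsilon>"
  shows "\<exists>W. infinite W \<and> (\<forall>w\<in>W. convex_integration_solution D \<rho>m \<rho> \<epsilon> w) \<and> (\<forall>w\<in>W. \<forall>w'\<in>W. w \<noteq> w' \<longrightarrow> \<not> flow_eq w w')"
proof -
  note s = sub[unfolded fan_subsolution_defined_def]
  let ?C = "fan_C D \<rho> \<epsilon>" and ?\<Omega> = "region_mid D \<rho>" and ?s = "sub_state \<rho> \<epsilon>"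
  have nu: "nu_minus D \<rho> < nu_plus D \<rho>" using fan_values_eq(5)[of \<rho>] s unfolding fan_relations_def by blast
  have C: "0 \<le> ?C" using s by (simp add: fan_C_def add_nonneg_nonneg less_imp_le)
  have hs: "hull_fun ?s < ?C" using s by (intro hull_sub_state) auto
  obtain g :: "spacetime \<Rightarrow> real" where g: "continuous_on UNIV g" "\<And>z. 0 < g z" "integrable lborel g" using weight_exists by blast
  obtain \<T> where \<T>: "\<And>n :: nat. exact_perturbation ?\<Omega> ?C ?s (\<T> n)" "\<And>m n. m \<noteq> n \<Longrightarrow> \<not> (AE z in lborel. fst (\<T> m z) = fst (\<T> n z))"
    by (rule infinitely_many_exact_perturbations[OF open_region_mid region_mid_nonempty[OF nu] hs g]) (rule that)
  define Q where "Q n T' \<longleftrightarrow> T' \<in> borel_measurable borel \<and> weak_pair T' \<and> (\<forall>z. z \<notin> ?\<Omega> \<longrightarrow> T' z = 0) \<and> (AE z in lborel. T' z = \<T> n z) \<and>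
    (\<forall>z\<in>?\<Omega>. (cmod (fst (?s + T' z)))\<^sup>2 = ?C \<and> (fst (?s + T' z))\<^sup>2 = 2 * snd (?s + T' z)) \<and>
    (\<forall>z. norm (T' z) \<le> sqrt ?C + ?C + norm ?s)" for n T'
  have "\<exists>T'. Q n T'" for n
    by (rule exact_perturbation_everywhere[OF \<T>(1)[of n] C open_region_mid]) (unfold Q_def, blast)
  then obtain T where T: "\<And>n. Q n (T n)" by metis
  define w where "w n = fan_flow D \<rho> (T n)" for n
  have ci: "convex_integration_solution D \<rho>m \<rho> \<epsilon> (w n)" for n
    unfolding w_def by (rule fan_flow_convex_integration[OF sub, where B = "sqrt ?C + ?C + norm ?s"]) (use T[of n] in \<open>auto simp: Q_def\<close>)
  have ne: "\<not> flow_eq (w m) (w n)" if mn: "m \<noteq> n" for m n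
  proof
    assume "flow_eq (w m) (w n)"
    then have "AE z in lborel. 0 < fst z \<longrightarrow> w m z = w n z" by (simp add: flow_eq_def AE_completion_iff)
    moreover have "AE z in lborel. T m z = \<T> m z" "AE z in lborel. T n z = \<T> n z" using T by (auto simp: Q_def)
    ultimately have "AE z in lborel. fst (\<T> m z) = fst (\<T> n z)"
    proof eventually_elim
      case (elim z)
      show ?case
      proof (cases "z \<in> ?\<Omega>")
        case True
        then have "w m z = w n z" "z \<notin> region_minus D \<rho>" using elim(1) by (auto simp: region_iff)
        then have "fst (T m z) = fst (T n z)" using True by (simp add: w_def fan_flow_def vec_of_eq_iff)
        then show ?thesis using elim by simp
      next
        case False
        then have "T m z = 0" "T n z = 0" using T[of m] T[of n] unfolding Q_def by blast+
        then show ?thesis using elim by simp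
      qed
    qed
    then show False using \<T>(2)[OF mn] by blast
  qed
  have "inj w"
  proof (rule injI, rule ccontr)
    fix m n assume e: "w m = w n" and "m \<noteq> n"
    then have "\<not> flow_eq (w m) (w n)" using ne by blast
    then show False using e by (simp add: flow_eq_def)
  qed
  then have "infinite (range w)" by (rule range_inj_infinite)
  moreover have "\<not> flow_eq x y" if xy: "x \<in> range w" "y \<in> range w" "x \<noteq> y" for x y
  proof -
    obtain m n where "x = w m" "y = w n" using xy(1,2) by (elim rangeE)
    then show ?thesis using ne[of m n] xy(3) by auto
  qed
  moreover have "convex_integration_solution D \<rho>m \<rho> \<epsilon> x" if "x \<in> range w" for x
    using that ci by (elim rangeE) simp
  ultimately show ?thesis by (intro exI[of _ "range w"] conjI ballI impI)
qed

end

section \<open>The action\<close>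

lemma action_box_eq: "action_box L3 T l1 l2 = {0..T} \<times> cbox (vector [- L3, l1]) (vector [L3, l2])"
  by (auto simp: action_box_def mem_box_cart forall_2)

lemma compact_action_box: "compact (action_box L3 T l1 l2)"
  unfolding action_box_eq by (intro compact_Times compact_Icc compact_cbox)

lemma action_box_borel [measurable]: "action_box L3 T l1 l2 \<in> sets borel"
  using compact_action_box by (rule borel_compact)

text \<open>As the interface stays between the two sides, the slice at time \<open>t\<close> is a
  rectangle of width 2 L3 and height \<nu>t - l1, and integrating in time gives the formula.\<close>

lemma measure_box_wedge:
  assumes L: "0 < L3" "0 < T" and l: "\<And>t. 0 \<le> t \<Longrightarrow> t \<le> T \<Longrightarrow> l1 \<le> \<nu> * t \<and> \<nu> * t \<le> l2"
  shows "(\<integral>z. indicator (action_box L3 T l1 l2) z * indicator (wedge \<nu>) z \<partial>lborel) = 2 * L3 * (\<nu> * T\<^sup>2 / 2 - l1 * T)"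
proof -
  let ?Bx = "action_box L3 T l1 l2"
  \<comment> \<open>Closing the wedge changes it by a null set and makes the time slices closed
    boxes.\<close>
  define S where "S = ?Bx \<inter> {z. snd z $ 2 \<le> \<nu> * fst z}"
  have cl: "closed {z :: spacetime. snd z $ 2 \<le> \<nu> * fst z}" by (intro closed_Collect_le continuous_intros)
  have Sc: "compact S" unfolding S_def using compact_action_box cl by (intro compact_Int_closed)
  have Sb[measurable]: "S \<in> sets borel" using Sc by (rule borel_compact)
  have "(\<integral>z. indicator ?Bx z * indicator (wedge \<nu>) z \<partial>lborel) = (\<integral>z. (indicator S z :: real) \<partial>lborel)"
  proof (rule integral_cong_AE)
    show "AE z in lborel. indicator ?Bx z * indicator (wedge \<nu>) z = (indicator S z :: real)"
      using AE_lborel_line[of \<nu>]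
      by eventually_elim (auto simp: S_def wedge_def action_box_def indicator_def)
  qed measurable
  also have "\<dots> = (\<integral>z. (case z of (t, x) \<Rightarrow> indicator S (t, x)) \<partial>(lborel \<Otimes>\<^sub>M lborel))"
    unfolding lborel_prod by (rule Bochner_Integration.integral_cong) auto
  also have "\<dots> = (\<integral>t. (\<integral>x. indicator S (t, x) \<partial>lborel) \<partial>lborel)"
  proof (rule lborel_pair.integral_fst[symmetric])
    have "integrable lborel (indicator S :: spacetime \<Rightarrow> real)"
      using emeasure_compact_finite[OF Sc] by (intro integrable_real_indicator) (auto simp: top.not_eq_extremum)
    then show "integrable (lborel \<Otimes>\<^sub>M lborel) (\<lambda>(t, x). indicator S (t, x) :: real)" unfolding lborel_prod by simp
  qed
  also have "\<dots> = (\<integral>t. 2 * L3 * (\<nu> * t - l1) * indicator {0..T} t \<partial>lborel)"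
  proof (rule Bochner_Integration.integral_cong[OF refl])
    fix t :: real
    show "(\<integral>x. indicator S (t, x) \<partial>lborel) = 2 * L3 * (\<nu> * t - l1) * indicator {0..T} t"
    proof (cases "t \<in> {0..T}")
      case True
      let ?c = "cbox (vector [- L3, l1]) (vector [L3, \<nu> * t]) :: (real ^ 2) set"
      have lt: "l1 \<le> \<nu> * t" "\<nu> * t \<le> l2" using l True by auto
      have "indicator S (t, x) = (indicator ?c x :: real)" for x
        using True lt by (auto simp: S_def action_box_def mem_box_cart forall_2 indicator_def)
      then have "(\<integral>x. indicator S (t, x) \<partial>lborel) = measure lborel ?c" by simp
      also have "\<dots> = 2 * L3 * (\<nu> * t - l1)"
      proof -
        have "vector [0, l1] \<in> ?c" using L lt by (simp add: mem_box_cart forall_2)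
        then have "?c \<noteq> {}" by blast
        then show ?thesis by (simp add: content_cbox_cart UNIV_2)
      qed
      finally show ?thesis using True by simp
    next
      case False
      then have "indicator S (t, x) = (0 :: real)" for x by (auto simp: S_def action_box_def indicator_def)
      then show ?thesis using False by simp
    qed
  qed
  also have "\<dots> = 2 * L3 * (\<nu> * T\<^sup>2 / 2 - l1 * T) - 2 * L3 * (\<nu> * 0\<^sup>2 / 2 - l1 * 0)"
  proof (rule integral_FTC_Icc_real)
    show "0 \<le> T" using L by simp
    show "((\<lambda>t. 2 * L3 * (\<nu> * t\<^sup>2 / 2 - l1 * t)) has_real_derivative 2 * L3 * (\<nu> * t - l1)) (at t)" for t
      by (auto intro!: derivative_eq_intros)
    show "isCont (\<lambda>t. 2 * L3 * (\<nu> * t - l1)) t" for t by (intro continuous_intros)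
  qed
  finally show ?thesis by simp
qed

text \<open>Up to time \<open>T\<close> the position \<nu>t lies between 0 and \<nu>T. The condition
  l1 < 0 < l2 covers interfaces that move away from a side, for which the bound at time
  \<open>T\<close> says nothing about small \<open>t\<close>.\<close>

lemma speed_bounds:
  fixes \<nu> T t l1 l2 :: real
  assumes "0 < T" "l1 < 0" "0 < l2" "0 \<le> t" "t \<le> T"
  shows "l1 < T * \<nu> \<Longrightarrow> min 0 (T * \<nu>) \<le> \<nu> * t \<and> l1 < \<nu> * t" "T * \<nu> < l2 \<Longrightarrow> \<nu> * t \<le> max 0 (T * \<nu>) \<and> \<nu> * t < l2"
proof -
  have "0 \<le> \<nu> * t \<and> \<nu> * t \<le> T * \<nu>" if "0 \<le> \<nu>" using that assms by (simp add: mult_left_mono mult.commute[of T])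
  moreover have "\<nu> * t \<le> 0 \<and> T * \<nu> \<le> \<nu> * t" if "\<nu> \<le> 0"
    using that assms by (simp add: mult_nonpos_nonneg mult_left_mono_neg mult.commute[of T])
  ultimately have a: "min 0 (T * \<nu>) \<le> \<nu> * t \<and> \<nu> * t \<le> max 0 (T * \<nu>)"
    by (meson linear max.coboundedI1 max.coboundedI2 min.coboundedI1 min.coboundedI2)
  show "l1 < T * \<nu> \<Longrightarrow> min 0 (T * \<nu>) \<le> \<nu> * t \<and> l1 < \<nu> * t" using a assms by (auto simp: min_def split: if_splits)
  show "T * \<nu> < l2 \<Longrightarrow> \<nu> * t \<le> max 0 (T * \<nu>) \<and> \<nu> * t < l2" using a assms by (auto simp: max_def split: if_splits)
qed

text \<open>Up to a factor and a constant, the action of a fan.\<close>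

definition fan_action :: "euler_riemann \<Rightarrow> real \<Rightarrow> real \<Rightarrow> real" where
  "fan_action D \<rho> L = nu_minus D \<rho> * (lagrangian D (state_minus D) - L) + nu_plus D \<rho> * (L - lagrangian D (state_plus D))"

text \<open>The Lagrangian is constant almost everywhere in each sector, so the action telescopes
  over the box and two wedges. Everything but the last summand is independent of \<rho>, and
  comparing actions means comparing \<open>fan_action\<close>.\<close>

lemma action_fan:
  assumes \<nu>: "nu_minus D \<rho> < nu_plus D \<rho>" and L: "0 < L3" "0 < T" "l1 < 0" "0 < l2"
    and box: "l1 < T * nu_minus D \<rho>" "T * nu_plus D \<rho> < l2"
    and w: "AE z in lebesgue. z \<in> region_minus D \<rho> \<longrightarrow> w z = state_minus D"
      "AE z in lebesgue. z \<in> region_mid D \<rho> \<longrightarrow> lagrangian D (w z) = Lag"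
      "AE z in lebesgue. z \<in> region_plus D \<rho> \<longrightarrow> w z = state_plus D"
  shows "action D L3 T l1 l2 w = lagrangian D (state_plus D) * (\<integral>z. indicator (action_box L3 T l1 l2) z \<partial>lborel)
     - 2 * L3 * l1 * T * (lagrangian D (state_minus D) - lagrangian D (state_plus D)) + L3 * T\<^sup>2 * fan_action D \<rho> Lag"
proof -
  let ?Bx = "action_box L3 T l1 l2" and ?n1 = "nu_minus D \<rho>" and ?n2 = "nu_plus D \<rho>"
  let ?Lm = "lagrangian D (state_minus D)" and ?Lp = "lagrangian D (state_plus D)"
  define f where "f z = ?Lp * indicator ?Bx z + ((Lag - ?Lp) * (indicator ?Bx z * indicator (wedge ?n2) z)
      + (?Lm - Lag) * (indicator ?Bx z * indicator (wedge ?n1) z))" for z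
  have fm[measurable]: "f \<in> borel_measurable borel" unfolding f_def by measurable
  have ae: "AE z in lebesgue. f z = indicator ?Bx z *\<^sub>R lagrangian D (w z)"
    using w AE_completion[OF AE_lborel_fst_ne_0] AE_completion[OF AE_lborel_line[of ?n1]] AE_completion[OF AE_lborel_line[of ?n2]]
  proof eventually_elim
    case (elim z)
    show ?case
    proof (cases "z \<in> ?Bx")
      case True
      then have t: "0 < fst z" using elim(4) by (auto simp: action_box_def)
      have lt: "?n1 * fst z < ?n2 * fst z" using t \<nu> by simp
      consider "snd z $ 2 < ?n1 * fst z" | "?n1 * fst z < snd z $ 2" "snd z $ 2 < ?n2 * fst z" | "?n2 * fst z < snd z $ 2"
        using elim(5,6) by linarith
      then show ?thesis
      proof cases
        case 1
        then have "snd z $ 2 < ?n2 * fst z" using lt by linarith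
        then show ?thesis using 1 t elim(1) True by (simp add: f_def wedge_def region_iff)
      next
        case 2
        then show ?thesis using t elim(2) True by (simp add: f_def wedge_def region_iff)
      next
        case 3
        then have "\<not> snd z $ 2 < ?n1 * fst z" using lt by linarith
        then show ?thesis using 3 t elim(3) True by (simp add: f_def wedge_def region_iff)
      qed
    qed (simp add: f_def)
  qed
  have fl: "f \<in> borel_measurable lebesgue" using fm by (auto intro: measurable_completion)
  have "action D L3 T l1 l2 w = (LINT z|lebesgue. f z)"
    unfolding action_def set_lebesgue_integral_def
    by (rule integral_cong_AE[OF borel_measurable_AE[OF fl ae] fl]) (use ae in \<open>auto elim!: eventually_mono\<close>)
  also have "\<dots> = (\<integral>z. f z \<partial>lborel)" by (rule integral_completion) simp
  also have "\<dots> = ?Lp * (\<integral>z. indicator ?Bx z \<partial>lborel) + ((Lag - ?Lp) * (\<integral>z. indicator ?Bx z * indicator (wedge ?n2) z \<partial>lborel)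
      + (?Lm - Lag) * (\<integral>z. indicator ?Bx z * indicator (wedge ?n1) z \<partial>lborel))"
  proof -
    have i0: "integrable lborel (indicator ?Bx :: spacetime \<Rightarrow> real)"
      using emeasure_compact_finite[OF compact_action_box] by (intro integrable_real_indicator) (auto simp: top.not_eq_extremum)
    have i1: "integrable lborel (\<lambda>z. indicator ?Bx z * indicator (wedge \<nu>) z :: real)" for \<nu>
      using integrable_indicator_scaleR[OF i0 wedge_borel, of \<nu>] by (simp add: mult.commute)
    show ?thesis unfolding f_def using i0 i1 by simp
  qed
  also have "(\<integral>z. indicator ?Bx z * indicator (wedge ?n2) z \<partial>lborel) = 2 * L3 * (?n2 * T\<^sup>2 / 2 - l1 * T)"
  proof (rule measure_box_wedge[OF L(1,2)])
    fix t assume t: "0 \<le> t" "t \<le> T"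
    have "T * ?n1 < T * ?n2" using \<nu> L(2) by simp
    then have "l1 < T * ?n2" using box(1) by linarith
    then show "l1 \<le> ?n2 * t \<and> ?n2 * t \<le> l2" using speed_bounds[OF L(2-4) t, of ?n2] box(2) by auto
  qed
  also have "(\<integral>z. indicator ?Bx z * indicator (wedge ?n1) z \<partial>lborel) = 2 * L3 * (?n1 * T\<^sup>2 / 2 - l1 * T)"
  proof (rule measure_box_wedge[OF L(1,2)])
    fix t assume t: "0 \<le> t" "t \<le> T"
    have "T * ?n1 < T * ?n2" using \<nu> L(2) by simp
    then have "T * ?n1 < l2" using box(2) by linarith
    then show "l1 \<le> ?n1 * t \<and> ?n1 * t \<le> l2" using speed_bounds[OF L(2-4) t, of ?n1] box(1) by auto
  qed
  finally show ?thesis by (simp add: fan_action_def algebra_simps)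
qed

text \<open>Both flows equal the same outer state in a whole layer next to each side, so the
  averaged distances are zero once \<open>h\<close> is small, not merely convergent to zero.\<close>

lemma same_boundary_fan:
  assumes L: "0 < T" "l1 < 0" "0 < l2"
    and nu: "nu_minus D \<rho> < nu_plus D \<rho>" "nu_minus D \<rho>' < nu_plus D \<rho>'"
    and box: "l1 < T * nu_minus D \<rho>" "T * nu_plus D \<rho> < l2" "l1 < T * nu_minus D \<rho>'" "T * nu_plus D \<rho>' < l2"
    and w: "AE z in lebesgue. z \<in> region_minus D \<rho> \<longrightarrow> w z = state_minus D"
      "AE z in lebesgue. z \<in> region_plus D \<rho> \<longrightarrow> w z = state_plus D"
    and w': "AE z in lebesgue. z \<in> region_minus D \<rho>' \<longrightarrow> w' z = state_minus D"
      "AE z in lebesgue. z \<in> region_plus D \<rho>' \<longrightarrow> w' z = state_plus D"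
  shows "same_boundary_data L3 T l1 l2 w w'"
proof -
  have zero: "((\<lambda>h. (\<integral>\<^sup>+ z \<in> B h. ennreal (dist (w z) (w' z)) \<partial>lebesgue) / ennreal h) \<longlongrightarrow> 0) (at_right 0)"
    if d: "0 < d" and ae: "\<And>h. 0 < h \<Longrightarrow> h < d \<Longrightarrow> AE z in lebesgue. z \<in> B h \<longrightarrow> w z = w' z" for B :: "real \<Rightarrow> spacetime set" and d
  proof (rule tendsto_eventually)
    show "\<forall>\<^sub>F h in at_right 0. (\<integral>\<^sup>+ z \<in> B h. ennreal (dist (w z) (w' z)) \<partial>lebesgue) / ennreal h = 0"
      unfolding eventually_at_right_field
    proof (intro exI[of _ d] conjI d allI impI)
      fix h assume h: "0 < h" "h < d"
      have "(\<integral>\<^sup>+ z \<in> B h. ennreal (dist (w z) (w' z)) \<partial>lebesgue) = (\<integral>\<^sup>+ z. 0 \<partial>(lebesgue :: spacetime measure))"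
        using ae[OF h] by (intro nn_integral_cong_AE) (auto elim!: eventually_mono split: split_indicator)
      then show "(\<integral>\<^sup>+ z \<in> B h. ennreal (dist (w z) (w' z)) \<partial>lebesgue) / ennreal h = 0" by simp
    qed
  qed
  note t0 = AE_completion[OF AE_lborel_fst_ne_0]
  \<comment> \<open>The lowest position that either left interface reaches up to time
    \<open>T\<close>; the gap \<open>m - l1\<close> is the thickness of the undisturbed layer. The
    next definition does the same on the right.\<close>
  define m where "m = min (min 0 (T * nu_minus D \<rho>)) (min 0 (T * nu_minus D \<rho>'))"
  define k where "k = max (max 0 (T * nu_plus D \<rho>)) (max 0 (T * nu_plus D \<rho>'))"
  have m: "0 < m - l1" using L box by (auto simp: m_def)
  have k: "0 < l2 - k" using L box by (auto simp: k_def)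
  show ?thesis
    unfolding same_boundary_data_def
  proof (rule conjI[OF zero[OF m] zero[OF k]])
    fix h assume h: "0 < h" "h < m - l1"
    show "AE z in lebesgue. z \<in> action_box L3 T l1 (l1 + h) \<longrightarrow> w z = w' z"
      using w(1) w'(1) t0
    proof eventually_elim
      case (elim z)
      show ?case
      proof
        assume z: "z \<in> action_box L3 T l1 (l1 + h)"
        then have t: "0 \<le> fst z" "fst z \<le> T" "snd z $ 2 < m" using h by (auto simp: action_box_def)
        have "m \<le> nu_minus D \<rho> * fst z" "m \<le> nu_minus D \<rho>' * fst z"
          using speed_bounds(1)[OF L t(1,2) box(1)] speed_bounds(1)[OF L t(1,2) box(3)] by (auto simp: m_def)
        then have "z \<in> region_minus D \<rho>" "z \<in> region_minus D \<rho>'" using t elim(3) unfolding region_iff by linarith+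
        then show "w z = w' z" using elim by simp
      qed
    qed
  next
    fix h assume h: "0 < h" "h < l2 - k"
    show "AE z in lebesgue. z \<in> action_box L3 T (l2 - h) l2 \<longrightarrow> w z = w' z"
      using w(2) w'(2) t0
    proof eventually_elim
      case (elim z)
      show ?case
      proof
        assume z: "z \<in> action_box L3 T (l2 - h) l2"
        then have t: "0 \<le> fst z" "fst z \<le> T" "k < snd z $ 2" using h by (auto simp: action_box_def)
        have "nu_plus D \<rho> * fst z \<le> k" "nu_plus D \<rho>' * fst z \<le> k"
          using speed_bounds(2)[OF L t(1,2) box(2)] speed_bounds(2)[OF L t(1,2) box(4)] by (auto simp: k_def)
        then have "z \<in> region_plus D \<rho>" "z \<in> region_plus D \<rho>'" using t elim(3) unfolding region_iff by linarith+
        then show "w z = w' z" using elim by simp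
      qed
    qed
  qed
qed

section \<open>Comparison of the actions, and entropy of the two shock solution\<close>

context shock_data
begin

lemma middle_state:
  assumes \<rho>: "max rm rp < \<rho>"
  defines "x \<equiv> 1 / \<rho>"
  shows "x \<in> vol" "nu_minus D \<rho> = um - jm x / rm" "nu_plus D \<rho> = up + jp x / rp" "\<rho> * (beta D \<rho> - nu_minus D \<rho>) = jm x"
    "\<rho> * (nu_plus D \<rho> - beta D \<rho>) = jp x"
    "um = beta D \<rho> + jm x * tm x" "up = beta D \<rho> - jp x * tp x" "jm x * (jm x * tm x) = PP x - pm" "jp x * (jp x * tp x) = PP x - pp"
    "eps1 D \<rho> = (PP x - pr x) * x" "pressure D \<rho> = pr x" "internal_energy D \<rho> = en x"
proof -
  have \<rho>0: "0 < \<rho>" using \<rho> data_pos by simp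
  show v: "x \<in> vol" using \<rho> vol_iff[OF \<rho>0] by (simp add: x_def)
  note f = fan_values_eq[OF \<rho>, folded x_def]
  note r = flux_relations[OF v]
  show "nu_minus D \<rho> = um - jm x / rm" "nu_plus D \<rho> = up + jp x / rp" by (fact f)+
  show b: "um = beta D \<rho> + jm x * tm x" using f(3) by simp
  show b2: "up = beta D \<rho> - jp x * tp x" using r(1) b by simp
  have "beta D \<rho> - nu_minus D \<rho> = jm x * x" unfolding f by (simp add: tm_def right_diff_distrib)
  then show "\<rho> * (beta D \<rho> - nu_minus D \<rho>) = jm x" using \<rho>0 by (simp add: x_def)
  have "nu_plus D \<rho> - beta D \<rho> = jp x * x" using b2 unfolding f(2) by (simp add: tp_def right_diff_distrib)
  then show "\<rho> * (nu_plus D \<rho> - beta D \<rho>) = jp x" using \<rho>0 by (simp add: x_def)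
  show "jm x * (jm x * tm x) = PP x - pm" by (simp add: PP_def power2_eq_square mult.assoc)
  show "jp x * (jp x * tp x) = PP x - pp" using r(2) by (simp add: PP_def power2_eq_square mult.assoc)
  show "eps1 D \<rho> = (PP x - pr x) * x" using f(4) by (simp add: x_def)
  show "pressure D \<rho> = pr x" using \<rho>0 pr_eq[of x] by (simp add: x_def)
  show "internal_energy D \<rho> = en x" by (simp add: en_def x_def)
qed

lemma lagrangian_outer:
  "lagrangian D (state_minus D) = rm * (um\<^sup>2 / 2 - internal_energy D rm)" "lagrangian D (state_plus D) = rp * (up\<^sup>2 / 2 - internal_energy D rp)"
  "energy D (state_minus D) = rm * (um\<^sup>2 / 2 + internal_energy D rm)" "energy D (state_plus D) = rp * (up\<^sup>2 / 2 + internal_energy D rp)"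
  "energy_flux D (state_minus D) $ 2 = (energy D (state_minus D) + pm) * um" "energy_flux D (state_plus D) $ 2 = (energy D (state_plus D) + pp) * up"
proof -
  have n: "(norm (vector [0, a] :: real ^ 2))\<^sup>2 = a\<^sup>2" for a by (simp add: norm_vec_def L2_set_def sum_2)
  show "lagrangian D (state_minus D) = rm * (um\<^sup>2 / 2 - internal_energy D rm)" "lagrangian D (state_plus D) = rp * (up\<^sup>2 / 2 - internal_energy D rp)"
    "energy D (state_minus D) = rm * (um\<^sup>2 / 2 + internal_energy D rm)" "energy D (state_plus D) = rp * (up\<^sup>2 / 2 + internal_energy D rp)"
    by (simp_all add: state_minus_def state_plus_def n algebra_simps)
  show "energy_flux D (state_minus D) $ 2 = (energy D (state_minus D) + pm) * um" "energy_flux D (state_plus D) $ 2 = (energy D (state_plus D) + pp) * up"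
    by (simp_all add: state_minus_def state_plus_def del: energy.simps)
qed

text \<open>Each interface speed is an outer velocity corrected by a mass flux over an outer
  density, so the jumps of the Lagrangian turn into fluxes times specific energies. The kinetic
  terms become stresses through j (u^2 - b^2), and \<epsilon> enters linearly with half the positive
  flux sum as coefficient.\<close>

lemma fan_action_Phi:
  assumes \<rho>: "max rm rp < \<rho>"
  shows "fan_action D \<rho> (\<rho> * ((beta D \<rho>)\<^sup>2 + eps1 D \<rho> + \<epsilon>) / 2 - \<rho> * internal_energy D \<rho>) =
    um * lagrangian D (state_minus D) - up * lagrangian D (state_plus D) + um * pm - up * pp
      - Phi (1 / \<rho>) + (jm (1 / \<rho>) + jp (1 / \<rho>)) * \<epsilon> / 2"
proof -
  define x where "x = 1 / \<rho>"
  define b e where "b = beta D \<rho>" and "e = eps1 D \<rho>"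
  note m = middle_state[OF \<rho>, folded x_def b_def e_def]
  define Lm Lp where "Lm = lagrangian D (state_minus D)" and "Lp = lagrangian D (state_plus D)"
  have nl: "nu_minus D \<rho> * Lm = um * Lm - jm x * (um\<^sup>2 / 2 - internal_energy D rm)"
    unfolding m(2) Lm_def lagrangian_outer using data_pos by (simp add: field_simps)
  have nr: "nu_plus D \<rho> * Lp = up * Lp + jp x * (up\<^sup>2 / 2 - internal_energy D rp)"
    unfolding m(3) Lp_def lagrangian_outer using data_pos by (simp add: field_simps)
  define K where "K = (b\<^sup>2 + e + \<epsilon>) / 2 - en x"
  have L: "\<rho> * (b\<^sup>2 + e + \<epsilon>) / 2 - \<rho> * internal_energy D \<rho> = \<rho> * K" unfolding m(12) by (simp add: K_def algebra_simps)
  have "\<rho> * (nu_plus D \<rho> - nu_minus D \<rho>) = jm x + jp x" using m(4,5) by (simp add: algebra_simps)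
  then have d: "(nu_plus D \<rho> - nu_minus D \<rho>) * (\<rho> * K) = (jm x + jp x) * K" by (metis mult.assoc mult.commute)
  have A: "fan_action D \<rho> (\<rho> * (b\<^sup>2 + e + \<epsilon>) / 2 - \<rho> * internal_energy D \<rho>) = um * Lm - up * Lp
      - jm x * (um\<^sup>2 / 2 - internal_energy D rm) - jp x * (up\<^sup>2 / 2 - internal_energy D rp) + (jm x + jp x) * K"
    unfolding fan_action_def L Lm_def[symmetric] Lp_def[symmetric] using nl nr d by (simp add: algebra_simps)
  define u1 u2 where "u1 = jm x * tm x" and "u2 = jp x * tp x"
  have u: "um = b + u1" "up = b - u2" "jm x * u1 = PP x - pm" "jp x * u2 = PP x - pp"
    using m(6-9) by (simp_all add: u1_def u2_def)
  have k1: "jm x * (um\<^sup>2 - b\<^sup>2) = (PP x - pm) * (2 * b + u1)"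
    unfolding u(1) u(3)[symmetric] by (simp add: power2_eq_square algebra_simps)
  have k2: "jp x * (up\<^sup>2 - b\<^sup>2) = (PP x - pp) * (u2 - 2 * b)"
    unfolding u(2) u(4)[symmetric] by (simp add: power2_eq_square algebra_simps)
  have c1: "um * pm = b * pm + u1 * pm" and c2: "up * pp = b * pp - u2 * pp" unfolding u by (simp_all add: algebra_simps)
  have P: "Phi x = u1 * (PP x + pm) / 2 + jm x * (en x - internal_energy D rm - e / 2)
      + (u2 * (PP x + pp) / 2 + jp x * (en x - internal_energy D rp - e / 2))"
    unfolding Phi_def m(10) u1_def u2_def by (simp add: algebra_simps)
  have "- jm x * (um\<^sup>2 / 2 - internal_energy D rm) - jp x * (up\<^sup>2 / 2 - internal_energy D rp) + (jm x + jp x) * K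
     = - (jm x * (um\<^sup>2 - b\<^sup>2)) / 2 - (jp x * (up\<^sup>2 - b\<^sup>2)) / 2 - jm x * (en x - internal_energy D rm - e / 2)
       - jp x * (en x - internal_energy D rp - e / 2) + (jm x + jp x) * \<epsilon> / 2"
    unfolding K_def by (simp add: field_simps)
  also have "\<dots> = um * pm - up * pp - Phi x + (jm x + jp x) * \<epsilon> / 2"
    unfolding k1 k2 P c1 c2 by (simp add: field_simps)
  finally show ?thesis using A unfolding x_def[symmetric] b_def[symmetric] e_def[symmetric] Lm_def[symmetric] Lp_def[symmetric] by simp
qed

text \<open>At each shock the entropy production is the mass flux times the gap between the mean
  pressure times the volume drop and the jump of internal energy. The flux is positive and the gap
  is nonnegative by \<open>energy_jump\<close>.\<close>

lemma two_shock_entropy: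
  assumes \<rho>: "max rm rp < \<rho>" and e: "eps1 D \<rho> = 0"
  defines "E1 \<equiv> 1 / 2 * \<rho> * (beta D \<rho>)\<^sup>2 + \<rho> * internal_energy D \<rho>"
  shows "nu_minus D \<rho> * (energy D (state_minus D) - E1) \<le> energy_flux D (state_minus D) $ 2 - (E1 + pressure D \<rho>) * beta D \<rho>"
    "nu_plus D \<rho> * (E1 - energy D (state_plus D)) \<le> (E1 + pressure D \<rho>) * beta D \<rho> - energy_flux D (state_plus D) $ 2"
proof -
  define x where "x = 1 / \<rho>"
  define b where "b = beta D \<rho>"
  note m = middle_state[OF \<rho>, folded x_def b_def]
  have x0: "0 < x" using vol_pos[OF m(1)] by simp
  have PP: "PP x = pr x" using m(10) e x0 by simp
  have j: "0 < jm x" "0 < jp x" using fluxes_positive[OF m(1)] PP by auto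
  define u1 u2 where "u1 = jm x * tm x" and "u2 = jp x * tp x"
  have u: "um = b + u1" "up = b - u2" "jm x * u1 = pr x - pm" "jp x * u2 = pr x - pp"
    using m(6-9) PP by (simp_all add: u1_def u2_def)
  have E1: "E1 = \<rho> * (b\<^sup>2 / 2 + en x)" unfolding E1_def b_def[symmetric] m(12) by (simp add: algebra_simps)
  have t1: "jm x * (en x - internal_energy D rm) \<le> u1 * (pr x + pm) / 2"
    using mult_left_mono[OF energy_jump(1)[OF m(1)], of "jm x"] j by (simp add: u1_def algebra_simps)
  have t2: "jp x * (en x - internal_energy D rp) \<le> u2 * (pr x + pp) / 2"
    using mult_left_mono[OF energy_jump(2)[OF m(1)], of "jp x"] j by (simp add: u2_def algebra_simps)
  have k1: "jm x * (um\<^sup>2 - b\<^sup>2) = (pr x - pm) * (2 * b + u1)"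
    unfolding u(1) u(3)[symmetric] by (simp add: power2_eq_square algebra_simps)
  have k2: "jp x * (up\<^sup>2 - b\<^sup>2) = (pr x - pp) * (u2 - 2 * b)"
    unfolding u(2) u(4)[symmetric] by (simp add: power2_eq_square algebra_simps)
  have c1: "pm * um = b * pm + u1 * pm" and c2: "pp * up = b * pp - u2 * pp" unfolding u by (simp_all add: algebra_simps)
  show "nu_minus D \<rho> * (energy D (state_minus D) - E1) \<le> energy_flux D (state_minus D) $ 2 - (E1 + pressure D \<rho>) * beta D \<rho>"
  proof -
    have n1: "(um - nu_minus D \<rho>) * energy D (state_minus D) = jm x * (um\<^sup>2 / 2 + internal_energy D rm)"
      unfolding m(2) lagrangian_outer using data_pos by simp
    have n2: "(b - nu_minus D \<rho>) * E1 = jm x * (b\<^sup>2 / 2 + en x)"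
      unfolding E1 m(4)[symmetric] by (simp add: algebra_simps)
    have "energy_flux D (state_minus D) $ 2 - (E1 + pressure D \<rho>) * b - nu_minus D \<rho> * (energy D (state_minus D) - E1)
      = (um - nu_minus D \<rho>) * energy D (state_minus D) - (b - nu_minus D \<rho>) * E1 + pm * um - pr x * b"
      unfolding lagrangian_outer(5) m(11) by (simp add: algebra_simps)
    also have "\<dots> = jm x * (um\<^sup>2 - b\<^sup>2) / 2 - jm x * (en x - internal_energy D rm) + pm * um - pr x * b"
      unfolding n1 n2 by (simp add: field_simps)
    also have "\<dots> = u1 * (pr x + pm) / 2 - jm x * (en x - internal_energy D rm)"
      unfolding k1 c1 by (simp add: field_simps)
    finally show ?thesis using t1 unfolding b_def by linarith
  qed
  show "nu_plus D \<rho> * (E1 - energy D (state_plus D)) \<le> (E1 + pressure D \<rho>) * beta D \<rho> - energy_flux D (state_plus D) $ 2"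
  proof -
    have n1: "(nu_plus D \<rho> - up) * energy D (state_plus D) = jp x * (up\<^sup>2 / 2 + internal_energy D rp)"
      unfolding m(3) lagrangian_outer using data_pos by simp
    have n2: "(nu_plus D \<rho> - b) * E1 = jp x * (b\<^sup>2 / 2 + en x)"
      unfolding E1 m(5)[symmetric] by (simp add: algebra_simps)
    have "(E1 + pressure D \<rho>) * b - energy_flux D (state_plus D) $ 2 - nu_plus D \<rho> * (E1 - energy D (state_plus D))
      = (nu_plus D \<rho> - up) * energy D (state_plus D) - (nu_plus D \<rho> - b) * E1 - pp * up + pr x * b"
      unfolding lagrangian_outer(6) m(11) by (simp add: algebra_simps)
    also have "\<dots> = jp x * (up\<^sup>2 - b\<^sup>2) / 2 - jp x * (en x - internal_energy D rp) - pp * up + pr x * b"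
      unfolding n1 n2 by (simp add: field_simps)
    also have "\<dots> = u2 * (pr x + pp) / 2 - jp x * (en x - internal_energy D rp)"
      unfolding k2 c2 by (simp add: field_simps)
    finally show ?thesis using t2 unfolding b_def by linarith
  qed
qed

lemma two_shock_fan_flow:
  assumes "intermediate_state D \<rho>m vm"
  shows "two_shock D \<rho>m vm = fan_flow D \<rho>m (\<lambda>_. 0)"
  using assms by (auto simp: fun_eq_iff two_shock_def fan_flow_def fan_v1_def intermediate_state_def)

lemma two_shock_entropic:
  assumes i: "intermediate_state D \<rho>m vm"
  shows "entropic_weak_solution D (two_shock D \<rho>m vm)"
  unfolding two_shock_fan_flow[OF i]
proof (rule entropic_fan_flow[where ?M0.0 = "outer_prod (fan_v1 D \<rho>m) (fan_v1 D \<rho>m)" and Cc = "(beta D \<rho>m)\<^sup>2" and B = 0])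
  have \<rho>: "max rm rp < \<rho>m" and e: "eps1 D \<rho>m = 0" using i by (auto simp: intermediate_state_def)
  show "max rm rp < \<rho>m" by (rule \<rho>)
  show "weak_pair (\<lambda>_. 0)" by (simp add: weak_pair_def)
  show "outer_prod (fan_v1 D \<rho>m) (fan_v1 D \<rho>m) $ 1 $ 2 = 0"
    "outer_prod (fan_v1 D \<rho>m) (fan_v1 D \<rho>m) $ 2 $ 2 = (beta D \<rho>m)\<^sup>2 + eps1 D \<rho>m"
    by (simp_all add: outer_prod_def fan_v1_def power2_eq_square e)
  show "(norm (fan_v1 D \<rho>m + vec_of (fst (0 :: state))))\<^sup>2 = (beta D \<rho>m)\<^sup>2"
    by (simp add: fan_v1_def norm_vec_def L2_set_def sum_2)
qed (use i two_shock_entropy[of \<rho>m] in \<open>auto simp: intermediate_state_def\<close>)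

end

text \<open>Taking the trace of the pointwise constraint removes both trace-free matrices and leaves
  |v|^2 = C. All solutions with the same parameters thus have the same Lagrangian in the middle
  region.\<close>

lemma convex_integration_lagrangian:
  assumes "convex_integration_solution D \<rho>m \<rho> \<epsilon> w"
  shows "AE z in lebesgue. z \<in> region_mid D \<rho> \<longrightarrow>
    lagrangian D (w z) = \<rho> * ((beta D \<rho>)\<^sup>2 + eps1 D \<rho> + \<epsilon>) / 2 - \<rho> * internal_energy D \<rho>"
proof -
  obtain v u where a: "AE z in lebesgue. z \<in> region_mid D \<rho> \<longrightarrow> w z = (\<rho>, fan_v1 D \<rho> + v z)"
    "AE z in lebesgue. transpose (u z) = u z \<and> trace (u z) = 0"
    "AE z in lebesgue. z \<in> region_mid D \<rho> \<longrightarrow>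
      outer_prod (fan_v1 D \<rho> + v z) (fan_v1 D \<rho> + v z) - (fan_u1 D \<rho> \<epsilon> + u z) = mat (fan_C D \<rho> \<epsilon> / 2)"
    using assms unfolding convex_integration_solution_def by blast
  show ?thesis
    using a
  proof eventually_elim
    case (elim z)
    show ?case
    proof
      assume z: "z \<in> region_mid D \<rho>"
      define W where "W = fan_v1 D \<rho> + v z"
      have c: "outer_prod W W - (fan_u1 D \<rho> \<epsilon> + u z) = mat (fan_C D \<rho> \<epsilon> / 2)" using elim z by (simp add: W_def)
      have "trace (outer_prod W W - (fan_u1 D \<rho> \<epsilon> + u z)) = fan_C D \<rho> \<epsilon>"
        unfolding c by (simp add: trace_def sum_2 mat_def)
      moreover have "trace (outer_prod W W - (fan_u1 D \<rho> \<epsilon> + u z)) = (norm W)\<^sup>2 - trace (u z)"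
        by (simp add: trace_def sum_2 outer_prod_def fan_u1_def norm_vec_def L2_set_def power2_eq_square)
      ultimately have "(norm W)\<^sup>2 = fan_C D \<rho> \<epsilon>" using elim by simp
      then show "lagrangian D (w z) = \<rho> * ((beta D \<rho>)\<^sup>2 + eps1 D \<rho> + \<epsilon>) / 2 - \<rho> * internal_energy D \<rho>"
        using elim z by (simp add: W_def[symmetric] fan_C_def)
    qed
  qed
qed

lemma (in shock_data) fan_speeds: "max rm rp < \<rho> \<Longrightarrow> nu_minus D \<rho> < nu_plus D \<rho>"
  using fan_values_eq(5) unfolding fan_relations_def by blast

text \<open>\<open>Phi\<close> is monotone only where the effective pressure is at least the
  pressure, so \<epsilon>1 \<ge> 0 is required on the whole interval up to \<rho>m and not just at
  its ends. Passing to 1/\<rho> reverses the order.\<close>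

lemma (in shock_data) fan_action_less:
  assumes \<rho>: "max rm rp < \<rho>" "\<rho> < \<rho>m" and \<epsilon>: "0 < \<epsilon>"
    and e: "\<And>r. \<rho> \<le> r \<Longrightarrow> r \<le> \<rho>m \<Longrightarrow> 0 \<le> eps1 D r" and m: "eps1 D \<rho>m = 0"
  shows "fan_action D \<rho>m (\<rho>m * (beta D \<rho>m)\<^sup>2 / 2 - \<rho>m * internal_energy D \<rho>m)
    < fan_action D \<rho> (\<rho> * ((beta D \<rho>)\<^sup>2 + eps1 D \<rho> + \<epsilon>) / 2 - \<rho> * internal_energy D \<rho>)"
proof -
  have \<rho>m: "max rm rp < \<rho>m" using \<rho> by linarith
  have \<rho>0: "0 < \<rho>" "0 < \<rho>m" using \<rho> data_pos by auto
  have "Phi (1 / \<rho>) < Phi (1 / \<rho>m)"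
  proof (rule Phi_decreasing)
    show "1 / \<rho>m < 1 / \<rho>" using \<rho> \<rho>0 by (simp add: frac_less2)
    fix z assume z: "1 / \<rho>m \<le> z" "z \<le> 1 / \<rho>"
    have z0: "0 < z" using z \<rho>0 by (meson divide_pos_pos less_le_trans zero_less_one)
    define r where "r = 1 / z"
    have r: "0 < r" "\<rho> \<le> r" "r \<le> \<rho>m" "1 / r = z" using z z0 \<rho>0 by (simp_all add: r_def field_simps)
    have rr: "max rm rp < r" using r \<rho> by linarith
    note ms = middle_state[OF rr, unfolded r(4)]
    have "0 \<le> (PP z - pr z) * z" using e[OF r(2,3)] ms(10) by simp
    then show "z \<in> vol \<and> pr z \<le> PP z" using ms(1) z0 by (simp add: zero_le_mult_iff)
  qed
  moreover have "0 < (jm (1 / \<rho>) + jp (1 / \<rho>)) * \<epsilon>"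
    using flux_relations(3)[OF middle_state(1)[OF \<rho>(1)]] \<epsilon> by simp
  ultimately show ?thesis using fan_action_Phi[OF \<rho>(1), of \<epsilon>] fan_action_Phi[OF \<rho>m, of 0] m by simp
qed

section \<open>The four claims for the action principle\<close>

theorem theorem5:
  fixes D :: euler_riemann and \<gamma> \<rho>m vm \<epsilon>2 \<rho>s L3 T l1 l2 :: real
  assumes gamma: "1 \<le> \<gamma>"
    and pressure_law: "\<And>\<rho>. 0 < \<rho> \<Longrightarrow> pressure D \<rho> = \<rho> powr \<gamma>"
    and internal_energy_law:
      "\<And>\<rho>. 0 < \<rho> \<Longrightarrow> (internal_energy D has_real_derivative pressure D \<rho> / \<rho>\<^sup>2) (at \<rho>)"
    and data: "two_shock_data D"
    and intermediate: "intermediate_state D \<rho>m vm"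
    and eps2: "0 < \<epsilon>2"
    and left_interval: "\<rho>s < \<rho>m"
    and subsolutions: "\<And>\<rho>1. \<rho>s \<le> \<rho>1 \<Longrightarrow> \<rho>1 < \<rho>m \<Longrightarrow> fan_subsolution_defined D \<rho>m \<rho>1 \<epsilon>2"
    and box: "0 < L3" "0 < T" "l1 < 0" "0 < l2"
    and box_left: "\<And>\<rho>1. \<rho>s \<le> \<rho>1 \<Longrightarrow> \<rho>1 \<le> \<rho>m \<Longrightarrow> l1 < T * nu_minus D \<rho>1"
    and box_right: "\<And>\<rho>1. \<rho>s \<le> \<rho>1 \<Longrightarrow> \<rho>1 \<le> \<rho>m \<Longrightarrow> T * nu_plus D \<rho>1 < l2"
  shows
    "(\<forall>\<rho>1. \<rho>s \<le> \<rho>1 \<and> \<rho>1 < \<rho>m \<longrightarrow>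
        (\<exists>W. infinite W \<and> (\<forall>w\<in>W. convex_integration_solution D \<rho>m \<rho>1 \<epsilon>2 w) \<and>
             (\<forall>w\<in>W. \<forall>w'\<in>W. w \<noteq> w' \<longrightarrow> \<not> flow_eq w w')))
     \<and>
     (\<forall>w\<in>convex_integration_family D \<rho>m \<rho>s \<epsilon>2.
        action D L3 T l1 l2 (two_shock D \<rho>m vm) < action D L3 T l1 l2 w)
     \<and>
     ((\<forall>w\<in>convex_integration_family D \<rho>m \<rho>s \<epsilon>2.
         same_boundary_data L3 T l1 l2 (two_shock D \<rho>m vm) w \<and>
         \<not> LAAP_admissible D L3 T l1 l2 w) \<and>
      entropic_weak_solution D (two_shock D \<rho>m vm) \<and>
      least_action_among (insert (two_shock D \<rho>m vm) (convex_integration_family D \<rho>m \<rho>s \<epsilon>2))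
        D L3 T l1 l2 (two_shock D \<rho>m vm))
     \<and>
     ((\<forall>w. entropic_weak_solution D w \<and>
           same_boundary_data L3 T l1 l2 (two_shock D \<rho>m vm) w \<longrightarrow>
           w \<in> convex_integration_family D \<rho>m \<rho>s \<epsilon>2 \<or> flow_eq w (two_shock D \<rho>m vm))
      \<longrightarrow>
      LAAP_admissible D L3 T l1 l2 (two_shock D \<rho>m vm) \<and>
      (\<forall>w. LAAP_admissible D L3 T l1 l2 w \<and>
           same_boundary_data L3 T l1 l2 (two_shock D \<rho>m vm) w \<longrightarrow>
           flow_eq w (two_shock D \<rho>m vm)))"
proof -
  interpret shock_data D \<gamma>
    using gamma pressure_law internal_energy_law data by (rule shock_data.intro)
  let ?s = "two_shock D \<rho>m vm" and ?F = "convex_integration_family D \<rho>m \<rho>s \<epsilon>2"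
  let ?A = "action D L3 T l1 l2"
  have \<rho>m: "max rm rp < \<rho>m" "eps1 D \<rho>m = 0" "beta D \<rho>m = vm" using intermediate by (auto simp: intermediate_state_def)
  have e: "0 \<le> eps1 D r" if "\<rho>s \<le> r" "r \<le> \<rho>m" for r
    using subsolutions[of r] \<rho>m(2) that by (cases "r = \<rho>m") (auto simp: fan_subsolution_defined_def)
  have s: "z \<in> region_minus D \<rho>m \<Longrightarrow> ?s z = state_minus D" "z \<in> region_mid D \<rho>m \<Longrightarrow> ?s z = (\<rho>m, vector [0, vm])"
    "z \<in> region_plus D \<rho>m \<Longrightarrow> ?s z = state_plus D" for z
  proof -
    have "\<not> snd z $ 2 < nu_minus D \<rho>m * fst z" if "0 < fst z" "nu_plus D \<rho>m * fst z < snd z $ 2"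
      using mult_strict_right_mono[OF fan_speeds[OF \<rho>m(1)] that(1)] that(2) by linarith
    then show "z \<in> region_minus D \<rho>m \<Longrightarrow> ?s z = state_minus D" "z \<in> region_mid D \<rho>m \<Longrightarrow> ?s z = (\<rho>m, vector [0, vm])"
      "z \<in> region_plus D \<rho>m \<Longrightarrow> ?s z = state_plus D"
      by (auto simp: two_shock_def region_iff)
  qed
  define K where "K = lagrangian D (state_plus D) * (\<integral>z. indicator (action_box L3 T l1 l2) z \<partial>lborel)
     - 2 * L3 * l1 * T * (lagrangian D (state_minus D) - lagrangian D (state_plus D))"
  \<comment> \<open>Stated for every flow that agrees with the two shock solution almost everywhere,
    because uniqueness among the admissible flows holds only up to null sets.\<close>
  have shock_action: "?A w = K + L3 * T\<^sup>2 * fan_action D \<rho>m (\<rho>m * (beta D \<rho>m)\<^sup>2 / 2 - \<rho>m * internal_energy D \<rho>m)"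
    if "flow_eq w ?s" for w
    unfolding K_def
  proof (rule action_fan[OF fan_speeds[OF \<rho>m(1)] box])
    have l: "lagrangian D (\<rho>m, vector [0, vm]) = \<rho>m * (beta D \<rho>m)\<^sup>2 / 2 - \<rho>m * internal_energy D \<rho>m"
      by (simp add: \<rho>m(3) norm_vec_def L2_set_def sum_2)
    show "AE z in lebesgue. z \<in> region_minus D \<rho>m \<longrightarrow> w z = state_minus D"
      "AE z in lebesgue. z \<in> region_mid D \<rho>m \<longrightarrow> lagrangian D (w z) = \<rho>m * (beta D \<rho>m)\<^sup>2 / 2 - \<rho>m * internal_energy D \<rho>m"
      "AE z in lebesgue. z \<in> region_plus D \<rho>m \<longrightarrow> w z = state_plus D"
      using that unfolding flow_eq_def by (eventually_elim; use s l in \<open>force simp: region_iff\<close>)+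
  qed (use box_left[of \<rho>m] box_right[of \<rho>m] left_interval in auto)
  \<comment> \<open>Both orders of the boundary relation are recorded: testing the admissibility of
    \<open>w\<close> starts from \<open>w\<close>, testing that of the two shock solution starts
    from the latter.\<close>
  have member: "?A ?s < ?A w \<and> same_boundary_data L3 T l1 l2 ?s w \<and> same_boundary_data L3 T l1 l2 w ?s"
    if F: "w \<in> ?F" for w
  proof -
    obtain \<rho> where \<rho>: "\<rho>s \<le> \<rho>" "\<rho> < \<rho>m" and w: "convex_integration_solution D \<rho>m \<rho> \<epsilon>2 w"
      using F by (auto simp: convex_integration_family_def)
    have \<rho>1: "max rm rp < \<rho>" using subsolutions[OF \<rho>] by (simp add: fan_subsolution_defined_def)
    have lr: "l1 < T * nu_minus D \<rho>" "T * nu_plus D \<rho> < l2" "l1 < T * nu_minus D \<rho>m" "T * nu_plus D \<rho>m < l2"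
      using box_left[of \<rho>] box_left[of \<rho>m] box_right[of \<rho>] box_right[of \<rho>m] \<rho> by auto
    have outer: "AE z in lebesgue. z \<in> region_minus D \<rho> \<longrightarrow> w z = state_minus D"
      "AE z in lebesgue. z \<in> region_plus D \<rho> \<longrightarrow> w z = state_plus D"
      using w unfolding convex_integration_solution_def by blast+
    have souter: "AE z in lebesgue. z \<in> region_minus D \<rho>m \<longrightarrow> ?s z = state_minus D"
      "AE z in lebesgue. z \<in> region_plus D \<rho>m \<longrightarrow> ?s z = state_plus D"
      using s by auto
    have "?A w = K + L3 * T\<^sup>2 * fan_action D \<rho> (\<rho> * ((beta D \<rho>)\<^sup>2 + eps1 D \<rho> + \<epsilon>2) / 2 - \<rho> * internal_energy D \<rho>)"
      unfolding K_def
      by (rule action_fan[OF fan_speeds[OF \<rho>1] box lr(1,2) outer(1) convex_integration_lagrangian[OF w] outer(2)])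
    moreover have "?A ?s = K + L3 * T\<^sup>2 * fan_action D \<rho>m (\<rho>m * (beta D \<rho>m)\<^sup>2 / 2 - \<rho>m * internal_energy D \<rho>m)"
      by (rule shock_action) (simp add: flow_eq_def)
    moreover have "fan_action D \<rho>m (\<rho>m * (beta D \<rho>m)\<^sup>2 / 2 - \<rho>m * internal_energy D \<rho>m)
      < fan_action D \<rho> (\<rho> * ((beta D \<rho>)\<^sup>2 + eps1 D \<rho> + \<epsilon>2) / 2 - \<rho> * internal_energy D \<rho>)"
      using e \<rho> by (intro fan_action_less[OF \<rho>1 \<rho>(2) eps2 _ \<rho>m(2)]) auto
    ultimately have "?A ?s < ?A w" using box by (simp add: mult_strict_left_mono)
    moreover have "same_boundary_data L3 T l1 l2 ?s w"
      by (rule same_boundary_fan[OF box(2-4) fan_speeds[OF \<rho>m(1)] fan_speeds[OF \<rho>1] lr(3,4) lr(1,2) souter outer])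
    moreover have "same_boundary_data L3 T l1 l2 w ?s"
      by (rule same_boundary_fan[OF box(2-4) fan_speeds[OF \<rho>1] fan_speeds[OF \<rho>m(1)] lr outer souter])
    ultimately show ?thesis by blast
  qed
  have ent: "entropic_weak_solution D ?s" by (rule two_shock_entropic[OF intermediate])
  \<comment> \<open>The two shock solution is itself an entropic competitor with the same boundary
    data and a strictly lower action.\<close>
  have not_adm: "\<not> LAAP_admissible D L3 T l1 l2 w" if "w \<in> ?F" for w
    using member[OF that] ent unfolding LAAP_admissible_def least_action_among_def by fastforce
  have least: "least_action_among (insert ?s ?F) D L3 T l1 l2 ?s"
    using member unfolding least_action_among_def by (auto intro: less_imp_le)
  show ?thesis
  proof (intro conjI allI impI ballI)
    fix \<rho> assume "\<rho>s \<le> \<rho> \<and> \<rho> < \<rho>m"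
    then show "\<exists>W. infinite W \<and> (\<forall>w\<in>W. convex_integration_solution D \<rho>m \<rho> \<epsilon>2 w) \<and> (\<forall>w\<in>W. \<forall>w'\<in>W. w \<noteq> w' \<longrightarrow> \<not> flow_eq w w')"
      by (intro infinitely_many_convex_integration_solutions subsolutions) auto
  next
    fix w assume "w \<in> ?F"
    then show "?A ?s < ?A w" "same_boundary_data L3 T l1 l2 ?s w" "\<not> LAAP_admissible D L3 T l1 l2 w"
      using member not_adm by blast+
  next
    assume only: "\<forall>w. entropic_weak_solution D w \<and> same_boundary_data L3 T l1 l2 ?s w \<longrightarrow> w \<in> ?F \<or> flow_eq w ?s"
    have "?A ?s \<le> ?A w" if "entropic_weak_solution D w" "same_boundary_data L3 T l1 l2 ?s w" for w
    proof -
      have "?A w = ?A ?s" if "flow_eq w ?s" using shock_action[OF that] shock_action[of ?s] by (simp add: flow_eq_def)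
      then show ?thesis using only that member[of w] by force
    qed
    then show "LAAP_admissible D L3 T l1 l2 ?s" using ent by (simp add: LAAP_admissible_def least_action_among_def)
    fix w assume w: "LAAP_admissible D L3 T l1 l2 w \<and> same_boundary_data L3 T l1 l2 ?s w"
    then have "entropic_weak_solution D w" by (simp add: LAAP_admissible_def least_action_among_def)
    then show "flow_eq w ?s" using only w not_adm by blast
  qed (fact ent least)+
qed

end
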